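(* Let $P(x)=\prod_{i=1}^\infty \frac{1}{1-x^i}$, and let $x_0$ be the unique real solution with $0<x_0<1$ of $xP(x)=1$ ($x_0=0.4196\ldots$). Define \begin{align*} \mu &= \frac{P(x_0)-1}{ P(x_0)+x_0P'(x_0) } \simeq 0.219273\ldots,\\ \sigma^2 &= \frac{(x_0-1) \left( -1-P'(x_0)x_0+P'(x_0)x_0^2+P'(x_0)^2x_0^3-P''(x_0)x_0^2+P''(x_0)x_0^3 \right) }{ x_0^2(P(x_0) +x_0P'(x_0) )^3 } \simeq 0.0567065\ldots. \end{align*} For each $n$, let $a_{n,k}$ be the number of isomorphism classes of $k$-linear trees on $n$ vertices, $a_n=\sum_k a_{n,k}$, and let $X_n$ be the random variable with $\Pr(X_n=k)=a_{n,k}/a_n$ (the number of HDVs of a uniformly random isomorphism class of linear trees on $n$ vertices). Then, for large $n$, $X_n$ converges in distribution to a Gaussian distribution with mean $\mu n$ and variance $\sigma^2 n$, with speed of convergence $O(n^{-1/2})$; i.e. the normalized variable $\frac{X_n-\mu n}{\sigma\sqrt n}$ converges in distribution to a standard normal distribution.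
   Context: All graphs are finite, simple and undirected. A high degree vertex (HDV) of a graph is a vertex of degree at least $3$. A tree is called linear if all of its HDVs lie on a single induced path, and $k$-linear if it is linear and has exactly $k$ HDVs. Trees are counted up to graph isomorphism (unlabeled). *)

theory Defs
  imports "HOL-Probability.Probability"
begin

text \<open>
  A graph is given by its vertex set \<open>V\<close> and a set \<open>E\<close> of two-element subsets of \<open>V\<close>.
\<close>

definition fin_simple_graph :: "'a set \<Rightarrow> 'a set set \<Rightarrow> bool" where
  "fin_simple_graph V E \<longleftrightarrow> finite V \<and> (\<forall>e\<in>E. e \<subseteq> V \<and> card e = 2)"

definition vertex_degree :: "'a set set \<Rightarrow> 'a \<Rightarrow> nat" where
  "vertex_degree E v = card {e \<in> E. v \<in> e}"

definition hdvs :: "'a set \<Rightarrow> 'a set set \<Rightarrow> 'a set" where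
  "hdvs V E = {v \<in> V. vertex_degree E v \<ge> 3}"

definition graph_path :: "'a set \<Rightarrow> 'a set set \<Rightarrow> 'a list \<Rightarrow> bool" where
  "graph_path V E p \<longleftrightarrow> p \<noteq> [] \<and> set p \<subseteq> V \<and> distinct p \<and>
     (\<forall>i. Suc i < length p \<longrightarrow> {p ! i, p ! Suc i} \<in> E)"

definition induced_graph_path :: "'a set \<Rightarrow> 'a set set \<Rightarrow> 'a list \<Rightarrow> bool" where
  "induced_graph_path V E p \<longleftrightarrow> graph_path V E p \<and>
     (\<forall>i < length p. \<forall>j < length p. {p ! i, p ! j} \<in> E \<longrightarrow> i = Suc j \<or> j = Suc i)"

definition graph_cycle :: "'a set \<Rightarrow> 'a set set \<Rightarrow> 'a list \<Rightarrow> bool" where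
  "graph_cycle V E c \<longleftrightarrow> graph_path V E c \<and> length c \<ge> 3 \<and> {last c, hd c} \<in> E"

definition graph_connected :: "'a set \<Rightarrow> 'a set set \<Rightarrow> bool" where
  "graph_connected V E \<longleftrightarrow> V \<noteq> {} \<and>
     (\<forall>u\<in>V. \<forall>v\<in>V. \<exists>p. graph_path V E p \<and> hd p = u \<and> last p = v)"

definition is_tree :: "'a set \<Rightarrow> 'a set set \<Rightarrow> bool" where
  "is_tree V E \<longleftrightarrow> fin_simple_graph V E \<and> graph_connected V E \<and> (\<nexists>c. graph_cycle V E c)"

definition linear_tree :: "'a set \<Rightarrow> 'a set set \<Rightarrow> bool" where
  "linear_tree V E \<longleftrightarrow> is_tree V E \<and> (\<exists>p. induced_graph_path V E p \<and> hdvs V E \<subseteq> set p)"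

definition k_linear_tree :: "nat \<Rightarrow> 'a set \<Rightarrow> 'a set set \<Rightarrow> bool" where
  "k_linear_tree k V E \<longleftrightarrow> linear_tree V E \<and> card (hdvs V E) = k"

definition graph_isomorphic :: "'a set \<Rightarrow> 'a set set \<Rightarrow> 'b set \<Rightarrow> 'b set set \<Rightarrow> bool" where
  "graph_isomorphic V E W F \<longleftrightarrow>
     (\<exists>f. bij_betw f V W \<and> (\<forall>u\<in>V. \<forall>v\<in>V. {u, v} \<in> E \<longleftrightarrow> {f u, f v} \<in> F))"

text \<open>
  Every graph on \<open>n\<close> vertices is isomorphic to one with vertex set \<open>{..<n}\<close>, so unlabeled
  trees are counted as isomorphism classes of trees on that vertex set.
\<close>

definition k_linear_edge_sets :: "nat \<Rightarrow> nat \<Rightarrow> nat set set set" where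
  "k_linear_edge_sets n k = {E. k_linear_tree k {..<n} E}"

definition iso_rel :: "nat \<Rightarrow> nat \<Rightarrow> (nat set set \<times> nat set set) set" where
  "iso_rel n k = {(E, F). E \<in> k_linear_edge_sets n k \<and> F \<in> k_linear_edge_sets n k \<and>
     graph_isomorphic {..<n} E {..<n} F}"

lemma equiv_iso_rel: "equiv (k_linear_edge_sets n k) (iso_rel n k)"
proof (rule equivI)
  show "iso_rel n k \<subseteq> k_linear_edge_sets n k \<times> k_linear_edge_sets n k"
    unfolding iso_rel_def by blast
  have "graph_isomorphic {..<n} E {..<n} E" for E :: "nat set set"
    unfolding graph_isomorphic_def by (rule exI[of _ id]) simp
  then show "refl_on (k_linear_edge_sets n k) (iso_rel n k)"
    unfolding refl_on_def iso_rel_def by blast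
  show "sym (iso_rel n k)"
  proof (rule symI)
    fix E F assume *: "(E, F) \<in> iso_rel n k"
    then obtain f where f: "bij_betw f {..<n} {..<n}"
      and e: "\<And>u v. u \<in> {..<n} \<Longrightarrow> v \<in> {..<n} \<Longrightarrow> {u, v} \<in> E \<longleftrightarrow> {f u, f v} \<in> F"
      unfolding iso_rel_def graph_isomorphic_def by blast
    let ?g = "inv_into {..<n} f"
    have g: "bij_betw ?g {..<n} {..<n}" using f by (rule bij_betw_inv_into)
    have "{u, v} \<in> F \<longleftrightarrow> {?g u, ?g v} \<in> E" if "u \<in> {..<n}" "v \<in> {..<n}" for u v
    proof -
      have "?g u \<in> {..<n}" "?g v \<in> {..<n}" using bij_betwE[OF g] that by blast+
      from e[OF this] show ?thesis
        unfolding bij_betw_inv_into_right[OF f that(1)] bij_betw_inv_into_right[OF f that(2)] by blast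
    qed
    with g * show "(F, E) \<in> iso_rel n k"
      unfolding iso_rel_def graph_isomorphic_def by blast
  qed
  show "trans (iso_rel n k)"
  proof (rule transI)
    fix E F G assume *: "(E, F) \<in> iso_rel n k" "(F, G) \<in> iso_rel n k"
    then obtain f g where f: "bij_betw f {..<n} {..<n}" and g: "bij_betw g {..<n} {..<n}"
      and e: "\<And>u v. u \<in> {..<n} \<Longrightarrow> v \<in> {..<n} \<Longrightarrow> {u, v} \<in> E \<longleftrightarrow> {f u, f v} \<in> F"
      and e': "\<And>u v. u \<in> {..<n} \<Longrightarrow> v \<in> {..<n} \<Longrightarrow> {u, v} \<in> F \<longleftrightarrow> {g u, g v} \<in> G"
      unfolding iso_rel_def graph_isomorphic_def by blast
    have gf: "bij_betw (g \<circ> f) {..<n} {..<n}" using f g by (rule bij_betw_trans)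
    have "{u, v} \<in> E \<longleftrightarrow> {(g \<circ> f) u, (g \<circ> f) v} \<in> G" if "u \<in> {..<n}" "v \<in> {..<n}" for u v
    proof -
      have "f u \<in> {..<n}" "f v \<in> {..<n}" using bij_betwE[OF f] that by blast+
      from e'[OF this] e[OF that] show ?thesis unfolding comp_apply by blast
    qed
    with gf * show "(E, G) \<in> iso_rel n k"
      unfolding iso_rel_def graph_isomorphic_def by blast
  qed
qed

definition num_k_linear :: "nat \<Rightarrow> nat \<Rightarrow> nat" where
  "num_k_linear n k = card (k_linear_edge_sets n k // iso_rel n k)"

text \<open>A tree on \<open>n\<close> vertices has at most \<open>n\<close> HDVs, so the sum over all \<open>k\<close> stops at \<open>n\<close>.\<close>

definition num_linear :: "nat \<Rightarrow> nat" where
  "num_linear n = (\<Sum>k\<le>n. num_k_linear n k)"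

text \<open>
  The product defining \<open>partition_gf\<close> is convergent only for \<open>\<bar>x\<bar> < 1\<close>; the function and its
  derivatives are used only at points of the open interval \<open>(0,1)\<close>.
\<close>

definition partition_gf :: "real \<Rightarrow> real" where
  "partition_gf x = (\<Prod>i. 1 / (1 - x ^ Suc i))"

definition x0 :: real where
  "x0 = (THE x. 0 < x \<and> x < 1 \<and> x * partition_gf x = 1)"

definition hdv_mu :: real where
  "hdv_mu = (let P = partition_gf x0; P' = deriv partition_gf x0
     in (P - 1) / (P + x0 * P'))"

definition hdv_sigma2 :: real where
  "hdv_sigma2 = (let P = partition_gf x0; P' = deriv partition_gf x0;
       P'' = deriv (deriv partition_gf) x0
     in (x0 - 1) * (- 1 - P' * x0 + P' * x0^2 + P'^2 * x0^3 - P'' * x0^2 + P'' * x0^3)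
        / (x0^2 * (P + x0 * P')^3))"

end

theory Submission
  imports Defs "HOL-Combinatorics.Combinatorics" "HOL-Complex_Analysis.Complex_Analysis"
begin

text \<open>
  Take as spine the path between the two extreme HDVs. A linear tree with at least two HDVs is then a
  word of partitions, one for each vertex of the spine (the lengths of the paths hanging from it), whose
  first and last letters have at least two parts. Two words give isomorphic trees iff they are equal or
  reverse to each other, so up to the negligibly many palindromes \<open>2 a(n,k)\<close> is the coefficient of
  \<open>z^n u^k\<close> in \<open>(u z (P(z) - 1/(1 - z)))^2 / (1 - z (1 + u (P(z) - 1)))\<close>.
  For \<open>|u| = 1\<close> near \<open>1\<close> the denominator has a single simple zero \<open>\<rho>(u)\<close> near \<open>x0\<close>, and for the other
  \<open>u\<close> on the unit circle it has none in a slightly larger disc. Hence the characteristic function of \<open>X n\<close>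
  is close to \<open>(A(u)/A(1)) (x0/\<rho>(u))^n\<close>; the first two derivatives of \<open>-ln \<rho>(e^\<tau>)\<close> at \<open>0\<close> are \<open>\<mu>\<close> and
  \<open>\<sigma>^2\<close>, and comparison with the Gaussian characteristic function by Fourier inversion gives the rate
  \<open>O(n^(-1/2))\<close>. With \<open>S\<close> and \<open>B\<close> the two Lambert series \<open>\<Sum> m x^m / (1 - x^m)\<close> and
  \<open>\<Sum> m^2 x^m / (1 - x^m)^2\<close> at \<open>x0\<close>, one has \<open>x P'/P = S\<close> and \<open>x S' = B\<close>, so \<open>\<mu> = (1 - x0) / (1 + S)\<close>,
  which makes the constants accessible to rational arithmetic.
\<close>

section \<open>Trees and their leaves\<close>

text \<open>Because \<open>X n\<close> is integer valued, its distribution function at an integer is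
  an exact Fourier integral over one period, with the Dirichlet kernel. For the mass of
  \<open>{0..K}\<close> this kernel has the same numerator as the Levy kernel of the interval from
  \<open>0\<close> to \<open>K + 1\<close>, and the two kernels differ by a bounded function. So no
  smoothing of the distributions is required, and the characteristic function of \<open>X n\<close>
  has to be controlled on \<open>[-pi, pi]\<close> only. The substitution
  \<open>u = exp \<tau>\<close>, \<open>z = x0 * exp (- s)\<close> turns the pole equation into
  \<open>q s = \<tau>\<close> with \<open>q\<close> injective near \<open>0\<close>; the pole is
  then an inverse function, and its derivatives come from implicit differentiation. Positivity of
  the coefficients excludes other poles on the critical circle: equality in the triangle inequality
  forces \<open>z = x0\<close> and \<open>u = 1\<close>. Three qualitative facts are read off from
  the numerical enclosures: the existence of the root, \<open>x0 < 1 / 2\<close>, which keeps the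
  leading coefficient from vanishing, and \<open>\<sigma>^2 > 0\<close>.\<close>

definition nbrs :: "'a set set \<Rightarrow> 'a \<Rightarrow> 'a set" where
  "nbrs E v = {u. {u, v} \<in> E}"

lemma simple_graph_edgeD:
  assumes "fin_simple_graph V E" "{u, v} \<in> E"
  shows "u \<in> V" "v \<in> V" "u \<noteq> v"
proof -
  have "\<forall>e\<in>E. e \<subseteq> V \<and> card e = 2" using assms(1) unfolding fin_simple_graph_def ..
  from bspec[OF this assms(2)] show "u \<in> V" "v \<in> V" "u \<noteq> v" by auto
qed

lemma finite_nbrs: "fin_simple_graph V E \<Longrightarrow> finite (nbrs E v)"
  by (rule finite_subset[of _ V]) (auto simp: nbrs_def fin_simple_graph_def)

lemma finite_edges: "fin_simple_graph V E \<Longrightarrow> finite E"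
  by (rule finite_subset[of _ "Pow V"]) (auto simp: fin_simple_graph_def)

lemma vertex_degree_nbrs:
  assumes "fin_simple_graph V E"
  shows "vertex_degree E v = card (nbrs E v)"
proof -
  have "bij_betw (\<lambda>u. {u, v}) (nbrs E v) {e \<in> E. v \<in> e}"
  proof (rule bij_betwI')
    fix x y assume "x \<in> nbrs E v" "y \<in> nbrs E v"
    then show "({x, v} = {y, v}) = (x = y)"
      using simple_graph_edgeD[OF assms] by (auto simp: nbrs_def doubleton_eq_iff)
  next
    fix x assume "x \<in> nbrs E v" then show "{x, v} \<in> {e \<in> E. v \<in> e}" by (auto simp: nbrs_def)
  next
    fix e assume e: "e \<in> {e \<in> E. v \<in> e}"
    then have "card e = 2" using assms by (auto simp: fin_simple_graph_def)
    then obtain a b where "e = {a, b}" by (auto simp: card_2_iff)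
    with e have "e = {a, v} \<or> e = {b, v}" by (auto simp: doubleton_eq_iff)
    with e show "\<exists>x\<in>nbrs E v. e = {x, v}" by (auto simp: nbrs_def)
  qed
  then show ?thesis unfolding vertex_degree_def by (simp add: bij_betw_same_card)
qed

section \<open>Decomposition of paths, and what acyclicity forbids\<close>

lemma graph_path_Cons_iff:
  assumes "p \<noteq> []"
  shows "graph_path V E (x # p) \<longleftrightarrow> x \<in> V \<and> x \<notin> set p \<and> {x, hd p} \<in> E \<and> graph_path V E p"
proof -
  obtain y ys where p: "p = y # ys" using assms by (cases p) auto
  have "(\<forall>i. Suc i < length (x # p) \<longrightarrow> {(x # p) ! i, (x # p) ! Suc i} \<in> E) \<longleftrightarrow>
      {x, hd p} \<in> E \<and> (\<forall>i. Suc i < length p \<longrightarrow> {p ! i, p ! Suc i} \<in> E)"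
    (is "(\<forall>i. ?A i) \<longleftrightarrow> _")
  proof -
    have "(\<forall>i. ?A i) \<longleftrightarrow> ?A 0 \<and> (\<forall>i. ?A (Suc i))" by (metis not0_implies_Suc)
    then show ?thesis by (simp add: p)
  qed
  then show ?thesis using assms by (auto simp: graph_path_def)
qed

lemma graph_path_single [simp]: "graph_path V E [x] \<longleftrightarrow> x \<in> V"
  by (auto simp: graph_path_def)

lemma graph_path_append_iff:
  "p \<noteq> [] \<Longrightarrow> q \<noteq> [] \<Longrightarrow> graph_path V E (p @ q) \<longleftrightarrow>
     graph_path V E p \<and> graph_path V E q \<and> set p \<inter> set q = {} \<and> {last p, hd q} \<in> E"
proof (induction p)
  case Nil then show ?case by simp
next
  case (Cons x p)
  show ?case
  proof (cases "p = []")
    case True then show ?thesis using Cons.prems by (auto simp: graph_path_Cons_iff)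
  next
    case False
    then show ?thesis using Cons by (auto simp: graph_path_Cons_iff)
  qed
qed

lemma graph_path_rev: "graph_path V E (rev p) \<longleftrightarrow> graph_path V E p"
proof (induction p)
  case Nil then show ?case by simp
next
  case (Cons x p)
  show ?case
  proof (cases "p = []")
    case False
    have *: "last (rev p) = hd p" using False by (simp add: last_rev)
    show ?thesis using Cons False
      by (auto simp: graph_path_append_iff[of "rev p" "[x]"] graph_path_Cons_iff * insert_commute)
  qed simp
qed

lemma graph_path_nonempty: "graph_path V E p \<Longrightarrow> p \<noteq> []"
  by (simp add: graph_path_def)

lemma graph_path_mono: "graph_path V E p \<Longrightarrow> V \<subseteq> W \<Longrightarrow> E \<subseteq> F \<Longrightarrow> graph_path W F p"
  by (auto simp: graph_path_def)

lemma graph_path_length_le: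
  assumes "graph_path V E p" "finite V" shows "length p \<le> card V"
  using assms card_mono[of V "set p"] distinct_card[of p] by (simp add: graph_path_def)

text \<open>Otherwise the segment of \<open>q\<close> from \<open>i\<close> to \<open>j\<close> has
  at least three vertices and the edge closes it to a cycle. In particular every path of a tree is
  induced.\<close>

lemma acyclic_chord:
  assumes acyc: "\<nexists>c. graph_cycle V E c" and q: "graph_path V E q"
    and ij: "i < j" "j < length q" and e: "{q ! i, q ! j} \<in> E"
  shows "j = Suc i"
proof (rule ccontr)
  assume "j \<noteq> Suc i"
  with ij have j: "i + 2 \<le> j" by simp
  let ?c = "take (Suc (j - i)) (drop i q)"
  have len: "length ?c = Suc (j - i)" using ij by simp
  have nth: "?c ! k = q ! (i + k)" if "k \<le> j - i" for k using that ij by simp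
  have "graph_path V E ?c"
    unfolding graph_path_def
  proof (intro conjI allI impI)
    show "?c \<noteq> []" using len by force
    show "set ?c \<subseteq> V" using q by (meson graph_path_def order_trans set_drop_subset set_take_subset)
    show "distinct ?c" using q by (auto simp: graph_path_def)
    fix k assume "Suc k < length ?c"
    then have k: "k < j - i" using len by simp
    then show "{?c ! k, ?c ! Suc k} \<in> E"
      using q ij nth[of k] nth[of "Suc k"] by (auto simp: graph_path_def)
  qed
  moreover have "{last ?c, hd ?c} \<in> E"
  proof -
    have ne: "?c \<noteq> []" using len by force
    have "hd ?c = q ! i" using nth[of 0] ne by (metis add.right_neutral hd_conv_nth le0)
    moreover have "last ?c = q ! j" using nth[of "j - i"] ne len ij
      by (metis add_diff_cancel_left' diff_Suc_1 last_conv_nth le_add_diff_inverse less_imp_le order_refl)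
    ultimately show ?thesis using e by (simp add: insert_commute)
  qed
  ultimately have "graph_cycle V E ?c" using j len by (simp add: graph_cycle_def)
  with acyc show False by blast
qed

text \<open>The ear \<open>p\<close> leaves \<open>q\<close> at its first vertex, and its last
  vertex is joined back to \<open>b\<close> on \<open>q\<close>; together with the stretch of
  \<open>q\<close> between \<open>hd p\<close> and \<open>b\<close> it would be a cycle.\<close>

lemma acyclic_ear:
  assumes acyc: "\<nexists>c. graph_cycle V E c" and q: "graph_path V E q" and p: "graph_path V E p"
    and int: "hd p \<in> set q" "set (tl p) \<inter> set q = {}" "length p \<ge> 2"
    and b: "b \<in> set q" "b \<noteq> hd p" "{last p, b} \<in> E"
  shows False
proof -
  have main: False if q: "graph_path V E q" and dec: "q = q1 @ [hd p] @ q2 @ [b] @ q3"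
    and int: "set (tl p) \<inter> set q = {}" for q q1 q2 q3
  proof -
    have ne: "p \<noteq> []" using p graph_path_nonempty by blast
    then obtain a p' where pp: "p = a # p'" by (cases p) auto
    have "graph_path V E (q2 @ [b])"
    proof -
      have "graph_path V E (q2 @ [b] @ q3)" using q dec graph_path_append_iff[of q1 "[hd p] @ q2 @ [b] @ q3"]
        by (cases "q1 = []") (auto simp: graph_path_Cons_iff)
      then show ?thesis using graph_path_append_iff[of "q2 @ [b]" q3] by (cases "q3 = []") auto
    qed
    then have 1: "graph_path V E (b # rev q2)" using graph_path_rev[of V E "q2 @ [b]"] by simp
    have dist: "distinct q" using q by (simp add: graph_path_def)
    \<comment> \<open>The cycle runs along the ear, over to \<open>b\<close>, and back along
      \<open>q\<close> to the neighbour of \<open>hd p\<close>.\<close>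
    have "graph_path V E (p @ (b # rev q2))"
      using 1 p int b dist ne unfolding dec pp
      by (subst graph_path_append_iff) auto
    moreover have "{last (p @ (b # rev q2)), hd (p @ (b # rev q2))} \<in> E"
    proof -
      have "graph_path V E ([hd p] @ q2 @ [b] @ q3)"
        using q dec graph_path_append_iff[of q1 "[hd p] @ q2 @ [b] @ q3"] by (cases "q1 = []") auto
      then have "{hd p, hd (q2 @ [b] @ q3)} \<in> E" by (auto simp: graph_path_Cons_iff)
      then show ?thesis using ne by (cases q2) (auto simp: insert_commute last_rev)
    qed
    ultimately have "graph_cycle V E (p @ (b # rev q2))" using assms(6) by (simp add: graph_cycle_def)
    with acyc show False by blast
  qed
  obtain q1 r where r: "q = q1 @ hd p # r" using int(1) by (meson split_list)
  show False
  proof (cases "b \<in> set r")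
    case True
    then obtain q2 q3 where "r = q2 @ b # q3" by (meson split_list)
    with main[OF q, of q1 q2 q3] r int show ?thesis by auto
  next
    case False
    \<comment> \<open>If \<open>b\<close> precedes \<open>hd p\<close> on \<open>q\<close>, the
      argument applies to the reversed path.\<close>
    then have "b \<in> set q1" using r b by auto
    then obtain q2 q3 where "q1 = q2 @ b # q3" by (meson split_list)
    then have "rev q = rev r @ [hd p] @ rev q3 @ [b] @ rev q2" using r by simp
    from main[OF _ this] q int show ?thesis by (simp add: graph_path_rev)
  qed
qed

text \<open>Take a longest path that starts on \<open>q\<close> and stays off it afterwards. Its
  last vertex \<open>v\<close> has no second neighbour: one on the path would give a chord, one on
  \<open>q\<close> would make the path an ear, and any other would prolong it.\<close>

lemma tree_leaf_off_path:
  assumes t: "is_tree V E" and q: "graph_path V E q" and ne: "set q \<noteq> V"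
  obtains v w where "v \<in> V" "v \<notin> set q" "w \<in> V" "w \<noteq> v" "nbrs E v = {w}"
proof -
  have fs: "fin_simple_graph V E" and acyc: "\<nexists>c. graph_cycle V E c" and con: "graph_connected V E"
    using t by (auto simp: is_tree_def)
  have fin: "finite V" using fs by (simp add: fin_simple_graph_def)
  define Q where "Q p \<longleftrightarrow> graph_path V E p \<and> hd p \<in> set q \<and> set (tl p) \<inter> set q = {} \<and> length p \<ge> 2" for p
  have "\<exists>p. Q p"
  proof -
    obtain v where v: "v \<in> V" "v \<notin> set q" using ne q by (auto simp: graph_path_def)
    have "hd q \<in> V" using q by (auto simp: graph_path_def)
    then obtain p where p: "graph_path V E p" "hd p = hd q" "last p = v"
      using con v by (auto simp: graph_connected_def)
    have "hd p \<in> set q" using p q graph_path_nonempty[OF q] by simp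
    moreover have "hd p \<in> set p" using graph_path_nonempty[OF p(1)] by simp
    ultimately have "\<exists>x\<in>set p. x \<in> set q" by blast
    \<comment> \<open>The part from the last visit to \<open>q\<close> onwards is a path of the
      required kind.\<close>
    then obtain ys x zs where s: "p = ys @ x # zs" "x \<in> set q" "\<forall>z\<in>set zs. z \<notin> set q"
      using split_list_last_prop[of p "\<lambda>x. x \<in> set q"] by blast
    have "zs \<noteq> []" using s(1,2) p(3) v(2) by (metis last_snoc)
    moreover have "graph_path V E (x # zs)"
      using p(1) unfolding s(1) using graph_path_append_iff[of ys "x # zs"] by (cases "ys = []") auto
    ultimately have "Q (x # zs)" unfolding Q_def using s(2,3) by (cases zs) auto
    then show ?thesis by blast
  qed
  then obtain p1 where "Q p1" by blast
  moreover have "\<forall>p. Q p \<longrightarrow> length p \<le> card V"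
    using graph_path_length_le[OF _ fin, of E] by (auto simp: Q_def)
  ultimately obtain p where p: "Q p" "\<And>p'. Q p' \<Longrightarrow> length p' \<le> length p"
    using ex_has_greatest_nat[of Q p1 length "Suc (card V)"] by (auto simp: less_Suc_eq_le)
  have gp: "graph_path V E p" "hd p \<in> set q" "set (tl p) \<inter> set q = {}" "length p \<ge> 2"
    using p(1) by (auto simp: Q_def)
  then obtain p0 v where pv: "p = p0 @ [v]" by (cases p rule: rev_cases) auto
  with gp(4) have pv: "p = p0 @ [v]" "p0 \<noteq> []" by auto
  define w where "w = last p0"
  have gp0: "graph_path V E p0" "v \<in> V" "v \<notin> set p0" "{w, v} \<in> E"
    using gp(1) unfolding pv(1) w_def by (auto simp: graph_path_append_iff[OF pv(2)])
  have vq: "v \<notin> set q" using gp(3) pv by (cases p0) auto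
  have wp: "w \<in> set p0" using pv w_def by auto
  have "z = w" if z: "z \<in> nbrs E v" for z
  proof (rule ccontr)
    assume "z \<noteq> w"
    have zE: "{z, v} \<in> E" using z by (simp add: nbrs_def)
    have zV: "z \<in> V" "z \<noteq> v" using simple_graph_edgeD[OF fs zE] by auto
    show False
    proof (cases "z \<in> set p")
      case True
      then have "z \<in> set p0" using zV pv by auto
      then obtain i where i: "i < length p0" "p0 ! i = z" by (meson in_set_conv_nth)
      have "length p0 = Suc i"
        by (rule acyclic_chord[OF acyc gp(1), of i "length p0"]) (use i pv zE in \<open>auto simp: nth_append\<close>)
      then have "z = w" using i pv w_def by (simp add: last_conv_nth)
      with \<open>z \<noteq> w\<close> show False by blast
    next
      case False
      show False
      proof (cases "z \<in> set q")
        case True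
        have "z \<noteq> hd p" using False pv by (metis hd_in_set append_is_Nil_conv)
        then show False using acyclic_ear[OF acyc q gp True] zE pv by (simp add: insert_commute)
      next
        case F2: False
        have "{last p, z} \<in> E" using zE pv by (simp add: insert_commute)
        then have "graph_path V E (p @ [z])"
          using gp(1) False zV graph_path_append_iff[of p "[z]"] pv by simp
        moreover have "hd (p @ [z]) = hd p" "set (tl (p @ [z])) = insert z (set (tl p))"
          using graph_path_nonempty[OF gp(1)] by simp_all
        ultimately have "Q (p @ [z])" unfolding Q_def using gp F2 by simp
        from p(2)[OF this] show False by simp
      qed
    qed
  qed
  moreover have "w \<in> nbrs E v" using gp0(4) by (simp add: nbrs_def)
  ultimately have "nbrs E v = {w}" by blast
  moreover have "w \<in> V" "w \<noteq> v" using simple_graph_edgeD[OF fs gp0(4)] by auto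
  ultimately show thesis using that gp0 vq by blast
qed

text \<open>A path between other vertices cannot pass through \<open>v\<close>, since it would have
  to enter and to leave through \<open>w\<close>; so connectedness survives.\<close>

lemma is_tree_remove_leaf:
  assumes t: "is_tree V E" and v: "v \<in> V" "nbrs E v = {w}"
  shows "is_tree (V - {v}) (E - {{v, w}})"
proof -
  have fs: "fin_simple_graph V E" and acyc: "\<nexists>c. graph_cycle V E c" and con: "graph_connected V E"
    using t by (auto simp: is_tree_def)
  have v_only: "x = w" if "{v, x} \<in> E" for x
  proof -
    have "x \<in> nbrs E v" using that by (simp add: nbrs_def insert_commute)
    then show ?thesis using v(2) by blast
  qed
  have "w \<in> nbrs E v" using v(2) by blast
  then have vw: "{v, w} \<in> E" by (simp add: nbrs_def insert_commute)
  have vE: "e = {v, w}" if "e \<in> E" "v \<in> e" for e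
  proof -
    have "card e = 2" using that fs by (auto simp: fin_simple_graph_def)
    then obtain a b where "e = {a, b}" by (auto simp: card_2_iff)
    then have "e = {v, b} \<or> e = {v, a}" using that(2) by (auto simp: doubleton_eq_iff)
    then show ?thesis using that(1) v_only by auto
  qed
  have fs': "fin_simple_graph (V - {v}) (E - {{v, w}})"
    using fs vE unfolding fin_simple_graph_def by blast
  have "w \<in> V" "w \<noteq> v" using simple_graph_edgeD[OF fs vw] by auto
  moreover have "\<exists>p. graph_path (V - {v}) (E - {{v, w}}) p \<and> hd p = a \<and> last p = b"
    if ab: "a \<in> V - {v}" "b \<in> V - {v}" for a b
  proof -
    obtain p where p: "graph_path V E p" "hd p = a" "last p = b"
      using con ab by (auto simp: graph_connected_def)
    have "v \<notin> set p"
    proof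
      assume "v \<in> set p"
      then obtain i where i: "i < length p" "p ! i = v" by (meson in_set_conv_nth)
      have "i \<noteq> 0" using i p ab graph_path_nonempty[OF p(1)] by (metis Diff_iff hd_conv_nth insertI1)
      then obtain k where k: "i = Suc k" by (cases i) auto
      have "Suc i \<noteq> length p" using i p ab graph_path_nonempty[OF p(1)]
        by (metis Diff_iff diff_Suc_1 insertI1 last_conv_nth)
      then have s: "Suc i < length p" using i by simp
      then have "{p ! k, v} \<in> E" "{v, p ! Suc i} \<in> E" using p(1) i k by (auto simp: graph_path_def)
      then have "p ! k = w" "p ! Suc i = w" using v_only[of "p ! k"] v_only[of "p ! Suc i"] by (simp_all add: insert_commute)
      then have "p ! k = p ! Suc i" by simp
      then show False using p(1) s k by (simp add: graph_path_def nth_eq_iff_index_eq)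
    qed
    then have "graph_path (V - {v}) (E - {{v, w}}) p"
      using p(1) unfolding graph_path_def by (auto simp: doubleton_eq_iff)
    with p show ?thesis by blast
  qed
  ultimately have "graph_connected (V - {v}) (E - {{v, w}})" unfolding graph_connected_def by blast
  moreover have "\<not> graph_cycle (V - {v}) (E - {{v, w}}) c" for c
    using acyc graph_path_mono[of "V - {v}" "E - {{v, w}}" c V E] unfolding graph_cycle_def by blast
  ultimately show ?thesis using fs' unfolding is_tree_def by simp
qed

section \<open>Trees encoded by spine codes\<close>

definition graph_reach :: "'a set \<Rightarrow> 'a set set \<Rightarrow> 'a \<Rightarrow> 'a \<Rightarrow> bool" where
  "graph_reach V E u v \<longleftrightarrow> (\<exists>p. graph_path V E p \<and> hd p = u \<and> last p = v)"

text \<open>Paths are free of repetitions, so a path that already contains \<open>w\<close> is cut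
  off there instead of being extended.\<close>

lemma graph_reach_step:
  assumes "graph_reach V E u v" "{v, w} \<in> E" "w \<in> V"
  shows "graph_reach V E u w"
proof -
  obtain p where p: "graph_path V E p" "hd p = u" "last p = v"
    using assms(1) by (auto simp: graph_reach_def)
  have ne: "p \<noteq> []" using graph_path_nonempty[OF p(1)] .
  show ?thesis
  proof (cases "w \<in> set p")
    case True
    then obtain p1 p2 where s: "p = p1 @ w # p2" by (meson split_list)
    have "graph_path V E (p1 @ [w])"
      using p(1) graph_path_append_iff[of "p1 @ [w]" p2 V E] s by (cases "p2 = []") auto
    moreover have "hd (p1 @ [w]) = u" using p(2) s by (cases p1) auto
    ultimately show ?thesis unfolding graph_reach_def by (metis last_snoc)
  next
    case False
    then have "graph_path V E (p @ [w])"
      using p assms graph_path_append_iff[OF ne, of "[w]" V E] by simp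
    then show ?thesis unfolding graph_reach_def using p(2) ne by (metis hd_append2 last_snoc)
  qed
qed

lemma graph_reach_sym: "graph_reach V E u v \<Longrightarrow> graph_reach V E v u"
  unfolding graph_reach_def by (metis graph_path_nonempty graph_path_rev hd_rev last_rev)

text \<open>A vertex of largest rank on a cycle would have its parent as both neighbours, and
  following parents leads every vertex to \<open>r\<close>.\<close>

lemma parent_function_tree:
  fixes par :: "'a \<Rightarrow> 'a" and rk :: "'a \<Rightarrow> nat"
  assumes fin: "finite V" and r: "r \<in> V"
    and par: "\<And>v. v \<in> V \<Longrightarrow> v \<noteq> r \<Longrightarrow> par v \<in> V" "\<And>v. v \<in> V \<Longrightarrow> v \<noteq> r \<Longrightarrow> rk (par v) < rk v"
    and E: "E = (\<lambda>v. {v, par v}) ` (V - {r})"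
  shows "is_tree V E"
proof -
  have fs: "fin_simple_graph V E"
    unfolding fin_simple_graph_def E
  proof (intro conjI fin ballI; elim imageE)
    fix e v assume e: "e = {v, par v}" and v: "v \<in> V - {r}"
    have "par v \<noteq> v" using par(2)[of v] v by force
    then show "card e = 2" by (simp add: e)
    show "e \<subseteq> V" using par(1)[of v] v e by simp
  qed
  have up: "b = par a" if ab: "{a, b} \<in> E" "rk b \<le> rk a" for a b
  proof -
    obtain v where v: "{a, b} = {v, par v}" "v \<in> V" "v \<noteq> r" using ab(1) E by blast
    then consider "a = v" "b = par v" | "b = v" "a = par v" by (auto simp: doubleton_eq_iff)
    then show ?thesis
    proof cases
      case 2 then show ?thesis using par(2)[OF v(2,3)] ab(2) by simp
    qed simp
  qed
  have acyc: False if c: "graph_cycle V E c" for c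
  proof -
    have n: "length c \<ge> 3" "distinct c" "{last c, hd c} \<in> E"
      and cE: "\<And>i. Suc i < length c \<Longrightarrow> {c ! i, c ! Suc i} \<in> E"
      using c by (auto simp: graph_cycle_def graph_path_def)
    let ?m = "arg_max_on (\<lambda>i. rk (c ! i)) {..<length c}"
    have ne: "c \<noteq> []" using n(1) by auto
    have "0 < length c" using n(1) by linarith
    then obtain i where i: "i < length c" "\<And>k. k < length c \<Longrightarrow> rk (c ! k) \<le> rk (c ! i)"
      using ex_has_greatest_nat[of "\<lambda>i. i < length c" 0 "\<lambda>i. rk (c ! i)" "Suc (Max ((\<lambda>i. rk (c ! i)) ` {..<length c}))"]
      by (auto simp: less_Suc_eq_le)
    have last: "last c = c ! (length c - 1)" and hd: "hd c = c ! 0" using ne by (simp_all add: last_conv_nth hd_conv_nth)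
    have nb: "c ! k = par (c ! i)" if "k < length c" "{c ! i, c ! k} \<in> E" for k
      using up[OF that(2)] i(2)[OF that(1)] by simp
    have key: False if "k < length c" "l < length c" "k \<noteq> l" "{c ! i, c ! k} \<in> E" "{c ! i, c ! l} \<in> E" for k l
    proof -
      have "c ! k = c ! l" using nb that by metis
      then show False using that n(2) by (simp add: nth_eq_iff_index_eq)
    qed
    have l: "Suc 0 < length c" "length c - 1 < length c" "Suc 0 \<noteq> length c - 1" using n(1) by linarith+
    \<comment> \<open>Whether the maximum sits at the start, at the end or inside the list decides
      which two positions are its neighbours on the cycle.\<close>
    consider "i = 0" | "Suc i = length c" | "0 < i" "Suc i < length c" using i(1) by linarith
    then show False
    proof cases
      case 1
      then show False using key[OF l] n(3) cE[of 0] l(1) unfolding last hd by (simp add: insert_commute)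
    next
      case 2
      then have i': "i = length c - 1" by simp
      have "Suc (i - 1) = i" using 2 n(1) by simp
      have "i - 1 < length c" "0 \<noteq> i - 1" using 2 n(1) by linarith+
      then show False using key[of 0 "i - 1"] l ne n(3) cE[of "i - 1"] 2 unfolding last hd i'[symmetric] by (simp add: insert_commute)
    next
      case 3
      then have "i - 1 < length c" "i - 1 \<noteq> Suc i" by linarith+
      then show False using 3 key[of "i - 1" "Suc i"] cE[of "i - 1"] cE[of i] by (simp add: insert_commute)
    qed
  qed
  have edge: "{par v, v} \<in> E" if "v \<in> V" "v \<noteq> r" for v using that by (auto simp: E insert_commute)
  have from_r: "graph_reach V E u v" if "graph_reach V E u r" "v \<in> V" for u v
    using that(2)
  proof (induction "rk v" arbitrary: v rule: less_induct)
    case less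
    show ?case
    proof (cases "v = r")
      case False
      then show ?thesis using graph_reach_step[OF less(1)] par edge less(2) by meson
    qed (use that in simp)
  qed
  have rr: "graph_reach V E r r" unfolding graph_reach_def using r by (intro exI[of _ "[r]"]) simp
  have "graph_connected V E"
    unfolding graph_connected_def graph_reach_def[symmetric]
  proof (intro conjI ballI)
    show "V \<noteq> {}" using r by blast
    show "graph_reach V E u v" if "u \<in> V" "v \<in> V" for u v
      by (rule from_r[OF graph_reach_sym[OF from_r[OF rr that(1)]] that(2)])
  qed
  then show ?thesis using fs acyc unfolding is_tree_def by blast
qed

text \<open>A code lists, for each vertex of the spine, the lengths of the paths hanging from it.
  Vertex \<open>(i, 0, 0)\<close> is the \<open>i\<close>-th spine vertex, and \<open>(i, j, d)\<close> with \<open>d > 0\<close> is the vertex at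
  distance \<open>d\<close> from it on its \<open>j\<close>-th hanging path.\<close>

definition code_verts :: "nat list list \<Rightarrow> (nat \<times> nat \<times> nat) set" where
  "code_verts c = {(i, j, d). i < length c \<and> (if d = 0 then j = 0 else j < length (c ! i) \<and> d \<le> c ! i ! j)}"

text \<open>At the root \<open>(0, 0, 0)\<close> truncated subtraction returns the root itself,
  which \<open>code_edges\<close> therefore leaves out.\<close>

fun code_par :: "nat \<times> nat \<times> nat \<Rightarrow> nat \<times> nat \<times> nat" where
  "code_par (i, j, d) = (if d = 0 then (i - 1, 0, 0) else if d = 1 then (i, 0, 0) else (i, j, d - 1))"

definition code_edges :: "nat list list \<Rightarrow> (nat \<times> nat \<times> nat) set set" where
  "code_edges c = (\<lambda>v. {v, code_par v}) ` (code_verts c - {(0, 0, 0)})"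

text \<open>A hanging path of length \<open>0\<close> has no vertices and would leave no trace in
  the tree.\<close>

definition pos_code :: "nat list list \<Rightarrow> bool" where
  "pos_code c \<longleftrightarrow> (\<forall>l\<in>set c. \<forall>x\<in>set l. 0 < x)"

lemma pos_code_nth: "pos_code c \<longleftrightarrow> (\<forall>i<length c. \<forall>j<length (c ! i). 0 < c ! i ! j)"
  unfolding pos_code_def by (metis in_set_conv_nth)

lemma code_par_in: "v \<in> code_verts c \<Longrightarrow> v \<noteq> (0, 0, 0) \<Longrightarrow> code_par v \<in> code_verts c"
  by (cases v) (auto simp: code_verts_def split: if_splits)

lemma finite_code_verts: "finite (code_verts c)"
proof -
  have "code_verts c \<subseteq> (\<Union>i<length c. \<Union>j\<in>{..length (c ! i)}. \<Union>d\<in>{..c ! i ! j}. {(i, j, d)})"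
    by (auto simp: code_verts_def split: if_splits)
  then show ?thesis by (rule finite_subset) auto
qed

text \<open>The rank \<open>i + d\<close> is the distance from the root and drops along
  \<open>code_par\<close>.\<close>

lemma code_tree:
  assumes "c \<noteq> []" shows "is_tree (code_verts c) (code_edges c)"
proof (rule parent_function_tree[where par = code_par and rk = "\<lambda>(i, j, d). i + d" and r = "(0, 0, 0)"])
  show "(0, 0, 0) \<in> code_verts c" using assms by (simp add: code_verts_def)
  show "(case code_par v of (i, j, d) \<Rightarrow> i + d) < (case v of (i, j, d) \<Rightarrow> i + d)"
    if "v \<in> code_verts c" "v \<noteq> (0, 0, 0)" for v
    using that by (cases v) (auto simp: code_verts_def split: if_splits)
qed (use code_par_in finite_code_verts in \<open>auto simp: code_edges_def\<close>)

lemma code_simple: "fin_simple_graph (code_verts c) (code_edges c)"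
proof (cases "c = []")
  case True
  then have "code_verts c = {}" by (auto simp: code_verts_def)
  then show ?thesis by (simp add: fin_simple_graph_def code_edges_def)
qed (use code_tree in \<open>auto simp: is_tree_def\<close>)

lemma code_edge_iff:
  "{u, v} \<in> code_edges c \<longleftrightarrow> u \<in> code_verts c \<and> v \<in> code_verts c \<and>
     (u \<noteq> (0, 0, 0) \<and> v = code_par u \<or> v \<noteq> (0, 0, 0) \<and> u = code_par v)"
  using code_par_in[of u c] code_par_in[of v c] by (auto simp: code_edges_def doubleton_eq_iff image_iff)

section \<open>Isomorphisms, and a code for every tree with a prescribed spine\<close>

definition graph_iso :: "('a \<Rightarrow> 'b) \<Rightarrow> 'a set \<Rightarrow> 'a set set \<Rightarrow> 'b set \<Rightarrow> 'b set set \<Rightarrow> bool" where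
  "graph_iso f V E W F \<longleftrightarrow> bij_betw f V W \<and> (\<forall>u\<in>V. \<forall>v\<in>V. {u, v} \<in> E \<longleftrightarrow> {f u, f v} \<in> F)"

lemma graph_iso_bij: "graph_iso f V E W F \<Longrightarrow> bij_betw f V W"
  by (simp add: graph_iso_def)

lemma graph_iso_edge: "graph_iso f V E W F \<Longrightarrow> a \<in> V \<Longrightarrow> b \<in> V \<Longrightarrow> {a, b} \<in> E \<longleftrightarrow> {f a, f b} \<in> F"
  by (simp add: graph_iso_def)

text \<open>The inductive step that builds a code: the leaf \<open>v\<close> and the new vertex
  \<open>z\<close> have a single neighbour each, \<open>w\<close> and \<open>y\<close>, which
  correspond under \<open>f\<close>, and the adjacency of the old vertices is unchanged.\<close>

lemma code_extend:
  assumes f: "graph_iso f (code_verts c) (code_edges c) (V - {v}) (E - {{v, w}})"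
    and fs: "fin_simple_graph V E" and v: "v \<in> V" "nbrs E v = {w}"
    and c': "code_verts c' = insert z (code_verts c)" "z \<notin> code_verts c" "z \<noteq> (0, 0, 0)"
    and y: "code_par z = y" "y \<in> code_verts c" "f y = w"
  shows "graph_iso (f(z := v)) (code_verts c') (code_edges c') V E"
proof -
  have bij: "bij_betw f (code_verts c) (V - {v})" 
    and fE: "\<And>a b. a \<in> code_verts c \<Longrightarrow> b \<in> code_verts c \<Longrightarrow> {a, b} \<in> code_edges c \<longleftrightarrow> {f a, f b} \<in> E - {{v, w}}"
    using graph_iso_bij[OF f] graph_iso_edge[OF f] by simp_all
  have inj: "inj_on f (code_verts c)" and im: "f ` code_verts c = V - {v}" using bij by (auto simp: bij_betw_def)
  have "bij_betw (f(z := v)) (code_verts c) (V - {v})"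
    using bij c'(2) by (subst bij_betw_cong[of _ _ f]) auto
  then have "bij_betw (f(z := v)) (code_verts c \<union> {z}) ((V - {v}) \<union> {v})"
    using c'(2) by (intro bij_betw_combine) auto
  moreover have "(V - {v}) \<union> {v} = V" using v by auto
  ultimately have b: "bij_betw (f(z := v)) (code_verts c') V" using c'(1) by simp
  have old: "{a, b} \<in> code_edges c' \<longleftrightarrow> {a, b} \<in> code_edges c" if "a \<in> code_verts c" "b \<in> code_verts c" for a b
    using that by (auto simp: code_edge_iff c'(1))
  have new: "{z, b} \<in> code_edges c' \<longleftrightarrow> b = y" if "b \<in> code_verts c" for b
    using that c' y code_par_in[of b c] by (auto simp: code_edge_iff)
  have v_iff: "{v, x} \<in> E \<longleftrightarrow> x = w" for x
  proof -
    have "{v, x} \<in> E \<longleftrightarrow> x \<in> nbrs E v" by (simp add: nbrs_def insert_commute)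
    then show ?thesis using v(2) by simp
  qed
  have Enew: "{v, f b} \<in> E \<longleftrightarrow> b = y" if "b \<in> code_verts c" for b
    using that inj y v_iff by (auto simp: inj_on_def)
  have fv: "f a \<noteq> v" if "a \<in> code_verts c" for a using im that by blast
  have Eold: "{f a, f b} \<in> E - {{v, w}} \<longleftrightarrow> {f a, f b} \<in> E" if "a \<in> code_verts c" "b \<in> code_verts c" for a b
    using fv[OF that(1)] fv[OF that(2)] by (auto simp: doubleton_eq_iff)
  have no1: "{z, z} \<notin> code_edges c'" using simple_graph_edgeD(3)[OF code_simple] by blast
  have no2: "{v, v} \<notin> E" using simple_graph_edgeD(3)[OF fs] by blast
  have "{a, b} \<in> code_edges c' \<longleftrightarrow> {(f(z := v)) a, (f(z := v)) b} \<in> E"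
    if ab: "a \<in> code_verts c'" "b \<in> code_verts c'" for a b
  proof -
    consider "a = z" "b = z" | "a = z" "b \<in> code_verts c" | "b = z" "a \<in> code_verts c"
      | "a \<in> code_verts c" "b \<in> code_verts c" 
      using ab c'(1) by blast
    then show ?thesis
    proof cases
      case 1 then show ?thesis using no1 no2 by simp
    next
      case 2
      then have "b \<noteq> z" using c'(2) by blast
      then show ?thesis using 2 new Enew by simp
    next
      case 3
      then have "a \<noteq> z" using c'(2) by blast
      then show ?thesis using 3 new[of a] Enew[of a] by (simp add: insert_commute)
    next
      case 4
      then have "a \<noteq> z" "b \<noteq> z" using c'(2) by blast+
      then show ?thesis using old[OF 4] fE[OF 4] Eold[OF 4] by simp
    qed
  qed
  with b show ?thesis unfolding graph_iso_def by blast
qed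

lemma graph_iso_nbrs:
  assumes "graph_iso f V E W F" "fin_simple_graph V E" "fin_simple_graph W F" "v \<in> V"
  shows "nbrs F (f v) = f ` nbrs E v"
proof -
  have bij: "bij_betw f V W" and fE: "\<And>a b. a \<in> V \<Longrightarrow> b \<in> V \<Longrightarrow> {a, b} \<in> E \<longleftrightarrow> {f a, f b} \<in> F"
    using graph_iso_bij[OF assms(1)] graph_iso_edge[OF assms(1)] by simp_all
  have im: "f ` V = W" using bij by (simp add: bij_betw_def)
  show ?thesis
  proof (intro equalityI subsetI)
    fix x assume x: "x \<in> nbrs F (f v)"
    then have "x \<in> W" using simple_graph_edgeD(1)[OF assms(3)] by (auto simp: nbrs_def)
    then obtain u where "u \<in> V" "x = f u" using im by blast
    then show "x \<in> f ` nbrs E v" using x fE assms(4) by (auto simp: nbrs_def)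
  next
    fix x assume "x \<in> f ` nbrs E v"
    then obtain u where u: "{u, v} \<in> E" "x = f u" by (auto simp: nbrs_def)
    then show "x \<in> nbrs F (f v)" using fE[of u v] simple_graph_edgeD(1)[OF assms(2) u(1)] assms(4) by (simp add: nbrs_def)
  qed
qed

lemma graph_iso_degree:
  assumes "graph_iso f V E W F" "fin_simple_graph V E" "fin_simple_graph W F" "v \<in> V"
  shows "vertex_degree F (f v) = vertex_degree E v"
proof -
  have "nbrs E v \<subseteq> V" using simple_graph_edgeD(1)[OF assms(2)] by (auto simp: nbrs_def)
  then have "inj_on f (nbrs E v)" using assms(1) by (auto simp: graph_iso_def bij_betw_def intro: inj_on_subset)
  then show ?thesis
    using graph_iso_nbrs[OF assms] vertex_degree_nbrs[OF assms(2)] vertex_degree_nbrs[OF assms(3)]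
    by (simp add: card_image)
qed

lemma tree_code_base:
  assumes t: "is_tree V E" and q: "graph_path V E q" and V: "set q = V"
  shows "graph_iso (\<lambda>(i, j, d). q ! i) (code_verts (replicate (length q) [])) (code_edges (replicate (length q) [])) V E"
proof -
  let ?c = "replicate (length q) ([] :: nat list)"
  have verts: "code_verts ?c = (\<lambda>i. (i, 0, 0)) ` {..<length q}"
    by (auto simp: code_verts_def split: if_splits)
  have dist: "distinct q" using q by (simp add: graph_path_def)
  have "bij_betw (\<lambda>(i, j, d). q ! i) (code_verts ?c) V"
    unfolding bij_betw_def verts inj_on_def image_image V[symmetric]
    using dist by (auto simp: nth_eq_iff_index_eq set_conv_nth)
  moreover have "{(i, 0, 0), (k, 0, 0)} \<in> code_edges ?c \<longleftrightarrow> {q ! i, q ! k} \<in> E" if "i < length q" "k < length q" for i k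
  proof -
    have L: "{(i, 0, 0), (k, 0, 0)} \<in> code_edges ?c \<longleftrightarrow> k = Suc i \<or> i = Suc k"
      using that by (auto simp: code_edge_iff verts)
    have acyc: "\<nexists>c. graph_cycle V E c" and fs: "fin_simple_graph V E" using t by (auto simp: is_tree_def)
    have step: "{q ! i, q ! Suc i} \<in> E" if "Suc i < length q" for i using q that by (simp add: graph_path_def)
    have "k = Suc i \<or> i = Suc k" if e: "{q ! i, q ! k} \<in> E"
    proof -
      have "i \<noteq> k" using simple_graph_edgeD(3)[OF fs e] by auto
      then show ?thesis using acyclic_chord[OF acyc q, of i k] acyclic_chord[OF acyc q, of k i] e \<open>i < length q\<close> \<open>k < length q\<close>
        by (cases "i < k") (auto simp: insert_commute)
    qed
    then show ?thesis using L step[of i] step[of k] that by (auto simp: insert_commute)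
  qed
  ultimately show ?thesis unfolding graph_iso_def by (auto simp: verts)
qed

text \<open>Leaves off \<open>q\<close> are removed until only the path remains, which is a code
  with empty letters. Putting a leaf back at \<open>w\<close> starts a new branch if
  \<open>w\<close> is on the spine, and otherwise prolongs the branch whose tip is
  \<open>w\<close>.\<close>

lemma tree_code_exists:
  assumes "is_tree V E" "graph_path V E q" "\<And>v. v \<in> V - set q \<Longrightarrow> vertex_degree E v \<le> 2"
  shows "\<exists>c f. length c = length q \<and> pos_code c \<and> graph_iso f (code_verts c) (code_edges c) V E \<and>
           (\<forall>i<length q. f (i, 0, 0) = q ! i)"
  using assms
proof (induction "card V" arbitrary: V E rule: less_induct)
  case less
  note t = less.prems(1) and q = less.prems(2) and deg = less.prems(3)
  have fs: "fin_simple_graph V E" using t by (simp add: is_tree_def)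
  have fin: "finite V" using fs by (simp add: fin_simple_graph_def)
  show ?case
  proof (cases "set q = V")
    case True
    show ?thesis
      by (intro exI[of _ "replicate (length q) []"] exI[of _ "\<lambda>(i, j, d). q ! i"] conjI tree_code_base[OF t q True])
        (auto simp: pos_code_def)
  next
    case False
    obtain v w where v: "v \<in> V" "v \<notin> set q" "w \<in> V" "w \<noteq> v" "nbrs E v = {w}"
      using tree_leaf_off_path[OF t q False] .
    let ?V = "V - {v}" and ?E = "E - {{v, w}}"
    have t': "is_tree ?V ?E" by (rule is_tree_remove_leaf[OF t v(1,5)])
    have fs': "fin_simple_graph ?V ?E" using t' by (simp add: is_tree_def)
    have q': "graph_path ?V ?E q"
      unfolding graph_path_def
    proof (intro conjI allI impI)
      show "set q \<subseteq> V - {v}" "q \<noteq> []" "distinct q" using q v(2) by (auto simp: graph_path_def)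
      fix i assume i: "Suc i < length q"
      then have "q ! i \<noteq> v" "q ! Suc i \<noteq> v" using v(2) by (metis Suc_lessD nth_mem, metis nth_mem)
      then show "{q ! i, q ! Suc i} \<in> ?E" using q i by (auto simp: graph_path_def doubleton_eq_iff)
    qed
    have deg': "vertex_degree ?E u \<le> 2" if "u \<in> ?V - set q" for u
    proof -
      have "vertex_degree ?E u \<le> vertex_degree E u"
        unfolding vertex_degree_def using finite_edges[OF fs] by (intro card_mono) auto
      then show ?thesis using deg[of u] that by force
    qed
    have "card ?V < card V" using fin v(1) by (meson card_Diff1_less)
    from less.hyps[OF this t' q' deg'] obtain c f where c: "length c = length q" "pos_code c"
      and f: "graph_iso f (code_verts c) (code_edges c) ?V ?E" and fq: "\<And>i. i < length q \<Longrightarrow> f (i, 0, 0) = q ! i"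
      by blast
    have im: "f ` code_verts c = ?V" using f by (simp add: graph_iso_def bij_betw_def)
    have "w \<in> ?V" using v by simp
    then have "w \<in> f ` code_verts c" unfolding im .
    then obtain y where y: "y \<in> code_verts c" "f y = w" by blast
    obtain i j d where ijd: "y = (i, j, d)" by (cases y)
    have ilen: "i < length c" using y(1) ijd by (simp add: code_verts_def)
    show ?thesis
    proof (cases "d = 0")
      case True
      then have j0: "j = 0" using y(1) ijd by (simp add: code_verts_def)
      \<comment> \<open>Here \<open>w\<close> is on the spine: a branch of length one is appended to
        its letter, at the index just past the old ones.\<close>
      let ?c = "c[i := c ! i @ [1]]" and ?z = "(i, length (c ! i), 1)"
      have verts: "code_verts ?c = insert ?z (code_verts c)"
        using ilen by (auto simp: code_verts_def nth_list_update nth_append split: if_splits)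
      have z: "?z \<notin> code_verts c" by (simp add: code_verts_def)
      have iso: "graph_iso (f(?z := v)) (code_verts ?c) (code_edges ?c) V E"
        by (rule code_extend[OF f fs v(1,5) verts z _ _ y]) (use ijd True j0 in auto)
      have "pos_code ?c" using c(2) ilen unfolding pos_code_nth
        by (auto simp: nth_list_update nth_append)
      then show ?thesis using iso c fq by (intro exI[of _ ?c] exI[of _ "f(?z := v)"]) auto
    next
      case False
      then have jd: "j < length (c ! i)" "d \<le> c ! i ! j" using y(1) ijd by (auto simp: code_verts_def)
      \<comment> \<open>An inner vertex of a branch has two neighbours even without
        \<open>v\<close>; together with \<open>v\<close> it would have degree three off the
        spine.\<close>
      have "d = c ! i ! j"
      proof (rule ccontr)
        assume "d \<noteq> c ! i ! j"
        then have s: "(i, j, Suc d) \<in> code_verts c" using jd ilen by (simp add: code_verts_def)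
        have p: "code_par y \<in> code_verts c" using y(1) ijd False by (intro code_par_in) auto
        have "{(i, j, Suc d), code_par y} \<subseteq> nbrs (code_edges c) y"
          using s p y(1) ijd False unfolding nbrs_def by (auto simp: code_edge_iff)
        moreover have "(i, j, Suc d) \<noteq> code_par y" using ijd by auto
        ultimately have "card {(i, j, Suc d), code_par y} \<le> card (nbrs (code_edges c) y)"
          by (intro card_mono finite_nbrs[OF code_simple])
        then have "2 \<le> vertex_degree (code_edges c) y"
          using \<open>(i, j, Suc d) \<noteq> code_par y\<close> by (simp add: vertex_degree_nbrs[OF code_simple])
        then have d2: "2 \<le> vertex_degree ?E w" using graph_iso_degree[OF f code_simple fs' y(1)] y(2) by simp
        have "{e \<in> E. w \<in> e} = insert {v, w} {e \<in> ?E. w \<in> e}"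
        proof -
          have "w \<in> nbrs E v" using v(5) by simp
          then have "{v, w} \<in> E" by (simp add: nbrs_def insert_commute)
          then show ?thesis by auto
        qed
        then have "vertex_degree E w = Suc (vertex_degree ?E w)"
          unfolding vertex_degree_def using finite_edges[OF fs] by simp
        moreover have "w \<notin> set q"
        proof
          assume "w \<in> set q"
          then obtain k where k: "k < length q" "q ! k = w" by (meson in_set_conv_nth)
          then have "f (k, 0, 0) = f y" using fq y(2) by simp
          moreover have "(k, 0, 0) \<in> code_verts c" using k c(1) by (simp add: code_verts_def)
          moreover have "inj_on f (code_verts c)" using f by (simp add: graph_iso_def bij_betw_def)
          ultimately have "(k, 0, 0) = y" using y(1) by (meson inj_onD)
          then show False using ijd False by simp
        qed
        ultimately show False using deg[of w] v(3) d2 by simp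
      qed
      let ?c = "c[i := (c ! i)[j := Suc d]]" and ?z = "(i, j, Suc d)"
      have verts: "code_verts ?c = insert ?z (code_verts c)"
        using ilen jd \<open>d = c ! i ! j\<close> False
        by (auto simp: code_verts_def nth_list_update le_Suc_eq split: if_splits)
      have z: "?z \<notin> code_verts c" using \<open>d = c ! i ! j\<close> by (simp add: code_verts_def)
      have iso: "graph_iso (f(?z := v)) (code_verts ?c) (code_edges ?c) V E"
        by (rule code_extend[OF f fs v(1,5) verts z _ _ y]) (use ijd False in auto)
      have "pos_code ?c" using c(2) ilen jd unfolding pos_code_nth
        by (auto simp: nth_list_update)
      then show ?thesis using iso c fq by (intro exI[of _ ?c] exI[of _ "f(?z := v)"]) auto
    qed
  qed
qed

section \<open>Recovering the code from the tree\<close>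

lemma nbrs_code:
  assumes "v \<in> code_verts c"
  shows "nbrs (code_edges c) v = (if v = (0, 0, 0) then {} else {code_par v}) \<union>
           {u \<in> code_verts c. u \<noteq> (0, 0, 0) \<and> code_par u = v}"
  using assms code_par_in[OF assms] unfolding nbrs_def by (auto simp: code_edge_iff)

lemma code_children_spine:
  assumes "pos_code c" "i < length c"
  shows "{u \<in> code_verts c. u \<noteq> (0, 0, 0) \<and> code_par u = (i, 0, 0)} =
     (if Suc i < length c then {(Suc i, 0, 0)} else {}) \<union> (\<lambda>j. (i, j, 1)) ` {..<length (c ! i)}"
  using assms by (fastforce simp: code_verts_def pos_code_nth Suc_le_eq split: if_splits)

lemma code_children_branch:
  assumes "(i, j, Suc d) \<in> code_verts c"
  shows "{u \<in> code_verts c. u \<noteq> (0, 0, 0) \<and> code_par u = (i, j, Suc d)} =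
     (if Suc (Suc d) \<le> c ! i ! j then {(i, j, Suc (Suc d))} else {})"
  using assms by (auto simp: code_verts_def split: if_splits)

lemma degree_code_spine:
  assumes "pos_code c" "i < length c"
  shows "vertex_degree (code_edges c) (i, 0, 0) =
     (if 0 < i then 1 else 0) + (if Suc i < length c then 1 else 0) + length (c ! i)"
proof -
  have v: "(i, 0, 0) \<in> code_verts c" using assms(2) by (simp add: code_verts_def)
  have card: "card ((\<lambda>j. (i, j, 1::nat)) ` {..<length (c ! i)}) = length (c ! i)"
    by (subst card_image) (auto simp: inj_on_def)
  let ?P = "if i = 0 then {} else {(i - 1, 0, 0)} :: (nat \<times> nat \<times> nat) set"
  let ?S = "if Suc i < length c then {(Suc i, 0, 0)} else {} :: (nat \<times> nat \<times> nat) set"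
  let ?B = "(\<lambda>j. (i, j, 1::nat)) ` {..<length (c ! i)}"
  have "nbrs (code_edges c) (i, 0, 0) = ?P \<union> (?S \<union> ?B)"
    unfolding nbrs_code[OF v] code_children_spine[OF assms] by simp
  moreover have "card (?P \<union> (?S \<union> ?B)) = card ?P + (card ?S + card ?B)"
    by (subst card_Un_disjoint, simp, simp, force, subst card_Un_disjoint) auto
  ultimately show ?thesis using card by (simp add: vertex_degree_nbrs[OF code_simple])
qed

lemma degree_code_branch:
  assumes "(i, j, Suc d) \<in> code_verts c"
  shows "vertex_degree (code_edges c) (i, j, Suc d) = (if Suc (Suc d) \<le> c ! i ! j then 2 else 1)"
proof -
  have "code_par (i, j, Suc d) \<noteq> (i, j, Suc (Suc d))" by auto
  then show ?thesis
    unfolding vertex_degree_nbrs[OF code_simple] nbrs_code[OF assms] code_children_branch[OF assms] 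
    by (simp add: card_insert_if)
qed

text \<open>An end of the spine has one neighbour on the spine, so it needs two hanging paths to be
  an HDV. With HDVs at both ends the spine is determined by the tree.\<close>

definition good_code :: "nat list list \<Rightarrow> bool" where
  "good_code c \<longleftrightarrow> pos_code c \<and> 2 \<le> length c \<and> 2 \<le> length (hd c) \<and> 2 \<le> length (last c)"

lemma good_code_ends:
  assumes "good_code c"
  shows "2 \<le> length (c ! 0)" "2 \<le> length (c ! (length c - 1))"
proof -
  have "c \<noteq> []" using assms by (auto simp: good_code_def)
  then show "2 \<le> length (c ! 0)" "2 \<le> length (c ! (length c - 1))"
    using assms by (simp_all add: good_code_def hd_conv_nth last_conv_nth)
qed

text \<open>An inner spine vertex has two spine neighbours, so a single hanging path makes it an
  HDV; at the two ends both sides are true.\<close>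

lemma good_code_spine_degree:
  assumes "good_code c" "i < length c"
  shows "3 \<le> vertex_degree (code_edges c) (i, 0, 0) \<longleftrightarrow> c ! i \<noteq> []"
proof -
  have p: "pos_code c" "2 \<le> length c" using assms by (auto simp: good_code_def)
  consider "i = 0" | "i = length c - 1" "i \<noteq> 0" | "0 < i" "Suc i < length c" using assms(2) by linarith
  then show ?thesis
  proof cases
    case 1
    have "c ! 0 \<noteq> []" using good_code_ends(1)[OF assms(1)] by auto
    then show ?thesis using 1 p good_code_ends(1)[OF assms(1)] assms(2) degree_code_spine[OF p(1), of 0] by simp
  next
    case 2
    have "c ! i \<noteq> []" "2 \<le> length (c ! i)" using 2 good_code_ends(2)[OF assms(1)] by auto
    moreover have "0 < length c - Suc 0" using 2 p by simp
    ultimately show ?thesis using 2 assms(2) degree_code_spine[OF p(1) assms(2)] by simp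
  next
    case 3
    then show ?thesis by (cases "c ! i") (simp_all add: degree_code_spine[OF p(1) assms(2)])
  qed
qed

lemma code_verts_cases:
  assumes "v \<in> code_verts c"
  obtains (spine) i where "v = (i, 0, 0)" "i < length c"
  | (branch) i j d where "v = (i, j, Suc d)" "i < length c" "j < length (c ! i)" "Suc d \<le> c ! i ! j"
proof -
  obtain i j d where "v = (i, j, d)" by (cases v)
  then show ?thesis using assms that by (cases d) (auto simp: code_verts_def)
qed

lemma hdvs_code:
  assumes "good_code c"
  shows "hdvs (code_verts c) (code_edges c) = (\<lambda>i. (i, 0, 0)) ` {i. i < length c \<and> c ! i \<noteq> []}"
proof (intro equalityI subsetI)
  fix v assume v: "v \<in> hdvs (code_verts c) (code_edges c)"
  then have "v \<in> code_verts c" "3 \<le> vertex_degree (code_edges c) v" by (auto simp: hdvs_def)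
  then show "v \<in> (\<lambda>i. (i, 0, 0)) ` {i. i < length c \<and> c ! i \<noteq> []}"
  proof (cases rule: code_verts_cases)
    case (spine i)
    then show ?thesis using good_code_spine_degree[OF assms spine(2)] \<open>3 \<le> _\<close> by auto
  next
    case (branch i j d)
    then have "vertex_degree (code_edges c) v \<le> 2"
      using degree_code_branch[of i j d c] \<open>v \<in> code_verts c\<close> by simp
    then show ?thesis using \<open>3 \<le> _\<close> by simp
  qed
next
  fix v :: "nat \<times> nat \<times> nat" assume "v \<in> (\<lambda>i. (i, 0, 0)) ` {i. i < length c \<and> c ! i \<noteq> []}"
  then show "v \<in> hdvs (code_verts c) (code_edges c)"
    using good_code_spine_degree[OF assms] by (auto simp: hdvs_def code_verts_def)
qed

lemma code_edge_spine_iff: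
  "{(i, 0, 0), (k, 0, 0)} \<in> code_edges c \<longleftrightarrow> i < length c \<and> k < length c \<and> (k = Suc i \<or> i = Suc k)"
  by (auto simp: code_edge_iff code_verts_def)

lemma k_linear_tree_code:
  assumes "good_code c"
  shows "k_linear_tree (length (filter (\<lambda>l. l \<noteq> []) c)) (code_verts c) (code_edges c)"
proof -
  let ?p = "map (\<lambda>i. (i, 0, 0) :: nat \<times> nat \<times> nat) [0..<length c]"
  have ne: "c \<noteq> []" using assms by (auto simp: good_code_def)
  have "induced_graph_path (code_verts c) (code_edges c) ?p"
    using ne unfolding induced_graph_path_def graph_path_def
    by (auto simp: code_edge_spine_iff code_verts_def distinct_map inj_on_def)
  moreover have "hdvs (code_verts c) (code_edges c) \<subseteq> set ?p" unfolding hdvs_code[OF assms] by auto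
  moreover have "card (hdvs (code_verts c) (code_edges c)) = length (filter (\<lambda>l. l \<noteq> []) c)"
    unfolding hdvs_code[OF assms] length_filter_conv_card by (rule card_image) (auto simp: inj_on_def)
  ultimately show ?thesis using code_tree[OF ne] unfolding k_linear_tree_def linear_tree_def by blast
qed

lemma card_code_verts: "card (code_verts c) = (\<Sum>l\<leftarrow>c. Suc (sum_list l))"
proof -
  let ?A = "\<lambda>i. insert (0, 0) (SIGMA j:{..<length (c ! i)}. {1..c ! i ! j})"
  have "code_verts c = (SIGMA i:{..<length c}. ?A i)"
  proof (intro equalityI subsetI)
    fix v assume "v \<in> code_verts c"
    then show "v \<in> (SIGMA i:{..<length c}. ?A i)"
      by (cases rule: code_verts_cases) auto
  next
    fix v assume "v \<in> (SIGMA i:{..<length c}. ?A i)"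
    then show "v \<in> code_verts c" by (cases v) (auto simp: code_verts_def)
  qed
  moreover have "card (?A i) = Suc (sum_list (c ! i))" for i
  proof -
    have "card (?A i) = Suc (card (SIGMA j:{..<length (c ! i)}. {1..c ! i ! j}))"
      by (rule card_insert_disjoint) auto
    then show ?thesis by (simp add: sum_list_sum_nth atLeast0LessThan)
  qed
  ultimately show ?thesis by (simp add: sum_list_sum_nth atLeast0LessThan)
qed

text \<open>Isomorphism invariants recovering a code from its tree: the spine of a good code consists of
  the vertices from which no path through vertices of degree at most two ends in a leaf.\<close>

definition thin_path :: "'a set \<Rightarrow> 'a set set \<Rightarrow> 'a list \<Rightarrow> bool" where
  "thin_path V E p \<longleftrightarrow> graph_path V E p \<and> (\<forall>x\<in>set p. vertex_degree E x \<le> 2) \<and> vertex_degree E (last p) \<le> 1"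

definition core :: "'a set \<Rightarrow> 'a set set \<Rightarrow> 'a set" where
  "core V E = {v \<in> V. \<nexists>p. thin_path V E p \<and> hd p = v}"

text \<open>For \<open>s\<close> on the spine \<open>S\<close> and \<open>d > 0\<close> there is one
  such path for each hanging path at \<open>s\<close> of length at least \<open>d\<close>, so the
  cardinalities determine the multiset of these lengths.\<close>

definition branches :: "'a set \<Rightarrow> 'a set set \<Rightarrow> 'a set \<Rightarrow> 'a \<Rightarrow> nat \<Rightarrow> 'a list set" where
  "branches V E S s d = {p. graph_path V E p \<and> hd p = s \<and> length p = Suc d \<and> set (tl p) \<inter> S = {}}"

text \<open>From a branch vertex the way outwards to the tip is thin. A thin path that starts on the
  spine never leaves it, because spine vertices of degree at most two carry no branch; its last
  vertex would have degree at most one, and the spine has no such vertex.\<close>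

lemma code_core:
  assumes "good_code c"
  shows "core (code_verts c) (code_edges c) = (\<lambda>i. (i, 0, 0)) ` {..<length c}" (is "_ = ?S")
proof (intro equalityI subsetI)
  have p: "pos_code c" "2 \<le> length c" using assms by (auto simp: good_code_def)
  fix v assume v: "v \<in> core (code_verts c) (code_edges c)"
  then have vv: "v \<in> code_verts c" by (simp add: core_def)
  then show "v \<in> ?S"
  proof (cases rule: code_verts_cases)
    case (branch i j d)
    \<comment> \<open>The rest of the branch, from \<open>v\<close> out to its tip.\<close>
    let ?p = "map (\<lambda>e. (i, j, e)) [Suc d..<Suc (c ! i ! j)]"
    have ne: "[Suc d..<Suc (c ! i ! j)] \<noteq> []" using branch by simp
    have in_verts: "(i, j, Suc e) \<in> code_verts c" if "Suc e \<le> c ! i ! j" for e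
      using branch that by (simp add: code_verts_def)
    have "thin_path (code_verts c) (code_edges c) ?p"
      unfolding thin_path_def graph_path_def
    proof (intro conjI ballI allI impI)
      show "?p \<noteq> []" using ne by simp
      show "set ?p \<subseteq> code_verts c" using branch by (auto simp: code_verts_def)
      show "distinct ?p" by (simp add: distinct_map inj_on_def)
      show "vertex_degree (code_edges c) (last ?p) \<le> 1"
      proof -
        have "last ?p = (i, j, c ! i ! j)" using ne branch by (subst last_map) auto
        moreover obtain e where "c ! i ! j = Suc e" using branch by (cases "c ! i ! j") auto
        ultimately show ?thesis using degree_code_branch[OF in_verts, of e] by simp
      qed
      show "vertex_degree (code_edges c) x \<le> 2" if "x \<in> set ?p" for x
      proof -
        obtain e where "x = (i, j, Suc e)" "Suc e \<le> c ! i ! j" using \<open>x \<in> set ?p\<close> by (auto elim: Suc_le_D[THEN exE])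
        then show ?thesis using degree_code_branch[OF in_verts, of e] by simp
      qed
      show "{?p ! k, ?p ! Suc k} \<in> code_edges c" if "Suc k < length ?p" for k
        using that branch by (auto simp: nth_append code_edge_iff code_verts_def simp del: upt_Suc)
    qed
    moreover have "hd ?p = v" using ne branch by (simp add: hd_map upt_rec)
    ultimately show ?thesis using v unfolding core_def by blast
  qed auto
next
  have p: "pos_code c" "2 \<le> length c" using assms by (auto simp: good_code_def)
  fix v assume "v \<in> ?S"
  then obtain i where i: "v = (i, 0, 0)" "i < length c" by auto
  have spine: "\<exists>i<length c. last p = (i, 0, 0)"
    if "graph_path (code_verts c) (code_edges c) p" "\<exists>i<length c. hd p = (i, 0, 0)"
       "\<forall>x\<in>set p. vertex_degree (code_edges c) x \<le> 2" for p
    using that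
  proof (induction p)
    case Nil then show ?case by (simp add: graph_path_def)
  next
    case (Cons x p)
    show ?case
    proof (cases "p = []")
      case False
      from Cons.prems obtain i where i: "i < length c" "x = (i, 0, 0)" by auto
      have "\<not> 3 \<le> vertex_degree (code_edges c) x" using Cons.prems(3) by auto
      then have ci: "c ! i = []" using good_code_spine_degree[OF assms i(1)] i(2) by simp
      have e: "{x, hd p} \<in> code_edges c" "graph_path (code_verts c) (code_edges c) p"
        using Cons.prems(1) False by (simp_all add: graph_path_Cons_iff)
      have hv: "hd p \<in> code_verts c" using simple_graph_edgeD(2)[OF code_simple e(1)] .
      then have "\<exists>i<length c. hd p = (i, 0, 0)"
      proof (cases rule: code_verts_cases)
        case (branch i' j d)
        then have "code_par (hd p) = x" using e(1) i by (auto simp: code_edge_iff)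
        then have "i' = i" using branch i by (auto split: if_splits)
        then show ?thesis using branch ci by simp
      qed auto
      then show ?thesis using Cons.IH[OF e(2)] Cons.prems(3) False by simp
    qed (use Cons.prems in auto)
  qed
  have False if t: "thin_path (code_verts c) (code_edges c) p" "hd p = v" for p
  proof -
    have g: "graph_path (code_verts c) (code_edges c) p" using t by (simp add: thin_path_def)
    obtain k where k: "k < length c" "last p = (k, 0, 0)" using spine[OF g] t i by (auto simp: thin_path_def)
    have l: "last p \<in> set p" using graph_path_nonempty[OF g] by simp
    then have "vertex_degree (code_edges c) (k, 0, 0) \<le> 1" using t(1) k by (auto simp: thin_path_def)
    then have "c ! k = []" "\<not> (0 < k \<and> Suc k < length c)"
      using degree_code_spine[OF p(1) k(1)] good_code_spine_degree[OF assms k(1)] by auto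
    moreover have "k = 0 \<or> k = length c - 1" using calculation k(1) by linarith
    ultimately show False using good_code_ends[OF assms] by auto
  qed
  moreover have "v \<in> code_verts c" using i by (simp add: code_verts_def)
  ultimately show "v \<in> core (code_verts c) (code_edges c)" unfolding core_def by blast
qed

text \<open>After the first step off the spine, a step to the parent would revisit the path or meet
  the spine again, so every further step goes outwards on the same branch.\<close>

lemma code_branch_path:
  assumes "p \<in> branches (code_verts c) (code_edges c) ((\<lambda>i. (i, 0, 0)) ` {..<length c}) (i, 0, 0) (Suc d)"
    "i < length c"
  shows "\<exists>j. j < length (c ! i) \<and> Suc d \<le> c ! i ! j \<and> p = (i, 0, 0) # map (\<lambda>e. (i, j, Suc e)) [0..<Suc d]"
  using assms
proof (induction d arbitrary: p)
  case 0
  then obtain v where p: "p = [(i, 0, 0), v]" 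
    by (auto simp: branches_def length_Suc_conv)
  have e: "{(i, 0, 0), v} \<in> code_edges c" and v: "v \<notin> (\<lambda>i. (i, 0, 0)) ` {..<length c}"
    using 0 by (auto simp: p branches_def graph_path_Cons_iff)
  have "v \<in> code_verts c" using simple_graph_edgeD(2)[OF code_simple e] .
  then show ?case
  proof (cases rule: code_verts_cases)
    case (branch i' j d)
    then have "code_par v = (i, 0, 0)" using e by (auto simp: code_edge_iff)
    then have "i' = i" "d = 0" using branch by (auto split: if_splits)
    then show ?thesis using branch p by auto
  qed (use v in auto)
next
  case (Suc d)
  have g: "graph_path (code_verts c) (code_edges c) p" "hd p = (i, 0, 0)" "length p = Suc (Suc (Suc d))"
     "set (tl p) \<inter> (\<lambda>i. (i, 0, 0)) ` {..<length c} = {}"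
    using Suc.prems by (auto simp: branches_def)
  then obtain p0 v where pv: "p = p0 @ [v]" by (cases p rule: rev_cases) auto
  then have ne: "p0 \<noteq> []" using g(3) by auto
  have g0: "graph_path (code_verts c) (code_edges c) p0" "v \<notin> set p0" "{last p0, v} \<in> code_edges c"
    using g(1) unfolding pv by (auto simp: graph_path_append_iff[OF ne])
  have tl: "tl p = tl p0 @ [v]" "hd p = hd p0" using pv ne by simp_all
  have "p0 \<in> branches (code_verts c) (code_edges c) ((\<lambda>i. (i, 0, 0)) ` {..<length c}) (i, 0, 0) (Suc d)"
    using g g0 pv tl by (auto simp: branches_def)
  from Suc.IH[OF this Suc.prems(2)] obtain j where j: "j < length (c ! i)" "Suc d \<le> c ! i ! j"
    "p0 = (i, 0, 0) # map (\<lambda>e. (i, j, Suc e)) [0..<Suc d]" by blast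
  have last: "last p0 = (i, j, Suc d)" by (simp add: j(3))
  have vS: "v \<notin> (\<lambda>i. (i, 0, 0)) ` {..<length c}" using g(4) tl by auto
  have vv: "v \<in> code_verts c" using simple_graph_edgeD(2)[OF code_simple g0(3)] .
  have "v \<noteq> code_par (i, j, Suc d)"
  proof
    assume v: "v = code_par (i, j, Suc d)"
    show False
    proof (cases d)
      case 0 then show False using v vS Suc.prems(2) by auto
    next
      case (Suc d')
      then have "v \<in> set p0" using v j(3) by auto
      then show False using g0(2) by blast
    qed
  qed
  then have "code_par v = (i, j, Suc d)" using g0(3) last by (auto simp: code_edge_iff)
  then have v: "v = (i, j, Suc (Suc d))" by (cases v) (auto split: if_splits)
  then have "Suc (Suc d) \<le> c ! i ! j" using vv by (simp add: code_verts_def)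
  then show ?case using j v pv by auto
qed

lemma card_code_branches:
  assumes "i < length c"
  shows "card (branches (code_verts c) (code_edges c) ((\<lambda>i. (i, 0, 0)) ` {..<length c}) (i, 0, 0) (Suc d)) =
     length (filter (\<lambda>x. Suc d \<le> x) (c ! i))"
proof -
  let ?path = "\<lambda>j. (i, 0, 0) # map (\<lambda>e. (i, j, Suc e)) [0..<Suc d] :: (nat \<times> nat \<times> nat) list"
  let ?J = "{j. j < length (c ! i) \<and> Suc d \<le> c ! i ! j}"
  have path: "?path j \<in> branches (code_verts c) (code_edges c) ((\<lambda>i. (i, 0, 0)) ` {..<length c}) (i, 0, 0) (Suc d)"
    if j: "j \<in> ?J" for j
  proof -
    have "graph_path (code_verts c) (code_edges c) (?path j)"
      unfolding graph_path_def
    proof (intro conjI allI impI)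
      show "set (?path j) \<subseteq> code_verts c" using j assms by (auto simp: code_verts_def)
      show "distinct (?path j)" by (auto simp: distinct_map inj_on_def)
      fix k assume k: "Suc k < length (?path j)"
      have nth: "?path j ! Suc k' = (i, j, Suc k')" if "k' < Suc d" for k' using that
        by (simp del: upt_Suc)
      show "{?path j ! k, ?path j ! Suc k} \<in> code_edges c"
      proof (cases k)
        case 0
        then show ?thesis using nth[of 0] j assms by (auto simp: code_edge_iff code_verts_def simp del: upt_Suc)
      next
        case (Suc k')
        then show ?thesis using k j assms nth[of k'] nth[of k]
          by (auto simp: code_edge_iff code_verts_def simp del: upt_Suc)
      qed
    qed simp
    then show ?thesis by (auto simp: branches_def)
  qed
  have "branches (code_verts c) (code_edges c) ((\<lambda>i. (i, 0, 0)) ` {..<length c}) (i, 0, 0) (Suc d) = ?path ` ?J"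
    using path code_branch_path[OF _ assms] by blast
  moreover have "inj_on ?path ?J" by (auto simp: inj_on_def)
  ultimately show ?thesis by (simp add: card_image length_filter_conv_card)
qed

section \<open>Every linear tree has a code\<close>

lemma graph_iso_sym:
  assumes "graph_iso f V E W F"
  shows "graph_iso (inv_into V f) W F V E"
proof -
  have bij: "bij_betw f V W" and fE: "\<And>a b. a \<in> V \<Longrightarrow> b \<in> V \<Longrightarrow> {a, b} \<in> E \<longleftrightarrow> {f a, f b} \<in> F"
    using graph_iso_bij[OF assms] graph_iso_edge[OF assms] by simp_all
  have "{a, b} \<in> F \<longleftrightarrow> {inv_into V f a, inv_into V f b} \<in> E" if "a \<in> W" "b \<in> W" for a b
  proof -
    have "inv_into V f a \<in> V" "inv_into V f b \<in> V" "f (inv_into V f a) = a" "f (inv_into V f b) = b"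
      using that bij by (auto simp: bij_betw_def inv_into_into f_inv_into_f)
    then show ?thesis using fE[of "inv_into V f a" "inv_into V f b"] by simp
  qed
  then show ?thesis using bij_betw_inv_into[OF bij] unfolding graph_iso_def by blast
qed

lemma graph_iso_trans:
  assumes "graph_iso f V E W F" "graph_iso g W F U G"
  shows "graph_iso (g \<circ> f) V E U G"
proof -
  have "f a \<in> W" if "a \<in> V" for a using that assms(1) by (auto simp: graph_iso_def bij_betw_def)
  moreover have "bij_betw (g \<circ> f) V U" using assms[THEN graph_iso_bij] by (rule bij_betw_trans)
  ultimately show ?thesis
    using graph_iso_edge[OF assms(1)] graph_iso_edge[OF assms(2)] by (simp add: graph_iso_def)
qed

lemma graph_iso_path:
  assumes f: "graph_iso f V E W F" and p: "graph_path V E p"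
  shows "graph_path W F (map f p)"
proof -
  have bij: "bij_betw f V W" and fE: "\<And>a b. a \<in> V \<Longrightarrow> b \<in> V \<Longrightarrow> {a, b} \<in> E \<longleftrightarrow> {f a, f b} \<in> F"
    using graph_iso_bij[OF f] graph_iso_edge[OF f] by simp_all
  have pV: "set p \<subseteq> V" using p by (simp add: graph_path_def)
  show ?thesis unfolding graph_path_def
  proof (intro conjI allI impI)
    show "map f p \<noteq> []" using p by (simp add: graph_path_def)
    show "set (map f p) \<subseteq> W" using pV bij by (auto simp: bij_betw_def)
    show "distinct (map f p)" using p pV bij by (auto simp: distinct_map graph_path_def bij_betw_def intro: inj_on_subset)
    fix i assume i: "Suc i < length (map f p)"
    then have "p ! i \<in> V" "p ! Suc i \<in> V" using pV by (auto simp: subset_iff)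
    moreover have "{p ! i, p ! Suc i} \<in> E" using i p by (simp add: graph_path_def)
    ultimately show "{map f p ! i, map f p ! Suc i} \<in> F" using i fE by simp
  qed
qed

lemma map_inv_into_map:
  "inj_on f V \<Longrightarrow> set p \<subseteq> V \<Longrightarrow> map (inv_into V f) (map f p) = p"
  by (induction p) auto

lemma map_map_inv_into:
  "f ` V = W \<Longrightarrow> set p \<subseteq> W \<Longrightarrow> map f (map (inv_into V f) p) = p"
proof -
  assume a: "f ` V = W" "set p \<subseteq> W"
  have "(f \<circ> inv_into V f) x = x" if "x \<in> set p" for x
  proof -
    have "x \<in> f ` V" using a that by blast
    then show ?thesis by (simp add: f_inv_into_f)
  qed
  then show ?thesis by (simp add: map_idI)
qed

lemma core_subset: "core V E \<subseteq> V"
  by (auto simp: core_def)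

lemma graph_iso_thin:
  assumes f: "graph_iso f V E W F" and fs: "fin_simple_graph V E" "fin_simple_graph W F" and p: "thin_path V E p"
  shows "thin_path W F (map f p)"
proof -
  have g: "graph_path V E p" using p by (simp add: thin_path_def)
  then have "set p \<subseteq> V" "p \<noteq> []" by (simp_all add: graph_path_def)
  then show ?thesis
    using p graph_iso_path[OF f g] graph_iso_degree[OF f fs] unfolding thin_path_def
    by (auto simp: last_map subset_iff)
qed

lemma graph_iso_core_subset:
  assumes f: "graph_iso f V E W F" and fs: "fin_simple_graph V E" "fin_simple_graph W F"
  shows "f ` core V E \<subseteq> core W F"
proof
  fix w assume "w \<in> f ` core V E"
  then obtain v where v: "v \<in> V" "w = f v" "\<And>p. thin_path V E p \<Longrightarrow> hd p \<noteq> v" by (auto simp: core_def)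
  have bij: "bij_betw f V W" using f by (simp add: graph_iso_def)
  have "hd p \<noteq> w" if p: "thin_path W F p" for p
  proof
    assume hd: "hd p = w"
    have "thin_path V E (map (inv_into V f) p)" by (rule graph_iso_thin[OF graph_iso_sym[OF f] fs(2,1) p])
    moreover have "p \<noteq> []" using p by (simp add: thin_path_def graph_path_def)
    ultimately have "inv_into V f w \<noteq> v" using v(3) hd by (metis hd_map)
    then show False using v(1,2) bij by (simp add: bij_betw_def)
  qed
  moreover have "w \<in> W" using v bij by (auto simp: bij_betw_def)
  ultimately show "w \<in> core W F" by (auto simp: core_def)
qed

lemma graph_iso_core:
  assumes f: "graph_iso f V E W F" and fs: "fin_simple_graph V E" "fin_simple_graph W F"
  shows "core W F = f ` core V E"
proof
  show "f ` core V E \<subseteq> core W F" by (rule graph_iso_core_subset[OF assms])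
  have im: "f ` V = W" using f by (simp add: graph_iso_def bij_betw_def)
  show "core W F \<subseteq> f ` core V E"
  proof
    fix w assume w: "w \<in> core W F"
    then have "inv_into V f w \<in> core V E"
      using graph_iso_core_subset[OF graph_iso_sym[OF f] fs(2,1)] by blast
    moreover have "w = f (inv_into V f w)" using w core_subset[of W F] im by (metis f_inv_into_f subsetD)
    ultimately show "w \<in> f ` core V E" by blast
  qed
qed

lemma graph_iso_branches_subset:
  assumes f: "graph_iso f V E W F" and S: "S \<subseteq> V" 
  shows "map f ` branches V E S s d \<subseteq> branches W F (f ` S) (f s) d"
proof
  fix q assume "q \<in> map f ` branches V E S s d"
  then obtain p where p: "q = map f p" "graph_path V E p" "hd p = s" "length p = Suc d" "set (tl p) \<inter> S = {}"
    by (auto simp: branches_def)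
  have inj: "inj_on f V" using f by (simp add: graph_iso_def bij_betw_def)
  have ne: "p \<noteq> []" and pV: "set p \<subseteq> V" using p(2) by (simp_all add: graph_path_def)
  then have "set (tl p) \<subseteq> V" by (meson list.set_sel(2) subset_iff)
  then have "f ` set (tl p) \<inter> f ` S = f ` (set (tl p) \<inter> S)" using inj S by (simp add: inj_on_image_Int)
  then have "set (tl q) \<inter> f ` S = {}" using p(5) by (simp add: p(1) map_tl[symmetric])
  then show "q \<in> branches W F (f ` S) (f s) d"
    using graph_iso_path[OF f p(2)] p ne by (simp add: branches_def hd_map)
qed

lemma graph_iso_branches:
  assumes f: "graph_iso f V E W F" and S: "S \<subseteq> V" and s: "s \<in> V"
  shows "card (branches W F (f ` S) (f s) d) = card (branches V E S s d)"
proof -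
  let ?g = "inv_into V f"
  have inj: "inj_on f V" and im: "f ` V = W" using f by (simp_all add: graph_iso_def bij_betw_def)
  have "?g ` f ` S = S" using inj S by (simp add: inv_into_image_cancel)
  moreover have "?g (f s) = s" using inj s by simp
  moreover have "f ` S \<subseteq> W" using S im by auto
  ultimately have 1: "map ?g ` branches W F (f ` S) (f s) d \<subseteq> branches V E S s d"
    using graph_iso_branches_subset[OF graph_iso_sym[OF f], of "f ` S" "f s" d] by simp
  have 2: "map f ` branches V E S s d \<subseteq> branches W F (f ` S) (f s) d"
    by (rule graph_iso_branches_subset[OF f S])
  have "bij_betw (map f) (branches V E S s d) (branches W F (f ` S) (f s) d)"
  proof (rule bij_betw_byWitness[where f' = "map ?g"])
    show "\<forall>p\<in>branches V E S s d. map ?g (map f p) = p"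
      using map_inv_into_map[OF inj] by (simp add: branches_def graph_path_def)
    show "\<forall>p\<in>branches W F (f ` S) (f s) d. map f (map ?g p) = p"
      using map_map_inv_into[OF im] by (simp add: branches_def graph_path_def)
  qed (fact 2, fact 1)
  then show ?thesis using bij_betw_same_card by fastforce
qed

text \<open>The multiplicity of \<open>a\<close> is the number of entries at least \<open>a\<close>
  minus the number of entries at least \<open>a + 1\<close>; positivity settles
  \<open>a = 0\<close>.\<close>

lemma mset_eq_by_thresholds:
  assumes "\<And>x. x \<in> set xs \<Longrightarrow> 0 < x" "\<And>x. x \<in> set ys \<Longrightarrow> 0 < x"
    and eq: "\<And>d. length (filter (\<lambda>x. Suc d \<le> x) xs) = length (filter (\<lambda>x. Suc d \<le> x) ys)"
  shows "mset xs = mset (ys :: nat list)"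
proof (rule multiset_eqI)
  have split: "length (filter (\<lambda>x. a \<le> x) zs) = count (mset zs) a + length (filter (\<lambda>x. Suc a \<le> x) zs)" for a and zs :: "nat list"
    by (induction zs) auto
  fix a
  show "count (mset xs) a = count (mset ys) a"
  proof (cases a)
    case 0
    have "0 \<notin> set xs" "0 \<notin> set ys" using assms(1)[of 0] assms(2)[of 0] by blast+
    then show ?thesis using 0 by (simp add: count_eq_zero_iff[THEN iffD2])
  next
    case (Suc a')
    then show ?thesis using split[of a xs] split[of a ys] eq[of a'] eq[of a] by simp
  qed
qed

text \<open>An injective walk that starts at \<open>0\<close> cannot turn back.\<close>

lemma path_automorphism_fix:
  assumes inj: "inj_on g {..<m}" and adj: "\<And>i. Suc i < m \<Longrightarrow> g (Suc i) = Suc (g i) \<or> g i = Suc (g (Suc i))"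
    and 0: "g 0 = (0::nat)" and i: "i < m"
  shows "g i = i"
  using i
proof (induction i rule: less_induct)
  case (less i)
  show ?case
  proof (cases i)
    case 0 then show ?thesis using \<open>g 0 = 0\<close> by simp
  next
    case (Suc k)
    then have k: "g k = k" using less by simp
    consider "g i = Suc (g k)" | "g k = Suc (g i)" using adj[of k] Suc less.prems by auto
    then show ?thesis
    proof cases
      case 2
      then have k': "g i = k - 1" "0 < k" using k by simp_all
      then have "g (k - 1) = k - 1" using less.IH[of "k - 1"] Suc less.prems by simp
      then have "g i = g (k - 1)" using k' by simp
      moreover have "i \<in> {..<m}" "k - 1 \<in> {..<m}" using Suc less.prems by auto
      ultimately have "i = k - 1" using inj by (meson inj_onD)
      then show ?thesis using Suc by simp
    qed (use k Suc in simp)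
  qed
qed

text \<open>The value \<open>g 0\<close> is an end of the path: if it were inner, both of its
  neighbours would have to be the value of \<open>g\<close> at \<open>1\<close>. Up to reflection it
  is then \<open>0\<close>.\<close>

lemma path_automorphism:
  assumes g: "bij_betw g {..<m} {..<m}"
    and adj: "\<And>i k. i < m \<Longrightarrow> k < m \<Longrightarrow> (k = Suc i \<or> i = Suc k) \<longleftrightarrow> (g k = Suc (g i) \<or> g i = Suc (g k))"
  shows "(\<forall>i<m. g i = i) \<or> (\<forall>i<m. g i = m - Suc i)"
proof (cases "m = 0")
  case False
  have inj: "inj_on g {..<m}" and im: "g ` {..<m} = {..<m}" using g by (simp_all add: bij_betw_def)
  have lt: "g i < m" if "i < m" for i using im that by auto
  have end0: "g 0 = 0 \<or> g 0 = m - 1"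
  proof (rule ccontr)
    assume "\<not> ?thesis"
    moreover have "g 0 < m" using lt False by simp
    ultimately have a: "0 < g 0" "Suc (g 0) < m" by auto
    then have "g 0 - 1 \<in> g ` {..<m}" "Suc (g 0) \<in> g ` {..<m}" unfolding im by auto
    then obtain x y where xy: "x < m" "g x = g 0 - 1" "y < m" "g y = Suc (g 0)" by auto
    have "x = Suc 0" using adj[of 0 x] xy a by simp
    moreover have "y = Suc 0" using adj[of 0 y] xy a by simp
    ultimately show False using xy a by simp
  qed
  have adj': "g (Suc i) = Suc (g i) \<or> g i = Suc (g (Suc i))" if "Suc i < m" for i
    using adj[of i "Suc i"] that by simp
  show ?thesis
  proof (cases "g 0 = 0")
    case True then show ?thesis using path_automorphism_fix[OF inj adj'] by blast
  next
    case F: False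
    then have g0: "g 0 = m - 1" using end0 by simp
    \<comment> \<open>Composing with the reflection reduces this case to
      \<open>path_automorphism_fix\<close>.\<close>
    let ?h = "\<lambda>i. m - Suc (g i)"
    have "inj_on ?h {..<m}"
    proof (rule inj_onI)
      fix x y assume xy: "x \<in> {..<m}" "y \<in> {..<m}" "m - Suc (g x) = m - Suc (g y)"
      then have "g x = g y" using lt[of x] lt[of y] by simp
      then show "x = y" using inj xy by (auto simp: inj_on_def)
    qed
    moreover have "?h (Suc i) = Suc (?h i) \<or> ?h i = Suc (?h (Suc i))" if "Suc i < m" for i
      using adj'[OF that] lt[of i] lt[of "Suc i"] that by auto
    moreover have "?h 0 = 0" using g0 by simp
    ultimately have h: "?h i = i" if "i < m" for i using path_automorphism_fix[of ?h m i] that by blast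
    have "g i = m - Suc i" if "i < m" for i using h[OF that] lt[OF that] that by linarith
    then show ?thesis by blast
  qed
qed simp

text \<open>An isomorphism maps core to core, hence spine to spine, and induces there an
  automorphism of a path, the identity or the reflection. Counting the branches of each length then
  compares the letters.\<close>

lemma code_iso_cases:
  assumes c: "good_code c" "good_code c'"
    and f: "graph_iso f (code_verts c) (code_edges c) (code_verts c') (code_edges c')"
  shows "map mset c' = map mset c \<or> map mset c' = rev (map mset c)"
proof -
  let ?S = "\<lambda>c. (\<lambda>i. (i, 0, 0)) ` {..<length c} :: (nat \<times> nat \<times> nat) set"
  have inj: "inj_on f (code_verts c)" using f by (simp add: graph_iso_def bij_betw_def)
  have Sv: "?S c \<subseteq> code_verts c" for c by (auto simp: code_verts_def)
  have S: "?S c' = f ` ?S c"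
    using graph_iso_core[OF f code_simple code_simple] by (simp only: code_core[OF c(1)] code_core[OF c(2)])
  have card_S: "card (?S c) = length c" for c by (subst card_image) (auto simp: inj_on_def)
  have "card (f ` ?S c) = card (?S c)" using inj Sv by (intro card_image) (rule inj_on_subset)
  then have len: "length c' = length c" using S card_S by metis
  define g where "g i = fst (f (i, 0, 0))" for i
  have fS: "f (i, 0, 0) \<in> ?S c'" if "i < length c" for i unfolding S using that by auto
  have fg: "f (i, 0, 0) = (g i, 0, 0)" if "i < length c" for i
    using fS[OF that] by (auto simp: g_def)
  have g_lt: "g i < length c'" if "i < length c" for i
    using fS[OF that] by (auto simp: g_def)
  have "bij_betw g {..<length c} {..<length c}"
    unfolding bij_betw_def
  proof
    show "inj_on g {..<length c}"
    proof (rule inj_onI)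
      fix x y assume xy: "x \<in> {..<length c}" "y \<in> {..<length c}" "g x = g y"
      then have "f (x, 0, 0) = f (y, 0, 0)" using fg by simp
      moreover have "(x, 0, 0) \<in> code_verts c" "(y, 0, 0) \<in> code_verts c" using xy by (auto simp: code_verts_def)
      ultimately have "(x, 0::nat, 0::nat) = (y, 0, 0)" using inj by (meson inj_onD)
      then show "x = y" by simp
    qed
    have "g ` {..<length c} = fst ` f ` ?S c" by (simp add: image_image g_def)
    also have "\<dots> = {..<length c'}" unfolding S[symmetric] by (simp add: image_image)
    finally show "g ` {..<length c} = {..<length c}" by (simp add: len)
  qed
  moreover have "(k = Suc i \<or> i = Suc k) \<longleftrightarrow> (g k = Suc (g i) \<or> g i = Suc (g k))"
    if ik: "i < length c" "k < length c" for i k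
  proof -
    have in_verts: "(i, 0, 0) \<in> code_verts c" "(k, 0, 0) \<in> code_verts c" using ik by (auto simp: code_verts_def)
    note g_lt[OF ik(1)] g_lt[OF ik(2)]
    moreover have "{(i, 0, 0), (k, 0, 0)} \<in> code_edges c \<longleftrightarrow> {f (i, 0, 0), f (k, 0, 0)} \<in> code_edges c'"
      by (rule graph_iso_edge[OF f in_verts])
    ultimately show ?thesis using ik unfolding fg[OF ik(1)] fg[OF ik(2)] code_edge_spine_iff by simp
  qed
  ultimately have cases: "(\<forall>i<length c. g i = i) \<or> (\<forall>i<length c. g i = length c - Suc i)"
    by (rule path_automorphism)
  have mset: "mset (c' ! g i) = mset (c ! i)" if i: "i < length c" for i
  proof (rule mset_eq_by_thresholds)
    note gi = g_lt[OF i]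
    show "0 < x" if "x \<in> set (c' ! g i)" for x using c(2) gi that by (auto simp: good_code_def pos_code_def)
    show "0 < x" if "x \<in> set (c ! i)" for x using c(1) i that by (auto simp: good_code_def pos_code_def)
    fix d
    have "(i, 0, 0) \<in> code_verts c" using i by (simp add: code_verts_def)
    from graph_iso_branches[OF f Sv this, of "Suc d"]
    show "length (filter (\<lambda>x. Suc d \<le> x) (c' ! g i)) = length (filter (\<lambda>x. Suc d \<le> x) (c ! i))"
      unfolding S[symmetric] fg[OF i] card_code_branches[OF i] card_code_branches[OF gi] .
  qed
  from cases show ?thesis
  proof
    assume "\<forall>i<length c. g i = i"
    then have "map mset c' = map mset c" using mset len by (intro nth_equalityI) auto
    then show ?thesis ..
  next
    assume g: "\<forall>i<length c. g i = length c - Suc i"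
    have "map mset c' = rev (map mset c)"
    proof (rule nth_equalityI)
      fix i assume "i < length (map mset c')"
      then have i: "i < length c" "length c - Suc i < length c" using len by simp_all
      have "g (length c - Suc i) = i" using g i by simp
      then show "map mset c' ! i = rev (map mset c) ! i" using mset[OF i(2)] i len by (simp add: rev_nth)
    qed (simp add: len)
    then show ?thesis ..
  qed
qed

text \<open>Matching equal entries of corresponding letters permutes the branches at every spine
  vertex, and such a permutation commutes with \<open>code_par\<close>.\<close>

lemma code_iso_mset:
  assumes "map mset c = map mset c'"
  shows "\<exists>f. graph_iso f (code_verts c) (code_edges c) (code_verts c') (code_edges c')"
proof -
  have len: "length c = length c'" using assms by (metis length_map)
  have "\<exists>\<pi>. bij_betw \<pi> {..<length (c ! i)} {..<length (c' ! i)} \<and> (\<forall>j<length (c ! i). c ! i ! j = c' ! i ! \<pi> j)"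
    if "i < length c" for i
  proof -
    have "mset (c ! i) = mset (c' ! i)" using that len assms by (metis nth_map)
    then show ?thesis by (rule permutation_Ex_bij)
  qed
  then obtain \<pi> where bij: "\<And>i. i < length c \<Longrightarrow> bij_betw (\<pi> i) {..<length (c ! i)} {..<length (c' ! i)}"
    and nth: "\<And>i j. i < length c \<Longrightarrow> j < length (c ! i) \<Longrightarrow> c ! i ! j = c' ! i ! \<pi> i j" by metis
  let ?f = "\<lambda>(i, j, d). (i, if d = 0 then 0 else \<pi> i j, d :: nat)"
  let ?g = "\<lambda>(i, j, d). (i, if d = 0 then 0 else inv_into {..<length (c ! i)} (\<pi> i) j, d :: nat)"
  have pi_lt: "\<pi> i j < length (c' ! i)" if "i < length c" "j < length (c ! i)" for i j
    using bij_betwE[OF bij[OF that(1)]] that(2) by simp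
  have inv_lt: "inv_into {..<length (c ! i)} (\<pi> i) j < length (c ! i)" if "i < length c" "j < length (c' ! i)" for i j
    using bij_betwE[OF bij_betw_inv_into[OF bij[OF that(1)]]] that(2) by simp
  have pi_inv: "\<pi> i (inv_into {..<length (c ! i)} (\<pi> i) j) = j" if "i < length c" "j < length (c' ! i)" for i j
    using bij_betw_inv_into_right[OF bij[OF that(1)]] that(2) by simp
  have inv_pi: "inv_into {..<length (c ! i)} (\<pi> i) (\<pi> i j) = j" if "i < length c" "j < length (c ! i)" for i j
    using bij_betw_inv_into_left[OF bij[OF that(1)]] that(2) by simp
  have maps: "?f v \<in> code_verts c'" if "v \<in> code_verts c" for v
    using that
  proof (cases rule: code_verts_cases)
    case (branch i j d)
    then show ?thesis using pi_lt[of i j] nth[of i j] len by (simp add: code_verts_def)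
  qed (simp add: code_verts_def len)
  have bij_f: "bij_betw ?f (code_verts c) (code_verts c')"
  proof (rule bij_betw_byWitness[where f' = ?g])
    show "\<forall>v\<in>code_verts c. ?g (?f v) = v"
      by (intro ballI, elim code_verts_cases) (simp_all add: inv_pi)
    show "\<forall>v\<in>code_verts c'. ?f (?g v) = v"
      by (intro ballI, elim code_verts_cases) (simp_all add: pi_inv len)
    show "?f ` code_verts c \<subseteq> code_verts c'" using maps by blast
    have "?g v \<in> code_verts c" if "v \<in> code_verts c'" for v
      using that
    proof (cases rule: code_verts_cases)
      case (branch i j d)
      then have i: "i < length c" using len by simp
      show ?thesis using branch inv_lt[OF i branch(3)] nth[OF i inv_lt[OF i branch(3)]] pi_inv[OF i branch(3)] i
        by (simp add: code_verts_def)
    qed (simp add: code_verts_def len)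
    then show "?g ` code_verts c' \<subseteq> code_verts c" by blast
  qed
  have inj_pi: "\<pi> i j = \<pi> i j' \<longleftrightarrow> j = j'" if "i < length c" "j < length (c ! i)" "j' < length (c ! i)" for i j j'
    using inv_pi that by metis
  have "{u, v} \<in> code_edges c \<longleftrightarrow> {?f u, ?f v} \<in> code_edges c'"
    if uv: "u \<in> code_verts c" "v \<in> code_verts c" for u v
  proof -
    have par: "?f (code_par w) = code_par (?f w)" if "w \<in> code_verts c" for w
      using that by (cases rule: code_verts_cases) (auto split: if_splits)
    have inj: "?f u = ?f w \<longleftrightarrow> u = w" if "u \<in> code_verts c" "w \<in> code_verts c" for u w
      using bij_f that by (auto simp: bij_betw_def inj_on_def)
    have root: "?f w = (0, 0, 0) \<longleftrightarrow> w = (0, 0, 0)" if "w \<in> code_verts c" for w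
      using that by (cases rule: code_verts_cases) auto
    have "v = code_par u \<longleftrightarrow> ?f v = code_par (?f u)" if "u \<noteq> (0, 0, 0)" "u \<in> code_verts c" "v \<in> code_verts c" for u v
      using par[OF that(2)] inj[OF that(3) code_par_in[OF that(2,1)]] by simp
    then have e: "(u \<noteq> (0, 0, 0) \<and> v = code_par u) \<longleftrightarrow> (?f u \<noteq> (0, 0, 0) \<and> ?f v = code_par (?f u))"
      if "u \<in> code_verts c" "v \<in> code_verts c" for u v
      using root[OF that(1)] that by blast
    show ?thesis unfolding code_edge_iff e[OF uv] e[OF uv(2,1)] using uv maps by blast
  qed
  with bij_f show ?thesis unfolding graph_iso_def by blast
qed

lemma code_par_eq_branch: "(i, j, Suc d) = code_par u \<longleftrightarrow> u = (i, j, Suc (Suc d))"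
  by (cases u) (auto split: if_splits)

lemma code_edge_branch_iff:
  "{u, (i, j, Suc d)} \<in> code_edges c \<longleftrightarrow> u \<in> code_verts c \<and> (i, j, Suc d) \<in> code_verts c \<and>
     (u = (if d = 0 then (i, 0, 0) else (i, j, d)) \<or> u = (i, j, Suc (Suc d)))"
  unfolding code_edge_iff code_par_eq_branch by auto

text \<open>Reversal moves the root to the other end and so does not respect \<open>code_par\<close>
  along the spine. Adjacency is therefore compared through symmetric descriptions of spine edges and
  branch edges.\<close>

lemma code_iso_rev:
  "graph_iso (\<lambda>(i, j, d). (length c - Suc i, j, d)) (code_verts c) (code_edges c) (code_verts (rev c)) (code_edges (rev c))"
    (is "graph_iso ?f _ _ _ _")
proof -
  have maps: "?f v \<in> code_verts (rev c)" if "v \<in> code_verts c" for v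
    using that by (auto simp: code_verts_def rev_nth split: if_splits)
  have bij: "bij_betw ?f (code_verts c) (code_verts (rev c))"
  proof (rule bij_betw_byWitness[where f' = ?f])
    show "?f ` code_verts (rev c) \<subseteq> code_verts c"
      by (auto simp: code_verts_def rev_nth split: if_splits)
    show "?f ` code_verts c \<subseteq> code_verts (rev c)" using maps by blast
    show "\<forall>v\<in>code_verts c. ?f (?f v) = v" "\<forall>v\<in>code_verts (rev c). ?f (?f v) = v"
      by (auto simp: code_verts_def)
  qed
  have "{u, v} \<in> code_edges c \<longleftrightarrow> {?f u, ?f v} \<in> code_edges (rev c)"
    if uv: "u \<in> code_verts c" "v \<in> code_verts c" for u v
  proof -
    have br: "{u, z} \<in> code_edges c \<longleftrightarrow> {?f u, ?f z} \<in> code_edges (rev c)"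
      if u: "u \<in> code_verts c" and z: "z \<in> code_verts c" "z = (i, j, Suc d)" for u z i j d
    proof -
      obtain i' j' d' where u': "u = (i', j', d')" by (cases u)
      have "i < length c" "i' < length c" using u z(1) unfolding u' z(2) code_verts_def by simp_all
      then have "length c - Suc i' = length c - Suc i \<longleftrightarrow> i' = i" by linarith
      then show ?thesis using u z maps[OF u] maps[OF z(1)]
        unfolding z(2) u' prod.case code_edge_branch_iff by simp
    qed
    from uv(1) show ?thesis
    proof (cases rule: code_verts_cases)
      case u: (spine i)
      from uv(2) show ?thesis
      proof (cases rule: code_verts_cases)
        case v: (spine k)
        then show ?thesis using u by (auto simp: code_edge_spine_iff)
      next
        case (branch i' j' d')
        then show ?thesis using br[OF uv] by blast
      qed
    next
      case (branch i' j' d')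
      then show ?thesis using br[OF uv(2,1)]
        by (simp add: insert_commute)
    qed
  qed
  with bij show ?thesis unfolding graph_iso_def by blast
qed

section \<open>Counting isomorphism classes by codes\<close>

lemma graph_iso_tree:
  assumes f: "graph_iso f V E W F" and t: "is_tree V E" and fs: "fin_simple_graph W F"
  shows "is_tree W F"
proof -
  have im: "f ` V = W" and inj: "inj_on f V" using graph_iso_bij[OF f] by (simp_all add: bij_betw_def)
  have con: "graph_connected V E" and acyc: "\<nexists>c. graph_cycle V E c" using t by (simp_all add: is_tree_def)
  have "graph_connected W F"
    unfolding graph_connected_def
  proof (intro conjI ballI)
    show "W \<noteq> {}" using con im by (auto simp: graph_connected_def)
    fix a b assume "a \<in> W" "b \<in> W"
    then obtain u v where uv: "u \<in> V" "v \<in> V" "a = f u" "b = f v" using im by blast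
    then obtain p where p: "graph_path V E p" "hd p = u" "last p = v" using con by (auto simp: graph_connected_def)
    have "p \<noteq> []" using graph_path_nonempty[OF p(1)] .
    then show "\<exists>p. graph_path W F p \<and> hd p = a \<and> last p = b"
      using graph_iso_path[OF f p(1)] p uv by (intro exI[of _ "map f p"]) (simp add: hd_map last_map)
  qed
  moreover have False if c: "graph_cycle W F c" for c
  proof -
    let ?g = "inv_into V f"
    have p: "graph_path W F c" "3 \<le> length c" "{last c, hd c} \<in> F" using c by (simp_all add: graph_cycle_def)
    have ne: "c \<noteq> []" and cW: "set c \<subseteq> W" using p(1) by (simp_all add: graph_path_def)
    have "{?g (last c), ?g (hd c)} \<in> E"
      using graph_iso_edge[OF graph_iso_sym[OF f], of "last c" "hd c"] p(3) ne cW by (simp add: subset_iff)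
    then have "graph_cycle V E (map ?g c)"
      using graph_iso_path[OF graph_iso_sym[OF f] p(1)] p(2) ne by (simp add: graph_cycle_def hd_map last_map)
    then show False using acyc by blast
  qed
  ultimately show ?thesis using fs unfolding is_tree_def by blast
qed

lemma graph_iso_hdvs:
  assumes "graph_iso f V E W F" "fin_simple_graph V E" "fin_simple_graph W F"
  shows "hdvs W F = f ` hdvs V E"
proof -
  have im: "f ` V = W" using graph_iso_bij[OF assms(1)] by (simp add: bij_betw_def)
  show ?thesis unfolding hdvs_def im[symmetric] using graph_iso_degree[OF assms] by force
qed

lemma graph_iso_k_linear:
  assumes f: "graph_iso f V E W F" and k: "k_linear_tree k V E" and fs: "fin_simple_graph W F"
  shows "k_linear_tree k W F"
proof -
  have t: "is_tree V E" and card: "card (hdvs V E) = k" using k by (simp_all add: k_linear_tree_def linear_tree_def)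
  have fsV: "fin_simple_graph V E" using t by (simp add: is_tree_def)
  obtain p where p: "induced_graph_path V E p" "hdvs V E \<subseteq> set p"
    using k by (auto simp: k_linear_tree_def linear_tree_def)
  have g: "graph_path V E p" using p(1) by (simp add: induced_graph_path_def)
  have pV: "set p \<subseteq> V" using g by (simp add: graph_path_def)
  have "{f (p ! i), f (p ! j)} \<in> F \<longleftrightarrow> {p ! i, p ! j} \<in> E" if "i < length p" "j < length p" for i j
    using graph_iso_edge[OF f, of "p ! i" "p ! j"] that pV by (simp add: subset_iff)
  then have "induced_graph_path W F (map f p)"
    using p(1) graph_iso_path[OF f g] by (simp add: induced_graph_path_def)
  moreover have "hdvs W F \<subseteq> set (map f p)" using p(2) by (auto simp: graph_iso_hdvs[OF f fsV fs])
  moreover have "card (hdvs W F) = k"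
  proof -
    have "inj_on f (hdvs V E)" using graph_iso_bij[OF f]
      by (auto simp: bij_betw_def hdvs_def intro: inj_on_subset)
    then show ?thesis using card by (simp add: graph_iso_hdvs[OF f fsV fs] card_image)
  qed
  ultimately show ?thesis
    using graph_iso_tree[OF f t fs] unfolding k_linear_tree_def linear_tree_def by blast
qed

text \<open>Moves the tree of a code to the vertex set \<open>{..<n}\<close>.\<close>

lemma graph_iso_transport:
  assumes fs: "fin_simple_graph V E" and f: "bij_betw f V W"
  shows "graph_iso f V E W ((`) f ` E)" "fin_simple_graph W ((`) f ` E)"
proof -
  have inj: "inj_on f V" and im: "f ` V = W" using f by (simp_all add: bij_betw_def)
  have EV: "e \<subseteq> V" if "e \<in> E" for e using fs that by (simp add: fin_simple_graph_def)
  show "graph_iso f V E W ((`) f ` E)"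
    unfolding graph_iso_def
  proof (intro conjI f ballI)
    fix u v assume uv: "u \<in> V" "v \<in> V"
    have "{f u, f v} \<in> (`) f ` E \<longleftrightarrow> (\<exists>e\<in>E. f ` {u, v} = f ` e)" by (auto simp: image_iff)
    also have "\<dots> \<longleftrightarrow> (\<exists>e\<in>E. {u, v} = e)"
    proof (rule bex_cong[OF refl])
      fix e assume "e \<in> E"
      then show "f ` {u, v} = f ` e \<longleftrightarrow> {u, v} = e"
        using inj_on_image_eq_iff[OF inj, of "{u, v}" e] EV uv by simp
    qed
    finally show "{u, v} \<in> E \<longleftrightarrow> {f u, f v} \<in> (`) f ` E" by simp
  qed
  show "fin_simple_graph W ((`) f ` E)"
    unfolding fin_simple_graph_def
  proof (intro conjI ballI)
    show "finite W" using fs im by (auto simp: fin_simple_graph_def)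
    fix d assume "d \<in> (`) f ` E"
    then obtain e where e: "d = f ` e" "e \<in> E" by blast
    show "d \<subseteq> W" using e EV im by blast
    have "card d = card e" unfolding e(1) by (rule card_image) (rule inj_on_subset[OF inj EV[OF e(2)]])
    then show "card d = 2" using fs e(2) by (simp add: fin_simple_graph_def)
  qed
qed

text \<open>Sorting picks one order of the branches for every multiset of lengths.\<close>

definition code_list :: "nat multiset list \<Rightarrow> nat list list" where
  "code_list C = map sorted_list_of_multiset C"

text \<open>The good codes with \<open>n\<close> vertices and \<open>k\<close> HDVs, up to the order
  of the branches, as words of partitions.\<close>

definition spine_codes :: "nat \<Rightarrow> nat \<Rightarrow> nat multiset list set" where
  "spine_codes n k = {C. 2 \<le> length C \<and> (\<forall>M\<in>set C. 0 \<notin># M) \<and> 2 \<le> size (hd C) \<and> 2 \<le> size (last C) \<and>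
     (\<Sum>M\<leftarrow>C. Suc (sum_mset M)) = n \<and> length (filter (\<lambda>M. M \<noteq> {#}) C) = k}"

text \<open>Becomes an element of the quotient in \<open>num_k_linear\<close>. The condition on
  \<open>F\<close> rules out members of \<open>F\<close> that are not pairs, which
  \<open>graph_iso\<close> cannot see.\<close>

definition code_class :: "nat \<Rightarrow> nat multiset list \<Rightarrow> nat set set set" where
  "code_class n C = {F. fin_simple_graph {..<n} F \<and>
     (\<exists>f. graph_iso f (code_verts (code_list C)) (code_edges (code_list C)) {..<n} F)}"

lemma mset_code_list: "map mset (code_list C) = C"
  by (simp add: code_list_def comp_def)

lemma length_sorted_list_of_multiset: "length (sorted_list_of_multiset M) = size M"
  by (metis mset_sorted_list_of_multiset size_mset)

lemma code_list_good:
  assumes "C \<in> spine_codes n k" shows "good_code (code_list C)"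
proof -
  have "C \<noteq> []" using assms by (auto simp: spine_codes_def)
  then show ?thesis using assms
    by (auto simp: spine_codes_def good_code_def code_list_def pos_code_def hd_map last_map length_sorted_list_of_multiset intro: gr0I)
qed

lemma sum_list_sorted_list_of_multiset: "sum_list (sorted_list_of_multiset M) = sum_mset (M :: nat multiset)"
  by (metis mset_sorted_list_of_multiset sum_mset_sum_list)

lemma card_code_list: "card (code_verts (code_list C)) = (\<Sum>M\<leftarrow>C. Suc (sum_mset M))"
  by (simp add: card_code_verts code_list_def sum_list_sorted_list_of_multiset comp_def)

lemma sorted_list_of_multiset_eq_Nil_iff: "sorted_list_of_multiset M = [] \<longleftrightarrow> M = {#}"
  by (metis mset.simps(1) mset_sorted_list_of_multiset sorted_list_of_multiset_empty)

lemma filter_code_list: "length (filter (\<lambda>l. l \<noteq> []) (code_list C)) = length (filter (\<lambda>M. M \<noteq> {#}) C)"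
  by (simp add: code_list_def filter_map comp_def sorted_list_of_multiset_eq_Nil_iff)

lemma code_class_exists:
  assumes "(\<Sum>M\<leftarrow>C. Suc (sum_mset M)) = n"
  shows "\<exists>F. F \<in> code_class n C"
proof -
  have "card (code_verts (code_list C)) = n" using card_code_list assms by simp
  then obtain h where "bij_betw h (code_verts (code_list C)) {..<n}"
    using ex_bij_betw_finite_nat[OF finite_code_verts] by (metis atLeast0LessThan)
  from graph_iso_transport[OF code_simple this] show ?thesis unfolding code_class_def by blast
qed

lemma graph_isomorphic_iff: "graph_isomorphic V E W F \<longleftrightarrow> (\<exists>f. graph_iso f V E W F)"
  by (simp add: graph_isomorphic_def graph_iso_def)

lemma k_linear_edge_setsD: "F \<in> k_linear_edge_sets n k \<Longrightarrow> fin_simple_graph {..<n} F"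
  by (simp add: k_linear_edge_sets_def k_linear_tree_def linear_tree_def is_tree_def)

lemma code_class_k_linear:
  assumes C: "C \<in> spine_codes n k" and F: "F \<in> code_class n C"
  shows "F \<in> k_linear_edge_sets n k"
proof -
  have "k_linear_tree k (code_verts (code_list C)) (code_edges (code_list C))"
    using k_linear_tree_code[OF code_list_good[OF C]] C by (simp add: filter_code_list spine_codes_def)
  then show ?thesis using F graph_iso_k_linear by (auto simp: code_class_def k_linear_edge_sets_def)
qed

lemma code_class_eq_image:
  assumes sub: "code_class n C \<subseteq> k_linear_edge_sets n k" and F: "F \<in> code_class n C"
  shows "code_class n C = iso_rel n k `` {F}"
proof -
  obtain f where f: "graph_iso f (code_verts (code_list C)) (code_edges (code_list C)) {..<n} F"
    using F by (auto simp: code_class_def)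
  show ?thesis
  proof (intro equalityI subsetI)
    fix G assume G: "G \<in> code_class n C"
    then obtain g where "graph_iso g (code_verts (code_list C)) (code_edges (code_list C)) {..<n} G"
      by (auto simp: code_class_def)
    with graph_iso_trans[OF graph_iso_sym[OF f]] have "graph_isomorphic {..<n} F {..<n} G"
      unfolding graph_isomorphic_iff by blast
    then show "G \<in> iso_rel n k `` {F}" using sub F G by (auto simp: iso_rel_def)
  next
    fix G assume "G \<in> iso_rel n k `` {F}"
    then have G: "G \<in> k_linear_edge_sets n k" "\<exists>g. graph_iso g {..<n} F {..<n} G"
      by (auto simp: iso_rel_def graph_isomorphic_iff)
    then show "G \<in> code_class n C"
      using graph_iso_trans[OF f] k_linear_edge_setsD[OF G(1)] unfolding code_class_def by blast
  qed
qed

lemma code_class_in_quotient: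
  assumes C: "C \<in> spine_codes n k"
  shows "code_class n C \<in> k_linear_edge_sets n k // iso_rel n k"
proof -
  have sub: "code_class n C \<subseteq> k_linear_edge_sets n k" using code_class_k_linear[OF C] by blast
  obtain F where F: "F \<in> code_class n C" using code_class_exists[of C n] C by (auto simp: spine_codes_def)
  then show ?thesis using code_class_eq_image[OF sub F] sub by (auto intro: quotientI)
qed

lemma rev_in_spine_codes: "C \<in> spine_codes n k \<Longrightarrow> rev C \<in> spine_codes n k"
  by (auto simp: spine_codes_def hd_rev last_rev rev_map[symmetric] rev_filter[symmetric])

lemma code_class_cong:
  assumes "graph_iso g (code_verts (code_list C)) (code_edges (code_list C)) (code_verts (code_list D)) (code_edges (code_list D))"
  shows "code_class n C = code_class n D"
  unfolding code_class_def using graph_iso_trans[OF assms] graph_iso_trans[OF graph_iso_sym[OF assms]] by blast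

lemma code_class_rev: "code_class n (rev C) = code_class n C"
proof -
  have "code_list (rev C) = rev (code_list C)" by (simp add: code_list_def rev_map)
  then show ?thesis using code_class_cong[of _ C "rev C"] code_iso_rev[of "code_list C"] by metis
qed

lemma code_class_inj:
  assumes C: "C \<in> spine_codes n k" "D \<in> spine_codes n k" and eq: "code_class n C = code_class n D"
  shows "D = C \<or> D = rev C"
proof -
  obtain F where F: "F \<in> code_class n C" using code_class_exists[of C n] C by (auto simp: spine_codes_def)
  then have F': "F \<in> code_class n D" using eq by simp
  obtain f g where f: "graph_iso f (code_verts (code_list C)) (code_edges (code_list C)) {..<n} F"
    and g: "graph_iso g (code_verts (code_list D)) (code_edges (code_list D)) {..<n} F"
    using F F' by (auto simp: code_class_def)
  show ?thesis
    using code_iso_cases[OF code_list_good[OF C(1)] code_list_good[OF C(2)] graph_iso_trans[OF f graph_iso_sym[OF g]]]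
    by (simp only: mset_code_list)
qed

text \<open>The ends of \<open>q\<close> may have any degree, so that a path with a single vertex
  serves the trees with at most one HDV. The degrees are recorded in order to recognise good codes
  afterwards.\<close>

lemma code_class_of_path:
  assumes E: "E \<in> k_linear_edge_sets n k" and q: "graph_path {..<n} E q" "hdvs {..<n} E \<subseteq> set q"
  obtains C where "length C = length q" "\<forall>M\<in>set C. 0 \<notin># M" "(\<Sum>M\<leftarrow>C. Suc (sum_mset M)) = n"
    "E \<in> code_class n C"
    "\<And>i. i < length q \<Longrightarrow> vertex_degree E (q ! i) =
       (if 0 < i then 1 else 0) + (if Suc i < length q then 1 else 0) + size (C ! i)"
proof -
  have t: "is_tree {..<n} E" using E by (simp add: k_linear_edge_sets_def k_linear_tree_def linear_tree_def)
  have fs: "fin_simple_graph {..<n} E" using t by (simp add: is_tree_def)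
  have deg: "vertex_degree E v \<le> 2" if "v \<in> {..<n} - set q" for v
    using q(2) that by (force simp: hdvs_def)
  obtain c f where c: "length c = length q" "pos_code c" "graph_iso f (code_verts c) (code_edges c) {..<n} E"
    and fq: "\<And>i. i < length q \<Longrightarrow> f (i, 0, 0) = q ! i"
    using tree_code_exists[OF t q(1) deg] by blast
  let ?C = "map mset c"
  obtain g where g: "graph_iso g (code_verts (code_list ?C)) (code_edges (code_list ?C)) (code_verts c) (code_edges c)"
    using code_iso_mset[OF mset_code_list] by blast
  have inC: "E \<in> code_class n ?C" using graph_iso_trans[OF g c(3)] fs unfolding code_class_def by blast
  have "bij_betw f (code_verts c) {..<n}" using graph_iso_bij[OF c(3)] .
  then have "card (code_verts c) = n" using bij_betw_same_card by fastforce
  then have "(\<Sum>M\<leftarrow>?C. Suc (sum_mset M)) = n" by (simp add: card_code_verts comp_def sum_mset_sum_list)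
  moreover have "vertex_degree E (q ! i) =
       (if 0 < i then 1 else 0) + (if Suc i < length q then 1 else 0) + size (?C ! i)" if i: "i < length q" for i
  proof -
    have "(i, 0, 0) \<in> code_verts c" using i c(1) by (simp add: code_verts_def)
    from graph_iso_degree[OF c(3) code_simple fs this] show ?thesis
      using i c(1) degree_code_spine[OF c(2), of i] by (simp add: fq)
  qed
  moreover have "\<forall>M\<in>set ?C. 0 \<notin># M" using c(2) by (auto simp: pos_code_def)
  ultimately show thesis using that[of ?C] c(1) inC by simp
qed

text \<open>The given path is cut at its first and its last HDV. These have degree at least three
  and one neighbour on the new path, so their letters have two parts, and altogether the HDVs are
  the vertices with nonempty letters.\<close>

lemma code_class_surj:
  assumes k: "2 \<le> k" and E: "E \<in> k_linear_edge_sets n k"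
  shows "\<exists>C\<in>spine_codes n k. E \<in> code_class n C"
proof -
  have kl: "k_linear_tree k {..<n} E" using E by (simp add: k_linear_edge_sets_def)
  then obtain p where p: "graph_path {..<n} E p" "hdvs {..<n} E \<subseteq> set p" and card: "card (hdvs {..<n} E) = k"
    by (auto simp: k_linear_tree_def linear_tree_def induced_graph_path_def)
  let ?H = "hdvs {..<n} E"
  have ex: "\<exists>x\<in>set p. x \<in> ?H" using p(2) card k by (metis card.empty not_numeral_le_zero subset_iff subset_empty)
  obtain p1 x p2 where s1: "p = p1 @ x # p2" "x \<in> ?H" "\<forall>z\<in>set p1. z \<notin> ?H"
    using split_list_first_prop[of p "\<lambda>x. x \<in> ?H"] ex by blast
  have "\<exists>y\<in>set (x # p2). y \<in> ?H" using s1(2) by simp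
  then obtain r1 y r2 where s2: "x # p2 = r1 @ y # r2" "y \<in> ?H" "\<forall>z\<in>set r2. z \<notin> ?H"
    using split_list_last_prop[of "x # p2" "\<lambda>x. x \<in> ?H"] by blast
  define q where "q = r1 @ [y]"
  have "graph_path {..<n} E (x # p2)"
    using p(1) unfolding s1(1) using graph_path_append_iff[of p1 "x # p2"] by (cases "p1 = []") auto
  then have gq: "graph_path {..<n} E q"
    unfolding s2(1) q_def using graph_path_append_iff[of "r1 @ [y]" r2] by (cases "r2 = []") auto
  have "set p = set p1 \<union> set q \<union> set r2" using s1(1) s2(1) by (simp add: q_def) (metis Un_assoc Un_insert_right list.set(2) set_append)
  then have Hq: "?H \<subseteq> set q" using p(2) s1(3) s2(3) by blast
  have hdq: "hd q = x" using s2(1) by (cases r1) (auto simp: q_def)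
  have lastq: "last q = y" by (simp add: q_def)
  have "k \<le> card (set q)" using card_mono[OF _ Hq] card by simp
  then have len: "2 \<le> length q" using k card_length[of q] by linarith
  obtain C where C: "length C = length q" "\<forall>M\<in>set C. 0 \<notin># M" "(\<Sum>M\<leftarrow>C. Suc (sum_mset M)) = n"
    "E \<in> code_class n C"
    and deg: "\<And>i. i < length q \<Longrightarrow> vertex_degree E (q ! i) =
       (if 0 < i then 1 else 0) + (if Suc i < length q then 1 else 0) + size (C ! i)"
    using code_class_of_path[OF E gq Hq] by blast
  have ne: "q \<noteq> []" "C \<noteq> []" using len C(1) by auto
  have dH: "3 \<le> vertex_degree E z" if "z \<in> ?H" for z using that by (simp add: hdvs_def)
  have "2 \<le> size (hd C)"
    using dH[OF s1(2)] deg[of 0] len hdq ne by (simp add: hd_conv_nth)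
  moreover have "2 \<le> size (last C)"
  proof -
    have "3 \<le> vertex_degree E (q ! (length q - 1))" using dH[OF s2(2)] lastq ne by (simp add: last_conv_nth)
    moreover have "last C = C ! (length q - 1)" using ne C(1) by (simp add: last_conv_nth)
    moreover have "\<not> Suc (length q - 1) < length q" "length q - 1 < length q" "0 < length q - 1" using len by linarith+
    ultimately show ?thesis using deg[of "length q - 1"] by simp
  qed
  moreover have "length (filter (\<lambda>M. M \<noteq> {#}) C) = k"
  proof -
    have iff: "q ! i \<in> ?H \<longleftrightarrow> C ! i \<noteq> {#}" if i: "i < length q" for i
    proof -
      have "q ! i \<in> {..<n}" using gq i unfolding graph_path_def by (meson nth_mem subsetD)
      then have H: "q ! i \<in> ?H \<longleftrightarrow> 3 \<le> vertex_degree E (q ! i)" by (simp add: hdvs_def)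
      consider "i = 0" | "i = length q - 1" | "0 < i" "Suc i < length q" using i by linarith
      then show ?thesis
      proof cases
        case 1
        then have "q ! i \<in> ?H" "2 \<le> size (C ! i)" using hdq s1(2) \<open>2 \<le> size (hd C)\<close> ne by (simp_all add: hd_conv_nth)
        then show ?thesis by auto
      next
        case 2
        then have "q ! i \<in> ?H" "2 \<le> size (C ! i)" using lastq s2(2) \<open>2 \<le> size (last C)\<close> ne C(1) by (simp_all add: last_conv_nth)
        then show ?thesis by auto
      next
        case 3
        then have "3 \<le> vertex_degree E (q ! i) \<longleftrightarrow> C ! i \<noteq> {#}"
          using deg[OF i] by (simp add: Suc_le_eq nonempty_has_size)
        then show ?thesis using H by simp
      qed
    qed
    have dist: "distinct q" using gq by (simp add: graph_path_def)
    have "?H = (!) q ` {i. i < length q \<and> C ! i \<noteq> {#}}"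
    proof (intro equalityI subsetI)
      fix x assume x: "x \<in> ?H"
      then have "x \<in> set q" using Hq by blast
      then obtain i where "i < length q" "q ! i = x" by (meson in_set_conv_nth)
      then show "x \<in> (!) q ` {i. i < length q \<and> C ! i \<noteq> {#}}" using iff x by blast
    qed (use iff in blast)
    moreover have "inj_on ((!) q) {i. i < length q \<and> C ! i \<noteq> {#}}"
      using dist by (auto simp: inj_on_def nth_eq_iff_index_eq)
    ultimately have "k = card {i. i < length q \<and> C ! i \<noteq> {#}}" using card by (simp add: card_image)
    then show ?thesis using C(1) by (simp add: length_filter_conv_card)
  qed
  ultimately have "C \<in> spine_codes n k" using C len by (simp add: spine_codes_def)
  then show ?thesis using C(4) by blast
qed

lemma quotient_eq_code_classes:
  assumes "2 \<le> k"
  shows "k_linear_edge_sets n k // iso_rel n k = code_class n ` spine_codes n k"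
proof (intro equalityI subsetI)
  fix Q assume "Q \<in> k_linear_edge_sets n k // iso_rel n k"
  then obtain E where E: "E \<in> k_linear_edge_sets n k" "Q = iso_rel n k `` {E}" by (auto elim: quotientE)
  then obtain C where C: "C \<in> spine_codes n k" "E \<in> code_class n C" using code_class_surj[OF assms] by blast
  have "Q = code_class n C" using code_class_eq_image[OF _ C(2)] code_class_k_linear[OF C(1)] E(2) by blast
  then show "Q \<in> code_class n ` spine_codes n k" using C(1) by blast
qed (use code_class_in_quotient in blast)

text \<open>By \<open>code_class_inj\<close> the codes of one class are \<open>C\<close> and
  \<open>rev C\<close>, which are two codes unless \<open>C\<close> is a palindrome.\<close>

lemma num_k_linear_bounds:
  assumes k: "2 \<le> k" and fin: "finite (spine_codes n k)"
  shows "card (spine_codes n k) \<le> 2 * num_k_linear n k"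
    "2 * num_k_linear n k \<le> card (spine_codes n k) + card {C \<in> spine_codes n k. rev C = C}"
proof -
  let ?Q = "code_class n ` spine_codes n k"
  let ?fib = "\<lambda>Q. {C \<in> spine_codes n k. code_class n C = Q}"
  let ?pal = "\<lambda>Q. {C \<in> spine_codes n k. code_class n C = Q \<and> rev C = C}"
  have num: "num_k_linear n k = card ?Q" by (simp add: num_k_linear_def quotient_eq_code_classes[OF k])
  have finQ: "finite ?Q" using fin by simp
  have fib: "card (spine_codes n k) = (\<Sum>Q\<in>?Q. card (?fib Q))"
    using fin finQ by (subst card_UN_disjoint[symmetric]) (auto intro!: arg_cong[of _ _ card])
  have pal: "card {C \<in> spine_codes n k. rev C = C} = (\<Sum>Q\<in>?Q. card (?pal Q))"
    using fin finQ by (subst card_UN_disjoint[symmetric]) (auto intro!: arg_cong[of _ _ card])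
  have "card (?fib Q) \<le> 2 \<and> 2 \<le> card (?fib Q) + card (?pal Q)" if Q: "Q \<in> ?Q" for Q
  proof -
    obtain C where C: "C \<in> spine_codes n k" "Q = code_class n C" using Q by blast
    have fibC: "?fib Q = {C, rev C}"
      using C rev_in_spine_codes[OF C(1)] code_class_rev[of n C] code_class_inj[OF C(1)] by auto
    show ?thesis
    proof (cases "rev C = C")
      case True
      then have "?pal Q = {C}" using fibC C by auto
      then show ?thesis unfolding fibC True by simp
    next
      case False
      then show ?thesis unfolding fibC by (simp add: card_insert_if)
    qed
  qed
  then have le: "\<And>Q. Q \<in> ?Q \<Longrightarrow> card (?fib Q) \<le> 2" "\<And>Q. Q \<in> ?Q \<Longrightarrow> 2 \<le> card (?fib Q) + card (?pal Q)" by blast+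
  show "card (spine_codes n k) \<le> 2 * num_k_linear n k"
    unfolding fib num using sum_bounded_above[of ?Q "\<lambda>Q. card (?fib Q)" 2] le(1) by (simp add: mult.commute)
  show "2 * num_k_linear n k \<le> card (spine_codes n k) + card {C \<in> spine_codes n k. rev C = C}"
    unfolding fib num pal sum.distrib[symmetric]
    using sum_bounded_below[of ?Q 2 "\<lambda>Q. card (?fib Q) + card (?pal Q)"] le(2) by (simp add: mult.commute)
qed

text \<open>A tree with at most one HDV consists of paths hanging from a single vertex and is given
  by one partition of \<open>n - 1\<close>. Such trees have no spine code, but they are few.\<close>

lemma num_k_linear_small:
  assumes k: "k < 2" and n: "n \<ge> 1" and fin: "finite {M :: nat multiset. 0 \<notin># M \<and> sum_mset M = n - 1}"
  shows "num_k_linear n k \<le> card {M :: nat multiset. 0 \<notin># M \<and> sum_mset M = n - 1}"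
proof -
  let ?P = "{M :: nat multiset. 0 \<notin># M \<and> sum_mset M = n - 1}"
  let ?cl = "\<lambda>M. code_class n [M] \<inter> k_linear_edge_sets n k"
  have "k_linear_edge_sets n k // iso_rel n k \<subseteq> ?cl ` ?P"
  proof
    fix Q assume "Q \<in> k_linear_edge_sets n k // iso_rel n k"
    then obtain E where E: "E \<in> k_linear_edge_sets n k" and Q: "Q = iso_rel n k `` {E}" by (auto elim: quotientE)
    have card: "card (hdvs {..<n} E) = k" using E by (simp add: k_linear_edge_sets_def k_linear_tree_def)
    have finH: "finite (hdvs {..<n} E)" by (simp add: hdvs_def)
    obtain v where v: "v < n" "hdvs {..<n} E \<subseteq> {v}"
    proof (cases "k = 0")
      case True
      then have "hdvs {..<n} E = {}" using card finH by simp
      \<comment> \<open>Without HDVs any vertex can be the centre; \<open>0\<close> is a vertex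
        because \<open>n \<ge> 1\<close>.\<close>
      then show ?thesis using that[of 0] n by simp
    next
      case False
      then have "card (hdvs {..<n} E) = 1" using k card by simp
      then obtain v where "hdvs {..<n} E = {v}" by (auto simp: card_1_singleton_iff)
      moreover from this have "v < n" by (auto simp: hdvs_def)
      ultimately show ?thesis using that[of v] by simp
    qed
    obtain C where C: "length C = length [v]" "\<forall>M\<in>set C. 0 \<notin># M" "(\<Sum>M\<leftarrow>C. Suc (sum_mset M)) = n" "E \<in> code_class n C"
      using code_class_of_path[OF E, of "[v]"] v by auto
    then obtain M where M: "C = [M]" by (auto simp: length_Suc_conv)
    have "M \<in> ?P" using C M by auto
    moreover have "Q = ?cl M"
    proof (intro equalityI subsetI)
      obtain f where f: "graph_iso f (code_verts (code_list [M])) (code_edges (code_list [M])) {..<n} E"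
        using C(4) M by (auto simp: code_class_def)
      {
        fix G assume "G \<in> Q"
        then have G: "G \<in> k_linear_edge_sets n k" "\<exists>g. graph_iso g {..<n} E {..<n} G"
          by (auto simp: Q iso_rel_def graph_isomorphic_iff)
        then show "G \<in> ?cl M"
          using graph_iso_trans[OF f] k_linear_edge_setsD[OF G(1)] unfolding code_class_def by blast
      next
        fix G assume G: "G \<in> ?cl M"
        then obtain g where "graph_iso g (code_verts (code_list [M])) (code_edges (code_list [M])) {..<n} G"
          by (auto simp: code_class_def)
        with graph_iso_trans[OF graph_iso_sym[OF f]] have "graph_isomorphic {..<n} E {..<n} G"
          unfolding graph_isomorphic_iff by blast
        then show "G \<in> Q" using G E by (auto simp: Q iso_rel_def)
      }
    qed
    ultimately show "Q \<in> ?cl ` ?P" by blast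
  qed
  then have "card (k_linear_edge_sets n k // iso_rel n k) \<le> card (?cl ` ?P)"
    using fin by (intro card_mono) auto
  also have "\<dots> \<le> card ?P" using fin by (rule card_image_le)
  finally show ?thesis by (simp add: num_k_linear_def)
qed

section \<open>The partition generating function\<close>

definition partitions :: "nat \<Rightarrow> nat multiset set" where
  "partitions n = {M. 0 \<notin># M \<and> sum_mset M = n}"

definition pnum :: "nat \<Rightarrow> nat" where
  "pnum n = card (partitions n)"

definition bounded_partitions :: "nat \<Rightarrow> nat \<Rightarrow> nat multiset set" where
  "bounded_partitions N n = {M \<in> partitions n. \<forall>x\<in>#M. x \<le> N}"

lemma size_le_sum_mset: "0 \<notin># M \<Longrightarrow> size M \<le> sum_mset (M :: nat multiset)"
proof (induction M)
  case (add x M)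
  then have "0 < x" "size M \<le> sum_mset M" by auto
  then show ?case by simp
qed simp

lemma member_le_sum_mset: "x \<in># M \<Longrightarrow> x \<le> sum_mset (M :: nat multiset)"
proof -
  assume "x \<in># M"
  then obtain A where "M = add_mset x A" by (rule mset_add)
  then show ?thesis by simp
qed

lemma finite_partitions: "finite (partitions n)"
proof -
  have "partitions n \<subseteq> mset ` {xs. set xs \<subseteq> {..n} \<and> length xs \<le> n}"
  proof
    fix M assume M: "M \<in> partitions n"
    obtain xs where xs: "mset xs = M" using ex_mset by blast
    have M': "0 \<notin># M" "sum_mset M = n" using M by (simp_all add: partitions_def)
    have "set xs \<subseteq> {..n}"
    proof
      fix x assume "x \<in> set xs"
      then have "x \<in># M" using xs by auto
      then show "x \<in> {..n}" using member_le_sum_mset M'(2) by blast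
    qed
    moreover have "length xs \<le> n" using size_le_sum_mset[OF M'(1)] M'(2) xs by (metis size_mset)
    ultimately show "M \<in> mset ` {xs. set xs \<subseteq> {..n} \<and> length xs \<le> n}" using xs by blast
  qed
  then show ?thesis by (rule finite_subset) (simp add: finite_lists_length_le)
qed

lemma partitions_0: "partitions 0 = {{#}}"
proof -
  have "M = {#}" if "M \<in> partitions 0" for M
    using size_le_sum_mset[of M] that unfolding partitions_def by (metis (mono_tags) le_zero_eq mem_Collect_eq size_eq_0_iff_empty)
  then show ?thesis by (auto simp: partitions_def)
qed

lemma pnum_0: "pnum 0 = 1"
  by (simp add: pnum_def partitions_0)

lemma pnum_pos: "0 < n \<Longrightarrow> 0 < pnum n"
  using finite_partitions[of n] unfolding pnum_def
  by (subst card_gt_0_iff) (auto simp: partitions_def intro!: exI[of _ "{#n#}"])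

lemma bounded_partitions_0: "bounded_partitions 0 n = (if n = 0 then {{#}} else {})"
proof -
  have "M = {#}" if "M \<in> bounded_partitions 0 n" for M
  proof (rule ccontr)
    assume "M \<noteq> {#}"
    then obtain x where "x \<in># M" by blast
    moreover have "x = 0" using calculation that by (simp add: bounded_partitions_def)
    ultimately show False using that by (simp add: bounded_partitions_def partitions_def)
  qed
  then have "bounded_partitions 0 n \<subseteq> {{#}}" by blast
  moreover have "{#} \<in> bounded_partitions 0 n \<longleftrightarrow> n = 0" by (auto simp: bounded_partitions_def partitions_def)
  ultimately show ?thesis by (cases "n = 0") auto
qed

text \<open>A partition into parts at most \<open>N + 1\<close> either avoids the part
  \<open>N + 1\<close> or arises by adding one copy of it.\<close>

lemma card_bounded_partitions_Suc:
  "card (bounded_partitions (Suc N) n) = card (bounded_partitions N n) +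
     (if Suc N \<le> n then card (bounded_partitions (Suc N) (n - Suc N)) else 0)"
proof -
  let ?A = "{M \<in> bounded_partitions (Suc N) n. Suc N \<in># M}"
  have fin: "finite (bounded_partitions k m)" for k m
    unfolding bounded_partitions_def using finite_partitions by simp
  have split: "bounded_partitions (Suc N) n = bounded_partitions N n \<union> ?A"
    by (auto simp: bounded_partitions_def le_Suc_eq)
  have disj: "bounded_partitions N n \<inter> ?A = {}" by (auto simp: bounded_partitions_def)
  have "?A = (if Suc N \<le> n then add_mset (Suc N) ` bounded_partitions (Suc N) (n - Suc N) else {})"
  proof (cases "Suc N \<le> n")
    case True
    have "M \<in> add_mset (Suc N) ` bounded_partitions (Suc N) (n - Suc N)" if "M \<in> ?A" for M
    proof -
      have "Suc N \<in># M" using that by simp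
      then obtain M' where M': "M = add_mset (Suc N) M'" by (metis multi_member_split)
      then have "M' \<in> bounded_partitions (Suc N) (n - Suc N)"
        using that by (auto simp: bounded_partitions_def partitions_def)
      then show ?thesis using M' by blast
    qed
    then show ?thesis using True by (auto simp: bounded_partitions_def partitions_def)
  next
    case False
    then show ?thesis using member_le_sum_mset by (fastforce simp: bounded_partitions_def partitions_def)
  qed
  moreover have "inj_on (add_mset (Suc N)) X" for X :: "nat multiset set" by (simp add: inj_on_def)
  ultimately have "card ?A = (if Suc N \<le> n then card (bounded_partitions (Suc N) (n - Suc N)) else 0)"
    by (simp add: card_image)
  moreover have "finite ?A" using fin[of "Suc N" n] by simp
  ultimately have "card (bounded_partitions N n \<union> ?A) = card (bounded_partitions N n) +
     (if Suc N \<le> n then card (bounded_partitions (Suc N) (n - Suc N)) else 0)"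
    using card_Un_disjoint[OF fin[of N n] _ disj] by presburger
  then show ?thesis using arg_cong[OF split, of card] by presburger
qed

lemma bounded_partitions_eq: "n \<le> N \<Longrightarrow> bounded_partitions N n = partitions n"
  using member_le_sum_mset by (fastforce simp: bounded_partitions_def partitions_def)

lemma card_bounded_partitions_le: "card (bounded_partitions N n) \<le> pnum n"
  unfolding pnum_def bounded_partitions_def by (intro card_mono finite_partitions) auto

lemma pow_Suc_less_one: "0 \<le> x \<Longrightarrow> x < 1 \<Longrightarrow> x ^ Suc i < (1 :: real)"
  using power_decreasing[of 1 "Suc i" x] by simp

text \<open>The recursion of \<open>card_bounded_partitions_Suc\<close> reads
  \<open>G = F + x^(N+1) G\<close> for the generating functions, and this is solved for
  \<open>G\<close>.\<close>

lemma bounded_partitions_gf: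
  fixes x :: real
  assumes x: "0 \<le> x" "x < 1"
  shows "(\<lambda>n. real (card (bounded_partitions N n)) * x ^ n) sums (\<Prod>i<N. 1 / (1 - x ^ Suc i))"
proof (induction N)
  case 0
  have "(\<lambda>n. real (card (bounded_partitions 0 n)) * x ^ n) = (\<lambda>n. if n = 0 then 1 else 0)"
    by (auto simp: bounded_partitions_0)
  then show ?case using sums_single[of 0 "\<lambda>_. 1 :: real"] by simp
next
  case (Suc N)
  let ?f = "\<lambda>n. real (card (bounded_partitions N n)) * x ^ n"
  let ?g = "\<lambda>n. real (card (bounded_partitions (Suc N) n)) * x ^ n"
  let ?P = "\<Prod>i<N. 1 / (1 - x ^ Suc i)"
  have x1: "x ^ Suc N < 1" using x by (rule pow_Suc_less_one)
  have rec: "?g n = ?f n + (if Suc N \<le> n then x ^ Suc N * ?g (n - Suc N) else 0)" for n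
  proof (cases "Suc N \<le> n")
    case True
    then have "x ^ n = x ^ Suc N * x ^ (n - Suc N)" by (metis le_add_diff_inverse power_add)
    then show ?thesis using True by (subst card_bounded_partitions_Suc) (simp add: algebra_simps)
  qed (simp add: card_bounded_partitions_Suc)
  \<comment> \<open>The shifted partial sum is at most the whole one, so the recursion bounds the
    partial sums before convergence is known.\<close>
  have bound: "sum ?g {..<m} \<le> ?P / (1 - x ^ Suc N)" for m
  proof -
    have "(\<Sum>n<m. if Suc N \<le> n then x ^ Suc N * ?g (n - Suc N) else 0) \<le> x ^ Suc N * sum ?g {..<m}"
    proof -
      have "(\<Sum>n<m. if Suc N \<le> n then x ^ Suc N * ?g (n - Suc N) else 0) =
          (\<Sum>n\<in>{Suc N..<m}. x ^ Suc N * ?g (n - Suc N))"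
        by (rule sum.mono_neutral_cong_right) auto
      also have "\<dots> = (\<Sum>n<m - Suc N. x ^ Suc N * ?g n)"
        by (rule sum.reindex_bij_witness[of _ "\<lambda>n. n + Suc N" "\<lambda>n. n - Suc N"]) auto
      also have "\<dots> \<le> (\<Sum>n<m. x ^ Suc N * ?g n)"
        using x by (intro sum_mono2) auto
      finally show ?thesis by (simp add: sum_distrib_left)
    qed
    moreover have "sum ?f {..<m} \<le> ?P"
      using Suc x by (intro sum_le_suminf[THEN order_trans, OF sums_summable[OF Suc]]) (auto simp: sums_unique[symmetric])
    moreover have "sum ?g {..<m} = sum ?f {..<m} + (\<Sum>n<m. if Suc N \<le> n then x ^ Suc N * ?g (n - Suc N) else 0)"
      unfolding sum.distrib[symmetric] by (intro sum.cong refl rec)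
    ultimately have "sum ?g {..<m} * (1 - x ^ Suc N) \<le> ?P" by (simp add: algebra_simps)
    then show ?thesis using x1 by (simp add: pos_le_divide_eq)
  qed
  have sm: "summable ?g"
  proof (rule bounded_imp_summable[where B = "?P / (1 - x ^ Suc N)"])
    show "sum ?g {..n} \<le> ?P / (1 - x ^ Suc N)" for n
      using bound[of "Suc n"] by (simp only: lessThan_Suc_atMost)
  qed (use x in simp)
  have "(\<lambda>n. x ^ Suc N * ?g n) sums (x ^ Suc N * suminf ?g)"
    by (intro sums_mult summable_sums sm)
  then have "(\<lambda>n. if Suc N \<le> n + Suc N then x ^ Suc N * ?g (n + Suc N - Suc N) else 0) sums (x ^ Suc N * suminf ?g)"
    by simp
  then have "(\<lambda>n. if Suc N \<le> n then x ^ Suc N * ?g (n - Suc N) else 0) sums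
      (x ^ Suc N * suminf ?g + (\<Sum>n<Suc N. if Suc N \<le> n then x ^ Suc N * ?g (n - Suc N) else 0))"
    
    by (rule sums_iff_shift[of "\<lambda>n. if Suc N \<le> n then x ^ Suc N * ?g (n - Suc N) else 0" "Suc N", THEN iffD1])
  then have "(\<lambda>n. if Suc N \<le> n then x ^ Suc N * ?g (n - Suc N) else 0) sums (x ^ Suc N * suminf ?g)" by simp
  from sums_add[OF Suc this] have "?g sums (?P + x ^ Suc N * suminf ?g)" by (simp only: rec[symmetric])
  then have "suminf ?g = ?P + x ^ Suc N * suminf ?g" by (rule sums_unique[symmetric])
  then have "suminf ?g * (1 - x ^ Suc N) = ?P" by (simp only: right_diff_distrib) (simp add: algebra_simps)
  then have "suminf ?g = ?P * (1 / (1 - x ^ Suc N))" using x1 by (simp add: field_simps)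
  then have "suminf ?g = (\<Prod>i<Suc N. 1 / (1 - x ^ Suc i))" by simp
  then show ?case using summable_sums[OF sm] by simp
qed

text \<open>The factors exceed \<open>1\<close> by at most \<open>x^(i+1) / (1 - x)\<close>, so the
  product converges absolutely and the infinite product in \<open>partition_gf\<close> has its
  intended value.\<close>

lemma partition_product_LIMSEQ:
  fixes x :: real
  assumes x: "0 \<le> x" "x < 1"
  shows "(\<lambda>N. \<Prod>i<N. 1 / (1 - x ^ Suc i)) \<longlonglongrightarrow> partition_gf x"
proof -
  have lt: "x ^ Suc i < 1" for i using x by (rule pow_Suc_less_one)
  have "summable (\<lambda>i. norm (1 / (1 - x ^ Suc i) - 1))"
  proof (rule summable_comparison_test')
    show "summable (\<lambda>i. (1 / (1 - x)) * x ^ Suc i)" using x by (intro summable_mult) (simp add: summable_Suc_iff)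
    fix i
    have "x ^ Suc i \<le> x ^ 1" using x by (intro power_decreasing) auto
    then have le: "1 - x \<le> 1 - x ^ Suc i" by simp
    have "1 / (1 - x ^ Suc i) - 1 = x ^ Suc i / (1 - x ^ Suc i)" using lt[of i] by (simp add: field_simps)
    also have "\<dots> \<le> x ^ Suc i / (1 - x)" using le x lt[of i] by (intro divide_left_mono) auto
    finally have "1 / (1 - x ^ Suc i) - 1 \<le> (1 / (1 - x)) * x ^ Suc i" by (simp add: mult.commute)
    moreover have "1 / (1 - x ^ Suc i) - 1 \<ge> 0" using lt[of i] x by (simp add: field_simps)
    ultimately show "norm (norm (1 / (1 - x ^ Suc i) - 1)) \<le> (1 / (1 - x)) * x ^ Suc i" by simp
  qed
  then have "abs_convergent_prod (\<lambda>i. 1 / (1 - x ^ Suc i))"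
    by (simp add: abs_convergent_prod_conv_summable)
  then have "convergent_prod (\<lambda>i. 1 / (1 - x ^ Suc i))" by (rule abs_convergent_prod_imp_convergent_prod)
  then have "(\<lambda>n. \<Prod>i\<le>n. 1 / (1 - x ^ Suc i)) \<longlonglongrightarrow> partition_gf x"
    unfolding partition_gf_def by (rule convergent_prod_LIMSEQ)
  then show ?thesis unfolding lessThan_Suc_atMost[symmetric] by (rule LIMSEQ_imp_Suc)
qed

text \<open>The coefficients of the \<open>N\<close>-th partial product equal \<open>pnum n\<close>
  for \<open>n \<le> N\<close> and never exceed it, which squeezes the series between the partial
  products and their limit.\<close>

lemma partition_gf_sums:
  fixes x :: real
  assumes x: "0 \<le> x" "x < 1"
  shows "(\<lambda>n. real (pnum n) * x ^ n) sums partition_gf x"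
proof -
  let ?f = "\<lambda>n. real (pnum n) * x ^ n"
  let ?P = "\<lambda>N. \<Prod>i<N. 1 / (1 - x ^ Suc i)"
  note bg = bounded_partitions_gf[OF x]
  have lt: "x ^ Suc i < 1" for i using x by (rule pow_Suc_less_one)
  have "incseq ?P"
  proof (rule incseq_SucI)
    fix N
    have "?P N * 1 \<le> ?P N * (1 / (1 - x ^ Suc N))"
      using lt x by (intro mult_left_mono prod_nonneg) (auto simp: less_imp_le field_simps)
    then show "?P N \<le> ?P (Suc N)" by simp
  qed
  then have P_le: "?P N \<le> partition_gf x" for N
    using partition_product_LIMSEQ[OF x] by (rule incseq_le)
  have part: "sum ?f {..<N} \<le> ?P N" for N
  proof -
    have "sum ?f {..<N} = (\<Sum>n<N. real (card (bounded_partitions N n)) * x ^ n)"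
      by (rule sum.cong) (auto simp: bounded_partitions_eq pnum_def)
    also have "\<dots> \<le> ?P N"
      using x sum_le_suminf[OF sums_summable[OF bg[of N]], of "{..<N}"] sums_unique[OF bg[of N]] by simp
    finally show ?thesis .
  qed
  have sm: "summable ?f"
  proof (rule bounded_imp_summable[where B = "partition_gf x"])
    show "sum ?f {..n} \<le> partition_gf x" for n
      using order_trans[OF part[of "Suc n"] P_le] by (simp only: lessThan_Suc_atMost)
  qed (use x in simp)
  have "?P N \<le> suminf ?f" for N
    unfolding sums_unique[OF bg[of N]]
    by (rule suminf_le) (use x sm sums_summable[OF bg] card_bounded_partitions_le in \<open>auto intro!: mult_right_mono\<close>)
  then have "partition_gf x \<le> suminf ?f"
    using partition_product_LIMSEQ[OF x] by (intro LIMSEQ_le_const2) auto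
  moreover have "suminf ?f \<le> partition_gf x"
    using part P_le order_trans by (intro suminf_le_const[OF sm]) blast
  ultimately show ?thesis using summable_sums[OF sm] by simp
qed

lemma pnum_pow_le: 
  fixes x :: real
  assumes "0 \<le> x" "x < 1"
  shows "real (pnum n) * x ^ n \<le> partition_gf x"
  using sum_le_suminf[OF sums_summable[OF partition_gf_sums[OF assms]], of "{n}"] sums_unique[OF partition_gf_sums[OF assms]] assms
  by simp

section \<open>The extension of \<open>partition_gf\<close> to the complex unit disc\<close>

definition pfps :: "complex fps" where
  "pfps = Abs_fps (\<lambda>n. of_nat (pnum n))"

definition Pc :: "complex \<Rightarrow> complex" where
  "Pc = eval_fps pfps"

lemma pfps_conv_radius: "fps_conv_radius pfps \<ge> 1"
  unfolding fps_conv_radius_def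
proof (rule conv_radius_geI_ex')
  fix r :: real assume r: "0 < r" "ereal r < 1"
  then have "summable (\<lambda>n. real (pnum n) * r ^ n)" using sums_summable[OF partition_gf_sums[of r]] by simp
  then have "summable (\<lambda>n. complex_of_real (real (pnum n) * r ^ n))" by (rule summable_of_real)
  then show "summable (\<lambda>n. fps_nth pfps n * of_real r ^ n)" by (simp add: pfps_def)
qed

lemma less_pfps_conv_radius: "r < 1 \<Longrightarrow> ereal r < fps_conv_radius pfps"
  by (rule less_le_trans[OF _ pfps_conv_radius]) (simp add: one_ereal_def)

lemma Pc_holomorphic [holomorphic_intros]: "Pc holomorphic_on ball 0 1"
  unfolding Pc_def
  by (intro holomorphic_on_eval_fps) (auto simp: in_eball_iff intro: less_pfps_conv_radius)

lemma Pc_expansion: "Pc has_fps_expansion pfps"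
  unfolding Pc_def has_fps_expansion_def using less_pfps_conv_radius[of 0]
  by (simp add: zero_ereal_def)

lemma Pc_sums:
  assumes "norm z < 1" shows "(\<lambda>n. of_nat (pnum n) * z ^ n) sums Pc z"
  using summable_sums[OF summable_fps[OF less_pfps_conv_radius[OF assms]]]
  by (simp add: Pc_def eval_fps_def pfps_def)

lemma Pc_of_real:
  assumes "0 \<le> x" "x < 1" shows "Pc (of_real x) = of_real (partition_gf x)"
proof -
  have "(\<lambda>n. of_real (real (pnum n) * x ^ n) :: complex) sums of_real (partition_gf x)"
    by (rule sums_of_real[OF partition_gf_sums[OF assms]])
  moreover have "(\<lambda>n. of_nat (pnum n) * (of_real x :: complex) ^ n) sums Pc (of_real x)"
    using assms by (intro Pc_sums) simp
  ultimately show ?thesis using sums_unique2 by fastforce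
qed

section \<open>Counting codes\<close>

definition code_size :: "nat multiset list \<Rightarrow> nat" where
  "code_size C = (\<Sum>M\<leftarrow>C. Suc (sum_mset M))"

definition code_hdvs :: "nat multiset list \<Rightarrow> nat" where
  "code_hdvs C = length (filter (\<lambda>M. M \<noteq> {#}) C)"

text \<open>Words without a condition on their ends; the inner part of a spine ranges over
  these.\<close>

definition pos_codes :: "nat \<Rightarrow> nat multiset list set" where
  "pos_codes n = {C. (\<forall>M\<in>set C. 0 \<notin># M) \<and> code_size C = n}"

text \<open>The letters that account for \<open>j\<close> vertices, one on the spine and
  \<open>j - 1\<close> in the hanging paths.\<close>

definition pieces :: "nat \<Rightarrow> nat multiset set" where
  "pieces j = {M. 0 \<notin># M \<and> Suc (sum_mset M) = j}"

lemma code_size_simps [simp]: "code_size [] = 0" "code_size (M # C) = Suc (sum_mset M) + code_size C"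
  "code_size (C @ D) = code_size C + code_size D" "code_size (rev C) = code_size C"
  by (simp_all add: code_size_def rev_map[symmetric])

lemma code_hdvs_simps [simp]: "code_hdvs [] = 0" "code_hdvs (M # C) = (if M = {#} then 0 else 1) + code_hdvs C"
  "code_hdvs (C @ D) = code_hdvs C + code_hdvs D"
  by (simp_all add: code_hdvs_def)

lemma pieces_simps: "pieces 0 = {}" "pieces (Suc m) = partitions m"
  by (auto simp: pieces_def partitions_def)

lemma finite_pieces: "finite (pieces j)"
  by (cases j) (simp_all add: pieces_simps finite_partitions)

lemma length_le_code_size: "length C \<le> code_size C"
  by (induction C) auto

lemma code_hdvs_le: "code_hdvs C \<le> code_size C"
  by (induction C) auto

lemma finite_pos_codes: "finite (pos_codes n)"
proof -
  have mem: "M \<in> set C \<Longrightarrow> sum_mset M < code_size C" for M C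
    by (induction C) auto
  have "pos_codes n \<subseteq> {C. set C \<subseteq> (\<Union>m\<le>n. partitions m) \<and> length C \<le> n}"
    using mem length_le_code_size by (fastforce simp: pos_codes_def partitions_def)
  then show ?thesis by (rule finite_subset) (simp add: finite_lists_length_le finite_partitions)
qed

text \<open>Apart from the empty word, a word is a first letter of size \<open>j\<close> followed by
  a word of size \<open>n - j\<close>.\<close>

lemma pos_codes_sum:
  fixes f :: "nat multiset list \<Rightarrow> 'a :: comm_monoid_add"
  shows "(\<Sum>C\<in>pos_codes n. f C) = (if n = 0 then f [] else 0) +
     (\<Sum>j\<le>n. \<Sum>M\<in>pieces j. \<Sum>C\<in>pos_codes (n - j). f (M # C))"
proof -
  let ?S = "SIGMA j:{..n}. SIGMA M:pieces j. pos_codes (n - j)"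
  have "(\<Sum>j\<le>n. \<Sum>M\<in>pieces j. \<Sum>C\<in>pos_codes (n - j). f (M # C)) = (\<Sum>(j, M, C)\<in>?S. f (M # C))"
    by (simp add: sum.Sigma finite_pieces finite_pos_codes finite_SigmaI)
  also have "\<dots> = (\<Sum>C\<in>pos_codes n - {[]}. f C)"
    by (rule sum.reindex_bij_witness[of _ "\<lambda>C. (Suc (sum_mset (hd C)), hd C, tl C)" "\<lambda>(j, M, C). M # C"])
      (auto simp: pieces_def pos_codes_def neq_Nil_conv)
  also have "(if n = 0 then f [] else 0) + \<dots> = (\<Sum>C\<in>pos_codes n. f C)"
  proof (cases "n = 0")
    case True
    then have "[] \<in> pos_codes n" by (simp add: pos_codes_def)
    then show ?thesis using True finite_pos_codes[of n] by (simp add: sum.remove)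
  next
    case False
    then have "[] \<notin> pos_codes n" by (simp add: pos_codes_def)
    then show ?thesis using False by simp
  qed
  finally show ?thesis by simp
qed

text \<open>The coefficient of \<open>z^n\<close> in \<open>1 / (1 - z (1 + u (P(z) - 1)))\<close>,
  see \<open>code_poly_fps\<close>.\<close>

definition code_poly :: "'a :: comm_semiring_1 \<Rightarrow> nat \<Rightarrow> 'a" where
  "code_poly u n = (\<Sum>C\<in>pos_codes n. u ^ code_hdvs C)"

definition piece_poly :: "'a :: comm_semiring_1 \<Rightarrow> nat \<Rightarrow> 'a" where
  "piece_poly u j = (\<Sum>M\<in>pieces j. if M = {#} then 1 else u)"

lemma code_poly_rec:
  "code_poly u n = (if n = 0 then 1 else 0) + (\<Sum>j\<le>n. piece_poly u j * code_poly u (n - j))"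
proof -
  have "code_poly u n = (if n = 0 then 1 else 0) +
      (\<Sum>j\<le>n. \<Sum>M\<in>pieces j. \<Sum>C\<in>pos_codes (n - j). u ^ code_hdvs (M # C))"
    unfolding code_poly_def by (subst pos_codes_sum) simp
  also have "(\<Sum>j\<le>n. \<Sum>M\<in>pieces j. \<Sum>C\<in>pos_codes (n - j). u ^ code_hdvs (M # C)) =
      (\<Sum>j\<le>n. piece_poly u j * code_poly u (n - j))"
    unfolding piece_poly_def code_poly_def sum_product
    by (intro sum.cong refl) (auto simp: power_add)
  finally show ?thesis .
qed

lemma piece_poly_Suc: "piece_poly u (Suc m) = (if m = 0 then 1 else u * of_nat (pnum m))"
proof (cases "m = 0")
  case False
  then have "M \<noteq> {#}" if "M \<in> partitions m" for M using that by (auto simp: partitions_def)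
  then have "piece_poly u (Suc m) = (\<Sum>M\<in>partitions m. u)"
    unfolding piece_poly_def pieces_simps by (intro sum.cong) auto
  then show ?thesis using False by (simp add: pnum_def mult.commute)
qed (simp add: piece_poly_def pieces_simps partitions_0)

lemma piece_poly_0: "piece_poly u 0 = 0"
  by (simp add: piece_poly_def pieces_simps)

definition end_pieces :: "nat \<Rightarrow> nat multiset set" where
  "end_pieces j = {M \<in> pieces j. 2 \<le> size M}"

text \<open>Exactly one partition of each \<open>m\<close> has fewer than two parts,
  \<open>{#}\<close> or \<open>{#m#}\<close>. This is the origin of the term
  \<open>1 / (1 - z)\<close> in \<open>end_gf\<close>.\<close>

lemma card_end_pieces: "card (end_pieces 0) = 0" "card (end_pieces (Suc m)) = pnum m - 1"
proof -
  let ?M = "if m = 0 then {#} else {#m#}"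
  have "M = ?M" if M: "M \<in> partitions m" "\<not> 2 \<le> size M" for M
  proof -
    have "size M = 0 \<or> size M = 1" using M(2) by linarith
    then show ?thesis
    proof
      assume "size M = 0"
      then show ?thesis using M(1) by (simp add: partitions_def)
    next
      assume "size M = 1"
      then obtain a where "M = {#a#}" using size_1_singleton_mset by blast
      then show ?thesis using M(1) by (auto simp: partitions_def)
    qed
  qed
  moreover have "?M \<in> partitions m" "\<not> 2 \<le> size ?M" by (auto simp: partitions_def)
  ultimately have "end_pieces (Suc m) = partitions m - {?M}"
    unfolding end_pieces_def pieces_simps by blast
  then show "card (end_pieces (Suc m)) = pnum m - 1"
    using \<open>?M \<in> partitions m\<close> by (simp add: pnum_def)
qed (simp add: end_pieces_def pieces_simps)

definition all_spine_codes :: "nat \<Rightarrow> nat multiset list set" where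
  "all_spine_codes n = {C \<in> pos_codes n. 2 \<le> length C \<and> 2 \<le> size (hd C) \<and> 2 \<le> size (last C)}"

lemma finite_all_spine_codes: "finite (all_spine_codes n)"
  by (simp add: all_spine_codes_def finite_pos_codes)

lemma spine_codes_eq: "spine_codes n k = {C \<in> all_spine_codes n. code_hdvs C = k}"
  by (auto simp: spine_codes_def all_spine_codes_def pos_codes_def code_size_def code_hdvs_def)

lemma finite_spine_codes: "finite (spine_codes n k)"
  by (simp add: spine_codes_eq finite_all_spine_codes)

lemma all_spine_codes_UN: "all_spine_codes n = (\<Union>k\<le>n. spine_codes n k)"
  using code_hdvs_le by (auto simp: spine_codes_eq all_spine_codes_def pos_codes_def)

text \<open>Both end letters are nonempty, and \<open>2 \<le> length C\<close> keeps them
  apart.\<close>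

lemma spine_codes_empty: "k < 2 \<Longrightarrow> spine_codes n k = {}"
proof -
  have "2 \<le> code_hdvs C" if "C \<in> all_spine_codes n" for C
  proof -
    have C: "2 \<le> length C" "2 \<le> size (hd C)" "2 \<le> size (last C)" using that by (auto simp: all_spine_codes_def)
    then obtain M D where M: "C = M # D" by (cases C) auto
    with C obtain D' N where "D = D' @ [N]" by (cases D rule: rev_cases) auto
    with M C show ?thesis by auto
  qed
  then show "k < 2 \<Longrightarrow> spine_codes n k = {}" by (fastforce simp: spine_codes_eq)
qed

definition spine_poly :: "'a :: comm_semiring_1 \<Rightarrow> nat \<Rightarrow> 'a" where
  "spine_poly u n = (\<Sum>k\<le>n. of_nat (card (spine_codes n k)) * u ^ k)"

lemma spine_poly_sum: "spine_poly u n = (\<Sum>C\<in>all_spine_codes n. u ^ code_hdvs C)"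
proof -
  have "(\<Sum>C\<in>all_spine_codes n. u ^ code_hdvs C) = (\<Sum>k\<le>n. \<Sum>C\<in>spine_codes n k. u ^ code_hdvs C)"
    unfolding all_spine_codes_UN
  proof (rule sum.UNION_disjoint)
    show "\<forall>k\<in>{..n}. finite (spine_codes n k)" by (simp add: finite_spine_codes)
  qed (auto simp: spine_codes_eq)
  also have "\<dots> = (\<Sum>k\<le>n. \<Sum>C\<in>spine_codes n k. u ^ k)"
    by (intro sum.cong refl) (auto simp: spine_codes_eq)
  finally show ?thesis by (simp add: spine_poly_def)
qed

lemma nested_sum_Sigma:
  assumes "\<And>i. finite (A i)" "\<And>j. finite (B j)"
  shows "(\<Sum>(i, M, j, C, N)\<in>(SIGMA i:{..n :: nat}. SIGMA M:A i. SIGMA j:{..n - i}. SIGMA C:B j. A (n - i - j)). g i M j C N) =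
    (\<Sum>i\<le>n. \<Sum>M\<in>A i. \<Sum>j\<le>n - i. \<Sum>C\<in>B j. \<Sum>N\<in>A (n - i - j). g i M j C N :: 'a :: comm_monoid_add)"
  by (simp add: sum.Sigma assms finite_SigmaI)

text \<open>A spine code is a first letter, an arbitrary inner word and a last letter;
  \<open>u^2\<close> marks the HDVs at the two ends.\<close>

lemma spine_poly_conv:
  "spine_poly u n = (\<Sum>i\<le>n. of_nat (card (end_pieces i)) * (\<Sum>j\<le>n - i. code_poly u j * (of_nat (card (end_pieces (n - i - j))) * u\<^sup>2)))"
proof -
  let ?T = "SIGMA i:{..n}. SIGMA M:end_pieces i. SIGMA j:{..n - i}. SIGMA C:pos_codes j. end_pieces (n - i - j)"
  have fin: "finite (end_pieces i)" for i by (simp add: end_pieces_def finite_pieces)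
  have "(\<Sum>C\<in>all_spine_codes n. u ^ code_hdvs C) = (\<Sum>(i, M, j, C, N)\<in>?T. u ^ code_hdvs C * u\<^sup>2)"
  proof (rule sum.reindex_bij_witness[of _ "\<lambda>(i, M, j, C, N). M # C @ [N]"
      "\<lambda>C. (Suc (sum_mset (hd C)), hd C, code_size (butlast (tl C)), butlast (tl C), last C)"])
    fix C assume C: "C \<in> all_spine_codes n"
    then have "2 \<le> length C" by (simp add: all_spine_codes_def)
    then obtain M D where "C = M # D" "D \<noteq> []" by (cases C; cases "tl C") auto
    then obtain D' N where CD: "C = M # D' @ [N]" by (cases D rule: rev_cases) auto
    have ne: "M \<noteq> {#}" "N \<noteq> {#}" using C CD by (auto simp: all_spine_codes_def)
    show "(case (Suc (sum_mset (hd C)), hd C, code_size (butlast (tl C)), butlast (tl C), last C) of (i, M, j, C, N) \<Rightarrow> M # C @ [N]) = C"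
      by (simp add: CD)
    show "(Suc (sum_mset (hd C)), hd C, code_size (butlast (tl C)), butlast (tl C), last C) \<in> ?T"
      using C by (auto simp: CD all_spine_codes_def pos_codes_def end_pieces_def pieces_def)
    show "(case (Suc (sum_mset (hd C)), hd C, code_size (butlast (tl C)), butlast (tl C), last C) of (i, M, j, C, N) \<Rightarrow> u ^ code_hdvs C * u\<^sup>2) = u ^ code_hdvs C"
      using ne by (simp add: CD power2_eq_square mult_ac)
  next
    fix x assume x: "x \<in> ?T"
    obtain i M j C N where xx: "x = (i, M, j, C, N)" by (cases x)
    show "(case x of (i, M, j, C, N) \<Rightarrow> M # C @ [N]) \<in> all_spine_codes n"
      using x by (auto simp: xx all_spine_codes_def pos_codes_def end_pieces_def pieces_def)
    show "(Suc (sum_mset (hd (case x of (i, M, j, C, N) \<Rightarrow> M # C @ [N]))), hd (case x of (i, M, j, C, N) \<Rightarrow> M # C @ [N]),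
      code_size (butlast (tl (case x of (i, M, j, C, N) \<Rightarrow> M # C @ [N]))), butlast (tl (case x of (i, M, j, C, N) \<Rightarrow> M # C @ [N])), last (case x of (i, M, j, C, N) \<Rightarrow> M # C @ [N])) = x"
      using x by (auto simp: xx all_spine_codes_def pos_codes_def end_pieces_def pieces_def)
  qed
  also have "\<dots> = (\<Sum>i\<le>n. \<Sum>M\<in>end_pieces i. \<Sum>j\<le>n - i. \<Sum>C\<in>pos_codes j. \<Sum>N\<in>end_pieces (n - i - j). u ^ code_hdvs C * u\<^sup>2)"
    by (rule nested_sum_Sigma[OF fin finite_pos_codes])
  also have "\<dots> = (\<Sum>i\<le>n. of_nat (card (end_pieces i)) * (\<Sum>j\<le>n - i. code_poly u j * (of_nat (card (end_pieces (n - i - j))) * u\<^sup>2)))"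
    unfolding code_poly_def by (simp add: sum_distrib_left sum_distrib_right mult_ac)
  finally show ?thesis unfolding spine_poly_sum .
qed

text \<open>A palindrome is \<open>l @ M @ rev l\<close> with \<open>M\<close> empty or a single
  letter. Here \<open>m\<close> is the size of the half \<open>l\<close>, and
  \<open>2 * m = n\<close> means that \<open>M\<close> is empty.\<close>

lemma card_palindromes_le:
  "card {C \<in> pos_codes n. rev C = C} \<le>
     (\<Sum>m\<le>n. if 2 * m \<le> n then card (pos_codes m) * (if 2 * m = n then 1 else card (pieces (n - 2 * m))) else 0)"
proof -
  let ?mid = "\<lambda>j. if j = 0 then {[]} else (\<lambda>M. [M]) ` pieces j"
  let ?T = "SIGMA m:{m. m \<le> n \<and> 2 * m \<le> n}. pos_codes m \<times> ?mid (n - 2 * m)"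
  have fin: "finite (?mid j)" for j using finite_pieces by simp
  have "{C \<in> pos_codes n. rev C = C} \<subseteq> (\<lambda>(m, l, M). l @ M @ rev l) ` ?T"
  proof
    fix C assume C: "C \<in> {C \<in> pos_codes n. rev C = C}"
    define l where "l = take (length C div 2) C"
    define M where "M = take (length C mod 2) (drop (length C div 2) C)"
    have "drop (length C div 2 + length C mod 2) C = rev (take (length C - (length C div 2 + length C mod 2)) (rev C))"
      by (simp add: rev_take)
    also have "length C - (length C div 2 + length C mod 2) = length C div 2" by presburger
    finally have "drop (length C mod 2) (drop (length C div 2) C) = rev l"
      using C by (simp add: l_def add.commute)
    then have CM: "C = l @ M @ rev l" unfolding M_def l_def by (metis append_take_drop_id)
    have size: "2 * code_size l + code_size M = n" and pos: "\<forall>N\<in>set l. 0 \<notin># N" "\<forall>N\<in>set M. 0 \<notin># N"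
      using C CM by (auto simp: pos_codes_def)
    have "M \<in> ?mid (n - 2 * code_size l)"
    proof (cases M)
      case Nil then show ?thesis using size by simp
    next
      case (Cons N M')
      have "length M \<le> 1" unfolding M_def by simp
      then have "M = [N]" using Cons by simp
      then show ?thesis using size pos(2) by (auto simp: pieces_def)
    qed
    moreover have "l \<in> pos_codes (code_size l)" using pos by (simp add: pos_codes_def)
    ultimately have "(code_size l, l, M) \<in> ?T" using size by auto
    then show "C \<in> (\<lambda>(m, l, M). l @ M @ rev l) ` ?T" 
      by (rule image_eqI[rotated]) (use CM in simp)
  qed
  moreover have finT: "finite ?T" by (intro finite_SigmaI) (simp_all add: finite_pos_codes finite_pieces)
  ultimately have "card {C \<in> pos_codes n. rev C = C} \<le> card ?T"
    by (meson surj_card_le)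
  also have "card ?T = (\<Sum>m\<in>{m. m \<le> n \<and> 2 * m \<le> n}. card (pos_codes m \<times> ?mid (n - 2 * m)))"
    by (rule card_SigmaI) (auto simp: finite_pos_codes finite_pieces)
  also have "\<dots> = (\<Sum>m\<in>{m. m \<le> n \<and> 2 * m \<le> n}. card (pos_codes m) * (if 2 * m = n then 1 else card (pieces (n - 2 * m))))"
    by (intro sum.cong refl) (auto simp: card_cartesian_product card_image inj_on_def)
  also have "\<dots> = (\<Sum>m\<le>n. if 2 * m \<le> n then card (pos_codes m) * (if 2 * m = n then 1 else card (pieces (n - 2 * m))) else 0)"
    by (rule sum.mono_neutral_cong_left) auto
  finally show ?thesis .
qed

lemma sum_Suc_split: "(\<Sum>j\<le>Suc n. f j) = f 0 + (\<Sum>j\<le>n. f (Suc j) :: 'a :: comm_monoid_add)"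
  by (rule sum.atMost_Suc_shift)

lemma card_pieces_Suc: "card (pieces (Suc m)) = pnum m"
  by (simp add: pieces_simps pnum_def)

text \<open>At the root the weights \<open>pnum j * x ^ (j + 1)\<close> of the recursion add up to
  at most \<open>x P(x) = 1\<close>, so the bound propagates by induction.\<close>

lemma card_pos_codes_bound:
  fixes x :: real
  assumes x: "0 < x" "x < 1" and root: "x * partition_gf x = 1"
  shows "real (card (pos_codes n)) * x ^ n \<le> 1"
proof (induction n rule: less_induct)
  case (less n)
  have b: "code_poly (1 :: real) m = real (card (pos_codes m))" for m by (simp add: code_poly_def)
  show ?case
  proof (cases n)
    case 0
    have "pos_codes 0 = {[]}"
    proof -
      have "C = []" if "code_size C = 0" for C using length_le_code_size[of C] that by simp
      then show ?thesis by (auto simp: pos_codes_def)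
    qed
    then show ?thesis using 0 by simp
  next
    case (Suc n')
    have pp: "piece_poly (1 :: real) (Suc m) = real (pnum m)" for m by (simp add: piece_poly_Suc pnum_0)
    have "real (card (pos_codes n)) = (\<Sum>j\<le>n'. real (pnum j) * real (card (pos_codes (n' - j))))"
      using code_poly_rec[of "1 :: real" n] unfolding b Suc sum_Suc_split by (simp add: pp piece_poly_0)
    then have "real (card (pos_codes n)) * x ^ n = (\<Sum>j\<le>n'. real (pnum j) * real (card (pos_codes (n' - j))) * x ^ n)"
      by (simp only: sum_distrib_right)
    also have "\<dots> = (\<Sum>j\<le>n'. (real (pnum j) * x ^ Suc j) * (real (card (pos_codes (n' - j))) * x ^ (n' - j)))"
    proof (intro sum.cong refl)
      fix j assume "j \<in> {..n'}"
      then have "x ^ n = x ^ Suc j * x ^ (n' - j)" unfolding Suc power_add[symmetric] by simp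
      then show "real (pnum j) * real (card (pos_codes (n' - j))) * x ^ n =
         (real (pnum j) * x ^ Suc j) * (real (card (pos_codes (n' - j))) * x ^ (n' - j))" by (simp only: mult_ac)
    qed
    also have "\<dots> \<le> (\<Sum>j\<le>n'. (real (pnum j) * x ^ Suc j) * 1)"
      using x less Suc by (intro sum_mono mult_left_mono) auto
    also have "\<dots> = x * (\<Sum>j\<le>n'. real (pnum j) * x ^ j)" by (simp add: sum_distrib_left mult_ac)
    also have "\<dots> \<le> x * partition_gf x"
      using x sum_le_suminf[OF sums_summable[OF partition_gf_sums[of x]], of "{..n'}"] sums_unique[OF partition_gf_sums[of x]]
      by (intro mult_left_mono) auto
    finally show ?thesis using root by simp
  qed
qed

text \<open>A palindrome is determined by its half and its middle letter, so the growth rate of the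
  words enters only with exponent \<open>n / 2\<close>; this is where \<open>y = sqrt x\<close>
  comes from.\<close>

lemma palindromes_bound:
  fixes x y :: real
  assumes x: "0 < x" "x < 1" and root: "x * partition_gf x = 1" and y: "y = sqrt x"
  shows "real (card {C \<in> pos_codes n. rev C = C}) * y ^ n \<le> 1 + real (Suc n) * partition_gf y"
proof -
  have y01: "0 < y" "y < 1" using x y by (auto simp: real_sqrt_lt_1_iff)
  have y2: "y\<^sup>2 = x" using x y by simp
  have P0: "0 \<le> partition_gf y" using pnum_pow_le[of y 0] y01 by (simp add: pnum_0)
  have bnd: "real (card (pos_codes m) * (if 2 * m = n then 1 else card (pieces (n - 2 * m)))) * y ^ n \<le>
     (if 2 * m = n then 1 else partition_gf y)" if m: "2 * m \<le> n" for m
  proof -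
    have yn: "y ^ n = x ^ m * y ^ (n - 2 * m)"
      using m unfolding y2[symmetric] power_mult[symmetric] power_add[symmetric] by simp
    have b: "real (card (pos_codes m)) * x ^ m \<le> 1" by (rule card_pos_codes_bound[OF x root])
    have c: "real (if 2 * m = n then 1 else card (pieces (n - 2 * m))) * y ^ (n - 2 * m) \<le> (if 2 * m = n then 1 else partition_gf y)"
    proof (cases "2 * m = n")
      case False
      then obtain j where j: "n - 2 * m = Suc j" using m by (metis Suc_diff_Suc le_neq_implies_less)
      have "real (pnum j) * y ^ Suc j \<le> real (pnum j) * y ^ j"
        using y01 by (intro mult_left_mono power_decreasing) auto
      also have "\<dots> \<le> partition_gf y" using y01 by (intro pnum_pow_le) auto
      finally show ?thesis using False j by (simp add: card_pieces_Suc)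
    qed simp
    have "real (card (pos_codes m) * (if 2 * m = n then 1 else card (pieces (n - 2 * m)))) * y ^ n =
       (real (card (pos_codes m)) * x ^ m) * (real (if 2 * m = n then 1 else card (pieces (n - 2 * m))) * y ^ (n - 2 * m))"
      unfolding yn by (simp only: of_nat_mult mult_ac)
    also have "\<dots> \<le> 1 * (if 2 * m = n then 1 else partition_gf y)"
      using x y01 P0 by (intro mult_mono b c) auto
    finally show ?thesis by simp
  qed
  have "real (card {C \<in> pos_codes n. rev C = C}) * y ^ n \<le>
     real (\<Sum>m\<le>n. if 2 * m \<le> n then card (pos_codes m) * (if 2 * m = n then 1 else card (pieces (n - 2 * m))) else 0) * y ^ n"
    using card_palindromes_le[of n] y01 by (intro mult_right_mono of_nat_mono) auto
  also have "\<dots> = (\<Sum>m\<le>n. if 2 * m \<le> n then real (card (pos_codes m) * (if 2 * m = n then 1 else card (pieces (n - 2 * m)))) * y ^ n else 0)"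
    unfolding of_nat_sum sum_distrib_right by (intro sum.cong refl) simp
  \<comment> \<open>Only \<open>m = n div 2\<close> can have an empty middle, which costs the
    additional \<open>1\<close>.\<close>
  also have "\<dots> \<le> (\<Sum>m\<le>n. (if m = n div 2 then 1 else 0) + partition_gf y)"
  proof (rule sum_mono)
    fix m
    show "(if 2 * m \<le> n then real (card (pos_codes m) * (if 2 * m = n then 1 else card (pieces (n - 2 * m)))) * y ^ n else 0)
      \<le> (if m = n div 2 then 1 else 0) + partition_gf y"
      using bnd[of m] P0 by (auto split: if_splits)
  qed
  also have "\<dots> = 1 + real (Suc n) * partition_gf y" by (simp add: sum.distrib)
  finally show ?thesis .
qed

text \<open>The error consists of the palindromes, at most \<open>1 + (n + 1) P(y)\<close>, and of
  the classes with \<open>k < 2\<close>, which have no codes and contribute at most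
  \<open>4 P(y)\<close>.\<close>

lemma num_k_linear_approx:
  fixes x y :: real
  assumes x: "0 < x" "x < 1" and root: "x * partition_gf x = 1" and y: "y = sqrt x" and n: "n \<ge> 1"
  shows "(\<Sum>k\<le>n. \<bar>2 * real (num_k_linear n k) - real (card (spine_codes n k))\<bar>) * y ^ n \<le> 1 + real (n + 9) * partition_gf y"
proof -
  have y01: "0 < y" "y < 1" using x y by (auto simp: real_sqrt_lt_1_iff)
  have P0: "0 \<le> partition_gf y" using pnum_pow_le[of y 0] y01 by (simp add: pnum_0)
  let ?pal = "\<lambda>k. {C \<in> spine_codes n k. rev C = C}"
  have small: "real (num_k_linear n k) * y ^ n \<le> partition_gf y" if "k < 2" for k
  proof -
    obtain m where m: "n = Suc m" using n by (cases n) auto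
    have "num_k_linear n k \<le> pnum m"
      using num_k_linear_small[OF that n] finite_partitions[of m] by (simp add: m pnum_def partitions_def)
    then have "real (num_k_linear n k) * y ^ n \<le> real (pnum m) * y ^ m"
      using y01 m by (intro mult_mono power_decreasing) auto
    also have "\<dots> \<le> partition_gf y" using y01 by (intro pnum_pow_le) auto
    finally show ?thesis .
  qed
  have bound: "\<bar>2 * real (num_k_linear n k) - real (card (spine_codes n k))\<bar> * y ^ n \<le>
     (if k < 2 then 2 * partition_gf y else 0) + real (card (?pal k)) * y ^ n" for k
  proof (cases "k < 2")
    case True
    then show ?thesis using small[OF True] by (simp add: spine_codes_empty)
  next
    case False
    then have "2 \<le> k" by simp
    from num_k_linear_bounds[OF this finite_spine_codes, of n]
    have "real (card (spine_codes n k)) \<le> real (2 * num_k_linear n k)"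
      "real (2 * num_k_linear n k) \<le> real (card (spine_codes n k) + card (?pal k))"
      by (simp_all only: of_nat_le_iff)
    then have "\<bar>2 * real (num_k_linear n k) - real (card (spine_codes n k))\<bar> \<le> real (card (?pal k))" by simp
    then show ?thesis using False y01 by (simp add: mult_right_mono)
  qed
  have "(\<Sum>k\<le>n. \<bar>2 * real (num_k_linear n k) - real (card (spine_codes n k))\<bar>) * y ^ n \<le>
     (\<Sum>k\<le>n. (if k < 2 then 2 * partition_gf y else 0) + real (card (?pal k)) * y ^ n)"
    unfolding sum_distrib_right by (rule sum_mono) (rule bound)
  also have "\<dots> = (\<Sum>k\<le>n. if k < 2 then 2 * partition_gf y else 0) + real (\<Sum>k\<le>n. card (?pal k)) * y ^ n"
    by (simp add: sum.distrib sum_distrib_right)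
  also have "(\<Sum>k\<le>n. if k < 2 then 2 * partition_gf y else 0) \<le> 2 * (2 * partition_gf y)"
  proof -
    have "(\<Sum>k\<le>n. if k < 2 then 2 * partition_gf y else 0) = (\<Sum>k\<in>{k. k \<le> n \<and> k < 2}. 2 * partition_gf y)"
      by (rule sum.mono_neutral_cong_right) auto
    also have "\<dots> = real (card {k. k \<le> n \<and> k < 2}) * (2 * partition_gf y)" by simp
    also have "\<dots> \<le> 2 * (2 * partition_gf y)"
    proof (rule mult_right_mono)
      have "card {k. k \<le> n \<and> k < 2} \<le> card {..<2::nat}" by (rule card_mono) auto
      then show "real (card {k. k \<le> n \<and> k < 2}) \<le> 2" by simp
    qed (use P0 in simp)
    finally show ?thesis .
  qed
  also have "(\<Sum>k\<le>n. card (?pal k)) = card (\<Union>k\<le>n. ?pal k)"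
  proof (rule card_UN_disjoint[symmetric])
    show "\<forall>k\<in>{..n}. finite (?pal k)" using finite_spine_codes by simp
    show "\<forall>k\<in>{..n}. \<forall>l\<in>{..n}. k \<noteq> l \<longrightarrow> ?pal k \<inter> ?pal l = {}" by (simp add: spine_codes_eq disjoint_iff)
  qed simp
  also have "real (card (\<Union>k\<le>n. ?pal k)) * y ^ n \<le> real (card {C \<in> pos_codes n. rev C = C}) * y ^ n"
  proof -
    have "card (\<Union>k\<le>n. ?pal k) \<le> card {C \<in> pos_codes n. rev C = C}"
      by (rule card_mono) (auto simp: finite_pos_codes spine_codes_eq all_spine_codes_def)
    then show ?thesis using y01 by (intro mult_right_mono) auto
  qed
  also have "\<dots> \<le> 1 + real (Suc n) * partition_gf y" by (rule palindromes_bound[OF x root y])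
  finally show ?thesis using P0 by (simp add: algebra_simps)
qed

section \<open>Generating functions of codes\<close>

definition end_gf :: "complex \<Rightarrow> complex" where
  "end_gf z = z * (Pc z - 1 / (1 - z))"

text \<open>An arbitrary letter of the spine; the empty letter carries no \<open>u\<close>.\<close>

definition step_gf :: "complex \<Rightarrow> complex \<Rightarrow> complex" where
  "step_gf u z = z * (1 + u * (Pc z - 1))"

lemma end_gf_expansion: "end_gf has_fps_expansion Abs_fps (\<lambda>n. of_nat (card (end_pieces n)))"
proof -
  have "(\<lambda>z :: complex. z * (Pc z - 1 / (1 - z))) has_fps_expansion fps_X * (pfps - 1 / (1 - fps_X))"
    by (intro fps_expansion_intros Pc_expansion) simp
  moreover have "fps_X * (pfps - 1 / (1 - fps_X)) = Abs_fps (\<lambda>n. of_nat (card (end_pieces n)) :: complex)"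
  proof (rule fps_ext)
    fix n
    have "inverse (1 - fps_X) = (Abs_fps (\<lambda>_. 1) :: complex fps)"
      by (subst fps_inverse_gp'[symmetric]) (rule fps_inverse_idempotent, simp)
    then have "1 / (1 - fps_X) = (Abs_fps (\<lambda>_. 1) :: complex fps)"
      by (subst fps_divide_unit) simp_all
    \<comment> \<open>\<open>card_end_pieces\<close> subtracts natural numbers; this bound turns it
      into the subtraction of series.\<close>
    moreover have "1 \<le> pnum m" for m using pnum_pos[of m] pnum_0 by (cases "m = 0") (auto simp: Suc_le_eq)
    ultimately show "fps_nth (fps_X * (pfps - 1 / (1 - fps_X))) n = fps_nth (Abs_fps (\<lambda>n. of_nat (card (end_pieces n)) :: complex)) n"
      by (cases n) (auto simp: card_end_pieces pfps_def of_nat_diff)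
  qed
  ultimately show ?thesis by (simp add: end_gf_def[abs_def])
qed

lemma step_gf_expansion: "step_gf u has_fps_expansion Abs_fps (piece_poly u)"
proof -
  have "(\<lambda>z :: complex. z * (1 + u * (Pc z - 1))) has_fps_expansion fps_X * (1 + fps_const u * (pfps - 1))"
    by (intro fps_expansion_intros Pc_expansion)
  moreover have "fps_X * (1 + fps_const u * (pfps - 1)) = Abs_fps (piece_poly u)"
  proof (rule fps_ext)
    fix n
    show "fps_nth (fps_X * (1 + fps_const u * (pfps - 1))) n = fps_nth (Abs_fps (piece_poly u)) n"
      by (cases n) (auto simp: piece_poly_0 piece_poly_Suc pfps_def pnum_0)
  qed
  ultimately show ?thesis by (simp add: step_gf_def[abs_def])
qed

lemma code_poly_fps: "Abs_fps (code_poly u) = inverse (1 - Abs_fps (piece_poly u :: nat \<Rightarrow> complex))"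
proof -
  have "Abs_fps (code_poly u) = 1 + Abs_fps (piece_poly u) * Abs_fps (code_poly u)"
    by (rule fps_ext) (subst fps_nth_Abs_fps, subst code_poly_rec, simp add: fps_mult_nth atLeast0AtMost)
  then have "Abs_fps (code_poly u) * (1 - Abs_fps (piece_poly u)) = 1" by (simp add: algebra_simps)
  then show ?thesis by (metis fps_inverse_unique mult.commute)
qed

lemma spine_poly_fps:
  fixes u :: complex
  defines "D \<equiv> Abs_fps (\<lambda>n. of_nat (card (end_pieces n)))"
  shows "Abs_fps (spine_poly u) = D * (Abs_fps (code_poly u) * (D * fps_const (u\<^sup>2)))"
proof (rule fps_ext)
  fix n
  have "fps_nth (D * fps_const (u\<^sup>2)) m = of_nat (card (end_pieces m)) * u\<^sup>2" for m
    by (simp add: D_def)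
  then show "fps_nth (Abs_fps (spine_poly u)) n = fps_nth (D * (Abs_fps (code_poly u) * (D * fps_const (u\<^sup>2)))) n"
    unfolding fps_mult_nth[of D "Abs_fps (code_poly u) * (D * fps_const (u\<^sup>2))"]
      fps_mult_nth[of "Abs_fps (code_poly u)" "D * fps_const (u\<^sup>2)"] fps_nth_Abs_fps spine_poly_conv
    by (simp add: D_def atLeast0AtMost)
qed

definition spine_gf :: "complex \<Rightarrow> complex \<Rightarrow> complex" where
  "spine_gf u z = u\<^sup>2 * (end_gf z)\<^sup>2 / (1 - step_gf u z)"

lemma spine_gf_expansion: "spine_gf u has_fps_expansion Abs_fps (spine_poly u)"
proof -
  have nz: "fps_nth (1 - Abs_fps (piece_poly u)) 0 \<noteq> (0 :: complex)" by (simp add: piece_poly_0)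
  have "(\<lambda>z. end_gf z * (inverse (1 - step_gf u z) * (end_gf z * u\<^sup>2))) has_fps_expansion Abs_fps (spine_poly u)"
    unfolding spine_poly_fps code_poly_fps
    by (intro fps_expansion_intros end_gf_expansion step_gf_expansion nz)
  moreover have "(\<lambda>z. end_gf z * (inverse (1 - step_gf u z) * (end_gf z * u\<^sup>2))) = spine_gf u"
    by (auto simp: spine_gf_def power2_eq_square divide_inverse mult_ac)
  ultimately show ?thesis by simp
qed

section \<open>A Berry--Esseen bound for lattice distributions\<close>

text \<open>The left side of the bound is \<open>2 |sin (\<theta> / 2)|\<close>. The cubic Taylor
  error of the sine takes away at most \<open>4/6\<close> of the linear term, as
  \<open>|\<theta> / 2| \<le> 2\<close>, and one third is left.\<close>

lemma norm_one_minus_iexp_ge: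
  fixes \<theta> :: real
  assumes "\<bar>\<theta>\<bar> \<le> pi" shows "norm (1 - iexp (- \<theta>)) \<ge> \<bar>\<theta>\<bar> / 3"
proof -
  let ?y = "\<theta> / 2"
  have y2: "?y\<^sup>2 \<le> 2\<^sup>2" using assms pi_less_4 by (intro abs_le_square_iff[THEN iffD1]) simp
  have "\<bar>sin ?y - ?y\<bar> \<le> inverse (fact 3) * \<bar>?y\<bar> ^ 3"
    using Maclaurin_sin_bound[of ?y 3] by (simp add: numeral_3_eq_3 sin_coeff_def)
  moreover have "\<bar>?y\<bar> - \<bar>sin ?y\<bar> \<le> \<bar>sin ?y - ?y\<bar>" by linarith
  ultimately have "\<bar>?y\<bar> - \<bar>sin ?y\<bar> \<le> inverse (fact 3) * \<bar>?y\<bar> ^ 3" by linarith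
  then have "\<bar>?y\<bar> - \<bar>sin ?y\<bar> \<le> \<bar>?y\<bar> ^ 3 / 6" by (simp add: fact_numeral)
  also have "\<bar>?y\<bar> ^ 3 = \<bar>?y\<bar> * ?y\<^sup>2" by (simp only: power3_eq_cube power2_abs[symmetric, of ?y]) (simp add: power2_eq_square)
  also have "\<bar>?y\<bar> * ?y\<^sup>2 / 6 \<le> \<bar>?y\<bar> * 4 / 6" using y2 by (intro divide_right_mono mult_left_mono) auto
  finally have "\<bar>sin ?y\<bar> \<ge> \<bar>?y\<bar> / 3" by simp
  moreover have "norm (iexp (- \<theta>) - 1) = 2 * \<bar>sin (- \<theta> / 2)\<bar>"
    using dist_exp_i_1[of "- \<theta>"] by simp
  ultimately show ?thesis by (simp add: norm_minus_commute)
qed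

text \<open>Integrated over a period against a characteristic function on the integers, it extracts
  \<open>2 pi\<close> times the mass of \<open>{0..K}\<close>.\<close>

definition dirichlet :: "nat \<Rightarrow> real \<Rightarrow> complex" where
  "dirichlet K \<theta> = (\<Sum>k\<le>K. iexp (- (real k * \<theta>)))"

lemma dirichlet_geometric: "dirichlet K \<theta> * (1 - iexp (- \<theta>)) = 1 - iexp (- (real (Suc K) * \<theta>))"
proof -
  have "dirichlet K \<theta> = (\<Sum>k<Suc K. iexp (- \<theta>) ^ k)"
    unfolding dirichlet_def lessThan_Suc_atMost
    by (intro sum.cong refl) (simp add: exp_of_nat_mult[symmetric] algebra_simps)
  moreover have "(\<Sum>k<Suc K. iexp (- \<theta>) ^ k) * (1 - iexp (- \<theta>)) = 1 - iexp (- \<theta>) ^ Suc K"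
    by (subst one_diff_power_eq) (simp add: mult.commute)
  moreover have "iexp (- \<theta>) ^ Suc K = iexp (- (real (Suc K) * \<theta>))"
    by (simp only: exp_of_nat_mult[symmetric]) (simp add: algebra_simps)
  ultimately show ?thesis by simp
qed

lemma norm_dirichlet_le: "norm (dirichlet K \<theta>) \<le> real (Suc K)"
proof -
  have "norm (dirichlet K \<theta>) \<le> (\<Sum>k\<le>K. norm (iexp (- (real k * \<theta>))))"
    unfolding dirichlet_def by (rule norm_sum)
  also have "\<dots> = (\<Sum>k\<le>K. 1)" by (intro sum.cong refl) (rule norm_exp_i_times)
  finally show ?thesis by simp
qed

lemma norm_one_minus_iexp_le: "norm (1 - iexp x) \<le> 2"
proof -
  have "norm (1 - iexp x) \<le> norm (1 :: complex) + norm (iexp x)" by (rule norm_triangle_ineq4)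
  then show ?thesis by simp
qed

lemma norm_dirichlet_le_inverse:
  assumes "\<bar>\<theta>\<bar> \<le> pi" "\<theta> \<noteq> 0" shows "norm (dirichlet K \<theta>) \<le> 6 / \<bar>\<theta>\<bar>"
proof -
  have "norm (dirichlet K \<theta>) * (\<bar>\<theta>\<bar> / 3) \<le> norm (dirichlet K \<theta>) * norm (1 - iexp (- \<theta>))"
    by (intro mult_left_mono norm_one_minus_iexp_ge assms) simp
  also have "\<dots> = norm (1 - iexp (- (real (Suc K) * \<theta>)))" by (simp only: norm_mult[symmetric] dirichlet_geometric)
  also have "\<dots> \<le> 2" by (rule norm_one_minus_iexp_le)
  finally show ?thesis using assms(2) by (simp add: field_simps)
qed

text \<open>The kernel of Levy's inversion formula for the interval \<open>{0<..b}\<close>. At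
  \<open>\<theta> = 0\<close> the division by zero yields \<open>0\<close> instead of
  \<open>b\<close>, which does not affect integrals.\<close>

definition levy_kernel :: "real \<Rightarrow> real \<Rightarrow> complex" where
  "levy_kernel b \<theta> = (1 - iexp (- (\<theta> * b))) / (\<i> * \<theta>)"

lemma norm_levy_kernel_le: "\<theta> \<noteq> 0 \<Longrightarrow> norm (levy_kernel b \<theta>) \<le> 2 / \<bar>\<theta>\<bar>"
  unfolding levy_kernel_def norm_divide norm_mult
  using norm_one_minus_iexp_le[of "- (\<theta> * b)"] by (simp add: divide_right_mono)

text \<open>With \<open>b = K + 1\<close> both kernels have the numerator
  \<open>1 - exp (- \<i> (K + 1) \<theta>)\<close>, of norm at most \<open>2\<close>. The
  denominators \<open>\<i> \<theta>\<close> and \<open>1 - exp (- \<i> \<theta>)\<close> differ by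
  at most \<open>\<theta>^2 / 2\<close>, and their product has norm at least
  \<open>\<theta>^2 / 3\<close>; this makes \<open>2 * (1/2) * 3\<close>.\<close>

lemma levy_kernel_dirichlet:
  assumes "\<bar>\<theta>\<bar> \<le> pi" "\<theta> \<noteq> 0"
  shows "norm (levy_kernel (real (Suc K)) \<theta> - dirichlet K \<theta>) \<le> 3"
proof -
  let ?e = "1 - iexp (- \<theta>)" and ?N = "1 - iexp (- (real (Suc K) * \<theta>))"
  have e: "norm ?e \<ge> \<bar>\<theta>\<bar> / 3" by (rule norm_one_minus_iexp_ge[OF assms(1)])
  then have e0: "?e \<noteq> 0" using assms(2) by auto
  have D: "dirichlet K \<theta> = ?N / ?e" using dirichlet_geometric[of K \<theta>] e0 by (simp add: field_simps)
  have "levy_kernel (real (Suc K)) \<theta> - dirichlet K \<theta> = ?N * ((?e - \<i> * \<theta>) / (\<i> * \<theta> * ?e))"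
    unfolding D levy_kernel_def using e0 assms(2) by (simp add: field_simps)
  then have "norm (levy_kernel (real (Suc K)) \<theta> - dirichlet K \<theta>) = norm ?N * (norm (?e - \<i> * \<theta>) / (\<bar>\<theta>\<bar> * norm ?e))"
    by (simp only: norm_mult norm_divide) simp
  also have "\<dots> \<le> 2 * ((\<bar>\<theta>\<bar>\<^sup>2 / 2) / (\<bar>\<theta>\<bar> * (\<bar>\<theta>\<bar> / 3)))"
  proof (intro mult_mono norm_one_minus_iexp_le frac_le mult_left_mono e)
    have "norm (iexp (- \<theta>) - (\<Sum>k \<le> 1. (\<i> * of_real (- \<theta>)) ^ k / fact k)) \<le> \<bar>- \<theta>\<bar> ^ Suc 1 / fact (Suc 1)"
      by (rule iexp_approx1)
    then have "norm (iexp (- \<theta>) - (1 - \<i> * \<theta>)) \<le> \<bar>\<theta>\<bar>\<^sup>2 / 2" by (simp add: power2_eq_square)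
    moreover have "?e - \<i> * \<theta> = - (iexp (- \<theta>) - (1 - \<i> * \<theta>))" by simp
    ultimately show "norm (?e - \<i> * \<theta>) \<le> \<bar>\<theta>\<bar>\<^sup>2 / 2" by (simp only: norm_minus_cancel)
    have "0 < \<theta> * \<theta>" using assms(2) not_real_square_gt_zero by blast
    then show "0 < \<bar>\<theta>\<bar> * (\<bar>\<theta>\<bar> / 3)" by simp
  qed (use assms(2) in auto)
  also have "\<dots> = 3" using assms(2) by (simp add: power2_eq_square)
  finally show ?thesis .
qed

lemma iexp_orthogonal:
  "integral {-pi..pi} (\<lambda>\<theta>. iexp (real_of_int m * \<theta>)) = (if m = 0 then 2 * pi else 0)"
proof (cases "m = 0")
  case False
  let ?F = "\<lambda>\<theta>::real. iexp (real_of_int m * \<theta>) / (\<i> * of_int m)"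
  have "((\<lambda>\<theta>. iexp (real_of_int m * \<theta>)) has_integral (?F pi - ?F (-pi))) {-pi..pi}"
  proof (rule fundamental_theorem_of_calculus)
    fix x :: real
    have "((\<lambda>z. exp (\<i> * (of_int m * z)) / (\<i> * of_int m)) has_field_derivative exp (\<i> * (of_int m * of_real x))) (at (of_real x))"
      using False by (auto intro!: derivative_eq_intros simp: field_simps)
    then have "((\<lambda>\<theta>. exp (\<i> * (of_int m * of_real \<theta>)) / (\<i> * of_int m)) has_vector_derivative exp (\<i> * (of_int m * of_real x))) (at x within {-pi..pi})"
      by (intro has_vector_derivative_real_field)
    then show "(?F has_vector_derivative iexp (real_of_int m * x)) (at x within {-pi..pi})" by simp
  qed simp
  moreover have "iexp (real_of_int m * pi) = iexp (real_of_int m * (-pi))"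
  proof -
    have "iexp (real_of_int m * pi) = exp (iexp_arg + \<i> * (of_int m * (of_real pi * 2)))"
      if "iexp_arg = \<i> * of_real (real_of_int m * (-pi))" for iexp_arg
      by (simp add: that algebra_simps)
    then show ?thesis by (simp only: exp_plus_2pin)
  qed
  ultimately have "((\<lambda>\<theta>. iexp (real_of_int m * \<theta>)) has_integral 0) {-pi..pi}" by simp
  then show ?thesis using False by (simp add: integral_unique)
next
  case True
  then show ?thesis by (simp add: scaleR_conv_of_real)
qed

lemma lattice_inversion:
  fixes p :: "nat \<Rightarrow> real"
  assumes "K \<le> n"
  shows "(CLINT \<theta>:{-pi..pi}|lborel. (\<Sum>k\<le>n. p k * iexp (real k * \<theta>)) * dirichlet K \<theta>) = 2 * pi * (\<Sum>k\<le>K. p k)"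
proof -
  have c: "continuous_on {-pi..pi} (\<lambda>\<theta>. (\<Sum>k\<le>n. p k * iexp (real k * \<theta>)) * dirichlet K \<theta>)"
    unfolding dirichlet_def by (intro continuous_intros)
  have "(CLINT \<theta>:{-pi..pi}|lborel. (\<Sum>k\<le>n. p k * iexp (real k * \<theta>)) * dirichlet K \<theta>) =
     integral {-pi..pi} (\<lambda>\<theta>. (\<Sum>k\<le>n. p k * iexp (real k * \<theta>)) * dirichlet K \<theta>)"
    by (rule set_borel_integral_eq_integral borel_integrable_atLeastAtMost' c)+
  also have "\<dots> = integral {-pi..pi} (\<lambda>\<theta>. \<Sum>k\<le>n. \<Sum>j\<le>K. p k * iexp (real_of_int (int k - int j) * \<theta>))"
  proof (rule arg_cong[of _ _ "integral _"], rule ext)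
    fix \<theta> :: real
    have "iexp (real k * \<theta>) * iexp (- (real j * \<theta>)) = iexp (real_of_int (int k - int j) * \<theta>)" for k j
      by (simp add: exp_add[symmetric] algebra_simps)
    then show "(\<Sum>k\<le>n. p k * iexp (real k * \<theta>)) * dirichlet K \<theta> = (\<Sum>k\<le>n. \<Sum>j\<le>K. p k * iexp (real_of_int (int k - int j) * \<theta>))"
      unfolding dirichlet_def sum_product by (intro sum.cong refl) (simp only: mult.assoc)
  qed
  also have "\<dots> = (\<Sum>k\<le>n. \<Sum>j\<le>K. p k * integral {-pi..pi} (\<lambda>\<theta>. iexp (real_of_int (int k - int j) * \<theta>)))"
    by (subst integral_sum; (intro integrable_sum integrable_continuous_interval continuous_intros finite_atMost)?)
       (intro sum.cong refl, subst integral_sum; (intro integrable_continuous_interval continuous_intros finite_atMost)?; simp)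
  also have "\<dots> = (\<Sum>k\<le>n. \<Sum>j\<le>K. if k = j then complex_of_real (p k) * (2 * pi) else 0)"
    unfolding iexp_orthogonal by (intro sum.cong refl) (auto simp: scaleR_conv_of_real)
  also have "\<dots> = (\<Sum>k\<le>n. if k \<le> K then 2 * pi * complex_of_real (p k) else 0)"
    by (intro sum.cong refl) (auto simp: mult.commute)
  also have "\<dots> = (\<Sum>k\<le>K. 2 * pi * complex_of_real (p k))"
    using assms by (intro sum.mono_neutral_cong_right) auto
  finally show ?thesis by (simp add: sum_distrib_left)
qed

section \<open>The normal distribution: integrals, tails and inversion\<close>

lemma gaussian_integral:
  fixes c :: real assumes "0 < c"
  shows "integrable lborel (\<lambda>x. exp (- c * x\<^sup>2))" "(LINT x|lborel. exp (- c * x\<^sup>2)) = sqrt (pi / c)"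
proof -
  define s where "s = 1 / sqrt (2 * c)"
  have s: "0 < s" "s\<^sup>2 = 1 / (2 * c)" using assms by (simp_all add: s_def power_divide)
  have eq: "exp (- c * x\<^sup>2) = sqrt (pi / c) * normal_density 0 s x" for x
    using assms by (simp add: normal_density_def s(2) field_simps real_sqrt_divide real_sqrt_mult)
  show "integrable lborel (\<lambda>x. exp (- c * x\<^sup>2))"
    unfolding eq using integrable_normal_density[OF s(1)] by simp
  show "(LINT x|lborel. exp (- c * x\<^sup>2)) = sqrt (pi / c)"
    unfolding eq using integral_normal_density[OF s(1)] by simp
qed

text \<open>Half of the exponent absorbs the factor \<open>1 + y\<close>, so that errors of the form
  polynomial times Gaussian integrate like a Gaussian.\<close>

lemma poly_exp_bound:
  fixes c y :: real assumes "0 < c" "0 \<le> y"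
  shows "(1 + y) * exp (- c * y) \<le> (1 + 2 / c) * exp (- (c / 2) * y)"
proof -
  have "1 + c * y / 2 \<le> exp (c * y / 2)" by (rule exp_ge_add_one_self)
  then have "c * y / 2 \<le> exp (c * y / 2)" by linarith
  then have "y \<le> (2 / c) * exp (c * y / 2)" using assms by (simp add: field_simps)
  moreover have "1 \<le> exp (c * y / 2)" using assms by simp
  ultimately have "1 + y \<le> exp (c * y / 2) + (2 / c) * exp (c * y / 2)" by (rule add_mono[rotated])
  then have "1 + y \<le> (1 + 2 / c) * exp (c * y / 2)" by (simp only: distrib_right mult_1_left)
  then have "(1 + y) * exp (- c * y) \<le> (1 + 2 / c) * exp (c * y / 2) * exp (- c * y)"
    by (rule mult_right_mono) simp
  also have "\<dots> = (1 + 2 / c) * exp (- (c / 2) * y)" by (simp add: mult.assoc exp_add[symmetric])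
  finally show ?thesis .
qed

abbreviation (input) std_cdf :: "real \<Rightarrow> real" where
  "std_cdf \<equiv> cdf std_normal_distribution"

lemma std_normal_singleton: "measure std_normal_distribution {x} = 0"
proof -
  have "emeasure std_normal_distribution {x} = 0"
    by (subst emeasure_density) (auto intro!: nn_integral_null_set simp: null_sets_def)
  then show ?thesis by (simp add: measure_def)
qed

text \<open>The density is at most \<open>1\<close>. This pays for the distance of a point to the
  next integer.\<close>

lemma std_cdf_lipschitz:
  assumes "a \<le> b" shows "std_cdf b - std_cdf a \<le> b - a"
proof -
  interpret real_distribution std_normal_distribution by (rule real_dist_normal_dist)
  have "std_cdf b - std_cdf a = measure std_normal_distribution {a<..b}"
    using assms cdf_diff_eq[of a b] by (cases "a = b") auto
  also have "\<dots> = enn2real (\<integral>\<^sup>+x. ennreal (std_normal_density x) * indicator {a<..b} x \<partial>lborel)"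
    by (simp add: measure_def emeasure_density)
  also have "\<dots> \<le> enn2real (\<integral>\<^sup>+x. indicator {a<..b} x \<partial>lborel)"
  proof (rule enn2real_mono[OF nn_integral_mono])
    fix x :: real
    have "1 / sqrt (2 * pi) \<le> 1" using pi_ge_two by simp
    moreover have "exp (- x\<^sup>2 / 2) \<le> 1" by simp
    ultimately have "std_normal_density x \<le> 1 * 1" unfolding std_normal_density_def by (intro mult_mono) auto
    then show "ennreal (std_normal_density x) * indicator {a<..b} x \<le> indicator {a<..b} x"
      by (auto split: split_indicator)
  qed (use assms in simp)
  also have "\<dots> = b - a" using assms by simp
  finally show ?thesis .
qed

text \<open>Markov's inequality with the mean absolute value \<open>sqrt (2 / pi) \<le> 1\<close>.
  The rate \<open>1 / y\<close> suffices because \<open>y\<close> will be of order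
  \<open>sqrt n\<close>.\<close>

lemma std_cdf_tail:
  assumes "0 < y" shows "std_cdf (- y) \<le> 1 / y"
proof -
  interpret real_distribution std_normal_distribution by (rule real_dist_normal_dist)
  have int: "integrable std_normal_distribution (\<lambda>x. \<bar>x\<bar>)"
    using integrable_std_normal_distribution_moment[of 1] by (simp add: integrable_abs)
  have "std_cdf (- y) \<le> measure std_normal_distribution {x \<in> space std_normal_distribution. y \<le> \<bar>x\<bar>}"
    unfolding cdf_def using assms by (intro finite_measure_mono) auto
  also have "\<dots> \<le> (\<integral>x. \<bar>x\<bar> \<partial>std_normal_distribution) / y"
    by (rule integral_Markov_inequality_measure[OF int]) (use assms in auto)
  also have "(\<integral>x. \<bar>x\<bar> \<partial>std_normal_distribution) = (\<integral>x. std_normal_density x * \<bar>x\<bar> \<partial>lborel)"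
    by (subst integral_density) auto
  also have "\<dots> = sqrt (2 / pi)"
    using integral_normal_moment_abs_odd[of 1 0 0] by simp
  also have "\<dots> \<le> 1" using pi_ge_two by (simp add: real_sqrt_le_1_iff)
  finally show ?thesis using assms by (simp add: divide_right_mono)
qed

text \<open>Inversion for the law of \<open>m + s N\<close>, \<open>N\<close> standard normal, on
  \<open>{0<..b}\<close>; the mass below \<open>0\<close> remains as the second term of the
  limit.\<close>

lemma levy_inversion_affine_normal:
  fixes m s b :: real
  assumes s: "0 < s" and b: "0 \<le> b"
  shows "(\<lambda>T. 1 / (2 * pi) * (CLBINT \<theta>=-real T..real T. levy_kernel b \<theta> * (iexp (m * \<theta>) * of_real (exp (- (s * \<theta>)\<^sup>2 / 2)))))
    \<longlonglongrightarrow> of_real (std_cdf ((b - m) / s) - std_cdf (- m / s))"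
proof -
  interpret N: real_distribution std_normal_distribution by (rule real_dist_normal_dist)
  let ?h = "\<lambda>x. m + s * x"
  let ?G = "distr std_normal_distribution borel ?h"
  interpret G: real_distribution ?G by (rule N.real_distribution_distr) simp
  have inv: "(m + s * x = y) = (x = (y - m) / s)" for x y using s by (auto simp: field_simps)
  have sing: "measure ?G {y} = 0" for y
    using std_normal_singleton[of "(y - m) / s"] by (simp add: measure_distr vimage_def inv)
  have "measure ?G {0<..b} = measure std_normal_distribution {- m / s<..(b - m) / s}"
  proof -
    have "{x. 0 < m + s * x \<and> m + s * x \<le> b} = {- m / s<..(b - m) / s}"
      using s by (auto simp: field_simps)
    then show ?thesis by (simp add: measure_distr vimage_def)
  qed
  also have "\<dots> = std_cdf ((b - m) / s) - std_cdf (- m / s)"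
  proof (cases "b = 0")
    case False
    then have "- m / s < (b - m) / s" using s b by (intro divide_strict_right_mono) auto
    then show ?thesis by (rule N.cdf_diff_eq[symmetric])
  qed simp
  finally have meas: "measure ?G {0<..b} = std_cdf ((b - m) / s) - std_cdf (- m / s)" .
  have char: "char ?G \<theta> = iexp (m * \<theta>) * of_real (exp (- (s * \<theta>)\<^sup>2 / 2))" for \<theta>
  proof -
    have "char ?G \<theta> = (CLINT x|std_normal_distribution. iexp (\<theta> * (m + s * x)))"
      unfolding char_def by (subst integral_distr) auto
    also have "\<dots> = (CLINT x|std_normal_distribution. iexp (m * \<theta>) * iexp ((s * \<theta>) * x))"
      by (intro Bochner_Integration.integral_cong refl) (simp add: exp_add[symmetric] algebra_simps)
    also have "\<dots> = iexp (m * \<theta>) * char std_normal_distribution (s * \<theta>)"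
      unfolding char_def by simp
    finally show ?thesis by (simp add: char_std_normal_distribution)
  qed
  show ?thesis
    using G.Levy_Inversion[OF b sing sing] unfolding meas char levy_kernel_def by simp
qed

lemma norm_levy_kernel_le_const: "norm (levy_kernel b \<theta>) \<le> \<bar>b\<bar>"
proof (cases "\<theta> = 0")
  case False
  have "norm (iexp (- (\<theta> * b)) - 1) \<le> \<bar>\<theta> * b\<bar>"
    using iexp_approx1[of "- (\<theta> * b)" 0] by simp
  then have "norm (1 - iexp (- (\<theta> * b))) \<le> \<bar>\<theta>\<bar> * \<bar>b\<bar>" by (simp only: norm_minus_commute abs_mult)
  then show ?thesis using False unfolding levy_kernel_def norm_divide norm_mult by (simp add: field_simps)
qed (simp add: levy_kernel_def)

lemma levy_kernel_measurable [measurable]: "levy_kernel b \<in> borel_measurable borel"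
  unfolding levy_kernel_def[abs_def] by measurable

text \<open>On \<open>[-pi, pi]\<close> the difference of the integrands splits into the difference
  of the kernels times the Gaussian, which costs \<open>3\<close>, and the Dirichlet kernel times
  the difference of the characteristic functions, where \<open>6 / |\<theta>|\<close> cancels a
  factor \<open>|\<theta>|\<close> of the hypothesis. Both are dominated by
  \<open>exp (- d n \<theta>^2)\<close>, whose integral is of order
  \<open>1 / sqrt n\<close>.\<close>

lemma smoothing_bound:
  fixes p :: "nat \<Rightarrow> real" and c C mu s2 T :: real
  defines "A \<equiv> 3 + 6 * (C * (1 + 2 / c))" and "d \<equiv> min (s2 / 2) (c / 2)"
  assumes n: "1 \<le> n" and K: "K \<le> n" and s: "s = sqrt s2 * sqrt (real n)" and pos: "0 < s2" "0 < c" "0 \<le> C"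
    and T: "pi \<le> T"
    and cf: "\<And>\<theta>. \<bar>\<theta>\<bar> \<le> pi \<Longrightarrow>
      norm ((\<Sum>k\<le>n. p k * iexp (real k * \<theta>)) - iexp (mu * real n * \<theta>) * of_real (exp (- (s * \<theta>)\<^sup>2 / 2))) \<le>
        C * (\<bar>\<theta>\<bar> + real n * \<bar>\<theta>\<bar> ^ 3) * exp (- c * (real n * \<theta>\<^sup>2)) + C / (real n)\<^sup>2"
  shows "norm ((CLBINT \<theta>=-T..T. levy_kernel (real (Suc K)) \<theta> * (iexp (mu * real n * \<theta>) * of_real (exp (- (s * \<theta>)\<^sup>2 / 2))))
      - 2 * pi * (\<Sum>k\<le>K. p k)) \<le> A * sqrt (pi / (d * real n)) + 2 * pi * (real (Suc n) * (C / (real n)\<^sup>2))"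
proof -
  let ?q = "levy_kernel (real (Suc K))" and ?D = "dirichlet K"
  define \<Psi> where "\<Psi> \<theta> = iexp (mu * real n * \<theta>) * of_real (exp (- (s * \<theta>)\<^sup>2 / 2))" for \<theta>
  define \<phi> where "\<phi> \<theta> = (\<Sum>k\<le>n. p k * iexp (real k * \<theta>))" for \<theta>
  have d: "0 < d" using pos by (simp add: d_def)
  have A: "3 \<le> A" "6 * (C * (1 + 2 / c)) \<le> A" "0 \<le> C * (1 + 2 / c)" using pos by (simp_all add: A_def)
  have norm\<Psi>: "norm (\<Psi> \<theta>) = exp (- (s2 / 2) * (real n * \<theta>\<^sup>2))" for \<theta>
    using pos by (simp add: \<Psi>_def norm_mult s power_mult_distrib mult_ac)
  have exp_d: "exp (- (s2 / 2) * (real n * \<theta>\<^sup>2)) \<le> exp (- (d * real n) * \<theta>\<^sup>2)"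
    "exp (- (c / 2) * (real n * \<theta>\<^sup>2)) \<le> exp (- (d * real n) * \<theta>\<^sup>2)" for \<theta>
  proof -
    have "d * (real n * \<theta>\<^sup>2) \<le> (s2 / 2) * (real n * \<theta>\<^sup>2)" "d * (real n * \<theta>\<^sup>2) \<le> (c / 2) * (real n * \<theta>\<^sup>2)"
      by (intro mult_right_mono; simp add: d_def)+
    then show "exp (- (s2 / 2) * (real n * \<theta>\<^sup>2)) \<le> exp (- (d * real n) * \<theta>\<^sup>2)"
      "exp (- (c / 2) * (real n * \<theta>\<^sup>2)) \<le> exp (- (d * real n) * \<theta>\<^sup>2)" by (simp_all add: mult.assoc)
  qed
  have meas\<Psi> [measurable]: "\<Psi> \<in> borel_measurable borel" unfolding \<Psi>_def[abs_def] by measurable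
  define E where "E = C / (real n)\<^sup>2"
  have E0: "0 \<le> E" using pos by (simp add: E_def)
  let ?g = "\<lambda>\<theta>. A * exp (- (d * real n) * \<theta>\<^sup>2) + real (Suc n) * E * indicator {-pi..pi} \<theta>"
  let ?f1 = "\<lambda>\<theta>. indicator {-T..T} \<theta> *\<^sub>R (?q \<theta> * \<Psi> \<theta>)"
  let ?f2 = "\<lambda>\<theta>. indicator {-pi..pi} \<theta> *\<^sub>R (\<phi> \<theta> * ?D \<theta>)"
  have int1: "integrable lborel ?f1"
  proof (rule integrableI_bounded_set_indicator[where B = "real (Suc K)"])
    show "AE \<theta> in lborel. \<theta> \<in> {-T..T} \<longrightarrow> norm (?q \<theta> * \<Psi> \<theta>) \<le> real (Suc K)"
    proof (intro AE_I2 impI)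
      fix \<theta>
      have "norm (?q \<theta>) \<le> real (Suc K)" using norm_levy_kernel_le_const[of "real (Suc K)" \<theta>] by simp
      moreover have "norm (\<Psi> \<theta>) \<le> 1" unfolding norm\<Psi> using pos by simp
      ultimately have "norm (?q \<theta>) * norm (\<Psi> \<theta>) \<le> real (Suc K) * 1" by (intro mult_mono) auto
      then show "norm (?q \<theta> * \<Psi> \<theta>) \<le> real (Suc K)" by (simp add: norm_mult)
    qed
  qed (auto simp: emeasure_lborel_Icc_eq)
  have "continuous_on {-pi..pi} (\<lambda>\<theta>. \<phi> \<theta> * ?D \<theta>)"
    unfolding \<phi>_def dirichlet_def by (intro continuous_intros)
  then have int2: "integrable lborel ?f2"
    using borel_integrable_atLeastAtMost'[of "-pi" pi] by (simp add: set_integrable_def)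
  have intg: "integrable lborel ?g"
    using gaussian_integral(1)[of "d * real n"] d n by (intro Bochner_Integration.integrable_add integrable_mult_right) auto
  have bound: "norm (?f1 \<theta> - ?f2 \<theta>) \<le> ?g \<theta>" if "\<theta> \<noteq> 0" for \<theta>
  proof (cases "\<bar>\<theta>\<bar> \<le> pi")
    case True
    then have ind: "\<theta> \<in> {-T..T}" "\<theta> \<in> {-pi..pi}" using T by auto
    have "?f1 \<theta> - ?f2 \<theta> = (?q \<theta> - ?D \<theta>) * \<Psi> \<theta> + ?D \<theta> * (\<Psi> \<theta> - \<phi> \<theta>)"
      using ind by (simp add: algebra_simps)
    then have "norm (?f1 \<theta> - ?f2 \<theta>) \<le> norm (?q \<theta> - ?D \<theta>) * norm (\<Psi> \<theta>) + norm (?D \<theta>) * norm (\<phi> \<theta> - \<Psi> \<theta>)"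
      by (metis norm_triangle_ineq norm_mult norm_minus_commute)
    also have "norm (?q \<theta> - ?D \<theta>) * norm (\<Psi> \<theta>) \<le> 3 * exp (- (d * real n) * \<theta>\<^sup>2)"
      using levy_kernel_dirichlet[OF True that, of K] exp_d(1)[of \<theta>] unfolding norm\<Psi> by (intro mult_mono) auto
    also have "norm (?D \<theta>) * norm (\<phi> \<theta> - \<Psi> \<theta>) \<le> norm (?D \<theta>) * (C * (\<bar>\<theta>\<bar> + real n * \<bar>\<theta>\<bar> ^ 3) * exp (- c * (real n * \<theta>\<^sup>2)) + E)"
      using cf[OF True] by (intro mult_left_mono) (simp_all add: \<phi>_def \<Psi>_def E_def)
    also have "\<dots> = norm (?D \<theta>) * (C * (\<bar>\<theta>\<bar> + real n * \<bar>\<theta>\<bar> ^ 3) * exp (- c * (real n * \<theta>\<^sup>2))) + norm (?D \<theta>) * E"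
      by (simp only: distrib_left)
    \<comment> \<open>\<open>1 / |\<theta>|\<close> is not integrable at \<open>0\<close>, so the
      constant error \<open>E\<close> is multiplied by the trivial bound \<open>n + 1\<close> of the
      kernel; for this reason the hypothesis has \<open>C / n^2\<close>.\<close>
    also have "norm (?D \<theta>) * E \<le> real (Suc n) * E"
    proof (rule mult_right_mono[OF _ E0])
      show "norm (?D \<theta>) \<le> real (Suc n)" using norm_dirichlet_le[of K \<theta>] K by simp
    qed
    also have "norm (?D \<theta>) * (C * (\<bar>\<theta>\<bar> + real n * \<bar>\<theta>\<bar> ^ 3) * exp (- c * (real n * \<theta>\<^sup>2))) \<le>
        (6 / \<bar>\<theta>\<bar>) * (C * (\<bar>\<theta>\<bar> + real n * \<bar>\<theta>\<bar> ^ 3) * exp (- c * (real n * \<theta>\<^sup>2)))"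
      using pos by (intro mult_right_mono norm_dirichlet_le_inverse True that) auto
    also have "\<dots> = 6 * C * ((1 + real n * \<theta>\<^sup>2) * exp (- c * (real n * \<theta>\<^sup>2)))"
    proof -
      have "\<bar>\<theta>\<bar> + real n * \<bar>\<theta>\<bar> ^ 3 = \<bar>\<theta>\<bar> * (1 + real n * \<theta>\<^sup>2)"
        by (simp add: power3_eq_cube power2_eq_square algebra_simps)
      then show ?thesis using that by simp
    qed
    also have "\<dots> \<le> 6 * C * ((1 + 2 / c) * exp (- (c / 2) * (real n * \<theta>\<^sup>2)))"
      using pos by (intro mult_left_mono poly_exp_bound) auto
    also have "\<dots> \<le> 6 * C * ((1 + 2 / c) * exp (- (d * real n) * \<theta>\<^sup>2))"
      using pos by (intro mult_left_mono exp_d(2)) auto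
    finally show ?thesis using ind by (simp add: A_def algebra_simps)
  next
    case False
    \<comment> \<open>Beyond \<open>pi\<close> only the Gaussian integrand is left, and the Levy
      kernel is at most \<open>2 / pi \<le> 1\<close>.\<close>
    then have ind: "\<theta> \<notin> {-pi..pi}" by auto
    have "norm (?f1 \<theta>) \<le> norm (?q \<theta>) * norm (\<Psi> \<theta>)" by (simp add: norm_mult indicator_def)
    also have "norm (?q \<theta>) \<le> 1"
    proof -
      have "2 / \<bar>\<theta>\<bar> \<le> 1" using False pi_ge_two by simp
      then show ?thesis using norm_levy_kernel_le[OF that, of "real (Suc K)"] by linarith
    qed
    also have "1 * norm (\<Psi> \<theta>) \<le> A * exp (- (d * real n) * \<theta>\<^sup>2)"
      unfolding norm\<Psi> using A exp_d(1)[of \<theta>] by (intro mult_mono) auto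
    finally show ?thesis using ind by (simp add: mult_right_mono)
  qed
  have "(CLBINT \<theta>=-T..T. ?q \<theta> * \<Psi> \<theta>) = integral\<^sup>L lborel ?f1"
  proof -
    have "-T \<le> T" using T pi_gt_zero by linarith
    show ?thesis unfolding interval_integral_Icc[OF \<open>-T \<le> T\<close>] set_lebesgue_integral_def by (rule refl)
  qed
  moreover have "2 * pi * (\<Sum>k\<le>K. p k) = integral\<^sup>L lborel ?f2"
    using lattice_inversion[OF K, of p] by (simp add: set_lebesgue_integral_def \<phi>_def)
  ultimately have "(CLBINT \<theta>=-T..T. ?q \<theta> * \<Psi> \<theta>) - 2 * pi * (\<Sum>k\<le>K. p k) = integral\<^sup>L lborel (\<lambda>\<theta>. ?f1 \<theta> - ?f2 \<theta>)"
    using int1 int2 by (subst Bochner_Integration.integral_diff) auto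
  then have "norm ((CLBINT \<theta>=-T..T. ?q \<theta> * \<Psi> \<theta>) - 2 * pi * (\<Sum>k\<le>K. p k)) \<le> integral\<^sup>L lborel (\<lambda>\<theta>. norm (?f1 \<theta> - ?f2 \<theta>))"
    by (simp only: integral_norm_bound)
  also have "\<dots> \<le> integral\<^sup>L lborel ?g"
  proof (rule integral_mono_AE[OF integrable_norm[OF Bochner_Integration.integrable_diff[OF int1 int2]] intg])
    show "AE \<theta> in lborel. norm (?f1 \<theta> - ?f2 \<theta>) \<le> ?g \<theta>"
      using AE_lborel_singleton[of 0] bound by (auto elim!: eventually_mono)
  qed
  also have "\<dots> = A * sqrt (pi / (d * real n)) + real (Suc n) * E * (2 * pi)"
    using gaussian_integral[of "d * real n"] d n
    by (subst Bochner_Integration.integral_add) (auto simp: measure_def)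
  finally show ?thesis unfolding \<Psi>_def E_def by (simp add: mult_ac)
qed

section \<open>From characteristic functions to distribution functions\<close>

definition lattice_cdf :: "(nat \<Rightarrow> real) \<Rightarrow> nat \<Rightarrow> real \<Rightarrow> real" where
  "lattice_cdf p n y = (\<Sum>k | k \<le> n \<and> real k \<le> y. p k)"

definition lattice_cf :: "(nat \<Rightarrow> real) \<Rightarrow> nat \<Rightarrow> real \<Rightarrow> complex" where
  "lattice_cf p n \<theta> = (\<Sum>k\<le>n. p k * iexp (real k * \<theta>))"

definition gauss_cf :: "real \<Rightarrow> real \<Rightarrow> nat \<Rightarrow> real \<Rightarrow> complex" where
  "gauss_cf mu s2 n \<theta> = iexp (mu * real n * \<theta>) * of_real (exp (- (sqrt s2 * sqrt (real n) * \<theta>)\<^sup>2 / 2))"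

text \<open>The smoothing bound compares the mass of \<open>{0..K}\<close> with the Gaussian mass
  between \<open>0\<close> and \<open>K + 1\<close>. What remains is the Gaussian mass below
  \<open>0\<close>, of order \<open>1 / sqrt n\<close> by \<open>std_cdf_tail\<close>, and the step
  from a point to the next integer, of order \<open>1 / sqrt n\<close> by
  \<open>std_cdf_lipschitz\<close>. \<open>C'\<close> is chosen before \<open>n\<close> and
  \<open>p\<close> so that it can serve a whole sequence of laws.\<close>

lemma lattice_berry_esseen:
  fixes mu s2 c C :: real
  assumes pos: "0 < mu" "0 < s2" "0 < c" "0 \<le> C"
  shows "\<exists>C'. \<forall>n\<ge>1. \<forall>p. (\<forall>k. 0 \<le> p k) \<longrightarrow> (\<Sum>k\<le>n. p k) = 1 \<longrightarrow>
    (\<forall>\<theta>. \<bar>\<theta>\<bar> \<le> pi \<longrightarrow> norm (lattice_cf p n \<theta> - gauss_cf mu s2 n \<theta>) \<le>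
        C * (\<bar>\<theta>\<bar> + real n * \<bar>\<theta>\<bar> ^ 3) * exp (- c * (real n * \<theta>\<^sup>2)) + C / (real n)\<^sup>2) \<longrightarrow>
    (\<forall>t. \<bar>lattice_cdf p n (mu * real n + sqrt s2 * sqrt (real n) * t) - std_cdf t\<bar> \<le> C' / sqrt (real n))"
proof -
  interpret N: real_distribution std_normal_distribution by (rule real_dist_normal_dist)
  define A where "A = 3 + 6 * (C * (1 + 2 / c))"
  define d where "d = min (s2 / 2) (c / 2)"
  \<comment> \<open>\<open>C1\<close> bounds the smoothing error, \<open>C2\<close> adds the
    Gaussian mass below \<open>0\<close>, and \<open>C'\<close> the rounding to an integer.\<close>
  define C1 where "C1 = A * sqrt (pi / d) + 4 * pi * C"
  define C2 where "C2 = C1 + sqrt s2 / mu"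
  define C' where "C' = C2 + 1 / sqrt s2"
  have d: "0 < d" using pos by (simp add: d_def)
  have A0: "0 \<le> A" using pos by (simp add: A_def)
  have C1: "0 \<le> C1" using A0 pos d by (simp add: C1_def)
  have C2: "sqrt s2 / mu \<le> C2" using C1 by (simp add: C2_def)
  have C'1: "C2 \<le> C'" "0 \<le> 1 / sqrt s2" using pos by (simp_all add: C'_def)
  have res: "\<bar>(\<Sum>k | k \<le> n \<and> real k \<le> mu * real n + sqrt s2 * sqrt (real n) * t. p k) - std_cdf t\<bar> \<le> C' / sqrt (real n)"
    if n: "1 \<le> n" and p: "\<And>k. 0 \<le> p k" "(\<Sum>k\<le>n. p k) = 1"
      and cf: "\<And>\<theta>. \<bar>\<theta>\<bar> \<le> pi \<Longrightarrow>
        norm ((\<Sum>k\<le>n. p k * iexp (real k * \<theta>)) - iexp (mu * real n * \<theta>) * of_real (exp (- (sqrt s2 * sqrt (real n) * \<theta>)\<^sup>2 / 2))) \<le>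
        C * (\<bar>\<theta>\<bar> + real n * \<bar>\<theta>\<bar> ^ 3) * exp (- c * (real n * \<theta>\<^sup>2)) + C / (real n)\<^sup>2"
    for n t and p :: "nat \<Rightarrow> real"
  proof -
    define s where "s = sqrt s2 * sqrt (real n)"
    define m where "m = mu * real n"
    define r where "r = sqrt (real n)"
    have r: "1 \<le> r" "r\<^sup>2 = real n" using n by (simp_all add: r_def)
    have s: "0 < s" using pos n by (simp add: s_def)
    have nr: "real n = r * r" using r(2) by (simp add: power2_eq_square)
    have b1: "A * sqrt (pi / (d * real n)) + 2 * pi * (real (Suc n) * (C / (real n)\<^sup>2)) \<le> C1 / r"
    proof -
      have "A * sqrt (pi / (d * real n)) = A * sqrt (pi / d) / r" by (simp add: real_sqrt_divide real_sqrt_mult r_def)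
      moreover have "real (Suc n) * (C / (real n)\<^sup>2) \<le> 2 * C / r"
      proof -
        have "real (Suc n) \<le> 2 * real n" using n by simp
        then have "real (Suc n) * (C / (real n)\<^sup>2) \<le> 2 * real n * (C / (real n)\<^sup>2)" using pos by (intro mult_right_mono) auto
        also have "\<dots> = 2 * C / (r * r)" using n unfolding nr[symmetric] by (simp add: power2_eq_square)
        also have "\<dots> \<le> 2 * C / r" using r pos by (intro divide_left_mono) (auto simp: mult_left_le intro: mult_pos_pos)
        finally show ?thesis .
      qed
      then have "2 * pi * (real (Suc n) * (C / (real n)\<^sup>2)) \<le> 2 * pi * (2 * C / r)" by (intro mult_left_mono) auto
      ultimately show ?thesis by (simp add: C1_def add_divide_distrib)
    qed
    have tail: "std_cdf (- m / s) \<le> sqrt s2 / mu / r"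
    proof -
      have "m / s = mu * r / sqrt s2" unfolding m_def s_def r_def[symmetric] nr using r by simp
      then have "std_cdf (- m / s) \<le> 1 / (mu * r / sqrt s2)"
        using std_cdf_tail[of "mu * r / sqrt s2"] pos r by simp
      then show ?thesis by simp
    qed
    have main: "\<bar>std_cdf ((real (Suc K) - m) / s) - (\<Sum>k\<le>K. p k)\<bar> \<le> C2 / r" if K: "K \<le> n" for K
    proof -
      let ?J = "\<lambda>T. CLBINT \<theta>=-real T..real T. levy_kernel (real (Suc K)) \<theta> * (iexp (m * \<theta>) * of_real (exp (- (s * \<theta>)\<^sup>2 / 2)))"
      have "(\<lambda>T. norm (1 / (2 * pi) * ?J T - of_real (\<Sum>k\<le>K. p k))) \<longlonglongrightarrow>
          norm (of_real (std_cdf ((real (Suc K) - m) / s) - std_cdf (- m / s)) - complex_of_real (\<Sum>k\<le>K. p k))"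
        by (intro tendsto_intros levy_inversion_affine_normal s) simp
      moreover have "eventually (\<lambda>T. norm (1 / (2 * pi) * ?J T - of_real (\<Sum>k\<le>K. p k)) \<le> C1 / r) sequentially"
        using eventually_ge_at_top[of 4]
      proof eventually_elim
        case (elim T)
        then have T: "pi \<le> real T" using pi_less_4 by linarith
        have J: "norm (?J T - 2 * pi * (\<Sum>k\<le>K. p k)) \<le> C1 / r"
          using smoothing_bound[OF n K _ pos(2,3,4) T, of s p mu] cf b1 by (simp add: s_def m_def A_def d_def)
        have "1 / (2 * pi) * ?J T - of_real (\<Sum>k\<le>K. p k) = of_real (1 / (2 * pi)) * (?J T - 2 * pi * (\<Sum>k\<le>K. p k))"
          by (simp add: field_simps)
        then have "norm (1 / (2 * pi) * ?J T - of_real (\<Sum>k\<le>K. p k)) = 1 / (2 * pi) * norm (?J T - 2 * pi * (\<Sum>k\<le>K. p k))"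
          by (simp only: norm_mult norm_of_real) simp
        also have "\<dots> \<le> 1 * (C1 / r)"
          using J C1 r pi_ge_two by (intro mult_mono) auto
        finally show ?case by simp
      qed
      ultimately have "norm (of_real (std_cdf ((real (Suc K) - m) / s) - std_cdf (- m / s)) - complex_of_real (\<Sum>k\<le>K. p k)) \<le> C1 / r"
        by (rule tendsto_upperbound) simp
      then have "\<bar>std_cdf ((real (Suc K) - m) / s) - std_cdf (- m / s) - (\<Sum>k\<le>K. p k)\<bar> \<le> C1 / r"
        by (simp only: of_real_diff[symmetric] norm_of_real)
      moreover have "0 \<le> std_cdf (- m / s)" by (rule N.cdf_nonneg)
      ultimately show ?thesis using tail by (simp add: C2_def add_divide_distrib)
    qed
    define y where "y = m + s * t"
    have t: "t = (y - m) / s" using s by (simp add: y_def)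
    have set: "{k. k \<le> n \<and> real k \<le> mu * real n + sqrt s2 * sqrt (real n) * t} = {k. k \<le> n \<and> real k \<le> y}"
      by (simp add: y_def m_def s_def)
    \<comment> \<open>Left of the support the Gaussian tail decides; right of it the comparison with
      \<open>K = n\<close> is used, where the mass is already \<open>1\<close>.\<close>
    consider "y < 0" | "0 \<le> y" "y < real (Suc n)" | "real (Suc n) \<le> y" by linarith
    then have "\<bar>(\<Sum>k | k \<le> n \<and> real k \<le> y. p k) - std_cdf t\<bar> \<le> C' / r"
    proof cases
      case 1
      then have "{k. k \<le> n \<and> real k \<le> y} = {}" by auto
      then have "(\<Sum>k | k \<le> n \<and> real k \<le> y. p k) = 0" by (simp only: sum.empty)
      moreover have "std_cdf t \<le> std_cdf (- m / s)" unfolding t using 1 s by (intro N.cdf_nondecreasing divide_right_mono) auto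
      moreover have "sqrt s2 / mu / r \<le> C' / r" using C2 C'1 r by (intro divide_right_mono) auto
      ultimately show ?thesis using tail N.cdf_nonneg[of t] by simp
    next
      case 2
      define K where "K = nat \<lfloor>y\<rfloor>"
      have Ky: "real K \<le> y" "y < real (Suc K)" using 2(1) by (simp_all add: K_def) linarith
      have K: "K \<le> n" using Ky 2(2) by simp
      have "k \<le> n \<and> real k \<le> y \<longleftrightarrow> k \<le> K" for k
      proof
        assume "k \<le> n \<and> real k \<le> y"
        then have "real k < real (Suc K)" using Ky(2) by linarith
        then show "k \<le> K" by simp
      qed (use K Ky in auto)
      then have set': "{k. k \<le> n \<and> real k \<le> y} = {..K}" by auto
      have "std_cdf t \<le> std_cdf ((real (Suc K) - m) / s)"
        unfolding t using Ky s by (intro N.cdf_nondecreasing divide_right_mono) auto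
      moreover have "std_cdf ((real (Suc K) - m) / s) - std_cdf t \<le> 1 / sqrt s2 / r"
      proof -
        have "std_cdf ((real (Suc K) - m) / s) - std_cdf t \<le> (real (Suc K) - m) / s - t"
          unfolding t using Ky s by (intro std_cdf_lipschitz divide_right_mono) auto
        also have "\<dots> = (real (Suc K) - y) / s" unfolding t by (simp add: diff_divide_distrib)
        also have "\<dots> \<le> 1 / s" using Ky s by (intro divide_right_mono) auto
        finally show ?thesis by (simp add: s_def r_def)
      qed
      ultimately have "\<bar>(\<Sum>k\<le>K. p k) - std_cdf t\<bar> \<le> C2 / r + 1 / sqrt s2 / r" using main[OF K] by linarith
      also have "\<dots> = C' / r" by (simp add: C'_def add_divide_distrib)
      finally show ?thesis unfolding set' .
    next
      case 3
      then have set': "{k. k \<le> n \<and> real k \<le> y} = {..n}" by auto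
      have "std_cdf ((real (Suc n) - m) / s) \<le> std_cdf t"
        unfolding t using 3 s by (intro N.cdf_nondecreasing divide_right_mono) auto
      moreover have "std_cdf t \<le> 1" by (rule N.cdf_bounded_prob)
      ultimately have "\<bar>(\<Sum>k\<le>n. p k) - std_cdf t\<bar> \<le> C2 / r" using main[of n] p(2) by simp
      also have "\<dots> \<le> C' / r" using C'1 r by (intro divide_right_mono) auto
      finally show ?thesis unfolding set' .
    qed
    then show ?thesis unfolding set r_def .
  qed
  show ?thesis
    unfolding lattice_cdf_def lattice_cf_def gauss_cf_def
    apply (intro exI[of _ C'] allI impI)
    apply (rule res)
    apply assumption
    apply (drule spec, assumption)
    apply assumption
    apply (drule spec, erule mp, assumption)
    done
qed

section \<open>The dominant pole of the bivariate generating function\<close>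

text \<open>The zeros of \<open>F\<close> form a compact set on which \<open>N > x\<close>, so
  \<open>N\<close> stays above some \<open>R > x\<close> there; on the compact part
  \<open>N \<le> R\<close> the norm of \<open>F\<close> has a positive minimum.\<close>

lemma compact_gap:
  fixes N :: "'a :: metric_space \<Rightarrow> real" and F :: "'a \<Rightarrow> complex"
  assumes K: "compact K" and N: "continuous_on K N" and F: "continuous_on K F"
    and nz: "\<And>k. k \<in> K \<Longrightarrow> N k \<le> x \<Longrightarrow> F k \<noteq> 0"
  shows "\<exists>R>x. \<exists>c>0. \<forall>k\<in>K. N k \<le> R \<longrightarrow> c \<le> norm (F k)"
proof -
  define Z where "Z = {k \<in> K. F k = 0}"
  have closed: "closed K" using K by (rule compact_imp_closed)
  have "closed Z" unfolding Z_def by (rule continuous_closed_preimage_constant[OF F closed])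
  then have Z: "compact Z" using K by (metis (no_types, lifting) Z_def closed_Int_compact inf.absorb1 mem_Collect_eq subsetI inf_commute)
  have "\<exists>R>x. \<forall>k\<in>Z. R < N k"
  proof (cases "Z = {}")
    case True then show ?thesis by (intro exI[of _ "x + 1"]) auto
  next
    case False
    have "continuous_on Z N" by (rule continuous_on_subset[OF N]) (auto simp: Z_def)
    then obtain k where k: "k \<in> Z" "\<And>l. l \<in> Z \<Longrightarrow> N k \<le> N l"
      using continuous_attains_inf[OF Z False] by blast
    have "x < N k" using nz[of k] k(1) by (force simp: Z_def)
    then show ?thesis using k(2) by (intro exI[of _ "(x + N k) / 2"]) force
  qed
  then obtain R where R: "x < R" "\<And>k. k \<in> Z \<Longrightarrow> R < N k" by blast
  define L where "L = K \<inter> {k \<in> K. N k \<le> R}"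
  have "closed {k \<in> K. N k \<le> R}" by (rule continuous_on_closed_Collect_le[OF N continuous_on_const closed])
  then have L: "compact L" unfolding L_def by (rule compact_Int_closed[OF K])
  have "\<exists>c>0. \<forall>k\<in>L. c \<le> norm (F k)"
  proof (cases "L = {}")
    case True then show ?thesis by (intro exI[of _ 1]) auto
  next
    case False
    have "continuous_on L (\<lambda>k. norm (F k))"
      by (intro continuous_on_norm continuous_on_subset[OF F]) (auto simp: L_def)
    then obtain k where k: "k \<in> L" "\<And>l. l \<in> L \<Longrightarrow> norm (F k) \<le> norm (F l)"
      using continuous_attains_inf[OF L False] by blast
    have "F k \<noteq> 0" using k(1) R(2)[of k] by (force simp: L_def Z_def)
    then show ?thesis using k(2) by (intro exI[of _ "norm (F k)"]) auto
  qed
  then show ?thesis using R(1) by (auto simp: L_def)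
qed

text \<open>Without its principal part at \<open>\<rho>\<close> the function is holomorphic around
  the closed disc of radius \<open>R\<close>, so Cauchy's inequality bounds its coefficients; the
  principal part contributes the geometric main term.\<close>

lemma simple_pole_coeff_bound:
  fixes f H T :: "complex \<Rightarrow> complex"
  assumes f: "f has_fps_expansion F" and fHT: "\<And>z. f z = H z / T z"
    and H: "H holomorphic_on ball 0 1" and T: "T holomorphic_on ball 0 1"
    and R: "0 < R" "R < 1" and \<rho>: "norm \<rho> < R" "\<rho> \<noteq> 0" and T0: "T \<rho> = 0" "deriv T \<rho> \<noteq> 0"
    and nz: "\<And>z. norm z \<le> R \<Longrightarrow> z \<noteq> \<rho> \<Longrightarrow> T z \<noteq> 0"
    and B: "\<And>z. norm z = R \<Longrightarrow> norm (f z) \<le> B"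
  shows "norm (fps_nth F n - (- H \<rho> / (\<rho> * deriv T \<rho>)) / \<rho> ^ n) \<le> (B + norm (H \<rho> / deriv T \<rho>) / (R - norm \<rho>)) / R ^ n"
proof -
  \<comment> \<open>\<open>T\<close> divided by its linear factor, with the singularity removed;
    then \<open>f = M / (z - \<rho>)\<close> for \<open>M = H / W\<close>.\<close>
  define W where "W z = (if z = \<rho> then deriv T \<rho> else (T z - T \<rho>) / (z - \<rho>))" for z
  have W: "W holomorphic_on ball 0 1" unfolding W_def by (rule pole_lemma_open[OF T open_ball])
  define S where "S = {z \<in> ball 0 1. W z \<noteq> 0}"
  have Wnz: "W z \<noteq> 0" if "norm z \<le> R" for z using nz[OF that] T0 by (auto simp: W_def)
  have "open S"
  proof -
    have "S = ball 0 1 - W -` {0} \<inter> ball 0 1" by (auto simp: S_def)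
    also have "\<dots> = ball 0 1 \<inter> W -` (- {0})" by auto
    also have "open \<dots>" by (rule continuous_open_preimage[OF holomorphic_on_imp_continuous_on[OF W]]) auto
    finally show ?thesis .
  qed
  have RS: "cball 0 R \<subseteq> S" using Wnz R by (auto simp: S_def)
  define M where "M z = H z / W z" for z
  have M: "M holomorphic_on S"
    unfolding M_def by (intro holomorphic_on_divide holomorphic_on_subset[OF H] holomorphic_on_subset[OF W]) (auto simp: S_def)
  \<comment> \<open>\<open>f\<close> without the principal part
    \<open>M \<rho> / (z - \<rho>)\<close>.\<close>
  define Q where "Q z = (if z = \<rho> then deriv M \<rho> else (M z - M \<rho>) / (z - \<rho>))" for z
  have Q: "Q holomorphic_on S" unfolding Q_def by (rule pole_lemma_open[OF M \<open>open S\<close>])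
  have M\<rho>: "M \<rho> = H \<rho> / deriv T \<rho>" by (simp add: M_def W_def)
  have fQ: "f z = Q z + M \<rho> / (z - \<rho>)" if "z \<noteq> \<rho>" for z
    using that T0 by (simp add: Q_def M_def W_def fHT diff_divide_distrib)
  define G where "G = fps_expansion Q 0"
  have Qe: "Q has_fps_expansion G"
    unfolding G_def using RS R by (intro has_fps_expansion_fps_expansion[OF \<open>open S\<close> _ Q]) auto
  let ?geo = "Abs_fps (\<lambda>n. - (M \<rho> / \<rho>) / \<rho> ^ n)"
  have "(\<lambda>z. - (M \<rho> / \<rho>) * (1 / (1 - z / \<rho>))) has_fps_expansion fps_const (- (M \<rho> / \<rho>)) * (1 / (1 - fps_X / fps_const \<rho>))"
    by (intro fps_expansion_intros) (use \<rho> in auto)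
  moreover have "fps_const (- (M \<rho> / \<rho>)) * (1 / (1 - fps_X / fps_const \<rho>)) = ?geo"
  proof -
    have X: "fps_X / fps_const \<rho> = fps_const (1 / \<rho>) * fps_X" using \<rho> by (simp add: fps_divide_unit fps_const_inverse field_simps)
    have "(1 - fps_const (1 / \<rho>) * fps_X) * Abs_fps (\<lambda>n. (1 / \<rho>) ^ n) = 1"
      by (rule fps_ext) (auto simp: left_diff_distrib mult.assoc fps_mult_left_const_nth fps_X_mult_nth power_eq_if)
    then have "inverse (1 - fps_const (1 / \<rho>) * fps_X) = Abs_fps (\<lambda>n. (1 / \<rho>) ^ n)"
      by (rule fps_inverse_unique)
    then have eq: "1 / (1 - fps_X / fps_const \<rho>) = Abs_fps (\<lambda>n. (1 / \<rho>) ^ n)"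
      unfolding X by (subst fps_divide_unit) auto
    show ?thesis unfolding eq by (auto simp: fps_eq_iff power_divide)
  qed
  ultimately have "(\<lambda>z. - (M \<rho> / \<rho>) * (1 / (1 - z / \<rho>))) has_fps_expansion ?geo" by simp
  from has_fps_expansion_add[OF Qe this]
  have e1: "(\<lambda>z. Q z + - (M \<rho> / \<rho>) * (1 / (1 - z / \<rho>))) has_fps_expansion (G + ?geo)" .
  \<comment> \<open>At \<open>\<rho>\<close> itself \<open>f\<close> has the value \<open>0\<close>
    of a division by zero, so the equality is claimed near \<open>0\<close> only.\<close>
  have ev: "eventually (\<lambda>z. Q z + - (M \<rho> / \<rho>) * (1 / (1 - z / \<rho>)) = f z) (nhds 0)"
  proof -
    have "eventually (\<lambda>z. z \<in> - {\<rho>}) (nhds 0)" using \<rho> by (intro eventually_nhds_in_open) auto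
    then show ?thesis
    proof eventually_elim
      case (elim z)
      then have z: "z \<noteq> \<rho>" by simp
      then have "- (M \<rho> / \<rho>) * (1 / (1 - z / \<rho>)) = M \<rho> / (z - \<rho>)"
        using \<rho> by (simp add: divide_simps) (simp add: algebra_simps)
      then show ?case using fQ[OF z] by simp
    qed
  qed
  have "f has_fps_expansion (G + ?geo)" using has_fps_expansion_cong[OF ev refl] e1 by (rule iffD1)
  then have FG: "F = G + ?geo" using f fps_expansion_unique_complex by blast
  have "norm ((deriv ^^ n) Q 0) \<le> fact n * (B + norm (M \<rho>) / (R - norm \<rho>)) / R ^ n"
  proof (rule Cauchy_inequality)
    show "Q holomorphic_on ball 0 R" by (rule holomorphic_on_subset[OF Q]) (use RS in auto)
    show "continuous_on (cball 0 R) Q" by (rule continuous_on_subset[OF holomorphic_on_imp_continuous_on[OF Q] RS])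
    fix z :: complex assume "norm (0 - z) = R"
    then have z: "norm z = R" by simp
    then have "z \<noteq> \<rho>" using \<rho> by auto
    then have "Q z = f z - M \<rho> / (z - \<rho>)" using fQ by simp
    then have "norm (Q z) \<le> norm (f z) + norm (M \<rho>) / norm (z - \<rho>)" by (metis norm_triangle_ineq4 norm_divide)
    also have "norm (M \<rho>) / norm (z - \<rho>) \<le> norm (M \<rho>) / (R - norm \<rho>)"
    proof (rule divide_left_mono)
      show "R - norm \<rho> \<le> norm (z - \<rho>)" using norm_triangle_ineq2[of z \<rho>] z by simp
      show "0 < norm (z - \<rho>) * (R - norm \<rho>)" using \<open>z \<noteq> \<rho>\<close> \<rho> by simp
    qed simp
    finally show "norm (Q z) \<le> B + norm (M \<rho>) / (R - norm \<rho>)" using B[OF z] by linarith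
  qed (rule R(1))
  then have "norm (fps_nth G n) \<le> (B + norm (M \<rho>) / (R - norm \<rho>)) / R ^ n"
    by (simp add: G_def fps_expansion_def norm_divide field_simps)
  moreover have "fps_nth F n - (- H \<rho> / (\<rho> * deriv T \<rho>)) / \<rho> ^ n = fps_nth G n"
    unfolding FG by (simp add: M\<rho> field_simps)
  ultimately show ?thesis by (simp only: M\<rho>)
qed

lemma no_pole_coeff_bound:
  fixes f H T :: "complex \<Rightarrow> complex"
  assumes f: "f has_fps_expansion F" and fHT: "\<And>z. f z = H z / T z"
    and H: "H holomorphic_on ball 0 1" and T: "T holomorphic_on ball 0 1"
    and R: "0 < R" "R < 1" and nz: "\<And>z. norm z \<le> R \<Longrightarrow> T z \<noteq> 0"
    and B: "\<And>z. norm z = R \<Longrightarrow> norm (f z) \<le> B"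
  shows "norm (fps_nth F n) \<le> B / R ^ n"
proof -
  define S where "S = ball 0 1 \<inter> T -` (- {0})"
  have "open S" unfolding S_def by (rule continuous_open_preimage[OF holomorphic_on_imp_continuous_on[OF T]]) auto
  have RS: "cball 0 R \<subseteq> S" using nz R by (auto simp: S_def)
  have "(\<lambda>z. H z / T z) holomorphic_on S"
    by (intro holomorphic_on_divide holomorphic_on_subset[OF H] holomorphic_on_subset[OF T]) (auto simp: S_def)
  then have Q: "f holomorphic_on S" using fHT by presburger
  have "f has_fps_expansion fps_expansion f 0"
    using RS R by (intro has_fps_expansion_fps_expansion[OF \<open>open S\<close> _ Q]) auto
  then have F: "F = fps_expansion f 0" using f fps_expansion_unique_complex by blast
  have "norm ((deriv ^^ n) f 0) \<le> fact n * B / R ^ n"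
  proof (rule Cauchy_inequality)
    show "f holomorphic_on ball 0 R" by (rule holomorphic_on_subset[OF Q]) (use RS in auto)
    show "continuous_on (cball 0 R) f" by (rule continuous_on_subset[OF holomorphic_on_imp_continuous_on[OF Q] RS])
  qed (use R B in auto)
  then show ?thesis unfolding F by (simp add: fps_expansion_def norm_divide field_simps)
qed

section \<open>The root of \<open>x P(x) = 1\<close> and the pole that moves with
  \<open>u\<close>\<close>

lemma partition_gf_mono:
  assumes "0 \<le> a" "a \<le> b" "b < 1"
  shows "partition_gf a \<le> partition_gf b"
proof -
  have a: "(\<lambda>n. real (pnum n) * a ^ n) sums partition_gf a" using assms by (intro partition_gf_sums) auto
  have b: "(\<lambda>n. real (pnum n) * b ^ n) sums partition_gf b" using assms by (intro partition_gf_sums) auto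
  show ?thesis by (rule sums_le[OF _ a b]) (use assms in \<open>auto intro!: mult_left_mono power_mono\<close>)
qed

text \<open>The analysis is carried out at an abstract root, and the numerical part supplies
  \<open>x0\<close>. The bound \<open>x < 1 / 2\<close> makes \<open>end_gf\<close> nonzero at the
  root.\<close>

locale partition_root =
  fixes x :: real
  assumes x: "0 < x" "x < 1" and x_half: "x < 1 / 2" and root: "x * partition_gf x = 1"
begin

text \<open>All coefficients are nonnegative, so the series of \<open>step_gf u z\<close> is
  dominated termwise by that of \<open>x P(x) = 1\<close>. If the sums agree, so do the real parts
  of all terms: the term of index \<open>0\<close>, which carries no \<open>u\<close>, yields
  \<open>z = x\<close>, and the next one \<open>u = 1\<close>.\<close>

lemma step_gf_eq_1:
  assumes z: "norm z \<le> x" and u: "norm u = 1" and eq: "step_gf u z = 1"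
  shows "z = of_real x" "u = 1"
proof -
  let ?f = "\<lambda>m. if m = 0 then z else u * of_nat (pnum m) * z ^ Suc m"
  let ?g = "\<lambda>m. real (pnum m) * x ^ Suc m"
  have z1: "norm z < 1" using z x by simp
  have "(\<lambda>m. u * z * (of_nat (pnum m) * z ^ m)) sums (u * z * Pc z)" by (rule sums_mult[OF Pc_sums[OF z1]])
  then have "(\<lambda>m. u * z * (of_nat (pnum m) * z ^ m) + (if m = 0 then z - u * z else 0)) sums (u * z * Pc z + (z - u * z))"
    by (rule sums_add) (rule sums_single[of 0 "\<lambda>_. z - u * z"])
  moreover have "(\<lambda>m. u * z * (of_nat (pnum m) * z ^ m) + (if m = 0 then z - u * z else 0)) = ?f"
    by (auto simp: pnum_0)
  moreover have "u * z * Pc z + (z - u * z) = 1" using eq by (simp add: step_gf_def algebra_simps)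
  ultimately have f: "?f sums 1" by simp
  have "(\<lambda>m. x * (real (pnum m) * x ^ m)) sums (x * partition_gf x)"
    using x by (intro sums_mult partition_gf_sums) auto
  then have g: "?g sums 1" by (simp add: root mult_ac)
  have "(\<lambda>m. ?g m - Re (?f m)) sums (1 - Re 1)" by (intro sums_diff g sums_Re f)
  then have s0: "(\<lambda>m. ?g m - Re (?f m)) sums 0" by simp
  have nn: "0 \<le> ?g m - Re (?f m)" for m
  proof -
    have "Re (?f m) \<le> norm (?f m)" by (rule complex_Re_le_cmod)
    also have "\<dots> = real (pnum m) * norm z ^ Suc m" using u by (simp add: norm_mult norm_power pnum_0)
    also have "\<dots> \<le> ?g m" using z by (intro mult_left_mono power_mono) auto
    finally show ?thesis by simp
  qed
  have "\<forall>m. ?g m - Re (?f m) = 0"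
    using suminf_eq_zero_iff[OF sums_summable[OF s0] nn] sums_unique[OF s0] by simp
  then have eqs: "Re (?f m) = ?g m" for m by (metis eq_iff_diff_eq_0)
  have Rez: "Re z = x" using eqs[of 0] by (simp add: pnum_0)
  have "(norm z)\<^sup>2 \<le> x\<^sup>2" using z by (intro power_mono) auto
  then have "Im z = 0" using Rez by (simp add: cmod_power2)
  then show zx: "z = of_real x" using Rez by (simp add: complex_eq_iff)
  have p1: "real (pnum 1) \<noteq> 0" using pnum_pos[of 1] by simp
  have "Re (u * of_nat (pnum 1) * z ^ Suc 1) = Re u * (real (pnum 1) * x ^ Suc 1)"
    by (simp add: zx power2_eq_square)
  then have "Re u * (real (pnum 1) * x ^ Suc 1) = real (pnum 1) * x ^ Suc 1" using eqs[of 1] by simp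
  then have Reu: "Re u = 1" using p1 x by simp
  have "(norm u)\<^sup>2 = (Re u)\<^sup>2 + (Im u)\<^sup>2" by (rule cmod_power2)
  then have "Im u = 0" using u Reu by simp
  then show "u = 1" using Reu by (simp add: complex_eq_iff)
qed

lemma step_gf_holomorphic: "step_gf u holomorphic_on ball 0 1"
  unfolding step_gf_def[abs_def] by (intro holomorphic_intros)

lemma end_gf_holomorphic: "end_gf holomorphic_on ball 0 1"
  unfolding end_gf_def[abs_def] by (intro holomorphic_intros) auto

text \<open>Separates the variables: in the unit disc \<open>step_gf u z = 1\<close> means
  \<open>u * wgf z = 1\<close>.\<close>

definition wgf :: "complex \<Rightarrow> complex" where
  "wgf z = z * (Pc z - 1) / (1 - z)"

lemma wgf_holomorphic: "wgf holomorphic_on ball 0 1"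
  unfolding wgf_def[abs_def] by (intro holomorphic_intros) auto

lemma step_gf_wgf: "z \<noteq> 1 \<Longrightarrow> 1 - step_gf u z = (1 - z) * (1 - u * wgf z)"
  by (simp add: step_gf_def wgf_def field_simps)

lemma step_gf_eq_1_iff: "norm z < 1 \<Longrightarrow> step_gf u z = 1 \<longleftrightarrow> u * wgf z = 1"
proof -
  assume "norm z < 1"
  then have "z \<noteq> 1" by auto
  then show ?thesis using step_gf_wgf[of z u] by auto
qed

lemma Pc_x: "of_real x * Pc (of_real x) = 1"
  using x root by (simp add: Pc_of_real of_real_mult[symmetric] del: of_real_mult)

lemma wgf_x: "wgf (of_real x) = 1"
proof -
  have "step_gf 1 (of_real x) = 1" using Pc_x by (simp add: step_gf_def)
  then show ?thesis using step_gf_eq_1_iff[of "of_real x" 1] x by simp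
qed

definition P1 :: real where "P1 = deriv partition_gf x"
definition P2 :: real where "P2 = deriv (deriv partition_gf) x"

lemma Pc_real_diffs:
  assumes y: "0 < y" "y < 1"
  shows "(partition_gf has_real_derivative Re (deriv Pc (of_real y))) (at y)"
    "((\<lambda>y. Re (deriv Pc (of_real y))) has_real_derivative Re (deriv (deriv Pc) (of_real y))) (at y)"
proof -
  have yb: "of_real y \<in> ball (0 :: complex) 1" using y by simp
  have re: "((\<lambda>y. Re (f (of_real y))) has_real_derivative Re (deriv f (of_real y))) (at y)"
    if "f holomorphic_on ball 0 1" for f :: "complex \<Rightarrow> complex"
  proof -
    have "(f has_field_derivative deriv f (of_real y)) (at (of_real y))"
      by (rule holomorphic_derivI[OF that open_ball yb])
    then have "((\<lambda>y. f (of_real y)) has_vector_derivative deriv f (of_real y)) (at y)"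
      by (rule has_vector_derivative_real_field)
    then show ?thesis unfolding has_real_derivative_iff_has_vector_derivative by (rule bounded_linear.has_vector_derivative[OF bounded_linear_Re])
  qed
  have "((\<lambda>y. Re (Pc (of_real y))) has_real_derivative Re (deriv Pc (of_real y))) (at y)" by (rule re[OF Pc_holomorphic])
  then show "(partition_gf has_real_derivative Re (deriv Pc (of_real y))) (at y)"
    by (rule has_field_derivative_transform_within_open[of _ _ _ "{0<..<1}"]) (use y Pc_of_real in auto)
  show "((\<lambda>y. Re (deriv Pc (of_real y))) has_real_derivative Re (deriv (deriv Pc) (of_real y))) (at y)"
    by (rule re[OF holomorphic_deriv[OF Pc_holomorphic open_ball]])
qed

text \<open>The imaginary part vanishes along the interval, hence so does its derivative.\<close>

lemma real_on_reals_deriv: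
  assumes "f holomorphic_on ball 0 1" "\<And>y. 0 < y \<Longrightarrow> y < 1 \<Longrightarrow> f (of_real y) \<in> \<real>" "0 < y" "y < (1 :: real)"
  shows "deriv f (of_real y) \<in> \<real>"
proof -
  have yb: "of_real y \<in> ball (0 :: complex) 1" using assms by simp
  have "(f has_field_derivative deriv f (of_real y)) (at (of_real y))"
    by (rule holomorphic_derivI[OF assms(1) open_ball yb])
  then have "((\<lambda>y. f (of_real y)) has_vector_derivative deriv f (of_real y)) (at y)"
    by (rule has_vector_derivative_real_field)
  then have "((\<lambda>y. Im (f (of_real y))) has_real_derivative Im (deriv f (of_real y))) (at y)"
    unfolding has_real_derivative_iff_has_vector_derivative by (rule bounded_linear.has_vector_derivative[OF bounded_linear_Im])
  moreover have "((\<lambda>y. Im (f (of_real y))) has_real_derivative 0) (at y)"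
    by (rule has_field_derivative_transform_within_open[of "\<lambda>_. 0" _ _ "{0<..<1}"])
      (use assms in \<open>auto simp: complex_is_Real_iff\<close>)
  ultimately have "Im (deriv f (of_real y)) = 0" by (rule DERIV_unique)
  then show ?thesis by (simp add: complex_is_Real_iff)
qed

lemma deriv_Pc_x: "deriv Pc (of_real x) = of_real P1" "deriv (deriv Pc) (of_real x) = of_real P2"
proof -
  have r1: "deriv Pc (of_real y) \<in> \<real>" if "0 < y" "y < 1" for y
    by (rule real_on_reals_deriv[OF Pc_holomorphic _ that]) (simp add: Pc_of_real)
  have r2: "deriv (deriv Pc) (of_real x) \<in> \<real>"
    by (rule real_on_reals_deriv[OF holomorphic_deriv[OF Pc_holomorphic open_ball] _ x]) (rule r1)
  have d1: "deriv partition_gf y = Re (deriv Pc (of_real y))" if "0 < y" "y < 1" for y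
    by (rule DERIV_imp_deriv[OF Pc_real_diffs(1)[OF that]])
  have "(deriv partition_gf has_real_derivative Re (deriv (deriv Pc) (of_real x))) (at x)"
    by (rule has_field_derivative_transform_within_open[OF Pc_real_diffs(2)[OF x], of "{0<..<1}"]) (use x d1 in auto)
  then have "P2 = Re (deriv (deriv Pc) (of_real x))" unfolding P2_def by (rule DERIV_imp_deriv)
  then show "deriv (deriv Pc) (of_real x) = of_real P2" using r2 by (simp add: of_real_Re)
  show "deriv Pc (of_real x) = of_real P1" using r1[OF x] d1[OF x] by (simp add: P1_def of_real_Re)
qed

lemma P1_nonneg: "0 \<le> P1"
proof -
  have "(partition_gf has_real_derivative P1) (at x)"
    using Pc_real_diffs(1)[OF x] deriv_Pc_x(1) by simp
  moreover have mono_on: "mono_on {0<..<1} partition_gf" by (rule mono_onI) (rule partition_gf_mono, auto)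
  ultimately show ?thesis using mono_on_imp_deriv_nonneg[OF mono_on, of P1 x] x by (simp add: interior_open)
qed

text \<open>As \<open>P(x) = 1 / x\<close>, this is \<open>x (P + x P')\<close>, and so
  \<open>mu\<close> is \<open>(P - 1) / (P + x P')\<close>.\<close>

definition D :: real where "D = 1 + x\<^sup>2 * P1"
definition mu :: real where "mu = (1 - x) / D"
text \<open>The form in which implicit differentiation delivers the second derivative;
  \<open>root_x0_sg2\<close> identifies it with \<open>hdv_sigma2\<close>.\<close>

definition sg2 :: real where "sg2 = (x * mu - mu * x\<^sup>2 * P1 + mu\<^sup>2 * (2 * x\<^sup>2 * P1 + x ^ 3 * P2)) / D"

lemma D_pos: "1 \<le> D"
  using P1_nonneg by (simp add: D_def)

lemma wgf_deriv_x: "(wgf has_field_derivative of_real (D / (x * (1 - x)))) (at (of_real x))"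
proof -
  have xb: "of_real x \<in> ball (0 :: complex) 1" and x1: "1 - complex_of_real x \<noteq> 0" and x0: "complex_of_real x \<noteq> 0"
    using x by (auto simp: of_real_eq_1_iff)
  have P: "(Pc has_field_derivative of_real P1) (at (of_real x))"
    using holomorphic_derivI[OF Pc_holomorphic open_ball xb] by (simp add: deriv_Pc_x)
  have Px: "Pc (of_real x) = 1 / of_real x" using Pc_x x0 by (simp add: field_simps)
  have "((\<lambda>z. z * (Pc z - 1) / (1 - z)) has_field_derivative
      ((of_real x * of_real P1 + (Pc (of_real x) - 1)) * (1 - of_real x) + of_real x * (Pc (of_real x) - 1)) / ((1 - of_real x) * (1 - of_real x))) (at (of_real x))"
    by (rule derivative_eq_intros P refl x1 | simp)+
  moreover have "((of_real x * of_real P1 + (Pc (of_real x) - 1)) * (1 - of_real x) + of_real x * (Pc (of_real x) - 1)) / ((1 - of_real x) * (1 - of_real x)) =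
      complex_of_real (D / (x * (1 - x)))"
  proof -
    have "((X * p + (1 / X - 1)) * (1 - X) + X * (1 / X - 1)) / ((1 - X) * (1 - X)) = (1 + X\<^sup>2 * p) / (X * (1 - X))"
      if "X \<noteq> 0" "1 - X \<noteq> 0" for X p :: complex
    proof -
      have "X * (1 / X - 1) = 1 - X" using that by (simp add: right_diff_distrib)
      then have "(X * p + (1 / X - 1)) * (1 - X) + X * (1 / X - 1) = (X * p + 1 / X) * (1 - X)" by (simp add: algebra_simps)
      moreover have "X * p + 1 / X = (1 + X\<^sup>2 * p) / X" using that by (simp add: field_simps power2_eq_square)
      ultimately show ?thesis using that by simp
    qed
    from this[OF x0 x1, of "of_real P1"] show ?thesis unfolding Px D_def by simp
  qed
  ultimately show ?thesis unfolding wgf_def[abs_def] by simp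
qed

text \<open>The pole in a logarithmic coordinate:
  \<open>(x / \<rho>)^n = exp (n * \<psi> \<tau>)\<close>, so \<open>\<psi>\<close> acts as a
  cumulant generating function per vertex.\<close>

definition root_branch :: "(complex \<Rightarrow> complex) \<Rightarrow> complex \<Rightarrow> complex" where
  "root_branch \<psi> \<tau> = of_real x * exp (- \<psi> \<tau>)"

text \<open>With \<open>z = x exp (- s)\<close> and \<open>u = exp \<tau>\<close> the pole equation
  reads \<open>q s = \<tau>\<close> for \<open>q s = - Ln (wgf (x exp (- s)))\<close>. The
  derivative of \<open>q\<close> at \<open>0\<close> is \<open>D / (1 - x)\<close>, which is not
  zero, so \<open>q\<close> is injective near \<open>0\<close>, and \<open>\<psi>\<close> is its
  holomorphic inverse.\<close>

lemma pole_branch: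
  obtains \<delta> \<epsilon> \<psi> where "0 < \<delta>" "\<delta> \<le> 1" "0 < \<epsilon>" "\<psi> holomorphic_on ball 0 \<delta>" "\<psi> 0 = 0"
    "\<And>\<tau>. \<tau> \<in> ball 0 \<delta> \<Longrightarrow> norm (root_branch \<psi> \<tau>) < 1"
    "\<And>\<tau>. \<tau> \<in> ball 0 \<delta> \<Longrightarrow> step_gf (exp \<tau>) (root_branch \<psi> \<tau>) = 1"
    "\<And>\<tau> z. \<tau> \<in> ball 0 \<delta> \<Longrightarrow> z \<in> ball (of_real x) \<epsilon> \<Longrightarrow> norm z < 1 \<Longrightarrow> step_gf (exp \<tau>) z = 1 \<Longrightarrow> z = root_branch \<psi> \<tau>"
proof -
  have x0: "complex_of_real x \<noteq> 0" using x by simp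
  \<comment> \<open>The half plane in which \<open>x exp (- s)\<close> stays in the unit
    disc.\<close>
  define V where "V = {s. ln x < Re s}"
  have "open V" unfolding V_def by (rule open_halfspace_Re_gt)
  have V1: "norm (of_real x * exp (- s)) < 1" if "s \<in> V" for s
  proof -
    have "norm (of_real x * exp (- s)) = x * exp (- Re s)" using x by (simp only: norm_mult norm_of_real norm_exp_eq_Re) simp
    also have "\<dots> = exp (ln x - Re s)" using x by (simp add: exp_diff exp_minus divide_inverse)
    also have "\<dots> < 1" using that by (simp add: V_def)
    finally show ?thesis .
  qed
  define v where "v s = wgf (of_real x * exp (- s))" for s
  have vh: "v holomorphic_on V"
    unfolding v_def
    by (rule holomorphic_on_compose_gen[where g = wgf and t = "ball 0 1", unfolded comp_def])
       (use V1 in \<open>auto intro!: holomorphic_intros wgf_holomorphic\<close>)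
  have v0: "v 0 = 1" by (simp add: v_def wgf_x)
  have zV: "0 \<in> V" using x by (simp add: V_def)
  define S0 where "S0 = V \<inter> v -` (- \<real>\<^sub>\<le>\<^sub>0)"
  have "open S0" unfolding S0_def
    by (rule continuous_open_preimage[OF holomorphic_on_imp_continuous_on[OF vh] \<open>open V\<close>]) auto
  have z0: "0 \<in> S0" using zV by (simp add: S0_def v0)
  define q where "q s = - Ln (v s)" for s
  have qh: "q holomorphic_on S0"
    unfolding q_def by (intro holomorphic_intros holomorphic_on_subset[OF vh]) (auto simp: S0_def)
  have q0: "q 0 = 0" by (simp add: q_def v0)
  have "(v has_field_derivative of_real (D / (x * (1 - x))) * (of_real x * (exp (- 0) * - 1))) (at 0)"
    unfolding v_def
    by (rule DERIV_chain2[where f = wgf]) (use wgf_deriv_x in \<open>auto intro!: derivative_eq_intros\<close>)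
  moreover have "complex_of_real (D / (x * (1 - x))) * (of_real x * (exp (- 0) * - 1)) = - complex_of_real (D / (x * (1 - x)) * x)"
    by simp
  moreover have "D / (x * (1 - x)) * x = D / (1 - x)" using x by simp
  ultimately have v': "(v has_field_derivative - of_real (D / (1 - x))) (at 0)" by simp
  have "(q has_field_derivative - (inverse (v 0) * - of_real (D / (1 - x)))) (at 0)"
    unfolding q_def by (intro DERIV_minus DERIV_chain2[OF _ v']) (rule has_field_derivative_Ln, simp add: v0)
  then have "deriv q 0 = of_real (D / (1 - x))" using v0 by (simp add: DERIV_imp_deriv)
  then have "deriv q 0 \<noteq> 0" using D_pos x by simp
  then obtain r where r: "0 < r" "ball 0 r \<subseteq> S0" "inj_on q (ball 0 r)"
    using has_complex_derivative_locally_injective[OF qh z0 \<open>open S0\<close>] by blast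
  have qh': "q holomorphic_on ball 0 r" by (rule holomorphic_on_subset[OF qh r(2)])
  obtain g where g: "g holomorphic_on q ` ball 0 r" "\<And>s. s \<in> ball 0 r \<Longrightarrow> g (q s) = s"
    using holomorphic_has_inverse[OF qh' open_ball r(3)] by blast
  have "open (q ` ball 0 r)" by (rule open_mapping_thm3[OF qh' open_ball r(3)])
  moreover have "0 \<in> q ` ball 0 r" using q0 r(1) by (intro image_eqI[of _ _ 0]) auto
  ultimately obtain d0 where d0: "0 < d0" "ball 0 d0 \<subseteq> q ` ball 0 r" by (meson openE)
  \<comment> \<open>At most \<open>1\<close>, so that the principal logarithm recovers
    \<open>\<tau>\<close> from \<open>exp (- \<tau>)\<close>.\<close>
  define \<delta> where "\<delta> = min d0 1"
  have \<delta>: "0 < \<delta>" "\<delta> \<le> 1" "ball 0 \<delta> \<subseteq> q ` ball 0 r" using d0 by (auto simp: \<delta>_def)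
  have gs: "g \<tau> \<in> ball 0 r \<and> q (g \<tau>) = \<tau>" if t: "\<tau> \<in> ball 0 \<delta>" for \<tau>
  proof -
    obtain s where "s \<in> ball 0 r" "\<tau> = q s" using t \<delta>(3) by blast
    then show ?thesis using g(2) by simp
  qed
  have "isCont (\<lambda>z. - Ln (z / of_real x)) (of_real x)"
    using x0 by (intro continuous_intros) auto
  then have "((\<lambda>z. - Ln (z / of_real x)) \<longlongrightarrow> 0) (nhds (of_real x))"
    using x0 tendsto_at_iff_tendsto_nhds[of "\<lambda>z. - Ln (z / of_real x)" "of_real x"] by (simp add: isCont_def)
  then have "eventually (\<lambda>z. - Ln (z / of_real x) \<in> ball 0 r) (nhds (of_real x))"
    by (rule topological_tendstoD) (use r in auto)
  then obtain e0 where e0: "0 < e0" "\<And>z. dist z (of_real x) < e0 \<Longrightarrow> - Ln (z / of_real x) \<in> ball 0 r"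
    unfolding eventually_nhds_metric by blast
  \<comment> \<open>At most \<open>x\<close>, so that the ball around \<open>x\<close> avoids
    \<open>0\<close>.\<close>
  define \<epsilon> where "\<epsilon> = min e0 x"
  have \<epsilon>: "0 < \<epsilon>" using e0 x by (simp add: \<epsilon>_def)
  show thesis
  proof (rule that[of \<delta> \<epsilon> g])
    show "g holomorphic_on ball 0 \<delta>" by (rule holomorphic_on_subset[OF g(1) \<delta>(3)])
    show "g 0 = 0" using g(2)[of 0] r(1) q0 by simp
    show "norm (root_branch g \<tau>) < 1" if "\<tau> \<in> ball 0 \<delta>" for \<tau>
      using gs[OF that] r(2) V1 by (auto simp: root_branch_def S0_def)
    show "step_gf (exp \<tau>) (root_branch g \<tau>) = 1" if t: "\<tau> \<in> ball 0 \<delta>" for \<tau>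
    proof -
      have s: "g \<tau> \<in> S0" "q (g \<tau>) = \<tau>" using gs[OF t] r(2) by auto
      have n1: "norm (root_branch g \<tau>) < 1" using s(1) V1 by (auto simp: root_branch_def S0_def)
      have "v (g \<tau>) \<noteq> 0" using s(1) by (auto simp: S0_def)
      then have "v (g \<tau>) = exp (- q (g \<tau>))" by (simp add: q_def)
      then have "exp \<tau> * v (g \<tau>) = 1" using s(2) by (simp add: exp_minus)
      then show ?thesis using step_gf_eq_1_iff[OF n1] by (simp add: v_def root_branch_def)
    qed
    show "z = root_branch g \<tau>"
      if t: "\<tau> \<in> ball 0 \<delta>" and z: "z \<in> ball (of_real x) \<epsilon>" "norm z < 1" and eq: "step_gf (exp \<tau>) z = 1" for \<tau> z
    proof -
      define s where "s = - Ln (z / of_real x)"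
      have sr: "s \<in> ball 0 r" unfolding s_def by (rule e0(2)) (use z in \<open>simp add: \<epsilon>_def dist_commute\<close>)
      have "z \<noteq> 0" using z(1) x by (auto simp: \<epsilon>_def dist_norm)
      then have zs: "z = of_real x * exp (- s)" using x0 by (simp add: s_def)
      have "exp \<tau> * wgf z = 1" using eq step_gf_eq_1_iff[OF z(2)] by simp
      then have "v s = exp (- \<tau>)" by (simp add: v_def zs exp_minus field_simps)
      moreover have "\<bar>Im \<tau>\<bar> < 1" using t \<delta>(2) abs_Im_le_cmod[of \<tau>] by simp
      then have "Ln (exp (- \<tau>)) = - \<tau>" using pi_ge_two by (intro Ln_exp) auto
      ultimately have "q s = \<tau>" by (simp add: q_def)
      then have "s = g \<tau>" using g(2)[OF sr] by simp
      then show ?thesis by (simp add: zs root_branch_def)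
    qed
  qed (use \<delta> \<epsilon> in auto)
qed

end

context partition_root
begin

text \<open>The pole equation is differentiated in \<open>\<tau>\<close>, and the equation itself
  then eliminates \<open>Pc - 1\<close>.\<close>

lemma root_branch_deriv:
  assumes \<delta>: "\<psi> holomorphic_on ball 0 \<delta>"
    and n1: "\<And>\<tau>. \<tau> \<in> ball 0 \<delta> \<Longrightarrow> norm (root_branch \<psi> \<tau>) < 1"
    and eq: "\<And>\<tau>. \<tau> \<in> ball 0 \<delta> \<Longrightarrow> step_gf (exp \<tau>) (root_branch \<psi> \<tau>) = 1"
    and t: "\<tau> \<in> ball 0 \<delta>"
  shows "1 - root_branch \<psi> \<tau> = deriv \<psi> \<tau> * (1 + exp \<tau> * (root_branch \<psi> \<tau>)\<^sup>2 * deriv Pc (root_branch \<psi> \<tau>))"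
proof -
  let ?z = "root_branch \<psi>"
  define E where "E \<tau> = exp \<tau> * ?z \<tau> * (Pc (?z \<tau>) - 1) + ?z \<tau>" for \<tau>
  have \<psi>': "(\<psi> has_field_derivative deriv \<psi> \<tau>) (at \<tau>)" by (rule holomorphic_derivI[OF \<delta> open_ball t])
  have z': "(?z has_field_derivative - deriv \<psi> \<tau> * ?z \<tau>) (at \<tau>)"
    unfolding root_branch_def by (rule derivative_eq_intros \<psi>' refl | simp)+
  have "?z \<tau> \<in> ball 0 1" using n1[OF t] by simp
  then have P': "(Pc has_field_derivative deriv Pc (?z \<tau>)) (at (?z \<tau>))" by (rule holomorphic_derivI[OF Pc_holomorphic open_ball])
  have Pz': "((\<lambda>\<tau>. Pc (?z \<tau>)) has_field_derivative deriv Pc (?z \<tau>) * (- deriv \<psi> \<tau> * ?z \<tau>)) (at \<tau>)"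
    by (rule DERIV_chain2[OF P' z'])
  have "(E has_field_derivative (exp \<tau> * ?z \<tau> + exp \<tau> * (- deriv \<psi> \<tau> * ?z \<tau>)) * (Pc (?z \<tau>) - 1)
      + exp \<tau> * ?z \<tau> * (deriv Pc (?z \<tau>) * (- deriv \<psi> \<tau> * ?z \<tau>)) + - deriv \<psi> \<tau> * ?z \<tau>) (at \<tau>)"
    unfolding E_def by (rule derivative_eq_intros z' Pz' refl | simp add: algebra_simps)+
  moreover have "(E has_field_derivative 0) (at \<tau>)"
  proof (rule has_field_derivative_transform_within_open[of "\<lambda>_. 1" 0 \<tau> "ball 0 \<delta>"])
    show "1 = E s" if "s \<in> ball 0 \<delta>" for s
      using eq[OF that] by (simp add: E_def step_gf_def algebra_simps)
  qed (use t in auto)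
  ultimately have 0: "(exp \<tau> * ?z \<tau> + exp \<tau> * (- deriv \<psi> \<tau> * ?z \<tau>)) * (Pc (?z \<tau>) - 1)
      + exp \<tau> * ?z \<tau> * (deriv Pc (?z \<tau>) * (- deriv \<psi> \<tau> * ?z \<tau>)) + - deriv \<psi> \<tau> * ?z \<tau> = 0"
    by (rule DERIV_unique)
  have e: "exp \<tau> * ?z \<tau> * (Pc (?z \<tau>) - 1) = 1 - ?z \<tau>"
    using eq[OF t] by (simp add: step_gf_def algebra_simps)
  have "(exp \<tau> * ?z \<tau> + exp \<tau> * (- deriv \<psi> \<tau> * ?z \<tau>)) * (Pc (?z \<tau>) - 1) = (1 - deriv \<psi> \<tau>) * (exp \<tau> * ?z \<tau> * (Pc (?z \<tau>) - 1))"
    by (simp add: algebra_simps)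
  then have "(1 - deriv \<psi> \<tau>) * (1 - ?z \<tau>) = deriv \<psi> \<tau> * (exp \<tau> * (?z \<tau>)\<^sup>2 * deriv Pc (?z \<tau>) + ?z \<tau>)"
    using 0 unfolding e by (simp add: algebra_simps power2_eq_square)
  then show ?thesis by (simp add: algebra_simps)
qed

text \<open>The relation of \<open>root_branch_deriv\<close> at \<open>0\<close> gives the first
  derivative; differentiating that relation once more at \<open>0\<close> gives the second.\<close>

lemma root_branch_moments:
  assumes d0: "0 < \<delta>" and \<delta>: "\<psi> holomorphic_on ball 0 \<delta>" and \<psi>0: "\<psi> 0 = 0"
    and n1: "\<And>\<tau>. \<tau> \<in> ball 0 \<delta> \<Longrightarrow> norm (root_branch \<psi> \<tau>) < 1"
    and eq: "\<And>\<tau>. \<tau> \<in> ball 0 \<delta> \<Longrightarrow> step_gf (exp \<tau>) (root_branch \<psi> \<tau>) = 1"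
  shows "deriv \<psi> 0 = of_real mu" "deriv (deriv \<psi>) 0 = of_real sg2"
proof -
  let ?z = "root_branch \<psi>"
  have t0: "0 \<in> ball (0 :: complex) \<delta>" using d0 by simp
  have ode: "1 - root_branch \<psi> \<tau> = deriv \<psi> \<tau> * (1 + exp \<tau> * (root_branch \<psi> \<tau>)\<^sup>2 * deriv Pc (root_branch \<psi> \<tau>))"
    if "\<tau> \<in> ball 0 \<delta>" for \<tau>
    by (rule root_branch_deriv[OF \<delta> _ _ that]) (use n1 eq in auto)
  have z0: "?z 0 = of_real x" by (simp add: root_branch_def \<psi>0)
  have D0: "complex_of_real D \<noteq> 0" using D_pos by simp
  have "1 - of_real x = deriv \<psi> 0 * complex_of_real D"
    using ode[OF t0] by (simp add: z0 deriv_Pc_x D_def)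
  then show m: "deriv \<psi> 0 = of_real mu" using D0 by (simp add: mu_def field_simps)
  have \<psi>': "(\<psi> has_field_derivative of_real mu) (at 0)" using holomorphic_derivI[OF \<delta> open_ball t0] m by simp
  have \<psi>'': "(deriv \<psi> has_field_derivative deriv (deriv \<psi>) 0) (at 0)"
    by (rule holomorphic_derivI[OF holomorphic_deriv[OF \<delta> open_ball] open_ball t0])
  have z': "(?z has_field_derivative - of_real mu * of_real x) (at 0)"
    unfolding root_branch_def by (rule derivative_eq_intros \<psi>' refl | simp add: \<psi>0)+
  have xb: "of_real x \<in> ball (0 :: complex) 1" using x by simp
  have P'': "(deriv Pc has_field_derivative of_real P2) (at (?z 0))"
    using holomorphic_derivI[OF holomorphic_deriv[OF Pc_holomorphic open_ball] open_ball xb] by (simp add: z0 deriv_Pc_x)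
  have Pz': "((\<lambda>\<tau>. deriv Pc (?z \<tau>)) has_field_derivative of_real P2 * (- of_real mu * of_real x)) (at 0)"
    by (rule DERIV_chain2[OF P'' z'])
  define L where "L \<tau> = 1 - ?z \<tau> - deriv \<psi> \<tau> * (1 + exp \<tau> * (?z \<tau>)\<^sup>2 * deriv Pc (?z \<tau>))" for \<tau>
  let ?X = "complex_of_real x" and ?m = "complex_of_real mu"
  let ?p1 = "complex_of_real P1" and ?p2 = "complex_of_real P2" and ?s = "deriv (deriv \<psi>) 0"
  have "(L has_field_derivative ?m * ?X - (?s * (1 + ?X\<^sup>2 * ?p1) + ?m * (?X\<^sup>2 * ?p1 + 2 * ?X * (- ?m * ?X) * ?p1 + ?X\<^sup>2 * (?p2 * (- ?m * ?X))))) (at 0)"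
    unfolding L_def
    by (rule derivative_eq_intros z' Pz' \<psi>'' refl | simp add: z0 m deriv_Pc_x)+ (simp add: algebra_simps)
  moreover have "(L has_field_derivative 0) (at 0)"
    by (rule has_field_derivative_transform_within_open[of "\<lambda>_. 0" 0 0 "ball 0 \<delta>"]) (use t0 ode in \<open>auto simp: L_def\<close>)
  ultimately have "?m * ?X - (?s * (1 + ?X\<^sup>2 * ?p1) + ?m * (?X\<^sup>2 * ?p1 + 2 * ?X * (- ?m * ?X) * ?p1 + ?X\<^sup>2 * (?p2 * (- ?m * ?X)))) = 0"
    by (rule DERIV_unique)
  then have "?s * complex_of_real D = complex_of_real (x * mu - mu * x\<^sup>2 * P1 + mu\<^sup>2 * (2 * x\<^sup>2 * P1 + x ^ 3 * P2))"
    by (simp add: D_def algebra_simps power2_eq_square power3_eq_cube)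
  then show "deriv (deriv \<psi>) 0 = of_real sg2" using D0 by (simp add: sg2_def field_simps)
qed

section \<open>Coefficients of \<open>spine_gf\<close> for \<open>u\<close> away from
  \<open>1\<close> and near \<open>1\<close>\<close>

lemma spine_gf_holomorphic_parts:
  "(\<lambda>z. u\<^sup>2 * (end_gf z)\<^sup>2) holomorphic_on ball 0 1" "(\<lambda>z. 1 - step_gf u z) holomorphic_on ball 0 1"
  by (intro holomorphic_intros end_gf_holomorphic step_gf_holomorphic)+

lemma step_gf_continuous: "continuous_on {p. norm (snd p) < 1} (\<lambda>p. step_gf (fst p) (snd p))"
proof -
  have "continuous_on (ball 0 1) Pc" by (rule holomorphic_on_imp_continuous_on[OF Pc_holomorphic])
  then have "continuous_on {p :: complex \<times> complex. norm (snd p) < 1} (\<lambda>p. Pc (snd p))"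
    by (rule continuous_on_compose2) (auto intro: continuous_intros)
  then show ?thesis unfolding step_gf_def by (intro continuous_intros)
qed

lemma end_gf_bounded:
  assumes "0 < R" "R < 1" obtains B where "\<And>z. norm z \<le> R \<Longrightarrow> norm ((end_gf z)\<^sup>2) \<le> B" "0 \<le> B"
proof -
  have "continuous_on (cball 0 R) (\<lambda>z. (end_gf z)\<^sup>2)"
    using assms by (intro continuous_intros continuous_on_subset[OF holomorphic_on_imp_continuous_on[OF end_gf_holomorphic]]) auto
  then have "bounded ((\<lambda>z. (end_gf z)\<^sup>2) ` cball 0 R)" by (intro compact_imp_bounded compact_continuous_image compact_cball)
  then obtain B where "\<forall>y\<in>(\<lambda>z. (end_gf z)\<^sup>2) ` cball 0 R. norm y \<le> B" unfolding bounded_iff by blast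
  then have B: "norm ((end_gf z)\<^sup>2) \<le> B" if "norm z \<le> R" for z using that by auto
  moreover have "0 \<le> B" using B[of 0] assms norm_ge_zero order_trans by (metis less_imp_le norm_zero)
  ultimately show thesis using that by blast
qed

text \<open>For these \<open>\<theta>\<close> the denominator has no zero with
  \<open>norm z \<le> x\<close>, by \<open>step_gf_eq_1\<close>. Compactness in the pair of
  \<open>\<theta>\<close> and \<open>z\<close> extends this to some radius \<open>R > x\<close>, the
  same for all \<open>\<theta>\<close>, and Cauchy's inequality applies.\<close>

lemma spine_poly_far:
  assumes d: "0 < d" "d \<le> pi"
  shows "\<exists>R>x. \<exists>B. \<forall>\<theta> n. d \<le> \<bar>\<theta>\<bar> \<longrightarrow> \<bar>\<theta>\<bar> \<le> pi \<longrightarrow> norm (spine_poly (iexp \<theta>) n) \<le> B / R ^ n"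
proof -
  \<comment> \<open>A radius between \<open>x\<close> and \<open>1\<close>: the closed disc stays
    where \<open>Pc\<close> is holomorphic.\<close>
  define R0 where "R0 = (1 + x) / 2"
  have R0: "x < R0" "R0 < 1" using x by (simp_all add: R0_def)
  let ?T = "{-pi..-d} \<union> {d..pi}"
  let ?K = "?T \<times> cball (0 :: complex) R0"
  let ?F = "\<lambda>(\<theta> :: real, z). 1 - step_gf (iexp \<theta>) z"
  have F: "continuous_on ?K ?F"
    unfolding case_prod_beta
    by (intro continuous_intros continuous_on_compose2[OF step_gf_continuous, of _ "\<lambda>p. (iexp (fst p), snd p)", unfolded fst_conv snd_conv])
       (use R0 in auto)
  have "\<exists>R>x. \<exists>c>0. \<forall>k\<in>?K. norm (snd k) \<le> R \<longrightarrow> c \<le> norm (?F k)"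
  proof (rule compact_gap[OF _ _ F])
    show "compact ?K" by (intro compact_Times compact_Un compact_Icc compact_cball)
    show "continuous_on ?K (\<lambda>k. norm (snd k))" by (intro continuous_intros)
    fix k assume k: "k \<in> ?K" "norm (snd k) \<le> x"
    obtain \<theta> z where kk: "k = (\<theta>, z)" by (cases k)
    show "?F k \<noteq> 0"
    proof
      assume "?F k = 0"
      then have "step_gf (iexp \<theta>) z = 1" by (simp add: kk)
      then have "iexp \<theta> = 1" using step_gf_eq_1(2)[of z "iexp \<theta>"] k(2) by (simp add: kk)
      then have "Re (iexp \<theta>) = 1" by simp
      then have "cos \<theta> = 1" by (simp add: Re_exp)
      then obtain m :: int where m: "\<theta> = of_int m * 2 * pi" using cos_one_2pi_int by auto
      have "\<bar>\<theta>\<bar> \<le> pi" "\<theta> \<noteq> 0" using k(1) d by (auto simp: kk)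
      then have "\<bar>of_int m * 2\<bar> * pi \<le> 1 * pi" "m \<noteq> 0" using m by (auto simp: abs_mult)
      then have "\<bar>of_int m * (2 :: real)\<bar> \<le> 1" by (simp only: mult_le_cancel_right_pos[OF pi_gt_zero])
      then show False using \<open>m \<noteq> 0\<close> by linarith
    qed
  qed
  then obtain R1 c where R1: "x < R1" "0 < c" "\<And>\<theta> z. \<theta> \<in> ?T \<Longrightarrow> norm z \<le> R0 \<Longrightarrow> norm z \<le> R1 \<Longrightarrow> c \<le> norm (1 - step_gf (iexp \<theta>) z)"
    by fastforce
  define R where "R = min R0 R1"
  have R: "x < R" "0 < R" "R < 1" using R0 R1 x by (auto simp: R_def)
  obtain B where B: "\<And>z. norm z \<le> R \<Longrightarrow> norm ((end_gf z)\<^sup>2) \<le> B" "0 \<le> B" using end_gf_bounded[OF R(2,3)] by blast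
  have "norm (spine_poly (iexp \<theta>) n) \<le> (B / c) / R ^ n" if \<theta>: "d \<le> \<bar>\<theta>\<bar>" "\<bar>\<theta>\<bar> \<le> pi" for \<theta> n
  proof -
    have T: "\<theta> \<in> ?T" using \<theta> by auto
    have low: "c \<le> norm (1 - step_gf (iexp \<theta>) z)" if "norm z \<le> R" for z
      using R1(3)[OF T] that by (simp add: R_def)
    have "norm (fps_nth (Abs_fps (spine_poly (iexp \<theta>))) n) \<le> (B / c) / R ^ n"
    proof (rule no_pole_coeff_bound[OF spine_gf_expansion spine_gf_def spine_gf_holomorphic_parts R(2,3)])
      show "1 - step_gf (iexp \<theta>) z \<noteq> 0" if "norm z \<le> R" for z using low[OF that] R1(2) by auto
      fix z :: complex assume z: "norm z = R"
      have "norm (spine_gf (iexp \<theta>) z) = norm ((end_gf z)\<^sup>2) / norm (1 - step_gf (iexp \<theta>) z)"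
        by (simp add: spine_gf_def norm_divide norm_mult norm_power)
      also have "\<dots> \<le> B / c" using B z low R1(2) by (intro frac_le) auto
      finally show "norm (spine_gf (iexp \<theta>) z) \<le> B / c" .
    qed
    then show ?thesis by simp
  qed
  then show ?thesis using R(1) by blast
qed

end

context partition_root
begin

text \<open>\<open>x P(x) = 1\<close> gives the value \<open>(1 - 2 x) / (1 - x)\<close>. It is a
  factor of the leading coefficient of the asymptotics.\<close>

lemma end_gf_x: "end_gf (of_real x) \<noteq> 0"
proof -
  have x0: "complex_of_real x \<noteq> 0" and x1: "1 - complex_of_real x \<noteq> 0" using x by (auto simp: of_real_eq_1_iff)
  have "end_gf (of_real x) = 1 - of_real x / (1 - of_real x)"
    using Pc_x by (simp add: end_gf_def right_diff_distrib)
  also have "\<dots> = complex_of_real ((1 - 2 * x) / (1 - x))" using x1 by (simp add: field_simps)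
  finally have e: "end_gf (of_real x) = complex_of_real ((1 - 2 * x) / (1 - x))" .
  have "(1 - 2 * x) / (1 - x) \<noteq> 0" using x x_half by simp
  then show ?thesis unfolding e of_real_eq_0_iff .
qed

text \<open>Uniformity in \<open>\<tau>\<close> comes from perturbing \<open>u = 1\<close>. There
  the denominator is bounded below off a ball around \<open>x\<close> and on the circle of radius
  \<open>R\<close>, and for small \<open>\<tau>\<close> half of this bound survives. Inside the ball
  \<open>pole_branch\<close> leaves a single zero, so \<open>simple_pole_coeff_bound\<close> applies
  with one \<open>R\<close> for all \<open>\<tau>\<close>.\<close>

lemma spine_poly_near:
  "\<exists>\<delta> \<psi> A R B. 0 < \<delta> \<and> x < R \<and> \<psi> holomorphic_on ball 0 \<delta> \<and> A holomorphic_on ball 0 \<delta> \<and> \<psi> 0 = 0 \<and>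
    deriv \<psi> 0 = of_real mu \<and> deriv (deriv \<psi>) 0 = of_real sg2 \<and> A 0 \<noteq> 0 \<and>
    (\<forall>\<tau>\<in>ball 0 \<delta>. \<forall>n. norm (spine_poly (exp \<tau>) n - A \<tau> * (exp (\<psi> \<tau>) / of_real x) ^ n) \<le> B / R ^ n)"
proof -
  obtain d0 \<epsilon> \<psi> where d0: "0 < d0" "d0 \<le> 1" and \<epsilon>: "0 < \<epsilon>" and \<psi>: "\<psi> holomorphic_on ball 0 d0" and \<psi>0: "\<psi> 0 = 0"
    and n1: "\<And>\<tau>. \<tau> \<in> ball 0 d0 \<Longrightarrow> norm (root_branch \<psi> \<tau>) < 1"
    and eq: "\<And>\<tau>. \<tau> \<in> ball 0 d0 \<Longrightarrow> step_gf (exp \<tau>) (root_branch \<psi> \<tau>) = 1"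
    and uniq: "\<And>\<tau> z. \<tau> \<in> ball 0 d0 \<Longrightarrow> z \<in> ball (of_real x) \<epsilon> \<Longrightarrow> norm z < 1 \<Longrightarrow> step_gf (exp \<tau>) z = 1 \<Longrightarrow> z = root_branch \<psi> \<tau>"
    using pole_branch by blast
  let ?\<rho> = "root_branch \<psi>"
  have ode: "1 - ?\<rho> \<tau> = deriv \<psi> \<tau> * (1 + exp \<tau> * (?\<rho> \<tau>)\<^sup>2 * deriv Pc (?\<rho> \<tau>))" if "\<tau> \<in> ball 0 d0" for \<tau>
    by (rule root_branch_deriv[OF \<psi> _ _ that]) (use n1 eq in auto)
  have mom: "deriv \<psi> 0 = of_real mu" "deriv (deriv \<psi>) 0 = of_real sg2"
    by (rule root_branch_moments[OF d0(1) \<psi> \<psi>0]; use n1 eq in auto)+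
  have z0: "(0 :: complex) \<in> ball 0 d0" using d0 by simp
  have \<rho>0: "?\<rho> 0 = of_real x" by (simp add: root_branch_def \<psi>0)
  have \<rho>nz: "?\<rho> \<tau> \<noteq> 0" for \<tau> using x by (simp add: root_branch_def)
  have \<rho>h: "?\<rho> holomorphic_on ball 0 d0" unfolding root_branch_def by (intro holomorphic_intros \<psi>)
  define den where "den \<tau> = 1 + exp \<tau> * (?\<rho> \<tau>)\<^sup>2 * deriv Pc (?\<rho> \<tau>)" for \<tau>
  have den: "den \<tau> \<noteq> 0" if "\<tau> \<in> ball 0 d0" for \<tau>
  proof
    assume "den \<tau> = 0"
    then have "?\<rho> \<tau> = 1" using ode[OF that] by (simp add: den_def)
    then show False using n1[OF that] by simp
  qed
  \<comment> \<open>The coefficient \<open>- H / (\<rho> T')\<close> of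
    \<open>simple_pole_coeff_bound\<close>, because \<open>\<rho> T' = - den\<close>.\<close>
  define A where "A \<tau> = (exp \<tau>)\<^sup>2 * (end_gf (?\<rho> \<tau>))\<^sup>2 / den \<tau>" for \<tau>
  have comp: "(\<lambda>\<tau>. f (?\<rho> \<tau>)) holomorphic_on ball 0 d0" if "f holomorphic_on ball 0 1" for f
    by (rule holomorphic_on_compose_gen[OF \<rho>h that, unfolded comp_def]) (use n1 in auto)
  have Ah: "A holomorphic_on ball 0 d0"
    unfolding A_def den_def
    by (intro holomorphic_intros comp end_gf_holomorphic holomorphic_deriv[OF Pc_holomorphic open_ball] \<rho>h)
      (use den in \<open>auto simp: den_def\<close>)
  have A0: "A 0 \<noteq> 0" using end_gf_x den[OF z0] by (simp add: A_def \<rho>0)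
  define R0 where "R0 = (1 + x) / 2"
  have R0: "x < R0" "R0 < 1" using x by (simp_all add: R0_def)
  have F: "continuous_on (cball 0 R0) (\<lambda>z. 1 - step_gf 1 z)"
    by (rule continuous_on_subset[OF holomorphic_on_imp_continuous_on[OF spine_gf_holomorphic_parts(2)]]) (use R0 in auto)
  have "\<exists>R>x. \<exists>c>0. \<forall>z\<in>cball 0 R0 - ball (of_real x) \<epsilon>. norm z \<le> R \<longrightarrow> c \<le> norm (1 - step_gf 1 z)"
  proof (rule compact_gap)
    show "compact (cball 0 R0 - ball (complex_of_real x) \<epsilon>)" by (intro compact_diff compact_cball open_ball)
    show "continuous_on (cball 0 R0 - ball (complex_of_real x) \<epsilon>) (\<lambda>z. 1 - step_gf 1 z)"
      by (rule continuous_on_subset[OF F]) auto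
    fix z :: complex assume "z \<in> cball 0 R0 - ball (complex_of_real x) \<epsilon>" "norm z \<le> x"
    then show "1 - step_gf 1 z \<noteq> 0" using step_gf_eq_1(1)[of z 1] \<epsilon> by auto
  qed (intro continuous_intros)
  then obtain R1 c1 where R1: "x < R1" "0 < c1"
    "\<And>z. norm z \<le> R0 \<Longrightarrow> z \<notin> ball (of_real x) \<epsilon> \<Longrightarrow> norm z \<le> R1 \<Longrightarrow> c1 \<le> norm (1 - step_gf 1 z)"
    by fastforce
  define R where "R = min R0 R1"
  have R: "x < R" "0 < R" "R < 1" "R \<le> R0" "R \<le> R1" using R0 R1 x by (auto simp: R_def)
  \<comment> \<open>With the constant \<open>N = 0\<close>, \<open>compact_gap\<close> just provides
    a positive lower bound on the circle.\<close>
  have "\<exists>r>(0 :: real). \<exists>c>0. \<forall>z\<in>sphere (0 :: complex) R. (\<lambda>_. 0 :: real) z \<le> r \<longrightarrow> c \<le> norm (1 - step_gf 1 z)"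
  proof (rule compact_gap[where N = "\<lambda>_. 0" and x = 0 and K = "sphere 0 R" and F = "\<lambda>z. 1 - step_gf 1 z"])
    show "continuous_on (sphere 0 R) (\<lambda>z. 1 - step_gf 1 z)" by (rule continuous_on_subset[OF F]) (use R in auto)
    fix z :: complex assume z: "z \<in> sphere 0 R"
    show "1 - step_gf 1 z \<noteq> 0"
    proof (cases "z \<in> ball (of_real x) \<epsilon>")
      case True
      have "z \<noteq> of_real x" using z R x by auto
      then show ?thesis using uniq[OF z0 True] z R \<rho>0 by auto
    next
      case False
      then show ?thesis using R1(3)[of z] R1(2) z R by auto
    qed
  qed (auto intro: continuous_intros)
  then obtain c2 where c2: "0 < c2" "\<And>z. norm z = R \<Longrightarrow> c2 \<le> norm (1 - step_gf 1 z)" by (auto simp: less_imp_le)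
  define c where "c = min c1 c2"
  have c: "0 < c" using R1(2) c2(1) by (simp add: c_def)
  have "continuous_on (cball 0 R) (\<lambda>z. z * (Pc z - 1))"
    using R by (intro continuous_intros continuous_on_subset[OF holomorphic_on_imp_continuous_on[OF Pc_holomorphic]]) auto
  then have "bounded ((\<lambda>z. z * (Pc z - 1)) ` cball 0 R)" by (intro compact_imp_bounded compact_continuous_image compact_cball)
  then obtain W0 where "\<forall>y\<in>(\<lambda>z. z * (Pc z - 1)) ` cball 0 R. norm y \<le> W0" unfolding bounded_iff by blast
  then have W0: "norm (z * (Pc z - 1)) \<le> W0" if "norm z \<le> R" for z using that by auto
  define W where "W = \<bar>W0\<bar> + 1"
  have W: "norm (z * (Pc z - 1)) \<le> W" if "norm z \<le> R" for z using W0[OF that] by (simp add: W_def)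
  have W_pos: "0 < W" by (simp add: W_def)
  have cont: "isCont f 0" if "f holomorphic_on ball 0 d0" for f :: "complex \<Rightarrow> complex"
    using holomorphic_on_imp_continuous_on[OF that] z0 by (simp add: continuous_on_eq_continuous_at)
  have near: "eventually (\<lambda>\<tau>. dist (f \<tau>) (f 0) < e) (nhds 0)" if "f holomorphic_on ball 0 d0" "0 < e" for e and f :: "complex \<Rightarrow> complex"
    using cont[OF that(1)] that(2) unfolding continuous_at_eps_delta eventually_nhds_metric by blast
  \<comment> \<open>In this order, the conditions make the change of the denominator at most
    \<open>c / 2\<close>, keep the pole well inside the circle, and bound \<open>A\<close>.\<close>
  have "eventually (\<lambda>\<tau>. dist (exp \<tau>) (exp 0) < c / (2 * W) \<and> dist (?\<rho> \<tau>) (?\<rho> 0) < (R - x) / 2 \<and> dist (A \<tau>) (A 0) < 1) (nhds (0 :: complex))"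
    by (intro eventually_conj near \<rho>h Ah holomorphic_intros) (use c W_pos R in auto)
  then obtain d1 where d1: "0 < d1" "\<And>\<tau>. dist \<tau> 0 < d1 \<Longrightarrow> dist (exp \<tau>) 1 < c / (2 * W) \<and> dist (?\<rho> \<tau>) (of_real x) < (R - x) / 2 \<and> dist (A \<tau>) (A 0) < 1"
    unfolding eventually_nhds_metric by (auto simp: \<rho>0)
  define \<delta> where "\<delta> = min d0 d1"
  have \<delta>: "0 < \<delta>" "ball 0 \<delta> \<subseteq> ball (0 :: complex) d0" using d0 d1 by (auto simp: \<delta>_def)
  obtain B where B: "\<And>z. norm z \<le> R \<Longrightarrow> norm ((end_gf z)\<^sup>2) \<le> B" "0 \<le> B" using end_gf_bounded[OF R(2,3)] by blast
  \<comment> \<open>\<open>exp 1\<close> bounds the norm of \<open>exp \<tau>\<close>, as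
    \<open>\<delta> \<le> d0 \<le> 1\<close>.\<close>
  define B1 where "B1 = (exp 1)\<^sup>2 * B / (c / 2)"
  define B2 where "B2 = B1 + (norm (A 0) + 1) / ((R - x) / 2)"
  have "norm (spine_poly (exp \<tau>) n - A \<tau> * (exp (\<psi> \<tau>) / of_real x) ^ n) \<le> B2 / R ^ n" if t: "\<tau> \<in> ball 0 \<delta>" for \<tau> n
  proof -
    have t0: "\<tau> \<in> ball 0 d0" using t \<delta> by blast
    have t1: "dist (exp \<tau>) 1 < c / (2 * W)" "dist (?\<rho> \<tau>) (of_real x) < (R - x) / 2" "dist (A \<tau>) (A 0) < 1"
      using d1(2)[of \<tau>] t by (auto simp: \<delta>_def dist_commute)
    let ?u = "exp \<tau>" and ?r = "?\<rho> \<tau>"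
    have "norm ?r \<le> norm (of_real x :: complex) + dist ?r (of_real x)" by (metis dist_norm norm_triangle_sub)
    moreover have "norm (complex_of_real x) = x" using x by simp
    ultimately have r: "norm ?r < x + (R - x) / 2" using t1(2) by linarith
    then have rR: "norm ?r < R" by (simp add: field_simps) (use R in linarith)
    have pert: "norm ((1 - step_gf ?u z) - (1 - step_gf 1 z)) \<le> c / 2" if "norm z \<le> R" for z
    proof -
      have "(1 - step_gf ?u z) - (1 - step_gf 1 z) = (1 - ?u) * (z * (Pc z - 1))" by (simp add: step_gf_def algebra_simps)
      then have "norm ((1 - step_gf ?u z) - (1 - step_gf 1 z)) = dist ?u 1 * norm (z * (Pc z - 1))"
        by (simp only: norm_mult dist_norm norm_minus_commute)
      also have "\<dots> \<le> c / (2 * W) * W" using t1(1) W[OF that] c W_pos by (intro mult_mono) auto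
      finally show ?thesis using W_pos by simp
    qed
    have low: "c / 2 \<le> norm (1 - step_gf ?u z)" if "norm z \<le> R" "c \<le> norm (1 - step_gf 1 z)" for z
      using pert[OF that(1)] that(2) norm_triangle_ineq3[of "1 - step_gf ?u z" "1 - step_gf 1 z"] by linarith
    have dT: "deriv (\<lambda>z. 1 - step_gf ?u z) ?r = - (1 + ?u * (Pc ?r - 1) + ?r * (?u * deriv Pc ?r))"
    proof (rule DERIV_imp_deriv)
      have "?r \<in> ball 0 1" using n1[OF t0] by simp
      then have "(Pc has_field_derivative deriv Pc ?r) (at ?r)" by (rule holomorphic_derivI[OF Pc_holomorphic open_ball])
      then show "((\<lambda>z. 1 - step_gf ?u z) has_field_derivative - (1 + ?u * (Pc ?r - 1) + ?r * (?u * deriv Pc ?r))) (at ?r)"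
        unfolding step_gf_def by (auto intro!: derivative_eq_intros simp: algebra_simps)
    qed
    have rT: "?r * deriv (\<lambda>z. 1 - step_gf ?u z) ?r = - den \<tau>"
      unfolding dT den_def using eq[OF t0] by (simp add: step_gf_def algebra_simps power2_eq_square)
    have T0: "deriv (\<lambda>z. 1 - step_gf ?u z) ?r \<noteq> 0" using rT den[OF t0] by auto
    have Aeq: "- (?u\<^sup>2 * (end_gf ?r)\<^sup>2) / (?r * deriv (\<lambda>z. 1 - step_gf ?u z) ?r) = A \<tau>" unfolding rT by (simp add: A_def)
    have MA: "?u\<^sup>2 * (end_gf ?r)\<^sup>2 / deriv (\<lambda>z. 1 - step_gf ?u z) ?r = - (A \<tau> * ?r)"
      unfolding Aeq[symmetric] using \<rho>nz T0 by simp
    have nA: "norm (A \<tau>) \<le> norm (A 0) + 1" using t1(3) norm_triangle_sub[of "A \<tau>" "A 0"] by (simp add: dist_norm)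
    have "norm (fps_nth (Abs_fps (spine_poly ?u)) n - (- (?u\<^sup>2 * (end_gf ?r)\<^sup>2) / (?r * deriv (\<lambda>z. 1 - step_gf ?u z) ?r)) / ?r ^ n) \<le>
       (B1 + norm (?u\<^sup>2 * (end_gf ?r)\<^sup>2 / deriv (\<lambda>z. 1 - step_gf ?u z) ?r) / (R - norm ?r)) / R ^ n"
    proof (rule simple_pole_coeff_bound[OF spine_gf_expansion spine_gf_def spine_gf_holomorphic_parts R(2,3) rR \<rho>nz _ T0])
      show "1 - step_gf ?u ?r = 0" using eq[OF t0] by simp
      show "1 - step_gf ?u z \<noteq> 0" if z: "norm z \<le> R" "z \<noteq> ?r" for z
      proof (cases "z \<in> ball (of_real x) \<epsilon>")
        case True
        then show ?thesis using uniq[OF t0 True] z R by auto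
      next
        case False
        then have "c \<le> norm (1 - step_gf 1 z)" using R1(3)[of z] z R by (auto simp: c_def)
        then show ?thesis using low[OF z(1)] c by auto
      qed
      fix z :: complex assume z: "norm z = R"
      have "norm (spine_gf ?u z) = (norm ?u)\<^sup>2 * norm ((end_gf z)\<^sup>2) / norm (1 - step_gf ?u z)"
        by (simp add: spine_gf_def norm_divide norm_mult norm_power)
      also have "\<dots> \<le> (exp 1)\<^sup>2 * B / (c / 2)"
      proof (intro frac_le mult_mono power_mono)
        show "norm ?u \<le> exp 1"
          using t0 d0 complex_Re_le_cmod[of \<tau>] by (simp add: norm_exp_eq_Re)
        show "c / 2 \<le> norm (1 - step_gf ?u z)" using low[of z] c2(2)[OF z] z by (simp add: c_def)
      qed (use B z c in auto)
      finally show "norm (spine_gf ?u z) \<le> B1" by (simp add: B1_def)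
    qed
    also have "norm (?u\<^sup>2 * (end_gf ?r)\<^sup>2 / deriv (\<lambda>z. 1 - step_gf ?u z) ?r) / (R - norm ?r) \<le> (norm (A 0) + 1) / ((R - x) / 2)"
    proof (rule frac_le)
      have "norm (A \<tau>) * norm ?r \<le> (norm (A 0) + 1) * 1" using nA rR R by (intro mult_mono) auto
      then show "norm (?u\<^sup>2 * (end_gf ?r)\<^sup>2 / deriv (\<lambda>z. 1 - step_gf ?u z) ?r) \<le> norm (A 0) + 1"
        unfolding MA by (simp add: norm_mult)
      show "(R - x) / 2 \<le> R - norm ?r" using r by (simp add: field_simps)
    qed (use R in auto)
    finally have "norm (spine_poly ?u n - A \<tau> / ?r ^ n) \<le> B2 / R ^ n"
      using R unfolding Aeq by (simp add: B2_def divide_right_mono)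
    moreover have "A \<tau> / ?r ^ n = A \<tau> * (exp (\<psi> \<tau>) / of_real x) ^ n"
      using x by (simp add: root_branch_def exp_minus field_simps)
    ultimately show ?thesis by simp
  qed
  then show ?thesis
    using \<delta> R(1) \<psi>0 mom A0 holomorphic_on_subset[OF \<psi> \<delta>(2)] holomorphic_on_subset[OF Ah \<delta>(2)]
    by (intro exI[of _ \<delta>] exI[of _ \<psi>] exI[of _ A] exI[of _ R] exI[of _ B2]) auto
qed

end

section \<open>Quasi-power asymptotics\<close>

lemma holomorphic_taylor_bound:
  assumes f: "f holomorphic_on ball 0 \<delta>" and d: "0 < \<delta>"
  shows "\<exists>M\<ge>0. \<forall>\<tau>. norm \<tau> \<le> \<delta> / 2 \<longrightarrow>
    norm (f \<tau> - (\<Sum>i\<le>k. (deriv ^^ i) f 0 * \<tau> ^ i / fact i)) \<le> M * norm \<tau> ^ Suc k"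
proof -
  have hol: "(deriv ^^ i) f holomorphic_on ball 0 \<delta>" for i by (rule holomorphic_higher_deriv[OF f open_ball])
  have sub: "cball 0 (\<delta> / 2) \<subseteq> ball (0 :: complex) \<delta>" using d by auto
  have "continuous_on (cball 0 (\<delta> / 2)) ((deriv ^^ Suc k) f)"
    by (rule continuous_on_subset[OF holomorphic_on_imp_continuous_on[OF hol] sub])
  then have "bounded ((deriv ^^ Suc k) f ` cball 0 (\<delta> / 2))" by (intro compact_imp_bounded compact_continuous_image compact_cball)
  then obtain B where "\<forall>y\<in>(deriv ^^ Suc k) f ` cball 0 (\<delta> / 2). norm y \<le> B" unfolding bounded_iff by blast
  then have B: "norm ((deriv ^^ Suc k) f z) \<le> B" if "z \<in> cball 0 (\<delta> / 2)" for z using that by blast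
  have B0: "0 \<le> B" using B[of 0] d norm_ge_zero order_trans by (metis centre_in_cball divide_nonneg_nonneg less_eq_real_def zero_le_numeral)
  have "norm (f \<tau> - (\<Sum>i\<le>k. (deriv ^^ i) f 0 * \<tau> ^ i / fact i)) \<le> B * norm \<tau> ^ Suc k" if t: "norm \<tau> \<le> \<delta> / 2" for \<tau>
  proof -
    have "norm ((deriv ^^ 0) f \<tau> - (\<Sum>i\<le>k. (deriv ^^ i) f 0 * (\<tau> - 0) ^ i / fact i)) \<le> B * norm (\<tau> - 0) ^ Suc k / fact k"
    proof (rule complex_Taylor[where S = "cball 0 (\<delta> / 2)"])
      fix i z assume z: "z \<in> cball (0 :: complex) (\<delta> / 2)"
      then have "z \<in> ball 0 \<delta>" using sub by blast
      then show "((deriv ^^ i) f has_field_derivative (deriv ^^ Suc i) f z) (at z within cball 0 (\<delta> / 2))"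
        using holomorphic_derivI[OF hol open_ball] by (simp add: has_field_derivative_at_within)
    qed (use B t d in auto)
    also have "\<dots> \<le> B * norm (\<tau> - 0) ^ Suc k / 1" using B0 by (intro divide_left_mono fact_ge_1) auto
    finally show ?thesis by simp
  qed
  then show ?thesis using B0 by blast
qed

text \<open>With \<open>l = - ln r\<close> one has \<open>n \<le> (3 / l) exp (l n / 3)\<close>, and
  the cube of this exponential is \<open>r^(-n)\<close>.\<close>

lemma cubic_geometric_bound:
  fixes r :: real assumes r: "0 < r" "r < 1"
  shows "\<exists>K. \<forall>n. real n ^ 3 * r ^ n \<le> K"
proof -
  define l where "l = - ln r"
  have l: "0 < l" using r by (simp add: l_def)
  have "real n ^ 3 * r ^ n \<le> (3 / l) ^ 3" for n
  proof -
    let ?e = "exp (l * real n / 3)"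
    have "1 + l * real n / 3 \<le> ?e" by (rule exp_ge_add_one_self)
    then have "l * real n / 3 \<le> ?e" by linarith
    then have "real n \<le> (3 / l) * ?e" using l by (simp add: field_simps)
    then have "real n ^ 3 \<le> ((3 / l) * ?e) ^ 3" by (intro power_mono) auto
    moreover have "?e ^ 3 = exp (l * real n)" by (simp add: exp_of_nat_mult[symmetric])
    ultimately have "real n ^ 3 \<le> (3 / l) ^ 3 * exp (l * real n)" by (simp only: power_mult_distrib)
    then have "real n ^ 3 * r ^ n \<le> (3 / l) ^ 3 * exp (l * real n) * r ^ n" using r by (intro mult_right_mono) auto
    moreover have "r ^ n = exp (- (l * real n))" using r by (simp add: l_def exp_of_nat_mult mult.commute)
    ultimately show ?thesis by (simp add: mult.assoc exp_add[symmetric])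
  qed
  then show ?thesis by blast
qed

text \<open>Brings exponentially small errors into the form \<open>C / n^2\<close> that the
  smoothing bound accepts.\<close>

lemma geometric_le_inverse_square:
  fixes r :: real assumes r: "0 < r" "r < 1"
  obtains K where "0 \<le> K" "\<And>n. 1 \<le> n \<Longrightarrow> r ^ n \<le> K / (real n)\<^sup>2" "\<And>n. 1 \<le> n \<Longrightarrow> real n * r ^ n \<le> K / (real n)\<^sup>2"
proof -
  obtain K where K: "\<And>n. real n ^ 3 * r ^ n \<le> K" using cubic_geometric_bound[OF r] by blast
  have b: "real n * r ^ n \<le> K / (real n)\<^sup>2" if "1 \<le> n" for n
    using K[of n] that by (simp add: field_simps power2_eq_square power3_eq_cube)
  have "r ^ n \<le> K / (real n)\<^sup>2" if n: "1 \<le> n" for n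
  proof -
    have "1 * r ^ n \<le> real n * r ^ n" using n r by (intro mult_right_mono) auto
    then show ?thesis using b[OF n] by simp
  qed
  then show thesis using that[of K] b K[of 0] by simp
qed

section \<open>The HDV distribution and its characteristic function\<close>

definition hdv_prob :: "nat \<Rightarrow> nat \<Rightarrow> real" where
  "hdv_prob n k = real (num_k_linear n k) / real (num_linear n)"

definition tree_poly :: "nat \<Rightarrow> real \<Rightarrow> complex" where
  "tree_poly n \<theta> = (\<Sum>k\<le>n. of_nat (num_k_linear n k) * iexp (real k * \<theta>))"

lemma tree_poly_0: "tree_poly n 0 = of_nat (num_linear n)"
  by (simp add: tree_poly_def num_linear_def)

lemma lattice_cf_hdv_prob: "lattice_cf (hdv_prob n) n \<theta> = tree_poly n \<theta> / tree_poly n 0"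
  by (simp add: lattice_cf_def hdv_prob_def tree_poly_0) (simp add: tree_poly_def sum_divide_distrib)

context partition_root
begin

text \<open>As \<open>x = y^2\<close>, one factor \<open>y^n\<close> absorbs the error of
  \<open>num_k_linear_approx\<close> up to a linear factor, and the other still decays
  exponentially.\<close>

lemma tree_poly_spine_poly:
  "\<exists>K\<ge>0. \<forall>n\<ge>1. \<forall>\<theta>. norm (of_real x ^ n * (2 * tree_poly n \<theta> - spine_poly (iexp \<theta>) n)) \<le> K / (real n)\<^sup>2"
proof -
  define y where "y = sqrt x"
  have y: "0 < y" "y < 1" using x by (simp_all add: y_def real_sqrt_lt_1_iff)
  have xy: "x = y * y" using x by (simp add: y_def)
  have P0: "0 \<le> partition_gf y" using pnum_pow_le[of y 0] y by (simp add: pnum_0)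
  obtain K where K: "0 \<le> K" "\<And>n. 1 \<le> n \<Longrightarrow> real n * y ^ n \<le> K / (real n)\<^sup>2"
    using geometric_le_inverse_square[OF y] by metis
  have "norm (of_real x ^ n * (2 * tree_poly n \<theta> - spine_poly (iexp \<theta>) n)) \<le> ((1 + 10 * partition_gf y) * K) / (real n)\<^sup>2"
    if n: "1 \<le> n" for n \<theta>
  proof -
    have "2 * tree_poly n \<theta> - spine_poly (iexp \<theta>) n =
       (\<Sum>k\<le>n. of_real (2 * real (num_k_linear n k) - real (card (spine_codes n k))) * iexp (real k * \<theta>))"
      unfolding tree_poly_def spine_poly_def sum_distrib_left sum_subtractf[symmetric]
      by (intro sum.cong refl) (simp add: exp_of_nat_mult[symmetric] algebra_simps)
    then have "norm (2 * tree_poly n \<theta> - spine_poly (iexp \<theta>) n) \<le>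
       (\<Sum>k\<le>n. norm (of_real (2 * real (num_k_linear n k) - real (card (spine_codes n k))) * iexp (real k * \<theta>)))"
      by (simp only: norm_sum)
    also have "\<dots> = (\<Sum>k\<le>n. \<bar>2 * real (num_k_linear n k) - real (card (spine_codes n k))\<bar>)"
      by (intro sum.cong refl) (simp only: norm_mult norm_of_real norm_exp_i_times mult_1_right)
    finally have "norm (of_real x ^ n * (2 * tree_poly n \<theta> - spine_poly (iexp \<theta>) n)) \<le>
       y ^ n * ((\<Sum>k\<le>n. \<bar>2 * real (num_k_linear n k) - real (card (spine_codes n k))\<bar>) * y ^ n)"
      using y by (simp add: norm_mult norm_power xy power_mult_distrib mult.assoc mult.left_commute mult_left_mono)
    also have "\<dots> \<le> y ^ n * (1 + real (n + 9) * partition_gf y)"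
      using num_k_linear_approx[OF x root y_def n] y by (intro mult_left_mono) auto
    also have "\<dots> \<le> y ^ n * (real n * (1 + 10 * partition_gf y))"
    proof -
      have "1 \<le> real n" "real (n + 9) * partition_gf y \<le> (10 * real n) * partition_gf y"
        using n P0 by (auto intro!: mult_right_mono)
      then have "1 + real (n + 9) * partition_gf y \<le> real n * (1 + 10 * partition_gf y)" by (simp add: algebra_simps)
      then show ?thesis using y by (intro mult_left_mono) auto
    qed
    also have "\<dots> = (1 + 10 * partition_gf y) * (real n * y ^ n)" by (simp add: mult_ac)
    also have "\<dots> \<le> (1 + 10 * partition_gf y) * (K / (real n)\<^sup>2)"
      using P0 K(2)[OF n] by (intro mult_left_mono) auto
    finally show ?thesis by simp
  qed
  moreover have "0 \<le> (1 + 10 * partition_gf y) * K" using P0 K(1) by simp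
  ultimately show ?thesis by blast
qed

end

lemma norm_triangle4: "norm (p + q + r - s) \<le> norm p + norm q + norm r + norm s"
  for p q r s :: "'a :: real_normed_vector"
  using norm_triangle_ineq4[of "p + q + r" s] norm_triangle_ineq[of "p + q" r] norm_triangle_ineq[of p q] by linarith

lemma geometric_inverse_square_ex:
  fixes r :: real assumes r: "0 < r" "r < 1"
  shows "\<exists>K. 0 \<le> K \<and> (\<forall>n. 1 \<le> n \<longrightarrow> r ^ n \<le> K / (real n)\<^sup>2)"
proof (rule geometric_le_inverse_square[OF r])
  fix K assume "0 \<le> K" "\<And>n. 1 \<le> n \<Longrightarrow> r ^ n \<le> K / (real n)\<^sup>2"
  then show ?thesis by (intro exI[of _ K]) simp
qed

lemma gauss_cf_exp:
  assumes "0 \<le> s2"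
  shows "gauss_cf m s2 n \<theta> = exp (of_nat n * (of_real m * (\<i> * \<theta>) + of_real s2 * (\<i> * \<theta>)\<^sup>2 / 2))"
    "norm (gauss_cf m s2 n \<theta>) = exp (- (s2 / 2) * (real n * \<theta>\<^sup>2))"
proof -
  have sq: "(sqrt s2 * sqrt (real n) * \<theta>)\<^sup>2 = s2 * (real n * \<theta>\<^sup>2)" using assms by (simp add: power_mult_distrib)
  show "gauss_cf m s2 n \<theta> = exp (of_nat n * (of_real m * (\<i> * \<theta>) + of_real s2 * (\<i> * \<theta>)\<^sup>2 / 2))"
    unfolding gauss_cf_def sq exp_of_real[symmetric] exp_add[symmetric]
    by (rule arg_cong[of _ _ exp]) (simp add: power_mult_distrib algebra_simps)
  show "norm (gauss_cf m s2 n \<theta>) = exp (- (s2 / 2) * (real n * \<theta>\<^sup>2))"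
    unfolding gauss_cf_def sq norm_mult by simp
qed

text \<open>Writing \<open>exp w ^ n\<close> as the Gaussian times \<open>exp (n e)\<close>, the
  remainder satisfies \<open>norm (n e) \<le> (s2 / 4) n \<theta>^2\<close>, so
  \<open>exp (n e)\<close> uses up at most half of the Gaussian decay \<open>s2 / 2\<close>.\<close>

lemma quasi_power_gauss:
  assumes s2: "0 < s2" and M: "0 \<le> M"
    and E: "norm (w - (of_real m * (\<i> * \<theta>) + of_real s2 * (\<i> * \<theta>)\<^sup>2 / 2)) \<le> M * \<bar>\<theta>\<bar> ^ 3"
    and small: "M * \<bar>\<theta>\<bar> \<le> s2 / 4"
  shows "norm (exp w ^ n - gauss_cf m s2 n \<theta>) \<le> M * (real n * \<bar>\<theta>\<bar> ^ 3) * exp (- (s2 / 4) * (real n * \<theta>\<^sup>2))"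
    "norm (exp w ^ n) \<le> exp (- (s2 / 4) * (real n * \<theta>\<^sup>2))"
proof -
  let ?g = "gauss_cf m s2 n \<theta>"
  define e where "e = w - (of_real m * (\<i> * \<theta>) + of_real s2 * (\<i> * \<theta>)\<^sup>2 / 2)"
  have e: "norm e \<le> M * \<bar>\<theta>\<bar> ^ 3" using E by (simp add: e_def)
  have cube: "\<bar>\<theta>\<bar> ^ 3 = \<bar>\<theta>\<bar> * \<theta>\<^sup>2" by (simp add: power3_eq_cube power2_eq_square)
  have "M * \<bar>\<theta>\<bar> ^ 3 = (M * \<bar>\<theta>\<bar>) * \<theta>\<^sup>2" by (simp add: cube)
  also have "\<dots> \<le> (s2 / 4) * \<theta>\<^sup>2" by (rule mult_right_mono[OF small]) simp
  finally have e': "norm e \<le> (s2 / 4) * \<theta>\<^sup>2" using e by linarith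
  have "exp w ^ n = exp (of_nat n * w)" by (simp add: exp_of_nat_mult)
  also have "of_nat n * w = of_nat n * (of_real m * (\<i> * \<theta>) + of_real s2 * (\<i> * \<theta>)\<^sup>2 / 2) + of_nat n * e"
    by (simp add: e_def algebra_simps)
  finally have ew: "exp w ^ n = ?g * exp (of_nat n * e)" using s2 by (simp add: exp_add gauss_cf_exp(1))
  have ne: "norm (of_nat n * e) \<le> (s2 / 4) * (real n * \<theta>\<^sup>2)"
    using mult_left_mono[OF e', of "real n"] by (simp add: norm_mult mult_ac)
  have comb: "exp (- (s2 / 2) * (real n * \<theta>\<^sup>2)) * exp ((s2 / 4) * (real n * \<theta>\<^sup>2)) = exp (- (s2 / 4) * (real n * \<theta>\<^sup>2))"
    unfolding exp_add[symmetric] by (rule arg_cong[of _ _ exp]) (simp add: field_simps)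
  have "norm (exp (of_nat n * e) - 1) \<le> exp \<bar>Re (of_nat n * e)\<bar> * norm (of_nat n * e)"
    using Taylor_exp[of "of_nat n * e" 0] by simp
  also have "\<dots> \<le> exp ((s2 / 4) * (real n * \<theta>\<^sup>2)) * (M * (real n * \<bar>\<theta>\<bar> ^ 3))"
  proof (rule mult_mono)
    show "exp \<bar>Re (of_nat n * e)\<bar> \<le> exp ((s2 / 4) * (real n * \<theta>\<^sup>2))"
      using abs_Re_le_cmod[of "of_nat n * e"] ne by (simp only: exp_le_cancel_iff)
    show "norm (of_nat n * e) \<le> M * (real n * \<bar>\<theta>\<bar> ^ 3)"
      using mult_left_mono[OF e, of "real n"] by (simp add: norm_mult mult_ac)
  qed auto
  finally have "norm (?g) * norm (exp (of_nat n * e) - 1) \<le>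
      exp (- (s2 / 2) * (real n * \<theta>\<^sup>2)) * (exp ((s2 / 4) * (real n * \<theta>\<^sup>2)) * (M * (real n * \<bar>\<theta>\<bar> ^ 3)))"
    using s2 by (simp add: gauss_cf_exp(2) del: mult_minus_left)
  also have "\<dots> = M * (real n * \<bar>\<theta>\<bar> ^ 3) * exp (- (s2 / 4) * (real n * \<theta>\<^sup>2))"
    by (subst mult.assoc[symmetric], subst comb) (rule mult.commute)
  finally have "norm (?g) * norm (exp (of_nat n * e) - 1) \<le> M * (real n * \<bar>\<theta>\<bar> ^ 3) * exp (- (s2 / 4) * (real n * \<theta>\<^sup>2))" .
  moreover have "exp w ^ n - ?g = ?g * (exp (of_nat n * e) - 1)" unfolding ew by (simp add: algebra_simps)
  ultimately show "norm (exp w ^ n - ?g) \<le> M * (real n * \<bar>\<theta>\<bar> ^ 3) * exp (- (s2 / 4) * (real n * \<theta>\<^sup>2))"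
    by (simp only: norm_mult)
  have "norm (exp w ^ n) = norm ?g * exp (Re (of_nat n * e))" unfolding ew by (simp only: norm_mult norm_exp_eq_Re)
  also have "\<dots> \<le> exp (- (s2 / 2) * (real n * \<theta>\<^sup>2)) * exp ((s2 / 4) * (real n * \<theta>\<^sup>2))"
    using complex_Re_le_cmod[of "of_nat n * e"] ne s2
    by (intro mult_mono) (auto simp: gauss_cf_exp(2) simp del: mult_minus_left)
  finally show "norm (exp w ^ n) \<le> exp (- (s2 / 4) * (real n * \<theta>\<^sup>2))" unfolding comb .
qed

context partition_root
begin

text \<open>The characteristic function is the quotient
  \<open>\<alpha> n \<theta> / \<alpha> n 0\<close>. For \<open>|\<theta>| < d\<close> the values of
  \<open>\<alpha>\<close> are close to quasi-powers and \<open>quasi_power_gauss\<close> applies;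
  for larger \<open>|\<theta>|\<close> the numerator and the Gaussian are both
  \<open>O(n^(-2))\<close>. Large \<open>n\<close> keeps the denominator away from
  \<open>0\<close>.\<close>

lemma hdv_prob_cf_bound:
  assumes sg: "0 < sg2"
  shows "\<exists>C c N. 0 \<le> C \<and> 0 < c \<and> (\<forall>n\<ge>N. 1 \<le> n \<longrightarrow> 0 < num_linear n \<and>
    (\<forall>\<theta>. \<bar>\<theta>\<bar> \<le> pi \<longrightarrow> norm (lattice_cf (hdv_prob n) n \<theta> - gauss_cf mu sg2 n \<theta>) \<le>
      C * (\<bar>\<theta>\<bar> + real n * \<bar>\<theta>\<bar> ^ 3) * exp (- c * (real n * \<theta>\<^sup>2)) + C / (real n)\<^sup>2))"
proof -
  obtain \<delta> \<psi> A R B where all: "0 < \<delta> \<and> x < R \<and> \<psi> holomorphic_on ball 0 \<delta> \<and> A holomorphic_on ball 0 \<delta> \<and> \<psi> 0 = 0 \<and>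
    deriv \<psi> 0 = of_real mu \<and> deriv (deriv \<psi>) 0 = of_real sg2 \<and> A 0 \<noteq> 0 \<and>
    (\<forall>\<tau>\<in>ball 0 \<delta>. \<forall>n. norm (spine_poly (exp \<tau>) n - A \<tau> * (exp (\<psi> \<tau>) / of_real x) ^ n) \<le> B / R ^ n)"
    using spine_poly_near by (elim exE)
  have \<delta>: "0 < \<delta>" and R: "x < R" and \<psi>: "\<psi> holomorphic_on ball 0 \<delta>" and A: "A holomorphic_on ball 0 \<delta>"
    and mom: "\<psi> 0 = 0" "deriv \<psi> 0 = of_real mu" "deriv (deriv \<psi>) 0 = of_real sg2" and A0: "A 0 \<noteq> 0"
    and near_all: "\<forall>\<tau>\<in>ball 0 \<delta>. \<forall>n. norm (spine_poly (exp \<tau>) n - A \<tau> * (exp (\<psi> \<tau>) / of_real x) ^ n) \<le> B / R ^ n"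
    using all by - (elim conjE, assumption)+
  have near: "norm (spine_poly (exp \<tau>) n - A \<tau> * (exp (\<psi> \<tau>) / of_real x) ^ n) \<le> B / R ^ n" if "\<tau> \<in> ball 0 \<delta>" for \<tau> n
    by (rule near_all[rule_format, OF that])
  obtain M3 where M3: "0 \<le> M3" "\<And>\<tau>. norm \<tau> \<le> \<delta> / 2 \<Longrightarrow> norm (\<psi> \<tau> - (\<Sum>i\<le>2. (deriv ^^ i) \<psi> 0 * \<tau> ^ i / fact i)) \<le> M3 * norm \<tau> ^ Suc 2"
    using holomorphic_taylor_bound[OF \<psi> \<delta>, of 2] by blast
  obtain M1 where M1: "0 \<le> M1" "\<And>\<tau>. norm \<tau> \<le> \<delta> / 2 \<Longrightarrow> norm (A \<tau> - (\<Sum>i\<le>0. (deriv ^^ i) A 0 * \<tau> ^ i / fact i)) \<le> M1 * norm \<tau> ^ Suc 0"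
    using holomorphic_taylor_bound[OF A \<delta>, of 0] by blast
  \<comment> \<open>Inside the disc of the Taylor bounds, small enough for
    \<open>quasi_power_gauss\<close>, and at most \<open>pi\<close>; \<open>M3 + 1\<close> avoids a
    division by zero.\<close>
  define d where "d = min (\<delta> / 2) (min (sg2 / (4 * (M3 + 1))) pi)"
  have "0 < sg2 / (4 * (M3 + 1))" using sg M3(1) by (intro divide_pos_pos) auto
  then have d1: "0 < d" unfolding d_def using \<delta> by simp
  have d2: "d \<le> \<delta> / 2" unfolding d_def by (rule min.cobounded1)
  have d': "d \<le> min (sg2 / (4 * (M3 + 1))) pi" unfolding d_def by (rule min.cobounded2)
  note d = d1 d2 order_trans[OF d' min.cobounded1] order_trans[OF d' min.cobounded2]
  obtain R' where rb: "x < R' \<and> (\<exists>B. \<forall>\<theta> n. d \<le> \<bar>\<theta>\<bar> \<longrightarrow> \<bar>\<theta>\<bar> \<le> pi \<longrightarrow> norm (spine_poly (iexp \<theta>) n) \<le> B / R' ^ n)"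
    using spine_poly_far[OF d(1,4)] by (elim exE)
  obtain B' where far_all: "\<forall>\<theta> n. d \<le> \<bar>\<theta>\<bar> \<longrightarrow> \<bar>\<theta>\<bar> \<le> pi \<longrightarrow> norm (spine_poly (iexp \<theta>) n) \<le> B' / R' ^ n"
    using conjunct2[OF rb] by (elim exE)
  note R' = conjunct1[OF rb] and far = far_all[rule_format]
  obtain K0 where K0_all: "0 \<le> K0 \<and> (\<forall>n\<ge>1. \<forall>\<theta>. norm (of_real x ^ n * (2 * tree_poly n \<theta> - spine_poly (iexp \<theta>) n)) \<le> K0 / (real n)\<^sup>2)"
    using tree_poly_spine_poly by (elim exE)
  note K0 = conjunct1[OF K0_all] conjunct2[OF K0_all, rule_format]
  have xR: "0 < x / R" "x / R < 1" using x R by simp_all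
  obtain K1 where K1_all: "0 \<le> K1 \<and> (\<forall>n. 1 \<le> n \<longrightarrow> (x / R) ^ n \<le> K1 / (real n)\<^sup>2)"
    using geometric_inverse_square_ex[OF xR] by (elim exE)
  note K1 = conjunct1[OF K1_all] conjunct2[OF K1_all, rule_format]
  have xR': "0 < x / R'" "x / R' < 1" using x R' by simp_all
  obtain K2 where K2_all: "0 \<le> K2 \<and> (\<forall>n. 1 \<le> n \<longrightarrow> (x / R') ^ n \<le> K2 / (real n)\<^sup>2)"
    using geometric_inverse_square_ex[OF xR'] by (elim exE)
  note K2 = conjunct1[OF K2_all] conjunct2[OF K2_all, rule_format]
  \<comment> \<open>For \<open>|\<theta>| \<ge> d\<close> the Gaussian is at most
    \<open>r^n\<close>.\<close>
  define r where "r = exp (- (sg2 / 2) * d\<^sup>2)"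
  have r: "0 < r" "r < 1" using sg d(1) by (simp_all add: r_def)
  obtain K3 where K3_all: "0 \<le> K3 \<and> (\<forall>n. 1 \<le> n \<longrightarrow> r ^ n \<le> K3 / (real n)\<^sup>2)"
    using geometric_inverse_square_ex[OF r] by (elim exE)
  note K3 = conjunct1[OF K3_all] conjunct2[OF K3_all, rule_format]
  \<comment> \<open>Scaled by \<open>x^n\<close> so that \<open>\<alpha> n 0\<close> tends to
    \<open>A 0\<close>; the factor \<open>2\<close> stands for the two directions of reading a
    code.\<close>
  define \<alpha> where "\<alpha> n \<theta> = of_real x ^ n * (2 * tree_poly n \<theta>)" for n \<theta>
  define Ke where "Ke = K0 + \<bar>B\<bar> * K1 + \<bar>B'\<bar> * K2"
  have Ke: "0 \<le> Ke" using K0 K1 K2 by (simp add: Ke_def)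
  have pw: "x ^ n * (b / S ^ n) \<le> \<bar>b\<bar> * (x / S) ^ n" if "x < S" for b S n
  proof -
    have "x ^ n * (b / S ^ n) = b * (x / S) ^ n" by (simp add: power_divide)
    also have "\<dots> \<le> \<bar>b\<bar> * (x / S) ^ n" using x that by (intro mult_right_mono) auto
    finally show ?thesis .
  qed
  have \<alpha>_near: "norm (\<alpha> n \<theta> - A (\<i> * \<theta>) * exp (\<psi> (\<i> * \<theta>)) ^ n) \<le> Ke / (real n)\<^sup>2" if n: "1 \<le> n" and t: "\<bar>\<theta>\<bar> < \<delta>" for n \<theta>
  proof -
    have tb: "\<i> * of_real \<theta> \<in> ball 0 \<delta>" using t by (simp add: norm_mult)
    have xn: "of_real x ^ n * (A (\<i> * \<theta>) * (exp (\<psi> (\<i> * \<theta>)) / of_real x) ^ n) = A (\<i> * \<theta>) * exp (\<psi> (\<i> * \<theta>)) ^ n"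
      using x by (simp add: power_divide)
    have "\<alpha> n \<theta> - A (\<i> * \<theta>) * exp (\<psi> (\<i> * \<theta>)) ^ n =
      of_real x ^ n * (2 * tree_poly n \<theta> - spine_poly (iexp \<theta>) n) +
      of_real x ^ n * (spine_poly (iexp \<theta>) n - A (\<i> * \<theta>) * (exp (\<psi> (\<i> * \<theta>)) / of_real x) ^ n)"
      unfolding xn[symmetric] \<alpha>_def by (simp only: right_diff_distrib) simp
    then have "norm (\<alpha> n \<theta> - A (\<i> * \<theta>) * exp (\<psi> (\<i> * \<theta>)) ^ n) \<le>
      norm (of_real x ^ n * (2 * tree_poly n \<theta> - spine_poly (iexp \<theta>) n)) +
      norm (of_real x ^ n * (spine_poly (iexp \<theta>) n - A (\<i> * \<theta>) * (exp (\<psi> (\<i> * \<theta>)) / of_real x) ^ n))"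
      by (simp only: norm_triangle_ineq)
    also have "norm (of_real x ^ n * (spine_poly (iexp \<theta>) n - A (\<i> * \<theta>) * (exp (\<psi> (\<i> * \<theta>)) / of_real x) ^ n)) \<le> x ^ n * (B / R ^ n)"
      using near[OF tb, of n] x by (simp only: norm_mult norm_power norm_of_real) (intro mult_mono, auto)
    also have "\<dots> \<le> \<bar>B\<bar> * (x / R) ^ n" by (rule pw[OF R])
    also have "\<dots> \<le> \<bar>B\<bar> * (K1 / (real n)\<^sup>2)" by (rule mult_left_mono[OF K1(2)[OF n]]) simp
    also have "norm (of_real x ^ n * (2 * tree_poly n \<theta> - spine_poly (iexp \<theta>) n)) \<le> K0 / (real n)\<^sup>2" by (rule K0(2)[OF n])
    finally have "norm (\<alpha> n \<theta> - A (\<i> * \<theta>) * exp (\<psi> (\<i> * \<theta>)) ^ n) \<le> (K0 + \<bar>B\<bar> * K1) / (real n)\<^sup>2" by (simp add: add_divide_distrib)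
    also have "\<dots> \<le> Ke / (real n)\<^sup>2" using K2 by (intro divide_right_mono) (simp_all add: Ke_def)
    finally show ?thesis .
  qed
  have \<alpha>_far: "norm (\<alpha> n \<theta>) \<le> Ke / (real n)\<^sup>2" if n: "1 \<le> n" and t: "d \<le> \<bar>\<theta>\<bar>" "\<bar>\<theta>\<bar> \<le> pi" for n \<theta>
  proof -
    have "\<alpha> n \<theta> = of_real x ^ n * (2 * tree_poly n \<theta> - spine_poly (iexp \<theta>) n) + of_real x ^ n * spine_poly (iexp \<theta>) n"
      unfolding \<alpha>_def by (simp only: right_diff_distrib) simp
    then have "norm (\<alpha> n \<theta>) \<le> norm (of_real x ^ n * (2 * tree_poly n \<theta> - spine_poly (iexp \<theta>) n)) + norm (of_real x ^ n * spine_poly (iexp \<theta>) n)"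
      by (simp only: norm_triangle_ineq)
    also have "norm (of_real x ^ n * spine_poly (iexp \<theta>) n) \<le> x ^ n * (B' / R' ^ n)"
      using far[OF t, of n] x by (simp only: norm_mult norm_power norm_of_real) (intro mult_mono, auto)
    also have "\<dots> \<le> \<bar>B'\<bar> * (x / R') ^ n" by (rule pw[OF R'])
    also have "\<dots> \<le> \<bar>B'\<bar> * (K2 / (real n)\<^sup>2)" by (rule mult_left_mono[OF K2(2)[OF n]]) simp
    also have "norm (of_real x ^ n * (2 * tree_poly n \<theta> - spine_poly (iexp \<theta>) n)) \<le> K0 / (real n)\<^sup>2" by (rule K0(2)[OF n])
    finally have "norm (\<alpha> n \<theta>) \<le> (K0 + \<bar>B'\<bar> * K2) / (real n)\<^sup>2" by (simp add: add_divide_distrib)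
    also have "\<dots> \<le> Ke / (real n)\<^sup>2" using K1 by (intro divide_right_mono) (simp_all add: Ke_def)
    finally show ?thesis .
  qed
  let ?a = "norm (A 0)"
  have a0: "0 < ?a" using A0 by simp
  \<comment> \<open>From \<open>N\<close> on, \<open>Ke / n^2\<close> is at most half of
    \<open>norm (A 0)\<close>.\<close>
  obtain N where N: "2 * Ke / ?a < real N" using reals_Archimedean2 by blast
  define c where "c = sg2 / 4"
  define C where "C = 2 / ?a * (M1 + ?a * M3 + 2 * Ke + (?a + Ke) * K3)"
  have C1: "0 \<le> ?a * M3" "0 \<le> 2 * Ke" "0 \<le> (?a + Ke) * K3" using M3 Ke K3 by simp_all
  have C0: "0 \<le> C" unfolding C_def using a0 M1(1) M3(1) K3(1) Ke by (intro mult_nonneg_nonneg add_nonneg_nonneg) auto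
  have "0 < num_linear n \<and> (\<forall>\<theta>. \<bar>\<theta>\<bar> \<le> pi \<longrightarrow> norm (lattice_cf (hdv_prob n) n \<theta> - gauss_cf mu sg2 n \<theta>) \<le>
      C * (\<bar>\<theta>\<bar> + real n * \<bar>\<theta>\<bar> ^ 3) * exp (- c * (real n * \<theta>\<^sup>2)) + C / (real n)\<^sup>2)"
    if nN: "N \<le> n" and n: "1 \<le> n" for n
  proof -
    have b: "norm (\<alpha> n 0 - A 0) \<le> Ke / (real n)\<^sup>2" using \<alpha>_near[OF n, of 0] \<delta> mom(1) by simp
    have "Ke / (real n)\<^sup>2 \<le> Ke / real n" using n Ke by (intro divide_left_mono) (auto simp: power2_eq_square)
    also have "\<dots> \<le> ?a / 2"
    proof -
      have "2 * Ke / ?a \<le> real n" using N nN by linarith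
      then show ?thesis using a0 n by (simp add: field_simps)
    qed
    finally have half: "Ke / (real n)\<^sup>2 \<le> ?a / 2" .
    have b1: "?a / 2 \<le> norm (\<alpha> n 0)"
      using b half norm_triangle_ineq3[of "\<alpha> n 0" "A 0"] by linarith
    then have \<alpha>0: "\<alpha> n 0 \<noteq> 0" using a0 by auto
    then have pos: "0 < num_linear n" by (auto simp: \<alpha>_def tree_poly_0)
    have "norm (lattice_cf (hdv_prob n) n \<theta> - gauss_cf mu sg2 n \<theta>) \<le>
      C * (\<bar>\<theta>\<bar> + real n * \<bar>\<theta>\<bar> ^ 3) * exp (- c * (real n * \<theta>\<^sup>2)) + C / (real n)\<^sup>2" if t: "\<bar>\<theta>\<bar> \<le> pi" for \<theta>
    proof -
      let ?g = "gauss_cf mu sg2 n \<theta>" and ?X = "exp (- c * (real n * \<theta>\<^sup>2))" and ?e = "Ke / (real n)\<^sup>2"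
      have e0: "0 \<le> ?e" using Ke by simp
      have g1: "norm ?g \<le> 1" using sg by (simp add: gauss_cf_exp(2))
      have "lattice_cf (hdv_prob n) n \<theta> = \<alpha> n \<theta> / \<alpha> n 0"
        using x by (simp add: lattice_cf_hdv_prob \<alpha>_def)
      then have "lattice_cf (hdv_prob n) n \<theta> - ?g = (\<alpha> n \<theta> - \<alpha> n 0 * ?g) / \<alpha> n 0" using \<alpha>0 by (simp add: diff_divide_distrib)
      then have "norm (lattice_cf (hdv_prob n) n \<theta> - ?g) = norm (\<alpha> n \<theta> - \<alpha> n 0 * ?g) / norm (\<alpha> n 0)" by (simp only: norm_divide)
      also have "\<dots> \<le> norm (\<alpha> n \<theta> - \<alpha> n 0 * ?g) / (?a / 2)" using b1 a0 by (intro divide_left_mono mult_pos_pos) auto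
      also have "\<dots> = 2 / ?a * norm (\<alpha> n \<theta> - \<alpha> n 0 * ?g)" by simp
      finally have red: "norm (lattice_cf (hdv_prob n) n \<theta> - ?g) \<le> 2 / ?a * norm (\<alpha> n \<theta> - \<alpha> n 0 * ?g)" .
      have "norm (\<alpha> n \<theta> - \<alpha> n 0 * ?g) \<le> (M1 + ?a * M3) * ((\<bar>\<theta>\<bar> + real n * \<bar>\<theta>\<bar> ^ 3) * ?X) + (2 * Ke + (?a + Ke) * K3) / (real n)\<^sup>2"
      proof (cases "\<bar>\<theta>\<bar> < d")
        case True
        then have td: "\<bar>\<theta>\<bar> < \<delta>" "norm (\<i> * complex_of_real \<theta>) \<le> \<delta> / 2" using d \<delta> by (auto simp: norm_mult)
        let ?t = "\<i> * complex_of_real \<theta>"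
        have E: "norm (\<psi> ?t - (of_real mu * ?t + of_real sg2 * ?t\<^sup>2 / 2)) \<le> M3 * \<bar>\<theta>\<bar> ^ 3"
        proof -
          have s: "(\<Sum>i\<le>2. (deriv ^^ i) \<psi> 0 * ?t ^ i / fact i) = of_real mu * ?t + of_real sg2 * ?t\<^sup>2 / 2"
            by (simp add: numeral_2_eq_2 mom)
          have c: "norm ?t ^ Suc 2 = \<bar>\<theta>\<bar> ^ 3" by (simp add: norm_mult)
          show ?thesis using M3(2)[OF td(2)] unfolding s c .
        qed
        have "M3 * \<bar>\<theta>\<bar> \<le> (M3 + 1) * (sg2 / (4 * (M3 + 1)))" using True d(3) M3(1) by (intro mult_mono) auto
        moreover have "q * (sg2 / (4 * q)) = sg2 / 4" if "q \<noteq> 0" for q using that by simp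
        moreover have "M3 + 1 \<noteq> 0" using M3(1) by linarith
        ultimately have sm: "M3 * \<bar>\<theta>\<bar> \<le> sg2 / 4" by metis
        note qp = quasi_power_gauss[OF sg M3(1) E sm, of n, folded c_def]
        have A1: "norm (A ?t - A 0) \<le> M1 * \<bar>\<theta>\<bar>" using M1(2)[OF td(2)] by (simp add: norm_mult)
        \<comment> \<open>The four terms are the quasi-power error at \<open>\<theta>\<close>, the
          variation of \<open>A\<close>, the Gaussian approximation, and the error at
          \<open>0\<close>.\<close>
        have "\<alpha> n \<theta> - \<alpha> n 0 * ?g = (\<alpha> n \<theta> - A ?t * exp (\<psi> ?t) ^ n) + (A ?t - A 0) * exp (\<psi> ?t) ^ n
            + A 0 * (exp (\<psi> ?t) ^ n - ?g) - (\<alpha> n 0 - A 0) * ?g" by (simp add: algebra_simps)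
        then have "norm (\<alpha> n \<theta> - \<alpha> n 0 * ?g) \<le> norm (\<alpha> n \<theta> - A ?t * exp (\<psi> ?t) ^ n) + norm ((A ?t - A 0) * exp (\<psi> ?t) ^ n)
            + norm (A 0 * (exp (\<psi> ?t) ^ n - ?g)) + norm ((\<alpha> n 0 - A 0) * ?g)"
          by (simp only: norm_triangle4)
        also have "norm (\<alpha> n \<theta> - A ?t * exp (\<psi> ?t) ^ n) \<le> ?e" by (rule \<alpha>_near[OF n td(1)])
        also have "norm ((A ?t - A 0) * exp (\<psi> ?t) ^ n) \<le> M1 * \<bar>\<theta>\<bar> * ?X"
          unfolding norm_mult using A1 qp(2) M1(1) by (intro mult_mono) auto
        also have "norm (A 0 * (exp (\<psi> ?t) ^ n - ?g)) \<le> ?a * (M3 * (real n * \<bar>\<theta>\<bar> ^ 3) * ?X)"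
          unfolding norm_mult using qp(1) by (intro mult_left_mono) auto
        also have "norm ((\<alpha> n 0 - A 0) * ?g) \<le> ?e * 1"
          unfolding norm_mult by (rule mult_mono[OF b g1 e0 norm_ge_zero])
        finally have 1: "norm (\<alpha> n \<theta> - \<alpha> n 0 * ?g) \<le> ?e + M1 * \<bar>\<theta>\<bar> * ?X + ?a * (M3 * (real n * \<bar>\<theta>\<bar> ^ 3) * ?X) + ?e * 1" by simp
        have "M1 * \<bar>\<theta>\<bar> * ?X + ?a * (M3 * (real n * \<bar>\<theta>\<bar> ^ 3) * ?X) \<le> (M1 + ?a * M3) * ((\<bar>\<theta>\<bar> + real n * \<bar>\<theta>\<bar> ^ 3) * ?X)"
        proof -
          have "0 \<le> M1 * (real n * \<bar>\<theta>\<bar> ^ 3) * ?X" "0 \<le> ?a * M3 * \<bar>\<theta>\<bar> * ?X" using M1(1) M3(1) by simp_all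
          then show ?thesis by (simp add: algebra_simps)
        qed
        moreover have "2 * ?e \<le> (2 * Ke + (?a + Ke) * K3) / (real n)\<^sup>2"
          using C1(3) by (simp add: add_divide_distrib)
        ultimately show ?thesis using 1 by linarith
      next
        case False
        then have td: "d \<le> \<bar>\<theta>\<bar>" by simp
        have "norm ?g \<le> r ^ n"
        proof -
          have "d\<^sup>2 \<le> \<theta>\<^sup>2" using td d(1) by (metis abs_le_square_iff abs_of_pos)
          then have "(sg2 / 2) * (real n * d\<^sup>2) \<le> (sg2 / 2) * (real n * \<theta>\<^sup>2)" using sg by (intro mult_left_mono) auto
          then have "norm ?g \<le> exp (- ((sg2 / 2) * (real n * d\<^sup>2)))" using sg by (simp add: gauss_cf_exp(2))
          also have "\<dots> = r ^ n" unfolding r_def exp_of_nat_mult[symmetric] by (rule arg_cong[of _ _ exp]) simp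
          finally show ?thesis .
        qed
        also have "\<dots> \<le> K3 / (real n)\<^sup>2" by (rule K3(2)[OF n])
        finally have g: "norm ?g \<le> K3 / (real n)\<^sup>2" .
        have "?e \<le> Ke / 1" using n Ke by (intro divide_left_mono) (auto simp: one_le_power)
        moreover have "norm (\<alpha> n 0) \<le> norm (A 0) + norm (\<alpha> n 0 - A 0)" by (rule norm_triangle_sub)
        ultimately have \<alpha>0': "norm (\<alpha> n 0) \<le> ?a + Ke" using b by linarith
        have "norm (\<alpha> n \<theta> - \<alpha> n 0 * ?g) \<le> norm (\<alpha> n \<theta>) + norm (\<alpha> n 0) * norm ?g"
          using norm_triangle_ineq4[of "\<alpha> n \<theta>" "\<alpha> n 0 * ?g"] by (simp only: norm_mult)
        also have "norm (\<alpha> n \<theta>) \<le> ?e" by (rule \<alpha>_far[OF n td t])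
        also have "norm (\<alpha> n 0) * norm ?g \<le> (?a + Ke) * (K3 / (real n)\<^sup>2)"
          by (rule mult_mono[OF \<alpha>0' g]) (use Ke in auto)
        finally have "norm (\<alpha> n \<theta> - \<alpha> n 0 * ?g) \<le> (Ke + (?a + Ke) * K3) / (real n)\<^sup>2" by (simp add: add_divide_distrib)
        also have "\<dots> \<le> (2 * Ke + (?a + Ke) * K3) / (real n)\<^sup>2" using Ke by (intro divide_right_mono) auto
        also have "\<dots> \<le> (M1 + ?a * M3) * ((\<bar>\<theta>\<bar> + real n * \<bar>\<theta>\<bar> ^ 3) * ?X) + \<dots>"
        proof -
          have "0 \<le> (M1 + ?a * M3) * ((\<bar>\<theta>\<bar> + real n * \<bar>\<theta>\<bar> ^ 3) * ?X)"
            using M1(1) M3(1) by (intro mult_nonneg_nonneg add_nonneg_nonneg) auto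
          then show ?thesis by linarith
        qed
        finally show ?thesis .
      qed
      from order_trans[OF red mult_left_mono[OF this, of "2 / ?a"]]
      have "norm (lattice_cf (hdv_prob n) n \<theta> - ?g) \<le> 2 / ?a * ((M1 + ?a * M3) * ((\<bar>\<theta>\<bar> + real n * \<bar>\<theta>\<bar> ^ 3) * ?X) + (2 * Ke + (?a + Ke) * K3) / (real n)\<^sup>2)"
        by simp
      also have "\<dots> = (2 / ?a * (M1 + ?a * M3)) * ((\<bar>\<theta>\<bar> + real n * \<bar>\<theta>\<bar> ^ 3) * ?X) + (2 / ?a * (2 * Ke + (?a + Ke) * K3)) / (real n)\<^sup>2"
      proof -
        have "k * (p * X + q / M) = (k * p) * X + (k * q) / M" for k p q X M :: real by (simp add: distrib_left)
        then show ?thesis .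
      qed
      also have "\<dots> \<le> C * ((\<bar>\<theta>\<bar> + real n * \<bar>\<theta>\<bar> ^ 3) * ?X) + C / (real n)\<^sup>2"
      proof (intro add_mono mult_right_mono divide_right_mono)
        show "2 / ?a * (M1 + ?a * M3) \<le> C" unfolding C_def by (rule mult_left_mono) (use C1 in linarith, use a0 in simp)
        show "2 / ?a * (2 * Ke + (?a + Ke) * K3) \<le> C" unfolding C_def by (rule mult_left_mono) (use C1 M1(1) in linarith, use a0 in simp)
      qed auto
      finally show ?thesis by (simp only: mult.assoc)
    qed
    then show ?thesis using pos by blast
  qed
  moreover have "0 < c" using sg by (simp add: c_def)
  ultimately show ?thesis using C0 by blast
qed

lemma hdv_berry_esseen:
  assumes "0 < mu" "0 < sg2"
  shows "\<exists>C N. \<forall>n\<ge>N. 1 \<le> n \<longrightarrow> (\<Sum>k\<le>n. hdv_prob n k) = 1 \<and>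
    (\<forall>t. \<bar>lattice_cdf (hdv_prob n) n (mu * real n + sqrt sg2 * sqrt (real n) * t) - std_cdf t\<bar> \<le> C / sqrt (real n))"
proof -
  obtain C c N where all: "0 \<le> C \<and> 0 < c \<and> (\<forall>n\<ge>N. 1 \<le> n \<longrightarrow> 0 < num_linear n \<and>
    (\<forall>\<theta>. \<bar>\<theta>\<bar> \<le> pi \<longrightarrow> norm (lattice_cf (hdv_prob n) n \<theta> - gauss_cf mu sg2 n \<theta>) \<le>
      C * (\<bar>\<theta>\<bar> + real n * \<bar>\<theta>\<bar> ^ 3) * exp (- c * (real n * \<theta>\<^sup>2)) + C / (real n)\<^sup>2))"
    using hdv_prob_cf_bound[OF assms(2)] by (elim exE)
  note C0 = conjunct1[OF all] and c0 = conjunct1[OF conjunct2[OF all]] and cf = conjunct2[OF conjunct2[OF all], rule_format]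
  obtain C' where C'_all: "\<forall>n\<ge>1. \<forall>p. (\<forall>k. 0 \<le> p k) \<longrightarrow> (\<Sum>k\<le>n. p k) = 1 \<longrightarrow>
    (\<forall>\<theta>. \<bar>\<theta>\<bar> \<le> pi \<longrightarrow> norm (lattice_cf p n \<theta> - gauss_cf mu sg2 n \<theta>) \<le>
        C * (\<bar>\<theta>\<bar> + real n * \<bar>\<theta>\<bar> ^ 3) * exp (- c * (real n * \<theta>\<^sup>2)) + C / (real n)\<^sup>2) \<longrightarrow>
    (\<forall>t. \<bar>lattice_cdf p n (mu * real n + sqrt sg2 * sqrt (real n) * t) - std_cdf t\<bar> \<le> C' / sqrt (real n))"
    using lattice_berry_esseen[OF assms c0 C0] by (elim exE)
  note C' = C'_all[rule_format]
  show ?thesis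
  proof (intro exI allI impI)
    fix n assume nN: "N \<le> n" and n: "1 \<le> n"
    note cfn = cf[OF nN n]
    have sum1: "(\<Sum>k\<le>n. hdv_prob n k) = 1"
    proof -
      have "(\<Sum>k\<le>n. hdv_prob n k) = real (num_linear n) / real (num_linear n)"
        unfolding hdv_prob_def sum_divide_distrib[symmetric] by (simp add: num_linear_def)
      then show ?thesis using conjunct1[OF cfn] by simp
    qed
    have nn: "0 \<le> hdv_prob n k" for k by (simp add: hdv_prob_def)
    show "(\<Sum>k\<le>n. hdv_prob n k) = 1 \<and>
      (\<forall>t. \<bar>lattice_cdf (hdv_prob n) n (mu * real n + sqrt sg2 * sqrt (real n) * t) - std_cdf t\<bar> \<le> C' / sqrt (real n))"
    proof (intro conjI allI sum1)
      fix t show "\<bar>lattice_cdf (hdv_prob n) n (mu * real n + sqrt sg2 * sqrt (real n) * t) - std_cdf t\<bar> \<le> C' / sqrt (real n)"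
      proof (rule C'[OF n nn sum1])
        fix \<theta> :: real assume t: "\<bar>\<theta>\<bar> \<le> pi"
        show "norm (lattice_cf (hdv_prob n) n \<theta> - gauss_cf mu sg2 n \<theta>) \<le>
          C * (\<bar>\<theta>\<bar> + real n * \<bar>\<theta>\<bar> ^ 3) * exp (- c * (real n * \<theta>\<^sup>2)) + C / (real n)\<^sup>2"
          by (rule conjunct2[OF cfn, rule_format, OF t])
      qed
    qed
  qed
qed

end

section \<open>Lambert series and the derivatives of the partition generating function\<close>

definition lambert_sum :: "real \<Rightarrow> real" where
  "lambert_sum x = (\<Sum>i. real (Suc i) * x ^ Suc i / (1 - x ^ Suc i))"

definition lambert_sum2 :: "real \<Rightarrow> real" where
  "lambert_sum2 x = (\<Sum>i. (real (Suc i))\<^sup>2 * x ^ Suc i / (1 - x ^ Suc i)\<^sup>2)"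

lemma summable_square_geometric:
  fixes r :: real assumes r: "0 < r" "r < 1"
  shows "summable (\<lambda>i. (real (Suc i))\<^sup>2 * r ^ Suc i)"
proof -
  define y where "y = sqrt r"
  have y: "0 < y" "y < 1" using r by (simp_all add: y_def)
  have ry: "r = y * y" using r by (simp add: y_def)
  obtain K where K: "\<And>n. real n ^ 3 * y ^ n \<le> K" using cubic_geometric_bound[OF y] by blast
  have le: "(real (Suc i))\<^sup>2 * r ^ Suc i \<le> K * y ^ Suc i" for i
  proof -
    have "(real (Suc i))\<^sup>2 * y ^ Suc i \<le> real (Suc i) ^ 3 * y ^ Suc i"
      using y by (intro mult_right_mono power_increasing) auto
    also have "\<dots> \<le> K" by (rule K)
    finally have "(real (Suc i))\<^sup>2 * y ^ Suc i * y ^ Suc i \<le> K * y ^ Suc i" using y by (intro mult_right_mono) auto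
    then show ?thesis unfolding ry power_mult_distrib by (simp only: mult.assoc)
  qed
  have "summable (\<lambda>i. y ^ Suc i)" using y by (subst summable_Suc_iff) (simp add: summable_geometric)
  then have "summable (\<lambda>i. K * y ^ Suc i)" by (rule summable_mult)
  then show ?thesis
    by (rule summable_comparison_test'[where N = 0]) (use le r in simp)
qed

text \<open>Majorants that depend on \<open>b\<close> alone, for comparison of series and for
  uniform convergence near a point.\<close>

lemma lambert_bounds:
  fixes y b :: real assumes y: "0 < y" "y \<le> b" "b < 1"
  shows "0 < 1 - b" "1 - b \<le> 1 - y ^ Suc i" "0 \<le> real (Suc i) * y ^ Suc i / (1 - y ^ Suc i)"
    "0 \<le> (real (Suc i))\<^sup>2 * y ^ Suc i / (1 - y ^ Suc i)\<^sup>2"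
    "real (Suc i) * y ^ Suc i / (1 - y ^ Suc i) \<le> (real (Suc i))\<^sup>2 * b ^ Suc i / (1 - b)"
    "(real (Suc i))\<^sup>2 * y ^ Suc i / (1 - y ^ Suc i)\<^sup>2 \<le> (real (Suc i))\<^sup>2 * b ^ Suc i / (1 - b)\<^sup>2"
proof -
  show b: "0 < 1 - b" using y by simp
  have "y ^ Suc i \<le> y ^ 1" using y by (intro power_decreasing) auto
  then have "y ^ Suc i \<le> b" using y(2) by (simp only: power_one_right)
  then show d: "1 - b \<le> 1 - y ^ Suc i" by simp
  then show "0 \<le> real (Suc i) * y ^ Suc i / (1 - y ^ Suc i)" "0 \<le> (real (Suc i))\<^sup>2 * y ^ Suc i / (1 - y ^ Suc i)\<^sup>2"
    using b y by (auto intro!: divide_nonneg_nonneg mult_nonneg_nonneg)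
  have p: "y ^ Suc i \<le> b ^ Suc i" using y by (intro power_mono) auto
  have "real (Suc i) ^ 1 \<le> real (Suc i) ^ 2" by (rule power_increasing) auto
  then show "real (Suc i) * y ^ Suc i / (1 - y ^ Suc i) \<le> (real (Suc i))\<^sup>2 * b ^ Suc i / (1 - b)"
    using p d b y by (intro frac_le mult_mono) auto
  show "(real (Suc i))\<^sup>2 * y ^ Suc i / (1 - y ^ Suc i)\<^sup>2 \<le> (real (Suc i))\<^sup>2 * b ^ Suc i / (1 - b)\<^sup>2"
    using p d b y by (intro frac_le mult_mono power_mono) auto
qed

lemma lambert_summable:
  assumes x: "0 < x" "x < 1"
  shows "summable (\<lambda>i. real (Suc i) * x ^ Suc i / (1 - x ^ Suc i))"
    "summable (\<lambda>i. (real (Suc i))\<^sup>2 * x ^ Suc i / (1 - x ^ Suc i)\<^sup>2)"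
proof -
  note b = lambert_bounds[OF x(1) order_refl x(2)]
  show "summable (\<lambda>i. real (Suc i) * x ^ Suc i / (1 - x ^ Suc i))"
    by (rule summable_comparison_test'[OF summable_divide[OF summable_square_geometric[OF x]], where N = 0])
      (unfold real_norm_def, subst abs_of_nonneg[OF b(3)], rule b(5))
  show "summable (\<lambda>i. (real (Suc i))\<^sup>2 * x ^ Suc i / (1 - x ^ Suc i)\<^sup>2)"
    by (rule summable_comparison_test'[OF summable_divide[OF summable_square_geometric[OF x]], where N = 0])
      (unfold real_norm_def, subst abs_of_nonneg[OF b(4)], rule b(6))
qed

lemma frac_power_mono:
  fixes a b w :: real
  assumes "0 < a" "a \<le> b" "b < 1" "0 \<le> w"
  shows "w * a ^ Suc i / (1 - a ^ Suc i) ^ k \<le> w * b ^ Suc i / (1 - b ^ Suc i) ^ k"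
proof -
  have "a ^ Suc i \<le> b ^ Suc i" using assms by (intro power_mono) auto
  moreover have "0 < 1 - b ^ Suc i" using lambert_bounds(2)[of b b i] assms by linarith
  ultimately show ?thesis using assms by (intro frac_le mult_left_mono power_mono zero_less_power) auto
qed

lemma lambert_mono:
  assumes "0 < a" "a \<le> b" "b < 1"
  shows "lambert_sum a \<le> lambert_sum b" "lambert_sum2 a \<le> lambert_sum2 b"
proof -
  have a: "a < 1" and b: "0 < b" using assms by auto
  show "lambert_sum a \<le> lambert_sum b" unfolding lambert_sum_def
    by (rule suminf_le[OF _ lambert_summable(1)[OF assms(1) a] lambert_summable(1)[OF b assms(3)]])
      (use frac_power_mono[OF assms, of _ _ 1] in simp)
  show "lambert_sum2 a \<le> lambert_sum2 b" unfolding lambert_sum2_def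
    by (rule suminf_le[OF _ lambert_summable(2)[OF assms(1) a] lambert_summable(2)[OF b assms(3)]])
      (rule frac_power_mono[OF assms], simp)
qed

lemma partition_gf_pos: "0 \<le> x \<Longrightarrow> x < 1 \<Longrightarrow> 0 < partition_gf x"
  using pnum_pow_le[of x 0] by (simp add: pnum_0)

lemma ln_partition_gf_sums:
  assumes x: "0 < x" "x < 1"
  shows "(\<lambda>i. - ln (1 - x ^ Suc i)) sums ln (partition_gf x)"
proof -
  have pos: "0 < 1 - x ^ Suc i" for i using lambert_bounds(2)[of x x i] x by linarith
  have "(\<lambda>N. ln (\<Prod>i<N. 1 / (1 - x ^ Suc i))) \<longlonglongrightarrow> ln (partition_gf x)"
    by (intro tendsto_ln partition_product_LIMSEQ) (use x partition_gf_pos[of x] in auto)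
  moreover have "ln (1 / (1 - x ^ Suc i)) = - ln (1 - x ^ Suc i)" for i
    using pos[of i] by (simp add: ln_div del: power_Suc)
  moreover have "ln (\<Prod>i<N. 1 / (1 - x ^ Suc i)) = (\<Sum>i<N. ln (1 / (1 - x ^ Suc i)))" for N
  proof (rule ln_prod[OF finite_lessThan])
    have "x ^ Suc i \<noteq> 1" for i using pos[of i] by (simp del: power_Suc)
    then show "1 / (1 - x ^ Suc i) \<noteq> 0" for i by (simp del: power_Suc)
  qed
  ultimately show ?thesis by (simp add: sums_def)
qed

text \<open>Termwise differentiation on an interval that is bounded away from \<open>1\<close>, for
  the majorants, and from \<open>0\<close>, because the derivatives of the terms contain a division
  by \<open>y\<close>.\<close>

lemma lambert_derivs:
  assumes x: "0 < x" "x < 1"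
  shows "((\<lambda>y. \<Sum>i. - ln (1 - y ^ Suc i)) has_real_derivative lambert_sum x / x) (at x)"
    "(lambert_sum has_real_derivative lambert_sum2 x / x) (at x)"
proof -
  define b where "b = (1 + x) / 2"
  have b: "x < b" "b < 1" "0 < b" using x by (simp_all add: b_def)
  let ?S = "{x / 2<..<b}"
  have S: "convex ?S" and xS: "x \<in> ?S" "x \<in> interior ?S" using x b by (auto simp: interior_open)
  have pos: "0 < 1 - y ^ Suc i" if "y \<in> ?S" for y i
    using lambert_bounds(2)[of y y i] x b that by (auto simp del: power_Suc)
  have yb: "0 < y" "y \<le> b" if "y \<in> ?S" for y using that x by auto
  have sq: "summable (\<lambda>i. (real (Suc i))\<^sup>2 * b ^ Suc i / q / (x / 2))" for q
    by (intro summable_divide summable_square_geometric b)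
  have pw: "((\<lambda>y. 1 - y ^ Suc i) has_real_derivative 0 - real (Suc i) * y ^ i) (at y within ?S)" for i y
    using DERIV_diff[OF DERIV_const DERIV_pow[of "Suc i" y ?S]] by simp
  have d: "((\<lambda>y. - ln (1 - y ^ Suc i)) has_real_derivative (real (Suc i) * y ^ Suc i / (1 - y ^ Suc i) / y)) (at y within ?S)"
    if "y \<in> ?S" for i y
  proof -
    let ?m = "real (Suc i)" and ?p = "1 - y ^ Suc i"
    have "((\<lambda>y. - ln (1 - y ^ Suc i)) has_real_derivative - (inverse ?p * (0 - ?m * y ^ i))) (at y within ?S)"
      by (rule DERIV_minus[OF DERIV_chain'[OF pw DERIV_ln[OF pos[OF that, of i]]]])
    moreover have "- (inverse ?p * (0 - ?m * y ^ i)) = ?m * y ^ Suc i / ?p / y"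
      using yb[OF that] by (simp add: divide_inverse)
    ultimately show ?thesis by (simp only:)
  qed
  have d2: "((\<lambda>y. real (Suc i) * y ^ Suc i / (1 - y ^ Suc i)) has_real_derivative ((real (Suc i))\<^sup>2 * y ^ Suc i / (1 - y ^ Suc i)\<^sup>2 / y)) (at y within ?S)"
    if "y \<in> ?S" for i y
  proof -
    let ?m = "real (Suc i)" and ?p = "1 - y ^ Suc i"
    have "((\<lambda>y. ?m * y ^ Suc i) has_real_derivative ?m * (?m * y ^ i)) (at y within ?S)"
      using DERIV_cmult[OF DERIV_pow[of "Suc i" y ?S], of ?m] by simp
    then have "((\<lambda>y. ?m * y ^ Suc i / (1 - y ^ Suc i)) has_real_derivative
       (((?m * (?m * y ^ i)) * ?p - (?m * y ^ Suc i) * (0 - ?m * y ^ i)) / (?p * ?p))) (at y within ?S)"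
      by (rule DERIV_divide[OF _ pw]) (use pos[OF that, of i] in simp)
    moreover have "((?m * (?m * y ^ i)) * ?p - (?m * y ^ Suc i) * (0 - ?m * y ^ i)) = ?m\<^sup>2 * y ^ i"
      by (simp add: algebra_simps power2_eq_square)
    moreover have "?m\<^sup>2 * y ^ i / (?p * ?p) = ?m\<^sup>2 * y ^ Suc i / ?p\<^sup>2 / y"
      using yb[OF that] by (simp add: power2_eq_square)
    ultimately show ?thesis by (simp only:)
  qed
  have u: "uniformly_convergent_on ?S (\<lambda>n y. \<Sum>i<n. real (Suc i) * y ^ Suc i / (1 - y ^ Suc i) / y)"
  proof (rule Weierstrass_m_test'[OF _ sq[of "1 - b"]])
    fix i y assume y: "y \<in> ?S"
    note lb = lambert_bounds(2-6)[OF yb[OF y] b(2), of i]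
    show "norm (real (Suc i) * y ^ Suc i / (1 - y ^ Suc i) / y) \<le> (real (Suc i))\<^sup>2 * b ^ Suc i / (1 - b) / (x / 2)"
      unfolding abs_divide[of _ y] real_norm_def abs_of_nonneg[OF lb(2)] abs_of_pos[OF yb(1)[OF y]]
      by (rule frac_le[OF order_trans[OF lb(2,4)] lb(4)]) (use x y in auto)
  qed
  have u2: "uniformly_convergent_on ?S (\<lambda>n y. \<Sum>i<n. (real (Suc i))\<^sup>2 * y ^ Suc i / (1 - y ^ Suc i)\<^sup>2 / y)"
  proof (rule Weierstrass_m_test'[OF _ sq[of "(1 - b)\<^sup>2"]])
    fix i y assume y: "y \<in> ?S"
    note lb = lambert_bounds(2-6)[OF yb[OF y] b(2), of i]
    show "norm ((real (Suc i))\<^sup>2 * y ^ Suc i / (1 - y ^ Suc i)\<^sup>2 / y) \<le> (real (Suc i))\<^sup>2 * b ^ Suc i / (1 - b)\<^sup>2 / (x / 2)"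
      unfolding abs_divide[of _ y] real_norm_def abs_of_nonneg[OF lb(3)] abs_of_pos[OF yb(1)[OF y]]
      by (rule frac_le[OF order_trans[OF lb(3,5)] lb(5)]) (use x y in auto)
  qed
  have "((\<lambda>y. \<Sum>i. - ln (1 - y ^ Suc i)) has_real_derivative (\<Sum>i. real (Suc i) * x ^ Suc i / (1 - x ^ Suc i) / x)) (at x)"
    by (rule has_field_derivative_series'(2)[OF S d u xS(1) _ xS(2)])
      (assumption, rule sums_summable[OF ln_partition_gf_sums[OF x]])
  then show "((\<lambda>y. \<Sum>i. - ln (1 - y ^ Suc i)) has_real_derivative lambert_sum x / x) (at x)"
    unfolding lambert_sum_def suminf_divide[OF lambert_summable(1)[OF x]] .
  have "((\<lambda>y. \<Sum>i. real (Suc i) * y ^ Suc i / (1 - y ^ Suc i)) has_real_derivative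
      (\<Sum>i. (real (Suc i))\<^sup>2 * x ^ Suc i / (1 - x ^ Suc i)\<^sup>2 / x)) (at x)"
    by (rule has_field_derivative_series'(2)[OF S d2 u2 xS(1) _ xS(2)])
      (assumption, rule lambert_summable(1)[OF x])
  then show "(lambert_sum has_real_derivative lambert_sum2 x / x) (at x)"
    unfolding lambert_sum2_def suminf_divide[OF lambert_summable(2)[OF x]] lambert_sum_def[abs_def] .
qed

text \<open>\<open>partition_gf\<close> is the exponential of the series in
  \<open>ln_partition_gf_sums\<close>.\<close>

lemma partition_gf_deriv:
  assumes x: "0 < x" "x < 1"
  shows "(partition_gf has_real_derivative partition_gf x * lambert_sum x / x) (at x)"
proof -
  have eq: "exp (\<Sum>i. - ln (1 - y ^ Suc i)) = partition_gf y" if "0 < y" "y < 1" for y :: real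
    using partition_gf_pos[of y] that by (simp add: sums_unique[OF ln_partition_gf_sums[OF that], symmetric] del: power_Suc)
  have "((\<lambda>y. exp (\<Sum>i. - ln (1 - y ^ Suc i))) has_real_derivative exp (\<Sum>i. - ln (1 - x ^ Suc i)) * (lambert_sum x / x)) (at x)"
    by (rule DERIV_fun_exp[OF lambert_derivs(1)[OF x]])
  then have "((\<lambda>y. exp (\<Sum>i. - ln (1 - y ^ Suc i))) has_real_derivative partition_gf x * lambert_sum x / x) (at x)"
    unfolding eq[OF x] by simp
  then show ?thesis
    by (rule has_field_derivative_transform_within_open[of _ _ _ "{0<..<1}"]) (use x eq in auto)
qed

lemma partition_gf_deriv2:
  assumes x: "0 < x" "x < 1"
  shows "(deriv partition_gf has_real_derivative
    partition_gf x * ((lambert_sum x)\<^sup>2 + lambert_sum2 x - lambert_sum x) / x\<^sup>2) (at x)"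
proof -
  have "((\<lambda>y. partition_gf y * lambert_sum y / y) has_real_derivative
    ((partition_gf x * lambert_sum x / x * lambert_sum x + lambert_sum2 x / x * partition_gf x) * x
      - partition_gf x * lambert_sum x * 1) / (x * x)) (at x)"
    by (intro DERIV_divide DERIV_mult partition_gf_deriv lambert_derivs(2) DERIV_ident x) (use x in simp)
  moreover have "((partition_gf x * lambert_sum x / x * lambert_sum x + lambert_sum2 x / x * partition_gf x) * x
      - partition_gf x * lambert_sum x * 1) / (x * x) =
    partition_gf x * ((lambert_sum x)\<^sup>2 + lambert_sum2 x - lambert_sum x) / x\<^sup>2"
    using x by (simp add: field_simps power2_eq_square)
  ultimately have "((\<lambda>y. partition_gf y * lambert_sum y / y) has_real_derivative
    partition_gf x * ((lambert_sum x)\<^sup>2 + lambert_sum2 x - lambert_sum x) / x\<^sup>2) (at x)" by simp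
  then show ?thesis
    by (rule has_field_derivative_transform_within_open[of _ _ _ "{0<..<1}"])
      (use x DERIV_imp_deriv[OF partition_gf_deriv] in auto)
qed

section \<open>Numerical bounds\<close>

text \<open>
  In both predicates below an entry \<open>(l, u, q, s, t)\<close> at position \<open>m\<close> stands for one-sided bounds, scaled by
  \<open>10^12\<close>: \<open>l \<le> a^m \<le> u\<close>, and \<open>q, s, t\<close> bound \<open>\<Prod>i\<le>m. 1 - a^i\<close> and the \<open>m\<close>-th terms of the two
  Lambert series, where \<open>a = c / 10^12\<close>; \<open>r\<close> bounds the last \<open>q\<close>.
\<close>

type_synonym certificate = "(real \<times> real \<times> real \<times> real \<times> real) list"

fun lower_certificate :: "real \<Rightarrow> real \<Rightarrow> real \<Rightarrow> real \<Rightarrow> real \<Rightarrow> real \<Rightarrow> certificate \<Rightarrow> bool" where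
  "lower_certificate c r m l0 u0 q0 [] \<longleftrightarrow> r \<le> q0"
| "lower_certificate c r m l0 u0 q0 ((l, u, q, s, t) # cs) \<longleftrightarrow>
    0 \<le> l \<and> l * 10^12 \<le> l0 * c \<and> u0 * c \<le> u * 10^12 \<and> u < 10^12 \<and> q * 10^12 \<le> q0 * (10^12 - u) \<and> 0 \<le> q \<and>
    s * (10^12 - l) \<le> m * l * 10^12 \<and> t * (10^12 - l)\<^sup>2 \<le> m\<^sup>2 * l * (10^12)\<^sup>2 \<and>
    lower_certificate c r (m + 1) l u q cs"

fun upper_certificate :: "real \<Rightarrow> real \<Rightarrow> real \<Rightarrow> real \<Rightarrow> real \<Rightarrow> real \<Rightarrow> certificate \<Rightarrow> bool" where
  "upper_certificate c r m l0 u0 q0 [] \<longleftrightarrow> q0 \<le> r"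
| "upper_certificate c r m l0 u0 q0 ((l, u, q, s, t) # cs) \<longleftrightarrow>
    0 \<le> l \<and> l * 10^12 \<le> l0 * c \<and> u0 * c \<le> u * 10^12 \<and> u < 10^12 \<and> q0 * (10^12 - l) \<le> q * 10^12 \<and> 0 \<le> q \<and>
    m * u * 10^12 \<le> s * (10^12 - u) \<and> m\<^sup>2 * u * (10^12)\<^sup>2 \<le> t * (10^12 - u)\<^sup>2 \<and>
    upper_certificate c r (m + 1) l u q cs"

fun total_s :: "certificate \<Rightarrow> real" where
  "total_s [] = 0" | "total_s ((l, u, q, s, t) # cs) = s + total_s cs"

fun total_t :: "certificate \<Rightarrow> real" where
  "total_t [] = 0" | "total_t ((l, u, q, s, t) # cs) = t + total_t cs"

lemma sum_offset_Suc: "(\<Sum>i<Suc k. f (n + i)) = f n + (\<Sum>i<k. f (Suc n + i))"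
  for f :: "nat \<Rightarrow> 'a :: comm_monoid_add"
  by (subst sum.lessThan_Suc_shift) simp

section \<open>Soundness of the certificates\<close>

lemma power_bracket:
  fixes a c K l0 u0 l u p :: real
  assumes K: "0 < K" "a = c / K" and a: "0 \<le> a" and p: "l0 \<le> K * p" "K * p \<le> u0"
    and c: "l * K \<le> l0 * c" "u0 * c \<le> u * K"
  shows "l \<le> K * (a * p)" "K * (a * p) \<le> u"
proof -
  have "l * K \<le> (l0 * a) * K" "(u0 * a) * K \<le> u * K" using c K by simp_all
  then have "l \<le> l0 * a" "u0 * a \<le> u" using K(1) by simp_all
  then show "l \<le> K * (a * p)" "K * (a * p) \<le> u"
    using mult_right_mono[OF p(1) a] mult_right_mono[OF p(2) a] by (simp_all add: mult_ac)
qed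

text \<open>\<open>p / (1 - p)^k\<close> increases with \<open>p\<close>, so
  \<open>l / K \<le> p\<close> reduces the claim to a condition free of division, as it stands in
  the certificate. The two series use \<open>k = 1\<close> and \<open>k = 2\<close>.\<close>

lemma lambert_term_lower:
  fixes K l p m s :: real
  assumes "0 < K" "0 \<le> l" "l \<le> K * p" "p < 1" "0 \<le> m" "s * (K - l) ^ k \<le> m * l * K ^ k"
  shows "s \<le> K * (m * p / (1 - p) ^ k)"
proof -
  have "K * p < K * 1" using assms by (intro mult_strict_left_mono)
  then have "l < K" using assms(3) by linarith
  then have lp: "l / K \<le> p" "l / K < 1" using assms(1,3) by (simp_all add: field_simps)
  have p0: "0 \<le> p" by (rule order_trans[OF _ lp(1)]) (use assms in simp)
  have Kl: "0 < K - l" using lp(2) assms(1) by (simp add: field_simps)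
  have "s \<le> m * l * K ^ k / (K - l) ^ k" using assms(6) Kl by (simp add: pos_le_divide_eq)
  also have "\<dots> = K * (m * (l / K) / (1 - l / K) ^ k)"
  proof -
    have "1 - l / K = (K - l) / K" using assms(1) by (simp add: field_simps)
    then show ?thesis using assms(1) by (simp add: power_divide)
  qed
  also have "\<dots> \<le> K * (m * p / (1 - p) ^ k)"
    using lp p0 assms by (intro mult_left_mono frac_le power_mono zero_less_power mult_nonneg_nonneg) auto
  finally show ?thesis .
qed

lemma lambert_term_upper:
  fixes K u p m s :: real
  assumes "0 < K" "K * p \<le> u" "0 \<le> p" "u < K" "0 \<le> m" "m * u * K ^ k \<le> s * (K - u) ^ k"
  shows "K * (m * p / (1 - p) ^ k) \<le> s"
proof -
  have lp: "p \<le> u / K" "u / K < 1" using assms by (simp_all add: field_simps)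
  have Kl: "0 < K - u" using assms by simp
  have "K * (m * p / (1 - p) ^ k) \<le> K * (m * (u / K) / (1 - u / K) ^ k)"
    using lp assms by (intro mult_left_mono frac_le power_mono zero_less_power mult_nonneg_nonneg) auto
  also have "\<dots> = m * u * K ^ k / (K - u) ^ k"
  proof -
    have "1 - u / K = (K - u) / K" using assms(1) by (simp add: field_simps)
    then show ?thesis using assms(1) by (simp add: power_divide)
  qed
  also have "\<dots> \<le> s" using assms(6) Kl by (simp add: pos_divide_le_eq)
  finally show ?thesis .
qed

text \<open>The induction runs over the remaining entries: \<open>n\<close> powers are already
  processed, and \<open>l0\<close>, \<open>u0\<close>, \<open>q0\<close> are the bounds reached so
  far.\<close>

lemma lower_certificate_sound:
  assumes "lower_certificate c r (real (Suc n)) l0 u0 q0 cs" and a: "a = c / 10^12" "0 < a" "a < 1"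
    and "l0 \<le> 10^12 * a ^ n" "10^12 * a ^ n \<le> u0" "q0 \<le> 10^12 * (\<Prod>i<n. 1 - a ^ Suc i)" "0 \<le> q0"
  shows "r \<le> 10^12 * (\<Prod>i<n + length cs. 1 - a ^ Suc i) \<and>
    total_s cs \<le> 10^12 * (\<Sum>i<length cs. real (Suc (n + i)) * a ^ Suc (n + i) / (1 - a ^ Suc (n + i))) \<and>
    total_t cs \<le> 10^12 * (\<Sum>i<length cs. (real (Suc (n + i)))\<^sup>2 * a ^ Suc (n + i) / (1 - a ^ Suc (n + i))\<^sup>2)"
  using assms(1,5-)
proof (induction cs arbitrary: n l0 u0 q0)
  case Nil
  then show ?case by simp
next
  case (Cons e cs)
  obtain l u q s t where e: "e = (l, u, q, s, t)" by (cases e)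
  define K :: real where "K = 10^12"
  have K0: "0 < K" by (simp add: K_def)
  have aK: "a = c / K" using a(1) by (simp only: K_def)
  have chk: "0 \<le> l \<and> l * K \<le> l0 * c \<and> u0 * c \<le> u * K \<and> u < K \<and> q * K \<le> q0 * (K - u) \<and> 0 \<le> q \<and>
    s * (K - l) \<le> real (Suc n) * l * K \<and> t * (K - l)\<^sup>2 \<le> (real (Suc n))\<^sup>2 * l * K\<^sup>2 \<and>
    lower_certificate c r (real (Suc n) + 1) l u q cs"
    using Cons.prems(1) unfolding e lower_certificate.simps K_def .
  note pr = Cons.prems(2-4)[folded K_def] Cons.prems(5)
  note IH = Cons.IH[folded K_def]
  have cl: "0 \<le> l" "l * K \<le> l0 * c" "u0 * c \<le> u * K" "u < K" "q * K \<le> q0 * (K - u)" "0 \<le> q"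
    "s * (K - l) \<le> real (Suc n) * l * K" "t * (K - l)\<^sup>2 \<le> (real (Suc n))\<^sup>2 * l * K\<^sup>2"
    "lower_certificate c r (real (Suc n) + 1) l u q cs" using chk by - (elim conjE, assumption)+
  have cert: "lower_certificate c r (real (Suc (Suc n))) l u q cs"
    using cl(9) by (simp add: add.commute)
  let ?p = "a ^ Suc n"
  have a0: "0 \<le> a" using a by simp
  have p: "l \<le> K * ?p" "K * ?p \<le> u"
    using power_bracket[OF K0 aK a0 pr(1,2) cl(2,3)] by simp_all
  have p1: "?p < 1" using p(2) cl(4) K0 by (metis less_le_trans linorder_not_less mult_le_cancel_left_pos mult.right_neutral)
  have Q: "q \<le> K * (\<Prod>i<Suc n. 1 - a ^ Suc i)"
  proof -
    have "q * K \<le> q0 * (K - u)" by (rule cl(5))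
    also have "\<dots> \<le> (K * (\<Prod>i<n. 1 - a ^ Suc i)) * (K - K * ?p)"
      using pr(3,4) p cl(4) by (intro mult_mono) auto
    also have "\<dots> = (K * (\<Prod>i<Suc n. 1 - a ^ Suc i)) * K" by (simp add: algebra_simps)
    finally show ?thesis using K0 by (simp only: mult_le_cancel_right_pos)
  qed
  have S: "s \<le> K * (real (Suc n) * ?p / (1 - ?p))"
    using lambert_term_lower[OF K0 cl(1) p(1) p1, of "real (Suc n)" s 1] cl(7) by simp
  have T: "t \<le> K * ((real (Suc n))\<^sup>2 * ?p / (1 - ?p)\<^sup>2)"
    by (rule lambert_term_lower[OF K0 cl(1) p(1) p1 _ cl(8)]) simp
  note ih = IH[OF cert p Q cl(6)]
  have len: "n + length (e # cs) = Suc n + length cs" by simp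
  show ?case unfolding len e list.size add_0_right add_Suc_right total_s.simps total_t.simps K_def[symmetric]
    unfolding sum_offset_Suc[where n = n and f = "\<lambda>i. real (Suc i) * a ^ Suc i / (1 - a ^ Suc i)"]
      sum_offset_Suc[where n = n and f = "\<lambda>i. (real (Suc i))\<^sup>2 * a ^ Suc i / (1 - a ^ Suc i)\<^sup>2"] distrib_left
    using ih add_mono[OF S conjunct1[OF conjunct2[OF ih]]] add_mono[OF T conjunct2[OF conjunct2[OF ih]]]
    by (intro conjI) simp_all
qed

lemma upper_certificate_sound:
  assumes "upper_certificate c r (real (Suc n)) l0 u0 q0 cs" and a: "a = c / 10^12" "0 < a" "a < 1"
    and "l0 \<le> 10^12 * a ^ n" "10^12 * a ^ n \<le> u0" "10^12 * (\<Prod>i<n. 1 - a ^ Suc i) \<le> q0"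
  shows "10^12 * (\<Prod>i<n + length cs. 1 - a ^ Suc i) \<le> r \<and>
    10^12 * (\<Sum>i<length cs. real (Suc (n + i)) * a ^ Suc (n + i) / (1 - a ^ Suc (n + i))) \<le> total_s cs \<and>
    10^12 * (\<Sum>i<length cs. (real (Suc (n + i)))\<^sup>2 * a ^ Suc (n + i) / (1 - a ^ Suc (n + i))\<^sup>2) \<le> total_t cs"
  using assms(1,5-)
proof (induction cs arbitrary: n l0 u0 q0)
  case Nil
  then show ?case by simp
next
  case (Cons e cs)
  obtain l u q s t where e: "e = (l, u, q, s, t)" by (cases e)
  define K :: real where "K = 10^12"
  have K0: "0 < K" by (simp add: K_def)
  have aK: "a = c / K" using a(1) by (simp only: K_def)
  have chk: "0 \<le> l \<and> l * K \<le> l0 * c \<and> u0 * c \<le> u * K \<and> u < K \<and> q0 * (K - l) \<le> q * K \<and> 0 \<le> q \<and>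
    real (Suc n) * u * K \<le> s * (K - u) \<and> (real (Suc n))\<^sup>2 * u * K\<^sup>2 \<le> t * (K - u)\<^sup>2 \<and>
    upper_certificate c r (real (Suc n) + 1) l u q cs"
    using Cons.prems(1) unfolding e upper_certificate.simps K_def .
  note pr = Cons.prems(2-4)[folded K_def]
  note IH = Cons.IH[folded K_def]
  have cl: "0 \<le> l" "l * K \<le> l0 * c" "u0 * c \<le> u * K" "u < K" "q0 * (K - l) \<le> q * K" "0 \<le> q"
    "real (Suc n) * u * K \<le> s * (K - u)" "(real (Suc n))\<^sup>2 * u * K\<^sup>2 \<le> t * (K - u)\<^sup>2"
    "upper_certificate c r (real (Suc n) + 1) l u q cs" using chk by - (elim conjE, assumption)+
  have cert: "upper_certificate c r (real (Suc (Suc n))) l u q cs"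
    using cl(9) by (simp add: add.commute)
  let ?p = "a ^ Suc n"
  have a0: "0 \<le> a" using a by simp
  have p: "l \<le> K * ?p" "K * ?p \<le> u"
    using power_bracket[OF K0 aK a0 pr(1,2) cl(2,3)] by simp_all
  have p1: "?p < 1" using p(2) cl(4) K0 by (metis less_le_trans linorder_not_less mult_le_cancel_left_pos mult.right_neutral)
  have p0: "0 \<le> ?p" using a0 by simp
  have Qn: "0 \<le> (\<Prod>i<n. 1 - a ^ Suc i)" using a by (intro prod_nonneg) (simp add: power_le_one mult_le_one)
  have Q: "K * (\<Prod>i<Suc n. 1 - a ^ Suc i) \<le> q"
  proof -
    have "(K * (\<Prod>i<Suc n. 1 - a ^ Suc i)) * K = (K * (\<Prod>i<n. 1 - a ^ Suc i)) * (K - K * ?p)" by (simp add: algebra_simps)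
    also have "\<dots> \<le> q0 * (K - l)"
      using pr(3) p p1 cl(4) K0 Qn by (intro mult_mono) (auto intro: order_trans[OF _ pr(3)])
    also have "\<dots> \<le> q * K" by (rule cl(5))
    finally show ?thesis using K0 by (simp only: mult_le_cancel_right_pos)
  qed
  have S: "K * (real (Suc n) * ?p / (1 - ?p)) \<le> s"
    using lambert_term_upper[OF K0 p(2) p0 cl(4), of "real (Suc n)" 1 s] cl(7) by simp
  have T: "K * ((real (Suc n))\<^sup>2 * ?p / (1 - ?p)\<^sup>2) \<le> t"
    by (rule lambert_term_upper[OF K0 p(2) p0 cl(4) _ cl(8)]) simp
  note ih = IH[OF cert p Q]
  have len: "n + length (e # cs) = Suc n + length cs" by simp
  show ?case unfolding len e list.size add_0_right add_Suc_right total_s.simps total_t.simps K_def[symmetric]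
    unfolding sum_offset_Suc[where n = n and f = "\<lambda>i. real (Suc i) * a ^ Suc i / (1 - a ^ Suc i)"]
      sum_offset_Suc[where n = n and f = "\<lambda>i. (real (Suc i))\<^sup>2 * a ^ Suc i / (1 - a ^ Suc i)\<^sup>2"] distrib_left
    using ih add_mono[OF S conjunct1[OF conjunct2[OF ih]]] add_mono[OF T conjunct2[OF conjunct2[OF ih]]]
    by (intro conjI) simp_all
qed

text \<open>Belongs to \<open>0.4196003525\<close>, the lower end of the bracket, with
  \<open>q\<close>, \<open>s\<close>, \<open>t\<close> as lower bounds. What follows the 28 entries
  is negligible: \<open>10^(-10)\<close> for the product, and \<open>2 * 10^(-9)\<close> and
  \<open>7 * 10^(-8)\<close> for the two series.\<close>

definition lower_data :: certificate where
  "lower_data = [(419600352500, 419600352500, 580399647500, 722950736285, 1245608503381),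
    (176064455818, 176064455819, 478211899405, 427374342717, 1037397514246),
    (73876707723, 73876707725, 442883178682, 239309522843, 775197616253),
    (30998692602, 30998692603, 429154379166, 127961406719, 528219748489),
    (13007062342, 13007062344, 423572341400, 65892377978, 333803695366),
    (5457767943, 5457767945, 421260581852, 32926311827, 198642012973),
    (2290081352, 2290081354, 420295860848, 16067365037, 112729715478),
    (960918942, 960918944, 419891990593, 7694745562, 61617173611),
    (403201926, 403201928, 419722689332, 3630281070, 32685708573),
    (169183670, 169183672, 419651679106, 1692122979, 16924093075),
    (70989527, 70989529, 419621888230, 780940235, 8590952459),
    (29787230, 29787232, 419609388855, 357457407, 4289616667),
    (12498732, 12498734, 419604144268, 162485546, 2112338510),
    (5244472, 5244474, 419601943664, 73422993, 1027927293),
    (2200582, 2200584, 419601020294, 33008802, 495133129),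
    (923364, 923366, 419600632848, 14773837, 236381620),
    (387443, 387445, 419600470275, 6586533, 111971113),
    (162571, 162573, 419600402059, 2926278, 52673021),
    (68214, 68216, 419600373435, 1296066, 24625257),
    (28622, 28624, 419600361424, 572440, 11448800),
    (12009, 12011, 419600356384, 252189, 5295969),
    (5038, 5040, 419600354269, 110836, 2438392),
    (2113, 2115, 419600353381, 48599, 1117777),
    (886, 888, 419600353008, 21264, 510336),
    (371, 373, 419600352851, 9275, 231875),
    (155, 157, 419600352785, 4030, 104780),
    (65, 66, 419600352757, 1755, 47385),
    (27, 28, 419600352745, 756, 21168)]"

text \<open>Belongs to the upper end \<open>0.4196003527\<close>, with \<open>q\<close>,
  \<open>s\<close>, \<open>t\<close> as upper bounds.\<close>

definition upper_data :: certificate where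
  "upper_data = [(419600352700, 419600352700, 580399647300, 722950736880, 1245608504834),
    (176064455985, 176064455986, 478211899145, 427374343212, 1037397515660),
    (73876707829, 73876707830, 442883178392, 239309523218, 775197617556),
    (30998692661, 30998692662, 429154378861, 127961406976, 528219749577),
    (13007062373, 13007062375, 423572341088, 65892378148, 333803696236),
    (5457767959, 5457767961, 421260581537, 32926311937, 198642013636),
    (2290081360, 2290081362, 420295860532, 16067365108, 112729715974),
    (960918946, 960918948, 419891990277, 7694745611, 61617173997),
    (403201928, 403201930, 419722689017, 3630281107, 32685708899),
    (169183671, 169183673, 419651678792, 1692123010, 16924093377),
    (70989528, 70989529, 419621887918, 780940258, 8590952702),
    (29787230, 29787232, 419609388545, 357457432, 4289616956),
    (12498732, 12498734, 419604143960, 162485573, 2112338849),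
    (5244472, 5244474, 419601943358, 73423022, 1027927686),
    (2200582, 2200584, 419601019990, 33008833, 495133580),
    (923364, 923366, 419600632546, 14773870, 236382133),
    (387443, 387445, 419600469975, 6586568, 111971692),
    (162571, 162573, 419600401761, 2926315, 52673670),
    (68214, 68216, 419600373139, 1296105, 24625980),
    (28622, 28624, 419600361130, 572481, 11449601),
    (12009, 12011, 419600356092, 252232, 5296852),
    (5038, 5040, 419600353979, 110881, 2439361),
    (2113, 2115, 419600353093, 48646, 1118836),
    (886, 888, 419600352722, 21313, 511489),
    (371, 373, 419600352567, 9326, 233126),
    (155, 157, 419600352502, 4083, 106133),
    (65, 66, 419600352475, 1783, 48115),
    (27, 28, 419600352464, 785, 21953)]"

lemma lower_data_checked:
  "lower_certificate 419600352500 419600352745 1 (10^12) (10^12) (10^12) lower_data"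
  "total_s lower_data = 1646933131858" "total_t lower_data = 4359788616996" "length lower_data = 28"
  by (simp_all add: lower_data_def)

lemma upper_data_checked:
  "upper_certificate 419600352700 419600352464 1 (10^12) (10^12) (10^12) upper_data"
  "total_s upper_data = 1646933134713" "total_t upper_data = 4359788638460" "length upper_data = 28"
  by (simp_all add: upper_data_def)

section \<open>The bracket of the root\<close>

abbreviation root_lower :: real where "root_lower \<equiv> 419600352500 / 10^12"
abbreviation root_upper :: real where "root_upper \<equiv> 419600352700 / 10^12"

lemma scaled_le: "a \<le> 10^12 * s \<Longrightarrow> a / 10^12 \<le> s" for a s :: real
  by simp

lemma scaled_ge: "10^12 * s \<le> a \<Longrightarrow> s \<le> a / 10^12" for a s :: real
  by simp

lemma root_lower_sound:
  "419600352745 / 10^12 \<le> (\<Prod>i<28. 1 - root_lower ^ Suc i)"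
  "1646933131858 / 10^12 \<le> (\<Sum>i<28. real (Suc i) * root_lower ^ Suc i / (1 - root_lower ^ Suc i))"
  "4359788616996 / 10^12 \<le> (\<Sum>i<28. (real (Suc i))\<^sup>2 * root_lower ^ Suc i / (1 - root_lower ^ Suc i)\<^sup>2)"
proof -
  have c: "lower_certificate 419600352500 419600352745 (real (Suc 0)) (10^12) (10^12) (10^12) lower_data"
    using lower_data_checked(1) by simp
  have "419600352745 \<le> 10^12 * (\<Prod>i<0 + length lower_data. 1 - root_lower ^ Suc i) \<and>
    total_s lower_data \<le> 10^12 * (\<Sum>i<length lower_data. real (Suc (0 + i)) * root_lower ^ Suc (0 + i) / (1 - root_lower ^ Suc (0 + i))) \<and>
    total_t lower_data \<le> 10^12 * (\<Sum>i<length lower_data. (real (Suc (0 + i)))\<^sup>2 * root_lower ^ Suc (0 + i) / (1 - root_lower ^ Suc (0 + i))\<^sup>2)"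
    by (rule lower_certificate_sound[OF c]) simp_all
  then show "419600352745 / 10^12 \<le> (\<Prod>i<28. 1 - root_lower ^ Suc i)"
    "1646933131858 / 10^12 \<le> (\<Sum>i<28. real (Suc i) * root_lower ^ Suc i / (1 - root_lower ^ Suc i))"
    "4359788616996 / 10^12 \<le> (\<Sum>i<28. (real (Suc i))\<^sup>2 * root_lower ^ Suc i / (1 - root_lower ^ Suc i)\<^sup>2)"
    unfolding lower_data_checked add_0_left by - (elim conjE, rule scaled_le, assumption)+
qed

lemma root_upper_sound:
  "(\<Prod>i<28. 1 - root_upper ^ Suc i) \<le> 419600352464 / 10^12"
  "(\<Sum>i<28. real (Suc i) * root_upper ^ Suc i / (1 - root_upper ^ Suc i)) \<le> 1646933134713 / 10^12"
  "(\<Sum>i<28. (real (Suc i))\<^sup>2 * root_upper ^ Suc i / (1 - root_upper ^ Suc i)\<^sup>2) \<le> 4359788638460 / 10^12"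
proof -
  have c: "upper_certificate 419600352700 419600352464 (real (Suc 0)) (10^12) (10^12) (10^12) upper_data"
    using upper_data_checked(1) by simp
  have "10^12 * (\<Prod>i<0 + length upper_data. 1 - root_upper ^ Suc i) \<le> 419600352464 \<and>
    10^12 * (\<Sum>i<length upper_data. real (Suc (0 + i)) * root_upper ^ Suc (0 + i) / (1 - root_upper ^ Suc (0 + i))) \<le> total_s upper_data \<and>
    10^12 * (\<Sum>i<length upper_data. (real (Suc (0 + i)))\<^sup>2 * root_upper ^ Suc (0 + i) / (1 - root_upper ^ Suc (0 + i))\<^sup>2) \<le> total_t upper_data"
    by (rule upper_certificate_sound[OF c]) simp_all
  then show "(\<Prod>i<28. 1 - root_upper ^ Suc i) \<le> 419600352464 / 10^12"
    "(\<Sum>i<28. real (Suc i) * root_upper ^ Suc i / (1 - root_upper ^ Suc i)) \<le> 1646933134713 / 10^12"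
    "(\<Sum>i<28. (real (Suc i))\<^sup>2 * root_upper ^ Suc i / (1 - root_upper ^ Suc i)\<^sup>2) \<le> 4359788638460 / 10^12"
    unfolding upper_data_checked add_0_left by - (elim conjE, rule scaled_ge, assumption)+
qed

text \<open>Weierstrass's product inequality for the factors from index \<open>n\<close> on.\<close>

lemma prod_tail_ge:
  fixes a :: real assumes a: "0 \<le> a" "a < 1"
  shows "(\<Prod>i<n + j. 1 - a ^ Suc i) \<ge> (\<Prod>i<n. 1 - a ^ Suc i) * (1 - (\<Sum>i<j. a ^ Suc (n + i)))"
proof (induction j)
  case 0
  then show ?case by simp
next
  case (Suc j)
  let ?Q = "\<Prod>i<n. 1 - a ^ Suc i" and ?s = "\<Sum>i<j. a ^ Suc (n + i)" and ?e = "a ^ Suc (n + j)"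
  have le1: "a ^ Suc i \<le> 1" for i by (rule power_le_one) (use a in auto)
  have Q: "0 \<le> ?Q" by (rule prod_nonneg) (use le1 in \<open>simp del: power_Suc\<close>)
  have s: "0 \<le> ?s" "0 \<le> ?e" using a by (auto intro!: sum_nonneg)
  have "?Q * (1 - (?s + ?e)) \<le> ?Q * ((1 - ?s) * (1 - ?e))"
    by (rule mult_left_mono[OF _ Q]) (use mult_nonneg_nonneg[OF s] in \<open>simp add: algebra_simps\<close>)
  also have "\<dots> \<le> (\<Prod>i<n + j. 1 - a ^ Suc i) * (1 - ?e)"
    unfolding mult.assoc[symmetric] by (rule mult_right_mono[OF Suc.IH]) (use le1[of "n + j"] in simp)
  finally show ?case by (simp del: power_Suc)
qed

text \<open>It suffices that \<open>root_lower\<close> is below the infinite product of the factors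
  \<open>1 - root_lower^i\<close>. The certificate bounds 28 of them, and the rest costs a factor of
  at least \<open>1 - 10^(-10)\<close>.\<close>

lemma root_lower_below: "root_lower * partition_gf root_lower < 1"
proof -
  let ?a = root_lower
  \<comment> \<open>\<open>21 / 50\<close> is a simple fraction above the root, for which the
    geometric tail can be computed.\<close>
  have a: "0 \<le> ?a" "?a < 1" "?a \<le> 21 / 50" by simp_all
  have tail: "(\<Sum>i<j. ?a ^ Suc (28 + i)) \<le> 1 / 10^10" for j
  proof -
    have "(\<Sum>i<j. ?a ^ Suc (28 + i)) = ?a ^ 29 * (\<Sum>i<j. ?a ^ i)"
      unfolding sum_distrib_left by (intro sum.cong refl) (simp only: power_add[symmetric] add_Suc[symmetric], simp)
    also have "\<dots> \<le> (21 / 50) ^ 29 * (\<Sum>i<j. (21 / 50) ^ i)"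
      using a by (intro mult_mono power_mono sum_mono sum_nonneg) auto
    also have "\<dots> \<le> (21 / 50) ^ 29 * (1 / (1 - 21 / 50))"
    proof (rule mult_left_mono)
      show "(\<Sum>i<j. (21 / 50 :: real) ^ i) \<le> 1 / (1 - 21 / 50)"
        by (subst suminf_geometric[symmetric]) (auto intro!: sum_le_suminf summable_geometric)
    qed simp
    also have "\<dots> \<le> 1 / 10^10" by (simp add: power_divide)
    finally show ?thesis .
  qed
  have lb: "4196003527 / 10^10 \<le> (\<Prod>i<28 + j. 1 - ?a ^ Suc i)" for j
  proof -
    have "4196003527 / 10^10 \<le> 419600352745 / 10^12 * (1 - 1 / 10^10 :: real)" by simp
    also have "\<dots> \<le> (\<Prod>i<28. 1 - ?a ^ Suc i) * (1 - (\<Sum>i<j. ?a ^ Suc (28 + i)))"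
    proof (rule mult_mono)
      show "419600352745 / 10^12 \<le> (\<Prod>i<28. 1 - ?a ^ Suc i)" by (rule root_lower_sound(1))
      then show "0 \<le> (\<Prod>i<28. 1 - ?a ^ Suc i)" by (rule order_trans[rotated]) simp
      show "1 - 1 / 10^10 \<le> 1 - (\<Sum>i<j. ?a ^ Suc (28 + i))" using tail[of j] by linarith
    qed simp
    also have "\<dots> \<le> (\<Prod>i<28 + j. 1 - ?a ^ Suc i)" by (rule prod_tail_ge[OF a(1,2)])
    finally show ?thesis .
  qed
  have "(\<lambda>j. \<Prod>i<j + 28. 1 / (1 - ?a ^ Suc i)) \<longlonglongrightarrow> partition_gf ?a"
    by (rule LIMSEQ_ignore_initial_segment[OF partition_product_LIMSEQ]) simp_all
  moreover have "(\<Prod>i<j + 28. 1 / (1 - ?a ^ Suc i)) \<le> 10^10 / 4196003527" for j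
  proof -
    have "(\<Prod>i<j + 28. 1 / (1 - ?a ^ Suc i)) = 1 / (\<Prod>i<28 + j. 1 - ?a ^ Suc i)"
      by (simp only: prod_dividef prod.neutral_const add.commute)
    also have "\<dots> \<le> 1 / (4196003527 / 10^10)"
      by (rule divide_left_mono[OF lb]) (use less_le_trans[OF _ lb[of j]] in simp_all)
    finally show ?thesis by simp
  qed
  ultimately have "partition_gf ?a \<le> 10^10 / 4196003527" by (intro LIMSEQ_le_const2) auto
  then have "?a * partition_gf ?a \<le> ?a * (10^10 / 4196003527)" by (rule mult_left_mono) simp
  also have "\<dots> < 1" by simp
  finally show ?thesis .
qed

text \<open>The further factors of the product are at most \<open>1\<close>, so the 28 of the
  certificate already bound it from above.\<close>

lemma root_upper_above: "1 < root_upper * partition_gf root_upper"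
proof -
  let ?b = root_upper
  have pos: "0 < 1 - ?b ^ Suc i" for i using lambert_bounds(2)[of ?b ?b i] by (simp del: power_Suc)
  have Qpos: "0 < (\<Prod>i<j. 1 - ?b ^ Suc i)" for j by (rule prod_pos) (rule pos)
  have ub: "(\<Prod>i<28 + j. 1 - ?b ^ Suc i) \<le> 419600352464 / 10^12" for j
  proof (induction j)
    case 0
    then show ?case using root_upper_sound(1) by simp
  next
    case (Suc j)
    have "(\<Prod>i<28 + Suc j. 1 - ?b ^ Suc i) = (\<Prod>i<28 + j. 1 - ?b ^ Suc i) * (1 - ?b ^ Suc (28 + j))"
      by (simp only: add_Suc_right prod.lessThan_Suc)
    also have "\<dots> \<le> (\<Prod>i<28 + j. 1 - ?b ^ Suc i) * 1"
      by (rule mult_left_mono) (use Qpos[of "28 + j"] in auto)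
    finally show ?case using Suc by simp
  qed
  have "(\<lambda>j. \<Prod>i<j + 28. 1 / (1 - ?b ^ Suc i)) \<longlonglongrightarrow> partition_gf ?b"
    by (rule LIMSEQ_ignore_initial_segment[OF partition_product_LIMSEQ]) simp_all
  moreover have "10^12 / 419600352464 \<le> (\<Prod>i<j + 28. 1 / (1 - ?b ^ Suc i))" for j
  proof -
    have "1 / (419600352464 / 10^12) \<le> 1 / (\<Prod>i<28 + j. 1 - ?b ^ Suc i)"
      by (rule divide_left_mono[OF ub]) (use Qpos[of "28 + j"] in simp_all)
    also have "\<dots> = (\<Prod>i<j + 28. 1 / (1 - ?b ^ Suc i))"
      by (simp only: prod_dividef prod.neutral_const add.commute)
    finally show ?thesis by simp
  qed
  ultimately have "10^12 / 419600352464 \<le> partition_gf ?b" by (intro LIMSEQ_le_const) auto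
  then have "?b * (10^12 / 419600352464) \<le> ?b * partition_gf ?b" by (rule mult_left_mono) simp
  moreover have "1 < ?b * (10^12 / 419600352464)" by simp
  ultimately show ?thesis by linarith
qed

lemma partition_root_ex:
  "\<exists>x. root_lower \<le> x \<and> x \<le> root_upper \<and> x * partition_gf x = 1"
proof (rule IVT')
  show "continuous_on {root_lower..root_upper} (\<lambda>x. x * partition_gf x)"
  proof (rule DERIV_atLeastAtMost_imp_continuous_on)
    fix x assume "root_lower \<le> x" "x \<le> root_upper"
    then have x: "0 < x" "x < 1" by simp_all
    show "\<exists>y. ((\<lambda>x. x * partition_gf x) has_real_derivative y) (at x)"
      by (rule exI) (rule DERIV_mult[OF DERIV_ident partition_gf_deriv[OF x]])
  qed
qed (use root_lower_below root_upper_above in simp_all)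

text \<open>\<open>x P(x)\<close> is strictly increasing, as \<open>P\<close> is positive and
  monotone.\<close>

lemma partition_root_unique: "\<exists>!x. 0 < x \<and> x < 1 \<and> x * partition_gf x = 1"
proof (rule ex_ex1I)
  show "\<exists>x. 0 < x \<and> x < 1 \<and> x * partition_gf x = 1"
  proof -
    obtain r where r: "root_lower \<le> r" "r \<le> root_upper" "r * partition_gf r = 1" using partition_root_ex by blast
    show ?thesis by (rule exI[of _ r]) (use r in simp)
  qed
next
  have less: False if "0 < a" "a < b" "b < 1" "a * partition_gf a = 1" "b * partition_gf b = 1" for a b
  proof -
    have "a * partition_gf a < b * partition_gf a" using that partition_gf_pos[of a] by (intro mult_strict_right_mono) auto
    also have "\<dots> \<le> b * partition_gf b" using that partition_gf_mono[of a b] by (intro mult_left_mono) auto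
    finally show False using that by simp
  qed
  fix a b assume "0 < a \<and> a < 1 \<and> a * partition_gf a = 1" "0 < b \<and> b < 1 \<and> b * partition_gf b = 1"
  then show "a = b" using less[of a b] less[of b a] by (cases a b rule: linorder_cases) auto
qed

lemma x0_root: "0 < x0" "x0 < 1" "x0 * partition_gf x0 = 1"
  using theI'[OF partition_root_unique] unfolding x0_def by simp_all

lemma x0_bracket: "root_lower \<le> x0" "x0 \<le> root_upper"
proof -
  obtain r where r: "root_lower \<le> r" "r \<le> root_upper" "r * partition_gf r = 1" using partition_root_ex by blast
  have "0 < r \<and> r < 1 \<and> r * partition_gf r = 1" using r by simp
  then have "x0 = r" unfolding x0_def by (rule the1_equality[OF partition_root_unique])
  then show "root_lower \<le> x0" "x0 \<le> root_upper" using r by simp_all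
qed

text \<open>Consecutive values have the quotient \<open>(1 + 1/m)^2 * 21/25 < 1\<close>. Since
  \<open>21 / 50 = 21/25 * 1/2\<close>, the square is absorbed and powers of \<open>1 / 2\<close>
  remain for the tails.\<close>

lemma square_power_le: "29 \<le> m \<Longrightarrow> (real m)\<^sup>2 * (21 / 25) ^ m \<le> 6"
proof (induction m rule: nat_induct_at_least)
  case base
  then show ?case by (simp add: power_divide)
next
  case (Suc m)
  have "29 * real m \<le> real m * real m" using Suc.hyps by (intro mult_right_mono) auto
  moreover have "29 \<le> real m" using Suc.hyps by simp
  moreover have "(real (Suc m))\<^sup>2 = real m * real m + 2 * real m + 1" by (simp add: power2_eq_square algebra_simps)
  ultimately have "(real (Suc m))\<^sup>2 * (21 / 25) \<le> (real m)\<^sup>2" unfolding power2_eq_square[of "real m"] by linarith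
  then have "(real (Suc m))\<^sup>2 * (21 / 25) * (21 / 25) ^ m \<le> (real m)\<^sup>2 * (21 / 25) ^ m" by (rule mult_right_mono) simp
  then show ?case using Suc.IH unfolding power_Suc mult.assoc by linarith
qed

text \<open>\<open>square_power_le\<close> gives the constant \<open>6\<close>, and
  \<open>6 / 29\<close> after division by \<open>m \<ge> 29\<close>; the denominators, at least
  \<open>99 / 100\<close> before squaring, raise these to \<open>7\<close> and
  \<open>1 / 4\<close>.\<close>

lemma lambert_tail_terms:
  assumes x: "0 < x" "x \<le> 21 / 50" and m: "29 \<le> m"
  shows "real m * x ^ m / (1 - x ^ m) \<le> 1 / 4 * (1 / 2) ^ m" "(real m)\<^sup>2 * x ^ m / (1 - x ^ m)\<^sup>2 \<le> 7 * (1 / 2) ^ m"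
proof -
  have "x ^ m \<le> (21 / 50) ^ m" using x by (intro power_mono) auto
  also have "(21 / 50 :: real) ^ m = (21 / 25) ^ m * (1 / 2) ^ m" by (simp add: power_mult_distrib[symmetric])
  finally have "(real m)\<^sup>2 * x ^ m \<le> (real m)\<^sup>2 * ((21 / 25) ^ m * (1 / 2) ^ m)" by (rule mult_left_mono) simp
  also have "\<dots> \<le> 6 * (1 / 2) ^ m"
    using mult_right_mono[OF square_power_le[OF m], of "(1 / 2) ^ m"] by (simp add: mult.assoc)
  finally have T: "(real m)\<^sup>2 * x ^ m \<le> 6 * (1 / 2) ^ m" .
  have m29: "29 \<le> real m" using m by simp
  have "29 * (real m * x ^ m) \<le> real m * (real m * x ^ m)" using m29 x by (intro mult_right_mono) auto
  then have S: "real m * x ^ m \<le> 6 / 29 * (1 / 2) ^ m" using T by (simp add: power2_eq_square mult.assoc)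
  have h: "(1 / 2 :: real) ^ m \<le> (1 / 2) ^ 29" using m by (intro power_decreasing) auto
  have "1 * x ^ m \<le> real m * x ^ m" using m29 x by (intro mult_right_mono) auto
  also have "\<dots> \<le> 6 / 29 * (1 / 2) ^ 29" using S h by linarith
  also have "\<dots> \<le> 1 / 100" by (simp add: power_divide)
  finally have d: "99 / 100 \<le> 1 - x ^ m" by simp
  then have d2: "(99 / 100)\<^sup>2 \<le> (1 - x ^ m)\<^sup>2" by (intro power_mono) auto
  have "real m * x ^ m / (1 - x ^ m) \<le> (6 / 29 * (1 / 2) ^ m) / (99 / 100)" using S d by (intro frac_le) auto
  also have "\<dots> \<le> 1 / 4 * (1 / 2) ^ m" by (simp add: field_simps)
  finally show "real m * x ^ m / (1 - x ^ m) \<le> 1 / 4 * (1 / 2) ^ m" .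
  have "(real m)\<^sup>2 * x ^ m / (1 - x ^ m)\<^sup>2 \<le> (6 * (1 / 2) ^ m) / (99 / 100)\<^sup>2" using T d2 by (intro frac_le) auto
  also have "\<dots> \<le> 7 * (1 / 2) ^ m" by (simp add: field_simps power2_eq_square)
  finally show "(real m)\<^sup>2 * x ^ m / (1 - x ^ m)\<^sup>2 \<le> 7 * (1 / 2) ^ m" .
qed

text \<open>The dominating geometric tail from index \<open>n\<close> on has the sum
  \<open>c (1/2)^n\<close>.\<close>

lemma suminf_le_half_tail:
  fixes f :: "nat \<Rightarrow> real"
  assumes f: "summable f" and le: "\<And>i. f (i + n) \<le> c * (1 / 2) ^ Suc (i + n)"
  shows "suminf f \<le> c * (1 / 2) ^ n + (\<Sum>i<n. f i)"
proof -
  have "(\<lambda>i. c * (1 / 2) ^ n * (1 / 2 :: real) ^ Suc i) sums (c * (1 / 2) ^ n * 1)"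
    by (intro sums_mult power_half_series)
  moreover have "(\<lambda>i. c * (1 / 2) ^ n * (1 / 2 :: real) ^ Suc i) = (\<lambda>i. c * (1 / 2) ^ Suc (i + n))"
    by (rule ext) (simp add: power_add)
  ultimately have s: "(\<lambda>i. c * (1 / 2 :: real) ^ Suc (i + n)) sums (c * (1 / 2) ^ n)" by (simp only: mult_1_right)
  have "(\<Sum>i. f (i + n)) \<le> (\<Sum>i. c * (1 / 2 :: real) ^ Suc (i + n))"
    by (rule suminf_le[OF le]) (use f s in \<open>simp_all add: summable_iff_shift sums_iff del: power_Suc\<close>)
  then show ?thesis using sums_unique[OF s] suminf_split_initial_segment[OF f, of n] by simp
qed

text \<open>Both series increase: partial sums at \<open>root_lower\<close> bound from below,
  partial sums at \<open>root_upper\<close> plus a tail from above. The allowances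
  \<open>2000\<close> and \<open>70000\<close> cover the tails \<open>1/4 * 2^(-28)\<close> and
  \<open>7 * 2^(-28)\<close>.\<close>

lemma lambert_x0:
  "1646933131858 / 10^12 \<le> lambert_sum x0" "lambert_sum x0 \<le> 1646933136713 / 10^12"
  "4359788616996 / 10^12 \<le> lambert_sum2 x0" "lambert_sum2 x0 \<le> 4359788708460 / 10^12"
proof -
  have l: "0 < root_lower" "root_lower < 1" and u: "0 < root_upper" "root_upper < 1" "root_upper \<le> 21 / 50" by simp_all
  note lb = lambert_bounds[OF l(1) order_refl l(2)]
  have "(\<Sum>i<28. real (Suc i) * root_lower ^ Suc i / (1 - root_lower ^ Suc i)) \<le> lambert_sum root_lower"
    unfolding lambert_sum_def by (rule sum_le_suminf[OF lambert_summable(1)[OF l] finite_lessThan lb(3)])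
  also have "\<dots> \<le> lambert_sum x0" by (rule lambert_mono(1)[OF l(1) x0_bracket(1) x0_root(2)])
  finally show "1646933131858 / 10^12 \<le> lambert_sum x0" by (rule order_trans[OF root_lower_sound(2)])
  have "(\<Sum>i<28. (real (Suc i))\<^sup>2 * root_lower ^ Suc i / (1 - root_lower ^ Suc i)\<^sup>2) \<le> lambert_sum2 root_lower"
    unfolding lambert_sum2_def by (rule sum_le_suminf[OF lambert_summable(2)[OF l] finite_lessThan lb(4)])
  also have "\<dots> \<le> lambert_sum2 x0" by (rule lambert_mono(2)[OF l(1) x0_bracket(1) x0_root(2)])
  finally show "4359788616996 / 10^12 \<le> lambert_sum2 x0" by (rule order_trans[OF root_lower_sound(3)])
  have "lambert_sum root_upper \<le> 1 / 4 * (1 / 2) ^ 28 + (\<Sum>i<28. real (Suc i) * root_upper ^ Suc i / (1 - root_upper ^ Suc i))"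
    unfolding lambert_sum_def
    by (rule suminf_le_half_tail[OF lambert_summable(1)[OF u(1,2)] lambert_tail_terms(1)[OF u(1,3)]]) simp
  also have "\<dots> \<le> 2000 / 10^12 + 1646933134713 / 10^12"
    by (rule add_mono[OF _ root_upper_sound(2)]) (simp add: power_divide)
  also have "\<dots> = 1646933136713 / 10^12" by simp
  finally show "lambert_sum x0 \<le> 1646933136713 / 10^12"
    by (rule order_trans[OF lambert_mono(1)[OF x0_root(1) x0_bracket(2) u(2)]])
  have "lambert_sum2 root_upper \<le> 7 * (1 / 2) ^ 28 + (\<Sum>i<28. (real (Suc i))\<^sup>2 * root_upper ^ Suc i / (1 - root_upper ^ Suc i)\<^sup>2)"
    unfolding lambert_sum2_def
    by (rule suminf_le_half_tail[OF lambert_summable(2)[OF u(1,2)] lambert_tail_terms(2)[OF u(1,3)]]) simp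
  also have "\<dots> \<le> 70000 / 10^12 + 4359788638460 / 10^12"
    by (rule add_mono[OF _ root_upper_sound(3)]) (simp add: power_divide)
  also have "\<dots> = 4359788708460 / 10^12" by simp
  finally show "lambert_sum2 x0 \<le> 4359788708460 / 10^12"
    by (rule order_trans[OF lambert_mono(2)[OF x0_root(1) x0_bracket(2) u(2)]])
qed

section \<open>Closed forms and enclosures of \<open>\<mu>\<close> and
  \<open>\<sigma>^2\<close>\<close>

lemma partition_gf_x0_derivs:
  "partition_gf x0 = 1 / x0" "deriv partition_gf x0 = lambert_sum x0 / x0\<^sup>2"
  "deriv (deriv partition_gf) x0 = ((lambert_sum x0)\<^sup>2 + lambert_sum2 x0 - lambert_sum x0) / x0 ^ 3"
proof -
  show P: "partition_gf x0 = 1 / x0" using x0_root by (simp add: field_simps)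
  show "deriv partition_gf x0 = lambert_sum x0 / x0\<^sup>2"
    using DERIV_imp_deriv[OF partition_gf_deriv[OF x0_root(1,2)]] unfolding P by (simp add: power2_eq_square)
  show "deriv (deriv partition_gf) x0 = ((lambert_sum x0)\<^sup>2 + lambert_sum2 x0 - lambert_sum x0) / x0 ^ 3"
    using DERIV_imp_deriv[OF partition_gf_deriv2[OF x0_root(1,2)]] unfolding P
    by (simp add: power2_eq_square power3_eq_cube mult_ac)
qed

lemma hdv_mu_eq: "hdv_mu = (1 - x0) / (1 + lambert_sum x0)"
proof -
  have S: "0 < 1 + lambert_sum x0" using lambert_x0(1) by simp
  have "1 / x0 + x0 * (lambert_sum x0 / x0\<^sup>2) = (1 + lambert_sum x0) / x0"
    using x0_root(1) by (simp add: field_simps power2_eq_square)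
  moreover have "1 / x0 - 1 = (1 - x0) / x0" using x0_root(1) by (simp add: field_simps)
  ultimately show ?thesis unfolding hdv_mu_def Let_def partition_gf_x0_derivs using x0_root(1) by simp
qed

text \<open>In this form the numerator is a difference of two products of positive factors, which
  can be enclosed factor by factor.\<close>

lemma hdv_sigma2_eq:
  "hdv_sigma2 = (hdv_mu\<^sup>2 * lambert_sum2 x0 - hdv_mu * x0 * (lambert_sum x0 - 1)) / (1 + lambert_sum x0)"
proof -
  have poly: "(x - 1) * (- 1 - (S / x\<^sup>2) * x + (S / x\<^sup>2) * x^2 + (S / x\<^sup>2)^2 * x^3 - ((S\<^sup>2 + B - S) / x ^ 3) * x^2 + ((S\<^sup>2 + B - S) / x ^ 3) * x^3)
        / (x^2 * (1 / x + x * (S / x\<^sup>2))^3) =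
      (((1 - x) / (1 + S))\<^sup>2 * B - (1 - x) / (1 + S) * x * (S - 1)) / (1 + S)"
    if x: "0 < x" and S: "0 < 1 + S" for x S B :: real
  proof -
    have d: "x^2 * (1 / x + x * (S / x\<^sup>2))^3 = (1 + S) ^ 3 / x"
    proof -
      have "1 / x + x * (S / x\<^sup>2) = (1 + S) / x" using x by (simp add: field_simps power2_eq_square)
      then show ?thesis using x by (simp add: power_divide power2_eq_square power3_eq_cube)
    qed
    have n: "- 1 - (S / x\<^sup>2) * x + (S / x\<^sup>2) * x^2 + (S / x\<^sup>2)^2 * x^3 - ((S\<^sup>2 + B - S) / x ^ 3) * x^2 + ((S\<^sup>2 + B - S) / x ^ 3) * x^3
      = (x * (S\<^sup>2 - 1) - B * (1 - x)) / x"
      using x by (simp add: field_simps power2_eq_square power3_eq_cube)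
    have "(x - 1) * ((x * (S\<^sup>2 - 1) - B * (1 - x)) / x) / ((1 + S) ^ 3 / x) = (x - 1) * (x * (S\<^sup>2 - 1) - B * (1 - x)) / (1 + S) ^ 3"
      using x by simp
    also have "\<dots> = ((1 - x)\<^sup>2 * B - (1 - x) * x * (S - 1) * (1 + S)) / (1 + S) ^ 3"
      by (rule arg_cong[of _ _ "\<lambda>y. y / _"]) (simp add: algebra_simps power2_eq_square)
    also have "\<dots> = (((1 - x) / (1 + S))\<^sup>2 * B - (1 - x) / (1 + S) * x * (S - 1)) / (1 + S)"
    proof -
      define m where "m = (1 - x) / (1 + S)"
      have m: "1 - x = m * (1 + S)" using S by (simp add: m_def)
      have "(1 - x)\<^sup>2 * B - (1 - x) * x * (S - 1) * (1 + S) = (m\<^sup>2 * B - m * x * (S - 1)) * (1 + S)\<^sup>2"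
        unfolding m by (simp add: algebra_simps power2_eq_square)
      then show ?thesis using S unfolding m_def[symmetric] by (simp add: power2_eq_square power3_eq_cube)
    qed
    finally show ?thesis unfolding d n .
  qed
  have S: "0 < 1 + lambert_sum x0" using lambert_x0(1) by simp
  show ?thesis unfolding hdv_sigma2_def Let_def partition_gf_x0_derivs hdv_mu_eq by (rule poly[OF x0_root(1) S])
qed

lemma hdv_mu_bounds: "2192725004 / 10^10 \<le> hdv_mu" "hdv_mu \<le> 2192725009 / 10^10"
proof -
  have "2192725004 / 10^10 \<le> (1 - root_upper) / (1 + 1646933136713 / 10^12)" by simp
  also have "\<dots> \<le> hdv_mu" unfolding hdv_mu_eq
    using x0_bracket x0_root lambert_x0(1,2) by (intro frac_le) (auto intro: order_trans[OF _ lambert_x0(1)])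
  finally show "2192725004 / 10^10 \<le> hdv_mu" .
  have "hdv_mu \<le> (1 - root_lower) / (1 + 1646933131858 / 10^12)" unfolding hdv_mu_eq
    using x0_bracket lambert_x0(1,2) by (intro frac_le) auto
  also have "\<dots> \<le> 2192725009 / 10^10" by simp
  finally show "hdv_mu \<le> 2192725009 / 10^10" .
qed

text \<open>Besides the decimals, this is the source of \<open>0 < hdv_sigma2\<close>, on which the
  comparison with the Gaussian rests.\<close>

lemma hdv_sigma2_bounds: "567064750 / 10^10 \<le> hdv_sigma2" "hdv_sigma2 \<le> 567064790 / 10^10"
proof -
  let ?S = "lambert_sum x0" and ?B = "lambert_sum2 x0"
  note S = lambert_x0(1,2) and B = lambert_x0(3,4) and m = hdv_mu_bounds and x = x0_bracket
  have S1: "1646933131858 / 10^12 - 1 \<le> ?S - 1" "?S - 1 \<le> 1646933136713 / 10^12 - 1" using S by linarith+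
  have m0: "0 \<le> hdv_mu" by (rule order_trans[OF _ m(1)]) simp
  have S0: "0 \<le> ?S - 1" by (rule order_trans[OF _ S1(1)]) simp
  have B0: "0 \<le> ?B" by (rule order_trans[OF _ B(1)]) simp
  have T1: "(2192725004 / 10^10)\<^sup>2 * (4359788616996 / 10^12) \<le> hdv_mu\<^sup>2 * ?B"
    using m B by (intro mult_mono power_mono) auto
  have T2: "hdv_mu\<^sup>2 * ?B \<le> (2192725009 / 10^10)\<^sup>2 * (4359788708460 / 10^12)"
    using m B m0 B0 by (intro mult_mono power_mono) auto
  have U1: "2192725004 / 10^10 * root_lower * (1646933131858 / 10^12 - 1) \<le> hdv_mu * x0 * (?S - 1)"
    using m0 x0_root(1) by (intro mult_mono m(1) x(1) S1(1)) auto
  have U2: "hdv_mu * x0 * (?S - 1) \<le> 2192725009 / 10^10 * root_upper * (1646933136713 / 10^12 - 1)"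
    using m0 x0_root(1) S0 by (intro mult_mono m(2) x(2) S1(2)) auto
  have "567064750 / 10^10 * (1 + ?S) \<le> 567064750 / 10^10 * (1 + 1646933136713 / 10^12)"
    using S(2) by (intro mult_left_mono) auto
  also have "\<dots> \<le> (2192725004 / 10^10)\<^sup>2 * (4359788616996 / 10^12) - 2192725009 / 10^10 * root_upper * (1646933136713 / 10^12 - 1)"
    by (simp add: power2_eq_square)
  also have "\<dots> \<le> hdv_mu\<^sup>2 * ?B - hdv_mu * x0 * (?S - 1)" using T1 U2 by (rule diff_mono)
  finally show "567064750 / 10^10 \<le> hdv_sigma2" unfolding hdv_sigma2_eq using S0 by (subst pos_le_divide_eq) auto
  have "hdv_mu\<^sup>2 * ?B - hdv_mu * x0 * (?S - 1) \<le>
      (2192725009 / 10^10)\<^sup>2 * (4359788708460 / 10^12) - 2192725004 / 10^10 * root_lower * (1646933131858 / 10^12 - 1)"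
    using T2 U1 by (rule diff_mono)
  also have "\<dots> \<le> 567064790 / 10^10 * (1 + 1646933131858 / 10^12)" by (simp add: power2_eq_square)
  also have "\<dots> \<le> 567064790 / 10^10 * (1 + ?S)" using S(1) by (intro mult_left_mono) auto
  finally show "hdv_sigma2 \<le> 567064790 / 10^10" unfolding hdv_sigma2_eq using S0 by (subst pos_divide_le_eq) auto
qed

interpretation root_x0: partition_root x0
  by unfold_locales (use x0_root x0_bracket in simp_all)

lemma root_x0_mu: "root_x0.mu = hdv_mu"
  unfolding root_x0.mu_def root_x0.D_def root_x0.P1_def partition_gf_x0_derivs hdv_mu_eq
  using x0_root(1) by simp

text \<open>The relation \<open>hdv_mu * (1 + S) = 1 - x0\<close> removes the square of
  \<open>S\<close> from the numerator of \<open>sg2\<close>.\<close>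

lemma root_x0_sg2: "root_x0.sg2 = hdv_sigma2"
proof -
  let ?S = "lambert_sum x0" and ?B = "lambert_sum2 x0"
  have S: "1 + ?S \<noteq> 0" using lambert_x0(1) by simp
  have D: "root_x0.D = 1 + ?S"
    unfolding root_x0.D_def root_x0.P1_def partition_gf_x0_derivs using x0_root(1) by simp
  have e: "x0\<^sup>2 * root_x0.P1 = ?S" "x0 ^ 3 * root_x0.P2 = ?S\<^sup>2 + ?B - ?S"
    unfolding root_x0.P1_def root_x0.P2_def partition_gf_x0_derivs using x0_root(1) by simp_all
  have m: "hdv_mu * (1 + ?S) = 1 - x0" unfolding hdv_mu_eq using S by simp
  have "x0 * hdv_mu - hdv_mu * ?S + hdv_mu\<^sup>2 * (2 * ?S + (?S\<^sup>2 + ?B - ?S)) =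
      x0 * hdv_mu - hdv_mu * ?S + hdv_mu * ?S * (hdv_mu * (1 + ?S)) + hdv_mu\<^sup>2 * ?B"
    by (simp add: algebra_simps power2_eq_square)
  also have "\<dots> = hdv_mu\<^sup>2 * ?B - hdv_mu * x0 * (?S - 1)" unfolding m by (simp add: algebra_simps)
  finally have n: "x0 * hdv_mu - hdv_mu * ?S + hdv_mu\<^sup>2 * (2 * ?S + (?S\<^sup>2 + ?B - ?S)) =
    hdv_mu\<^sup>2 * ?B - hdv_mu * x0 * (?S - 1)" .
  have "root_x0.sg2 = (x0 * hdv_mu - hdv_mu * (x0\<^sup>2 * root_x0.P1) +
      hdv_mu\<^sup>2 * (2 * (x0\<^sup>2 * root_x0.P1) + x0 ^ 3 * root_x0.P2)) / root_x0.D"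
    unfolding root_x0.sg2_def root_x0_mu by (simp add: mult.assoc)
  then show ?thesis unfolding e D n hdv_sigma2_eq .
qed

section \<open>The limit theorem\<close>

text \<open>The \<open>p k\<close> with \<open>k \<le> n\<close> already add up to \<open>1\<close>,
  so \<open>X\<close> is almost surely at most \<open>n\<close> and its distribution function is a
  finite sum.\<close>

lemma (in prob_space) prob_lattice_cdf:
  fixes X :: "'a \<Rightarrow> nat"
  assumes X: "X \<in> measurable M (count_space UNIV)"
    and p: "\<And>k. prob {\<omega> \<in> space M. X \<omega> = k} = p k" and sum1: "(\<Sum>k\<le>n. p k) = 1"
  shows "prob {\<omega> \<in> space M. real (X \<omega>) \<le> y} = lattice_cdf p n y"
proof -
  have ev: "{\<omega> \<in> space M. X \<omega> = k} \<in> events" for k using X by measurable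
  have U: "prob (\<Union>k\<in>I. {\<omega> \<in> space M. X \<omega> = k}) = (\<Sum>k\<in>I. p k)" if "finite I" for I
    by (subst finite_measure_finite_Union) (use that ev p in \<open>auto simp: disjoint_family_on_def\<close>)
  have "AE \<omega> in M. \<omega> \<in> (\<Union>k\<in>{..n}. {\<omega> \<in> space M. X \<omega> = k})"
    by (rule prob_eq_1[THEN iffD1]) (use ev U[of "{..n}"] sum1 in auto)
  then have "AE \<omega> in M. X \<omega> \<le> n" by (rule AE_mp) (auto intro!: AE_I2)
  then have "prob {\<omega> \<in> space M. real (X \<omega>) \<le> y} = prob (\<Union>k\<in>{k. k \<le> n \<and> real k \<le> y}. {\<omega> \<in> space M. X \<omega> = k})"
  proof (intro finite_measure_eq_AE)
    show "AE \<omega> in M. \<omega> \<in> {\<omega> \<in> space M. real (X \<omega>) \<le> y} \<longleftrightarrow>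
        \<omega> \<in> (\<Union>k\<in>{k. k \<le> n \<and> real k \<le> y}. {\<omega> \<in> space M. X \<omega> = k})" if "AE \<omega> in M. X \<omega> \<le> n"
      using that by (rule AE_mp) (auto intro!: AE_I2)
    show "{\<omega> \<in> space M. real (X \<omega>) \<le> y} \<in> events" using X by measurable
    show "(\<Union>k\<in>{k. k \<le> n \<and> real k \<le> y}. {\<omega> \<in> space M. X \<omega> = k}) \<in> events"
      by (intro sets.finite_UN ev) auto
  qed
  also have "\<dots> = lattice_cdf p n y" unfolding lattice_cdf_def by (rule U) simp
  finally show ?thesis .
qed

lemma weak_conv_m_if_rate:
  assumes N: "real_distribution N" and M: "\<And>n. n \<ge> 1 \<Longrightarrow> prob_space (M n)"
    and Z: "\<And>n. n \<ge> 1 \<Longrightarrow> Z n \<in> borel_measurable (M n)"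
    and rate: "\<And>n t. n \<ge> 1 \<Longrightarrow> \<bar>measure (M n) {\<omega> \<in> space (M n). Z n \<omega> \<le> t} - cdf N t\<bar> \<le> C / sqrt (real n)"
  shows "weak_conv_m (\<lambda>n. distr (M n) borel (Z n)) N"
  unfolding weak_conv_m_def weak_conv_def
proof (intro allI impI)
  fix t
  have eq: "cdf (distr (M n) borel (Z n)) t = measure (M n) {\<omega> \<in> space (M n). Z n \<omega> \<le> t}" if "n \<ge> 1" for n
    unfolding cdf_def by (subst measure_distr[OF Z[OF that]]) (auto intro!: arg_cong[of _ _ "measure (M n)"])
  have "(\<lambda>n. C / sqrt (real n)) \<longlonglongrightarrow> 0"
    by (rule tendsto_divide_0[OF tendsto_const filterlim_at_top_imp_at_infinity[OF
      filterlim_compose[OF sqrt_at_top filterlim_real_sequentially]]])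
  then have "(\<lambda>n. cdf (distr (M n) borel (Z n)) t - cdf N t) \<longlonglongrightarrow> 0"
  proof (rule Lim_null_comparison[rotated])
    show "\<forall>\<^sub>F n in sequentially. norm (cdf (distr (M n) borel (Z n)) t - cdf N t) \<le> C / sqrt (real n)"
      using eventually_ge_at_top[of 1] by eventually_elim (simp add: eq rate)
  qed
  then show "(\<lambda>n. cdf (distr (M n) borel (Z n)) t) \<longlonglongrightarrow> cdf N t" by (rule LIM_zero_cancel)
qed

theorem theorem4:
  fixes M :: "nat \<Rightarrow> 'a measure" and X :: "nat \<Rightarrow> 'a \<Rightarrow> nat"
  assumes "\<And>n. n \<ge> 1 \<Longrightarrow> prob_space (M n)"
    and "\<And>n. n \<ge> 1 \<Longrightarrow> X n \<in> measurable (M n) (count_space UNIV)"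
    and "\<And>n k. n \<ge> 1 \<Longrightarrow>
           measure (M n) {\<omega> \<in> space (M n). X n \<omega> = k} = real (num_k_linear n k) / real (num_linear n)"
  defines "Z \<equiv> \<lambda>n \<omega>. (real (X n \<omega>) - hdv_mu * real n) / (sqrt hdv_sigma2 * sqrt (real n))"
  shows "(\<exists>!x. 0 < x \<and> x < 1 \<and> x * partition_gf x = 1)
    \<and> 0.4196 \<le> x0 \<and> x0 < 0.4197
    \<and> \<bar>hdv_mu - 0.219273\<bar> \<le> 0.0000005
    \<and> \<bar>hdv_sigma2 - 0.0567065\<bar> \<le> 0.00000005
    \<and> weak_conv_m (\<lambda>n. distr (M n) borel (Z n)) std_normal_distribution
    \<and> (\<exists>C. \<forall>n\<ge>1. \<forall>t.
         \<bar>measure (M n) {\<omega> \<in> space (M n). Z n \<omega> \<le> t} - cdf std_normal_distribution t\<bar>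
           \<le> C / sqrt (real n))"
proof -
  note prob = assms(1) and meas = assms(2) and law = assms(3)
  interpret N: real_distribution std_normal_distribution by (rule real_dist_normal_dist)
  have mu: "0 < hdv_mu" by (rule less_le_trans[OF _ hdv_mu_bounds(1)]) simp
  have sg: "0 < hdv_sigma2" by (rule less_le_trans[OF _ hdv_sigma2_bounds(1)]) simp
  obtain C N where CN: "\<forall>n\<ge>N. 1 \<le> n \<longrightarrow> (\<Sum>k\<le>n. hdv_prob n k) = 1 \<and>
    (\<forall>t. \<bar>lattice_cdf (hdv_prob n) n (hdv_mu * real n + sqrt hdv_sigma2 * sqrt (real n) * t) - std_cdf t\<bar> \<le> C / sqrt (real n))"
    using root_x0.hdv_berry_esseen[unfolded root_x0_mu root_x0_sg2, OF mu sg] by (elim exE)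
  note rate = CN[rule_format]
  have Zm: "Z n \<in> borel_measurable (M n)" if "n \<ge> 1" for n
    unfolding Z_def by (intro borel_measurable_divide borel_measurable_diff borel_measurable_const
      measurable_compose[OF meas[OF that]]) simp
  \<comment> \<open>For \<open>n < N\<close> the trivial bound \<open>1\<close> is at most
    \<open>sqrt N / sqrt n\<close>, so one constant serves all \<open>n \<ge> 1\<close>.\<close>
  define C' where "C' = max C (sqrt (real N))"
  have bound: "\<bar>measure (M n) {\<omega> \<in> space (M n). Z n \<omega> \<le> t} - std_cdf t\<bar> \<le> C' / sqrt (real n)" if n: "n \<ge> 1" for n t
  proof -
    interpret P: prob_space "M n" by (rule prob[OF n])
    have s: "0 < sqrt hdv_sigma2 * sqrt (real n)" using sg n by simp
    show ?thesis
    proof (cases "N \<le> n")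
      case True
      note r = rate[OF True n]
      have "{\<omega> \<in> space (M n). Z n \<omega> \<le> t} =
          {\<omega> \<in> space (M n). real (X n \<omega>) \<le> hdv_mu * real n + sqrt hdv_sigma2 * sqrt (real n) * t}"
        unfolding Z_def pos_divide_le_eq[OF s] by (intro Collect_cong) (auto simp: algebra_simps)
      also have "P.prob \<dots> = lattice_cdf (hdv_prob n) n (hdv_mu * real n + sqrt hdv_sigma2 * sqrt (real n) * t)"
        by (rule P.prob_lattice_cdf[OF meas[OF n] _ conjunct1[OF r]]) (simp add: law[OF n] hdv_prob_def)
      finally have "\<bar>P.prob {\<omega> \<in> space (M n). Z n \<omega> \<le> t} - std_cdf t\<bar> \<le> C / sqrt (real n)"
        using conjunct2[OF r] by simp
      also have "\<dots> \<le> C' / sqrt (real n)" by (intro divide_right_mono) (simp_all add: C'_def)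
      finally show ?thesis .
    next
      case False
      have "\<bar>P.prob {\<omega> \<in> space (M n). Z n \<omega> \<le> t} - std_cdf t\<bar> \<le> 1"
        using P.prob_le_1[of "{\<omega> \<in> space (M n). Z n \<omega> \<le> t}"] measure_nonneg[of "M n" "{\<omega> \<in> space (M n). Z n \<omega> \<le> t}"]
          N.cdf_nonneg[of t] N.cdf_bounded_prob[of t] by linarith
      also have "1 \<le> C' / sqrt (real n)"
      proof -
        have "sqrt (real n) \<le> C'" unfolding C'_def using False by (intro max.coboundedI2) simp
        then show ?thesis using n by (simp add: le_divide_eq)
      qed
      finally show ?thesis .
    qed
  qed
  have conv: "weak_conv_m (\<lambda>n. distr (M n) borel (Z n)) std_normal_distribution"
    by (rule weak_conv_m_if_rate[OF real_dist_normal_dist prob Zm bound])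
  have x0b: "0.4196 \<le> x0" "x0 < 0.4197"
    by (rule order_trans[OF _ x0_bracket(1)], simp) (rule le_less_trans[OF x0_bracket(2)], simp)
  have mub: "\<bar>hdv_mu - 0.219273\<bar> \<le> 0.0000005" using hdv_mu_bounds by (simp add: abs_le_iff)
  have sgb: "\<bar>hdv_sigma2 - 0.0567065\<bar> \<le> 0.00000005" using hdv_sigma2_bounds by (simp add: abs_le_iff)
  show ?thesis
    using partition_root_unique x0b mub sgb conv bound by (intro conjI exI[of _ C'] allI impI)
qed

end
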